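(* Under the assumptions on $\nu$, $A$, $(g^k)_{k\ge1}$ and $\overline A$ listed in the context, the following two statements hold: (i) for any $N\geq1$, the process $(\mathbf U^N(t))_{t\geq0}$ solution of the SDE $$\mathrm d\mathbf U^N(t)=\mathbf b(\mathbf U^N(t))\,\mathrm dt+\mathrm d\mathbf W^{Q,N}(t)$$ in $\mathbb R^N_0$ admits a unique invariant measure $\vartheta_N\in\mathcal P(\mathbb R^N_0)$; (ii) for any $N\geq1$ and $\Delta t>0$, the sequence $(\mathbf U^{N,\Delta t}_n)_{n\in\mathbb N}$ defined by $$\mathbf U^{N,\Delta t}_{n+\frac12}=\mathbf U^{N,\Delta t}_n+\Delta t\,\mathbf b\big(\mathbf U^{N,\Delta t}_{n+\frac12}\big),\qquad \mathbf U^{N,\Delta t}_{n+1}=\mathbf U^{N,\Delta t}_{n+\frac12}+\Delta\mathbf W^{Q,N}_{n+1},$$ admits a unique invariant measure $\vartheta_{N,\Delta t}\in\mathcal P(\mathbb R^N_0)$. Moreover, for any $N\geq1$ and $\Delta t>0$, the measures $\vartheta_N$ and $\vartheta_{N,\Delta t}$ belong to $\mathcal P_2(\mathbb R^N_0)$.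
   Context: $\mathbb N=\{0,1,2,\dots\}$, $\mathbb N^*=\{1,2,\dots\}$, $\mathbb T=\mathbb R/\mathbb Z$ identified with $(0,1]$. $L^p_0(\mathbb T)$ is the set of $v\in L^p(\mathbb T)$ with $\int_{\mathbb T}v=0$; $H^m_0(\mathbb T)=L^2_0(\mathbb T)\cap H^m(\mathbb T)$ with norm $\|v\|_{H^m_0(\mathbb T)}=\|\partial_x^mv\|_{L^2(\mathbb T)}$. $\mathcal P(E)$ is the set of Borel probability measures on $E$ and $\mathcal P_2(E)$ the subset of those with finite second moment. Assumptions. $\nu>0$. The function $A:\mathbb R\to\mathbb R$ is $C^2$, $A''$ is locally Lipschitz, and there are $\mathsf C_A>0$, $\mathsf p_A\in\mathbb N^*$ with $|A'(v)|\le\mathsf C_A(1+|v|^{\mathsf p_A})$ for all $v\in\mathbb R$. For all $k\ge1$, $g^k\in H^2_0(\mathbb T)$, and $\mathsf D:=\sum_{k\ge1}\|g^k\|^2_{H^2_0(\mathbb T)}<+\infty$. $(W^k)_{k\ge1}$ are independent real Brownian motions on a probability space $(\Omega,\mathcal F,\mathbb P)$ with respect to a normal filtration $(\mathcal F_t)_{t\ge0}$. The function $\overline A:\mathbb R^2\to\mathbb R$ is $C^1$, its partial derivatives $\partial_1\overline A,\partial_2\overline A$ are locally Lipschitz on $\mathbb R^2$, and: $\overline A(v,v)=A(v)$ for all $v$; $\partial_1\overline A(v,w)\ge0$ and $\partial_2\overline A(v,w)\le0$ for all $v,w$; there are $\mathsf C_{\bar A}>0$, $\mathsf p_{\bar A}\in\mathbb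 N^*$ with $|\partial_1\overline A(v,w)|\le\mathsf C_{\bar A}(1+|v|^{\mathsf p_{\bar A}})$ and $|\partial_2\overline A(v,w)|\le\mathsf C_{\bar A}(1+|w|^{\mathsf p_{\bar A}})$ for all $v,w\in\mathbb R$. Discretisation. $\mathbb T_N=\mathbb Z/N\mathbb Z$ (identified with $\{1,\dots,N\}$, indices modulo $N$), $x_i=i/N$, $\mathbb R^N_0=\{\mathbf v\in\mathbb R^N:v_1+\dots+v_N=0\}$, with norms $\|\mathbf v\|_{\ell^p_0(\mathbb T_N)}=(\frac1N\sum_i|v_i|^p)^{1/p}$. $(\Pi_Nv)_i=N\int_{x_{i-1}}^{x_i}v(x)\,\mathrm dx$. $(\mathbf D^{(1,+)}_N\mathbf v)_i=N(v_{i+1}-v_i)$, $(\mathbf D^{(1,-)}_N\mathbf v)_i=N(v_i-v_{i-1})$, $\mathbf D^{(2)}_N=\mathbf D^{(1,-)}_N\mathbf D^{(1,+)}_N$. $\overline{\mathbf A}^N(\mathbf v)$ is the vector with coordinates $\overline A(v_i,v_{i+1})$, and $\mathbf b(\mathbf v)=-\mathbf D^{(1,-)}_N\overline{\mathbf A}^N(\mathbf v)+\nu\mathbf D^{(2)}_N\mathbf v$. $\mathbf g^k=\Pi_Ng^k$, $\mathbf W^{Q,N}=\sum_{k\ge1}\mathbf g^kW^k$, $\Delta\mathbf W^{Q,N}_n=\mathbf W^{Q,N}(n\Delta t)-\mathbf W^{Q,N}((n-1)\Delta t)$. Initial conditions are $\mathcal F_0$-measurable and $\mathbb R^N_0$-valued;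 both the SDE (globally in time, strong solutions) and the implicit equation of the scheme (for each $\Delta t>0$) are well-posed in $\mathbb R^N_0$. A probability measure is invariant for one of these Markov processes if, when it is the law of the initial condition, it is the law of the process at all times. *)

theory Defs
  imports "HOL-Probability.Probability"
begin

section \<open>Function spaces on the torus\<close>

text \<open>The torus is identified with the interval (0,1]. A function on it is represented by a map on
  the reals of which only the values on (0,1] are ever used; it stands for its class modulo
  equality almost everywhere.\<close>

definition torus :: "real measure" where
  "torus = lebesgue_on {0<..1}"

definition L2_torus :: "(real \<Rightarrow> real) set" where
  "L2_torus = {v \<in> borel_measurable torus. integrable torus (\<lambda>x. (v x)\<^sup>2)}"

definition L2_norm_torus :: "(real \<Rightarrow> real) \<Rightarrow> real" where
  "L2_norm_torus v = sqrt (LINT x|torus. (v x)\<^sup>2)"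

definition torus_test_fun :: "(real \<Rightarrow> real) \<Rightarrow> bool" where
  "torus_test_fun \<phi> \<longleftrightarrow>
     (\<forall>x. \<phi> (x + 1) = \<phi> x) \<and> (\<forall>n x. (deriv ^^ n) \<phi> field_differentiable (at x))"

definition weak_deriv_torus :: "nat \<Rightarrow> (real \<Rightarrow> real) \<Rightarrow> (real \<Rightarrow> real) \<Rightarrow> bool" where
  "weak_deriv_torus m v w \<longleftrightarrow> w \<in> L2_torus \<and>
     (\<forall>\<phi>. torus_test_fun \<phi> \<longrightarrow>
        (LINT x|torus. v x * (deriv ^^ m) \<phi> x) = (-1) ^ m * (LINT x|torus. w x * \<phi> x))"

definition H0_torus :: "nat \<Rightarrow> (real \<Rightarrow> real) set" where
  "H0_torus m = {v \<in> L2_torus. (LINT x|torus. v x) = 0 \<and>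
                                (\<forall>j\<le>m. \<exists>w. weak_deriv_torus j v w)}"

text \<open>The weak derivative is unique almost everywhere, so the choice does not matter.\<close>

definition H0_norm_torus :: "nat \<Rightarrow> (real \<Rightarrow> real) \<Rightarrow> real" where
  "H0_norm_torus m v = L2_norm_torus (SOME w. weak_deriv_torus m v w)"

definition locally_lipschitz :: "('a::metric_space \<Rightarrow> 'b::metric_space) \<Rightarrow> bool" where
  "locally_lipschitz f \<longleftrightarrow> (\<forall>x. \<exists>r>0. \<exists>L. L-lipschitz_on (cball x r) f)"


section \<open>Brownian motions\<close>

definition normal_filtration :: "'w measure \<Rightarrow> (real \<Rightarrow> 'w measure) \<Rightarrow> bool" where
  "normal_filtration M F \<longleftrightarrow>
     (\<forall>t\<ge>0. subalgebra M (F t)) \<and>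
     (\<forall>s t. 0 \<le> s \<and> s \<le> t \<longrightarrow> sets (F s) \<subseteq> sets (F t)) \<and>
     null_sets M \<subseteq> sets (F 0) \<and>
     (\<forall>t\<ge>0. (\<Inter>s\<in>{t<..}. sets (F s)) = sets (F t))"

definition brownian_motion ::
    "'w measure \<Rightarrow> (real \<Rightarrow> 'w measure) \<Rightarrow> (real \<Rightarrow> 'w \<Rightarrow> real) \<Rightarrow> bool" where
  "brownian_motion M F B \<longleftrightarrow>
     (\<forall>t\<ge>0. B t \<in> borel_measurable (F t)) \<and>
     (AE \<omega> in M. B 0 \<omega> = 0) \<and>
     (AE \<omega> in M. continuous_on {0..} (\<lambda>t. B t \<omega>)) \<and>
     (\<forall>s t. 0 \<le> s \<and> s < t \<longrightarrow>
        distributed M lborel (\<lambda>\<omega>. B t \<omega> - B s \<omega>) (normal_density 0 (sqrt (t - s))) \<and>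
        prob_space.indep_set M (sets (F s))
          (sets (vimage_algebra (space M) (\<lambda>\<omega>. B t \<omega> - B s \<omega>) borel)))"

text \<open>Families are indexed by the integers at least 1; independence is that of whole paths.\<close>

definition independent_brownian_motions ::
    "'w measure \<Rightarrow> (real \<Rightarrow> 'w measure) \<Rightarrow> (nat \<Rightarrow> real \<Rightarrow> 'w \<Rightarrow> real) \<Rightarrow> bool" where
  "independent_brownian_motions M F W \<longleftrightarrow>
     (\<forall>k\<ge>1. brownian_motion M F (W k)) \<and>
     prob_space.indep_vars M (\<lambda>k. \<Pi>\<^sub>M t\<in>{0..}. borel) (\<lambda>k \<omega>. \<lambda>t\<in>{0..}. W k t \<omega>) {1..}"


section \<open>Discretisation\<close>

text \<open>Vectors with N coordinates are extensional functions on the index set {1..N}.\<close>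

definition R0 :: "nat \<Rightarrow> (nat \<Rightarrow> real) set" where
  "R0 N = {v \<in> {1..N} \<rightarrow>\<^sub>E UNIV. (\<Sum>i=1..N. v i) = 0}"

definition borel_R0 :: "nat \<Rightarrow> (nat \<Rightarrow> real) measure" where
  "borel_R0 N = restrict_space (\<Pi>\<^sub>M i\<in>{1..N}. borel) (R0 N)"

definition l2_norm :: "nat \<Rightarrow> (nat \<Rightarrow> real) \<Rightarrow> real" where
  "l2_norm N v = sqrt ((\<Sum>i=1..N. (v i)\<^sup>2) / real N)"

definition prob_measures_R0 :: "nat \<Rightarrow> (nat \<Rightarrow> real) measure set" where
  "prob_measures_R0 N = {\<mu>. prob_space \<mu> \<and> sets \<mu> = sets (borel_R0 N)}"

definition prob_measures2_R0 :: "nat \<Rightarrow> (nat \<Rightarrow> real) measure set" where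
  "prob_measures2_R0 N = {\<mu> \<in> prob_measures_R0 N. integrable \<mu> (\<lambda>v. (l2_norm N v)\<^sup>2)}"

text \<open>Successor and predecessor in {1..N} modulo N.\<close>

definition nxt :: "nat \<Rightarrow> nat \<Rightarrow> nat" where
  "nxt N i = (if i = N then 1 else i + 1)"

definition prv :: "nat \<Rightarrow> nat \<Rightarrow> nat" where
  "prv N i = (if i = 1 then N else i - 1)"

definition cell_mean :: "nat \<Rightarrow> (real \<Rightarrow> real) \<Rightarrow> nat \<Rightarrow> real" where
  "cell_mean N v = (\<lambda>i\<in>{1..N}.
     real N * (LINT x:{(real i - 1) / real N <.. real i / real N}|lebesgue. v x))"

definition Dplus :: "nat \<Rightarrow> (nat \<Rightarrow> real) \<Rightarrow> nat \<Rightarrow> real" where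
  "Dplus N v = (\<lambda>i\<in>{1..N}. real N * (v (nxt N i) - v i))"

definition Dminus :: "nat \<Rightarrow> (nat \<Rightarrow> real) \<Rightarrow> nat \<Rightarrow> real" where
  "Dminus N v = (\<lambda>i\<in>{1..N}. real N * (v i - v (prv N i)))"

definition D2 :: "nat \<Rightarrow> (nat \<Rightarrow> real) \<Rightarrow> nat \<Rightarrow> real" where
  "D2 N v = Dminus N (Dplus N v)"

definition num_flux :: "(real \<times> real \<Rightarrow> real) \<Rightarrow> nat \<Rightarrow> (nat \<Rightarrow> real) \<Rightarrow> nat \<Rightarrow> real" where
  "num_flux Abar N v = (\<lambda>i\<in>{1..N}. Abar (v i, v (nxt N i)))"

definition drift ::
    "real \<Rightarrow> (real \<times> real \<Rightarrow> real) \<Rightarrow> nat \<Rightarrow> (nat \<Rightarrow> real) \<Rightarrow> nat \<Rightarrow> real" where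
  "drift \<nu> Abar N v = (\<lambda>i\<in>{1..N}. - Dminus N (num_flux Abar N v) i + \<nu> * D2 N v i)"

text \<open>The series over k = 1, 2, ... is summed in the order of the indices. Under the standing
  assumptions it converges almost surely, locally uniformly in time, and its sum is also the
  limit in quadratic mean (it need not converge absolutely).\<close>

definition WQN ::
    "(nat \<Rightarrow> real \<Rightarrow> real) \<Rightarrow> (nat \<Rightarrow> real \<Rightarrow> 'w \<Rightarrow> real) \<Rightarrow> nat \<Rightarrow> real \<Rightarrow> 'w \<Rightarrow> nat \<Rightarrow> real" where
  "WQN g W N t \<omega> = (\<lambda>i\<in>{1..N}. \<Sum>k. cell_mean N (g (Suc k)) i * W (Suc k) t \<omega>)"


section \<open>The stochastic differential equation and the split-step scheme\<close>

text \<open>In both definitions, b is the drift, Q the noise and U0 the initial condition.\<close>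

definition sde_solution ::
    "'w measure \<Rightarrow> (real \<Rightarrow> 'w measure) \<Rightarrow> nat \<Rightarrow> ((nat \<Rightarrow> real) \<Rightarrow> nat \<Rightarrow> real) \<Rightarrow>
     (real \<Rightarrow> 'w \<Rightarrow> nat \<Rightarrow> real) \<Rightarrow> ('w \<Rightarrow> nat \<Rightarrow> real) \<Rightarrow> (real \<Rightarrow> 'w \<Rightarrow> nat \<Rightarrow> real) \<Rightarrow> bool" where
  "sde_solution M F N b Q U0 U \<longleftrightarrow>
     (\<forall>t\<ge>0. U t \<in> F t \<rightarrow>\<^sub>M borel_R0 N) \<and>
     (AE \<omega> in M. \<forall>i\<in>{1..N}. continuous_on {0..} (\<lambda>t. U t \<omega> i)) \<and>
     (AE \<omega> in M. \<forall>t\<ge>0. \<forall>i\<in>{1..N}.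
        U t \<omega> i = U0 \<omega> i + integral {0..t} (\<lambda>s. b (U s \<omega>) i) + Q t \<omega> i)"

definition scheme_solution ::
    "'w measure \<Rightarrow> (real \<Rightarrow> 'w measure) \<Rightarrow> nat \<Rightarrow> real \<Rightarrow> ((nat \<Rightarrow> real) \<Rightarrow> nat \<Rightarrow> real) \<Rightarrow>
     (real \<Rightarrow> 'w \<Rightarrow> nat \<Rightarrow> real) \<Rightarrow> ('w \<Rightarrow> nat \<Rightarrow> real) \<Rightarrow> (nat \<Rightarrow> 'w \<Rightarrow> nat \<Rightarrow> real) \<Rightarrow> bool" where
  "scheme_solution M F N \<Delta>t b Q U0 U \<longleftrightarrow>
     (\<forall>n. U n \<in> F (real n * \<Delta>t) \<rightarrow>\<^sub>M borel_R0 N) \<and>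
     (AE \<omega> in M. \<forall>i\<in>{1..N}. U 0 \<omega> i = U0 \<omega> i) \<and>
     (\<exists>Uhalf. (\<forall>n. Uhalf n \<in> F (real n * \<Delta>t) \<rightarrow>\<^sub>M borel_R0 N) \<and>
        (AE \<omega> in M. \<forall>n. \<forall>i\<in>{1..N}.
           Uhalf n \<omega> i = U n \<omega> i + \<Delta>t * b (Uhalf n \<omega>) i \<and>
           U (Suc n) \<omega> i = Uhalf n \<omega> i +
             (Q (real (Suc n) * \<Delta>t) \<omega> i - Q (real n * \<Delta>t) \<omega> i)))"


section \<open>Invariant measures\<close>

text \<open>The given sigma-algebra F 0 may be too small to carry an initial condition with a prescribed
  law (it may contain only events of probability 0 or 1). The stochastic basis is therefore enlarged
  by an independent coordinate with law \<mu>, known at time 0; the initial condition is that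
  coordinate, and the noise is the given one, seen as a function of the first coordinate.

  A probability measure \<mu> is invariant if, whenever it is the law of the initial condition, it is
  the law of the process at all times. The existence conjuncts exclude that this holds for lack
  of any solution; they express the (known) solvability of the equations.\<close>

definition ext_filtration ::
    "(real \<Rightarrow> 'w measure) \<Rightarrow> 'e measure \<Rightarrow> real \<Rightarrow> ('w \<times> 'e) measure" where
  "ext_filtration F \<mu> t = F t \<Otimes>\<^sub>M \<mu>"

definition ext_noise ::
    "(real \<Rightarrow> 'w \<Rightarrow> nat \<Rightarrow> real) \<Rightarrow> real \<Rightarrow> 'w \<times> 'e \<Rightarrow> nat \<Rightarrow> real" where
  "ext_noise Q t z = Q t (fst z)"

definition sde_invariant ::
    "'w measure \<Rightarrow> (real \<Rightarrow> 'w measure) \<Rightarrow> nat \<Rightarrow> ((nat \<Rightarrow> real) \<Rightarrow> nat \<Rightarrow> real) \<Rightarrow>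
     (real \<Rightarrow> 'w \<Rightarrow> nat \<Rightarrow> real) \<Rightarrow> (nat \<Rightarrow> real) measure \<Rightarrow> bool" where
  "sde_invariant M F N b Q \<mu> \<longleftrightarrow>
     \<mu> \<in> prob_measures_R0 N \<and>
     (\<exists>U. sde_solution (M \<Otimes>\<^sub>M \<mu>) (ext_filtration F \<mu>) N b (ext_noise Q) snd U) \<and>
     (\<forall>U. sde_solution (M \<Otimes>\<^sub>M \<mu>) (ext_filtration F \<mu>) N b (ext_noise Q) snd U \<longrightarrow>
        (\<forall>t\<ge>0. distr (M \<Otimes>\<^sub>M \<mu>) (borel_R0 N) (U t) = \<mu>))"

definition scheme_invariant ::
    "'w measure \<Rightarrow> (real \<Rightarrow> 'w measure) \<Rightarrow> nat \<Rightarrow> real \<Rightarrow> ((nat \<Rightarrow> real) \<Rightarrow> nat \<Rightarrow> real) \<Rightarrow>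
     (real \<Rightarrow> 'w \<Rightarrow> nat \<Rightarrow> real) \<Rightarrow> (nat \<Rightarrow> real) measure \<Rightarrow> bool" where
  "scheme_invariant M F N \<Delta>t b Q \<mu> \<longleftrightarrow>
     \<mu> \<in> prob_measures_R0 N \<and>
     (\<exists>U. scheme_solution (M \<Otimes>\<^sub>M \<mu>) (ext_filtration F \<mu>) N \<Delta>t b (ext_noise Q) snd U) \<and>
     (\<forall>U. scheme_solution (M \<Otimes>\<^sub>M \<mu>) (ext_filtration F \<mu>) N \<Delta>t b (ext_noise Q) snd U \<longrightarrow>
        (\<forall>n. distr (M \<Otimes>\<^sub>M \<mu>) (borel_R0 N) (U n) = \<mu>))"

end

theory Submission
  imports Defs "HOL-Complex_Analysis.Complex_Analysis" "HOL-Real_Asymp.Real_Asymp"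
begin

text \<open>The noise is additive and the equations are driven by a drift \<open>b\<close> that is minus the discrete
  divergence of a flux, nondecreasing in its left and nonincreasing in its right argument, plus
  \<open>\<nu>\<close> times the discrete Laplacian. Two summations by parts carry everything that is specific to
  the equation. Tested against the signs of \<open>u - v\<close>, the difference \<open>b u - b v\<close> gives a sum that is
  nonpositive, and negative as soon as \<open>u - v\<close> takes both signs (\<open>drift_accretive\<close>,
  \<open>drift_strictly_accretive\<close>); two distinct vectors of mean zero always differ with both signs.
  Tested against \<open>v\<close> itself, \<open>b v\<close> gives at most \<open>- \<nu>\<close> times the squared norm
  (\<open>drift_dissipative\<close>).

  The noise cancels in the difference of two trajectories. Hence both the step of the scheme and
  the solution map of the equation at time 1, driven by one and the same noise, do not increase the
  \<open>\<ell>\<^sup>1\<close> distance, and strictly decrease it between distinct states; and the dissipation bounds the second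
  moment after one step by \<open>\<rho> |x|\<^sup>2 + C\<close> with \<open>\<rho> < 1\<close>. Such a \<open>random_contraction\<close> has exactly one
  invariant measure, and it has finite second moment (\<open>unique_invariant_measure\<close>). Strict
  decrease comes without a rate, but compactness makes the mean decrease uniform over pairs that are
  bounded and at least \<open>\<delta>\<close> apart; since the total decrease is at most the initial distance and
  the moments keep the pairs bounded, two copies of the chain are rarely far apart after a long time
  (\<open>mixing\<close>). This gives uniqueness, and it makes the backward iteration Cauchy in probability,
  which gives existence.

  The equation is solved path by path: the integral equation has a solution for every continuous
  driving path, and the split-step scheme converges to any solution
  (\<open>split_step_converges\<close>). That single fact transfers uniqueness, contraction,
  measurability, moment bounds and, through the independent increments, the semigroup property
  (\<open>flow_op_add\<close>) from the scheme to the flow, without stochastic calculus. A law invariant at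
  time 1 is then invariant at every time \<open>t\<close>, because its image at time \<open>t\<close> is again
  invariant at time 1.

  Finally, the noise has to be a continuous path at all. A function with square integrable second
  derivative and mean zero has cell means bounded by a multiple of its \<open>H\<^sup>2\<close> norm (\<open>cell_mean_bound\<close>),
  so the coefficients of the Brownian motions are square summable, and a maximal inequality of
  Ottaviani type, applied once in time and once in the summation index, makes the series converge
  almost surely and locally uniformly (\<open>AE_series_continuous\<close>).\<close>

section \<open>Vectors on the cycle\<close>

definition l1_dist :: "nat \<Rightarrow> (nat \<Rightarrow> real) \<Rightarrow> (nat \<Rightarrow> real) \<Rightarrow> real" where
  "l1_dist N x y = (\<Sum>i=1..N. \<bar>x i - y i\<bar>)"

definition sq_sum :: "nat \<Rightarrow> (nat \<Rightarrow> real) \<Rightarrow> real" where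
  "sq_sum N v = (\<Sum>i=1..N. (v i)\<^sup>2)"

lemma l1_dist_nonneg [simp]: "0 \<le> l1_dist N x y"
  by (simp add: l1_dist_def sum_nonneg)

lemma l1_dist_commute: "l1_dist N x y = l1_dist N y x"
  by (simp add: l1_dist_def abs_minus_commute)

lemma l1_dist_triangle: "l1_dist N x z \<le> l1_dist N x y + l1_dist N y z"
  unfolding l1_dist_def sum.distrib[symmetric] by (intro sum_mono) linarith

lemma l1_dist_cong:
  "(\<And>i. i \<in> {1..N} \<Longrightarrow> x i = x' i) \<Longrightarrow> (\<And>i. i \<in> {1..N} \<Longrightarrow> y i = y' i) \<Longrightarrow> l1_dist N x y = l1_dist N x' y'"
  unfolding l1_dist_def by (intro sum.cong) auto

lemma coord_le_l1_dist: "i \<in> {1..N} \<Longrightarrow> \<bar>x i - y i\<bar> \<le> l1_dist N x y"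
  unfolding l1_dist_def by (rule member_le_sum) auto

lemma l1_dist_le: "(\<And>i. i \<in> {1..N} \<Longrightarrow> \<bar>x i - y i\<bar> \<le> c) \<Longrightarrow> l1_dist N x y \<le> real N * c"
  unfolding l1_dist_def using sum_bounded_above[of "{1..N}" "\<lambda>i. \<bar>x i - y i\<bar>" c] by auto

lemma l1_dist_eq_0: "l1_dist N x y = 0 \<longleftrightarrow> (\<forall>i\<in>{1..N}. x i = y i)"
  unfolding l1_dist_def by (subst sum_nonneg_eq_0_iff) auto

lemma sq_sum_nonneg [simp]: "0 \<le> sq_sum N v"
  by (simp add: sq_sum_def sum_nonneg)

lemma nxt_in: "i \<in> {1..N} \<Longrightarrow> nxt N i \<in> {1..N}"
  by (auto simp: nxt_def)

lemma prv_in: "i \<in> {1..N} \<Longrightarrow> prv N i \<in> {1..N}"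
  by (auto simp: prv_def)

lemma prv_nxt: "i \<in> {1..N} \<Longrightarrow> prv N (nxt N i) = i"
  by (auto simp: prv_def nxt_def)

lemma nxt_prv: "i \<in> {1..N} \<Longrightarrow> nxt N (prv N i) = i"
  by (auto simp: prv_def nxt_def)

lemma sum_nxt: "(\<Sum>i=1..N. f (nxt N i)) = (\<Sum>i=1..N. f i)"
proof -
  have "bij_betw (nxt N) {1..N} {1..N}"
    by (rule bij_betwI[where g = "prv N"]) (use nxt_in prv_in prv_nxt nxt_prv in auto)
  then show ?thesis
    by (rule sum.reindex_bij_betw)
qed

lemma sum_by_parts_cycle:
  fixes s G :: "nat \<Rightarrow> real"
  shows "(\<Sum>i=1..N. s i * (G i - G (prv N i))) = (\<Sum>i=1..N. G i * (s i - s (nxt N i)))"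
proof -
  have "(\<Sum>i=1..N. s i * G (prv N i)) = (\<Sum>i=1..N. s (nxt N i) * G (prv N (nxt N i)))"
    using sum_nxt[of "\<lambda>i. s i * G (prv N i)" N] by simp
  also have "\<dots> = (\<Sum>i=1..N. s (nxt N i) * G i)"
    by (intro sum.cong refl) (simp add: prv_nxt)
  finally show ?thesis
    by (simp add: algebra_simps sum_subtractf)
qed

lemma cycle_induct:
  assumes "i0 \<in> {1..N}" "P i0" and step: "\<And>i. i \<in> {1..N} \<Longrightarrow> P i \<Longrightarrow> P (nxt N i)" and "j \<in> {1..N}"
  shows "P j"
proof -
  have up: "P (i + k)" if "P i" "i + k \<le> N" "i \<in> {1..N}" for i k
    using that(2)
  proof (induction k)
    case (Suc k)
    then have "P (i + k)" "i + k \<in> {1..N}" "i + k \<noteq> N" using that by auto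
    then show ?case using step[of "i + k"] by (simp add: nxt_def)
  qed (use that in simp)
  have "P N" using up[of i0 "N - i0"] assms by auto
  moreover have "nxt N N = 1" by (simp add: nxt_def)
  ultimately have "P 1" using step[of N] assms by auto
  then show ?thesis using up[of 1 "j - 1"] assms by auto
qed

section \<open>The drift is dissipative\<close>

text \<open>What the scheme needs of the numerical flux: monotonicity in both arguments, and a Lipschitz bound
  on bounded sets. In contrast to differentiability, this class is stable under truncation of the
  arguments, which the existence proofs use.\<close>

locale monotone_flux =
  fixes \<nu> :: real and N :: nat and Abar :: "real \<times> real \<Rightarrow> real"
  assumes nu: "\<nu> > 0" and N: "N \<ge> 1"
    and mono1: "\<And>a a' c. a \<le> a' \<Longrightarrow> Abar (a, c) \<le> Abar (a', c)"
    and mono2: "\<And>a c c'. c \<le> c' \<Longrightarrow> Abar (a, c') \<le> Abar (a, c)"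
    and loc_lip: "\<And>K. \<exists>L\<ge>0. \<forall>a c a' c'. \<bar>a\<bar> \<le> K \<longrightarrow> \<bar>c\<bar> \<le> K \<longrightarrow> \<bar>a'\<bar> \<le> K \<longrightarrow> \<bar>c'\<bar> \<le> K \<longrightarrow>
                    \<bar>Abar (a, c) - Abar (a', c')\<bar> \<le> L * (\<bar>a - a'\<bar> + \<bar>c - c'\<bar>)"
begin

abbreviation b :: "(nat \<Rightarrow> real) \<Rightarrow> nat \<Rightarrow> real" where
  "b \<equiv> drift \<nu> Abar N"

text \<open>The viscous term is absorbed in the flux; it makes the flux strictly monotone, which is the source
  of strict contraction.\<close>

definition flux :: "(nat \<Rightarrow> real) \<Rightarrow> nat \<Rightarrow> real" where
  "flux v i = Abar (v i, v (nxt N i)) - \<nu> * real N * (v (nxt N i) - v i)"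

lemma drift_eq: "i \<in> {1..N} \<Longrightarrow> b v i = - real N * (flux v i - flux v (prv N i))"
  using prv_in[of i N] nxt_prv[of i N]
  by (simp add: drift_def Dminus_def D2_def Dplus_def num_flux_def flux_def algebra_simps)

lemma drift_cong: "(\<And>i. i \<in> {1..N} \<Longrightarrow> u i = v i) \<Longrightarrow> b u = b v"
  using prv_in[of _ N] nxt_in[of _ N]
  by (auto simp: drift_def Dminus_def D2_def Dplus_def num_flux_def fun_eq_iff)

text \<open>All estimates on the drift are instances of this summation by parts, with different weights \<open>s\<close>.\<close>

lemma sum_drift: "(\<Sum>i=1..N. s i * b v i) = real N * (\<Sum>i=1..N. flux v i * (s (nxt N i) - s i))"
proof -
  have "(\<Sum>i=1..N. s i * b v i) = (\<Sum>i=1..N. - real N * (s i * (flux v i - flux v (prv N i))))"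
    by (intro sum.cong refl) (simp add: drift_eq)
  also have "\<dots> = - real N * (\<Sum>i=1..N. flux v i * (s i - s (nxt N i)))"
    by (simp only: sum_distrib_left[symmetric] sum_by_parts_cycle)
  finally show ?thesis
    by (simp add: sum_distrib_left flip: sum_negf) (simp add: algebra_simps)
qed

lemma sum_drift_0: "(\<Sum>i=1..N. b v i) = 0"
  using sum_drift[of "\<lambda>_. 1" v] by simp

text \<open>Ties count as positive, so that the values are \<open>\<plusminus>1\<close> and the product with \<open>u - v\<close> is still \<open>\<bar>u - v\<bar>\<close>.\<close>

definition sgn_vec :: "(nat \<Rightarrow> real) \<Rightarrow> (nat \<Rightarrow> real) \<Rightarrow> nat \<Rightarrow> real" where
  "sgn_vec u v i = (if u i \<ge> v i then 1 else -1)"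

text \<open>Between neighbours at which \<open>u - v\<close> changes sign, one argument of the flux goes up and the
  other goes down, and monotonicity fixes the sign of the difference of the fluxes.\<close>

lemma flux_sign_change:
  "(flux u i - flux v i) * (sgn_vec u v (nxt N i) - sgn_vec u v i) \<le> 0"
  "sgn_vec u v i \<noteq> sgn_vec u v (nxt N i) \<Longrightarrow>
     (flux u i - flux v i) * (sgn_vec u v (nxt N i) - sgn_vec u v i) < 0"
proof -
  let ?j = "nxt N i"
  have nuN: "\<nu> * real N > 0" using nu N by simp
  have up: "flux u i - flux v i < 0" if "u i < v i" "u ?j \<ge> v ?j"
  proof -
    have "Abar (u i, u ?j) \<le> Abar (v i, v ?j)"
      using mono1[of "u i" "v i" "u ?j"] mono2[of "v ?j" "u ?j" "v i"] that by simp
    moreover have "\<nu> * real N * (u ?j - u i) > \<nu> * real N * (v ?j - v i)"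
      by (rule mult_strict_left_mono[OF _ nuN]) (use that in simp)
    ultimately show ?thesis by (simp add: flux_def)
  qed
  have down: "flux u i - flux v i > 0" if "u i \<ge> v i" "u ?j < v ?j"
  proof -
    have "Abar (v i, v ?j) \<le> Abar (u i, u ?j)"
      using mono1[of "v i" "u i" "v ?j"] mono2[of "u ?j" "v ?j" "u i"] that by simp
    moreover have "\<nu> * real N * (u ?j - u i) < \<nu> * real N * (v ?j - v i)"
      by (rule mult_strict_left_mono[OF _ nuN]) (use that in simp)
    ultimately show ?thesis by (simp add: flux_def)
  qed
  show "(flux u i - flux v i) * (sgn_vec u v (nxt N i) - sgn_vec u v i) \<le> 0"
    using up down by (auto simp: sgn_vec_def)
  show "(flux u i - flux v i) * (sgn_vec u v (nxt N i) - sgn_vec u v i) < 0"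
    if "sgn_vec u v i \<noteq> sgn_vec u v (nxt N i)"
    using up down that by (auto simp: sgn_vec_def split: if_splits)
qed

lemma sgn_drift_eq:
  fixes u v
  shows "(\<Sum>i=1..N. sgn_vec u v i * (b u i - b v i))
     = real N * (\<Sum>i=1..N. (flux u i - flux v i) * (sgn_vec u v (nxt N i) - sgn_vec u v i))"
proof -
  have "(\<Sum>i=1..N. sgn_vec u v i * (b u i - b v i))
     = (\<Sum>i=1..N. sgn_vec u v i * b u i) - (\<Sum>i=1..N. sgn_vec u v i * b v i)"
    by (simp add: sum_subtractf right_diff_distrib)
  also have "\<dots> = real N * ((\<Sum>i=1..N. flux u i * (sgn_vec u v (nxt N i) - sgn_vec u v i))
      - (\<Sum>i=1..N. flux v i * (sgn_vec u v (nxt N i) - sgn_vec u v i)))"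
    by (simp only: sum_drift right_diff_distrib)
  finally show ?thesis
    by (simp only: sum_subtractf[symmetric] left_diff_distrib)
qed

lemma drift_accretive: "(\<Sum>i=1..N. sgn_vec u v i * (b u i - b v i)) \<le> 0"
  unfolding sgn_drift_eq using flux_sign_change(1)
  by (intro mult_nonneg_nonpos[OF _ sum_nonpos]) simp_all

text \<open>Going around the cycle from \<open>i\<close> to \<open>j\<close>, the sign changes somewhere, and that place contributes a
  negative term.\<close>

lemma drift_strictly_accretive:
  assumes "i \<in> {1..N}" "u i \<ge> v i" "j \<in> {1..N}" "u j < v j"
  shows "(\<Sum>i=1..N. sgn_vec u v i * (b u i - b v i)) < 0"
proof -
  have "\<exists>k\<in>{1..N}. sgn_vec u v k \<noteq> sgn_vec u v (nxt N k)"
  proof (rule ccontr)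
    assume *: "\<not> ?thesis"
    have "sgn_vec u v j = 1"
      by (rule cycle_induct[where P = "\<lambda>k. sgn_vec u v k = 1", OF assms(1)])
         (use assms * in \<open>auto simp: sgn_vec_def\<close>)
    then show False using assms by (simp add: sgn_vec_def)
  qed
  then obtain k where k: "k \<in> {1..N}" "sgn_vec u v k \<noteq> sgn_vec u v (nxt N k)" by auto
  have "(\<Sum>i=1..N. (flux u i - flux v i) * (sgn_vec u v (nxt N i) - sgn_vec u v i)) < (\<Sum>i=1..N. 0)"
    using flux_sign_change k by (intro sum_strict_mono_ex1) (simp, blast, blast)
  then show ?thesis unfolding sgn_drift_eq using N by (simp add: mult_pos_neg)
qed

lemma sgn_vec_mult: "sgn_vec u v i * (u i - v i) = \<bar>u i - v i\<bar>" "\<bar>sgn_vec u v i\<bar> = 1"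
  by (auto simp: sgn_vec_def)

lemma l1_dist_sgn_le: "(\<Sum>i=1..N. sgn_vec u v i * (x i - y i)) \<le> l1_dist N x y"
  unfolding l1_dist_def
proof (intro sum_mono)
  fix i
  have "sgn_vec u v i * (x i - y i) \<le> \<bar>sgn_vec u v i * (x i - y i)\<bar>" by simp
  then show "sgn_vec u v i * (x i - y i) \<le> \<bar>x i - y i\<bar>" by (simp add: abs_mult sgn_vec_mult)
qed

lemma l1_dist_eq_sgn: "l1_dist N u v = (\<Sum>i=1..N. sgn_vec u v i * (u i - v i))"
  by (simp add: l1_dist_def sgn_vec_mult)

text \<open>Accretivity in the form that serves implicit steps: subtracting \<open>h b\<close> can only push two
  vectors apart, because it does so when tested against the signs of \<open>u - v\<close>.\<close>

lemma l1_dist_implicit: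
  assumes "h \<ge> 0"
  shows "l1_dist N u v \<le> l1_dist N (\<lambda>i. u i - h * b u i) (\<lambda>i. v i - h * b v i)"
    (is "_ \<le> l1_dist N ?u ?v")
proof -
  have "l1_dist N u v \<le> l1_dist N u v - h * (\<Sum>i=1..N. sgn_vec u v i * (b u i - b v i))"
    using assms drift_accretive[of u v] by (simp add: mult_nonneg_nonpos)
  also have "\<dots> = (\<Sum>i=1..N. sgn_vec u v i * (?u i - ?v i))"
    unfolding l1_dist_eq_sgn by (simp add: sum_distrib_left algebra_simps flip: sum.distrib sum_subtractf)
  also have "\<dots> \<le> l1_dist N ?u ?v" by (rule l1_dist_sgn_le)
  finally show ?thesis .
qed

text \<open>A nonzero vector of mean zero takes both signs; this is where conservation of mass enters.\<close>

lemma opposite_signs: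
  assumes "l1_dist N u v \<noteq> 0" "(\<Sum>i=1..N. u i) = (\<Sum>i=1..N. v i)"
  obtains i j where "i \<in> {1..N}" "u i \<ge> v i" "j \<in> {1..N}" "u j < v j"
proof -
  have neg: "\<exists>j\<in>{1..N}. u j < v j"
  proof (rule ccontr)
    assume "\<not> ?thesis"
    then have "l1_dist N u v = (\<Sum>i=1..N. u i - v i)"
      unfolding l1_dist_def by (intro sum.cong) (auto simp: not_less)
    then show False using assms by (simp add: sum_subtractf)
  qed
  have "\<exists>i\<in>{1..N}. u i \<ge> v i"
  proof (rule ccontr)
    assume "\<not> ?thesis"
    then have "(\<Sum>i=1..N. u i) < (\<Sum>i=1..N. v i)"
      using N by (intro sum_strict_mono) (auto simp: not_le)
    then show False using assms by simp
  qed
  with neg that show thesis by blast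
qed

lemma l1_dist_implicit_strict:
  assumes "h > 0" "l1_dist N u v \<noteq> 0" "(\<Sum>i=1..N. u i) = (\<Sum>i=1..N. v i)"
  shows "l1_dist N u v < l1_dist N (\<lambda>i. u i - h * b u i) (\<lambda>i. v i - h * b v i)"
    (is "_ < l1_dist N ?u ?v")
proof -
  obtain i j where "i \<in> {1..N}" "u i \<ge> v i" "j \<in> {1..N}" "u j < v j"
    by (rule opposite_signs[OF assms(2,3)])
  then have "(\<Sum>i=1..N. sgn_vec u v i * (b u i - b v i)) < 0"
    by (rule drift_strictly_accretive)
  then have "l1_dist N u v < l1_dist N u v - h * (\<Sum>i=1..N. sgn_vec u v i * (b u i - b v i))"
    using assms by (simp add: mult_pos_neg)
  also have "\<dots> = (\<Sum>i=1..N. sgn_vec u v i * (?u i - ?v i))"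
    unfolding l1_dist_eq_sgn by (simp add: sum_distrib_left algebra_simps flip: sum.distrib sum_subtractf)
  also have "\<dots> \<le> l1_dist N ?u ?v" by (rule l1_dist_sgn_le)
  finally show ?thesis .
qed

lemma drift_lipschitz:
  assumes L: "L \<ge> 0" "\<And>a c a' c'. a \<in> S \<Longrightarrow> c \<in> S \<Longrightarrow> a' \<in> S \<Longrightarrow> c' \<in> S \<Longrightarrow>
                \<bar>Abar (a, c) - Abar (a', c')\<bar> \<le> L * (\<bar>a - a'\<bar> + \<bar>c - c'\<bar>)"
    and S: "\<And>i. i \<in> {1..N} \<Longrightarrow> u i \<in> S" "\<And>i. i \<in> {1..N} \<Longrightarrow> v i \<in> S" and i: "i \<in> {1..N}"
  shows "\<bar>b u i - b v i\<bar> \<le> 4 * real N * (L + \<nu> * real N) * l1_dist N u v"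
proof -
  have F: "\<bar>flux u k - flux v k\<bar> \<le> (L + \<nu> * real N) * (2 * l1_dist N u v)" if k: "k \<in> {1..N}" for k
  proof -
    let ?j = "nxt N k"
    have j: "?j \<in> {1..N}" by (rule nxt_in[OF k])
    have "\<bar>flux u k - flux v k\<bar> \<le> \<bar>Abar (u k, u ?j) - Abar (v k, v ?j)\<bar>
        + \<bar>\<nu> * real N * ((u ?j - v ?j) - (u k - v k))\<bar>"
      unfolding flux_def by (simp add: algebra_simps)
    also have "\<bar>\<nu> * real N * ((u ?j - v ?j) - (u k - v k))\<bar>
       = \<nu> * real N * \<bar>(u ?j - v ?j) - (u k - v k)\<bar>" using nu by (simp add: abs_mult)
    also have "\<dots> \<le> \<nu> * real N * (\<bar>u k - v k\<bar> + \<bar>u ?j - v ?j\<bar>)"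
      by (intro mult_left_mono) (use nu in auto)
    also have "\<bar>Abar (u k, u ?j) - Abar (v k, v ?j)\<bar> \<le> L * (\<bar>u k - v k\<bar> + \<bar>u ?j - v ?j\<bar>)"
      using S k j by (intro L) auto
    finally have "\<bar>flux u k - flux v k\<bar> \<le> (L + \<nu> * real N) * (\<bar>u k - v k\<bar> + \<bar>u ?j - v ?j\<bar>)"
      by (simp add: algebra_simps)
    also have "\<dots> \<le> (L + \<nu> * real N) * (2 * l1_dist N u v)"
      using coord_le_l1_dist[OF k, of u v] coord_le_l1_dist[OF j, of u v] nu L(1)
      by (intro mult_left_mono) auto
    finally show ?thesis .
  qed
  have "\<bar>b u i - b v i\<bar> = real N * \<bar>(flux u i - flux v i) - (flux u (prv N i) - flux v (prv N i))\<bar>"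
  proof -
    have "b u i - b v i = - real N * ((flux u i - flux v i) - (flux u (prv N i) - flux v (prv N i)))"
      unfolding drift_eq[OF i] by (simp add: algebra_simps)
    then show ?thesis by (simp only: abs_mult) simp
  qed
  also have "\<dots> \<le> real N * ((L + \<nu> * real N) * (2 * l1_dist N u v) + (L + \<nu> * real N) * (2 * l1_dist N u v))"
    by (intro mult_left_mono order_trans[OF abs_triangle_ineq4] add_mono F i prv_in) simp
  finally show ?thesis by (simp add: algebra_simps)
qed

lemma drift_loc_lip:
  "\<exists>L\<ge>0. \<forall>u v. (\<forall>i\<in>{1..N}. \<bar>u i\<bar> \<le> K \<and> \<bar>v i\<bar> \<le> K) \<longrightarrow> l1_dist N (b u) (b v) \<le> L * l1_dist N u v"
proof -
  obtain L where L: "L \<ge> 0" "\<And>a c a' c'. \<bar>a\<bar> \<le> K \<Longrightarrow> \<bar>c\<bar> \<le> K \<Longrightarrow> \<bar>a'\<bar> \<le> K \<Longrightarrow> \<bar>c'\<bar> \<le> K \<Longrightarrow>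
                    \<bar>Abar (a, c) - Abar (a', c')\<bar> \<le> L * (\<bar>a - a'\<bar> + \<bar>c - c'\<bar>)"
    using loc_lip[of K] by blast
  have "l1_dist N (b u) (b v) \<le> real N * (4 * real N * (L + \<nu> * real N)) * l1_dist N u v"
    if "\<forall>i\<in>{1..N}. \<bar>u i\<bar> \<le> K \<and> \<bar>v i\<bar> \<le> K" for u v
  proof -
    have "\<bar>b u i - b v i\<bar> \<le> 4 * real N * (L + \<nu> * real N) * l1_dist N u v" if "i \<in> {1..N}" for i
      by (rule drift_lipschitz[of L "{x. \<bar>x\<bar> \<le> K}"]) (use L \<open>\<forall>i\<in>{1..N}. _\<close> that in auto)
    from l1_dist_le[OF this] show ?thesis by (simp add: mult.assoc)
  qed
  moreover have "real N * (4 * real N * (L + \<nu> * real N)) \<ge> 0" using L nu by simp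
  ultimately show ?thesis by blast
qed

lemma drift_const: "b (\<lambda>_. c) i = (if i \<in> {1..N} then 0 else undefined)"
  using drift_eq[of i "\<lambda>_. c"] by (auto simp: flux_def drift_def)

section \<open>Energy dissipation\<close>

text \<open>The flux at \<open>(v, w)\<close> is compared with its values on the diagonal between \<open>v\<close> and \<open>w\<close>, which
  monotonicity orders. The right-hand side telescopes around the cycle, so the convective part
  contributes no energy. The lower limit \<open>-K\<close> only serves to name a primitive.\<close>

lemma flux_energy: "(v - w) * Abar (v, w) \<ge> integral {-K..v} (\<lambda>z. Abar (z, z)) - integral {-K..w} (\<lambda>z. Abar (z, z))"
  if K: "\<bar>v\<bar> \<le> K" "\<bar>w\<bar> \<le> K"
proof -
  obtain L where L: "L \<ge> 0" "\<And>a c a' c'. \<bar>a\<bar> \<le> K \<Longrightarrow> \<bar>c\<bar> \<le> K \<Longrightarrow> \<bar>a'\<bar> \<le> K \<Longrightarrow> \<bar>c'\<bar> \<le> K \<Longrightarrow>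
                    \<bar>Abar (a, c) - Abar (a', c')\<bar> \<le> L * (\<bar>a - a'\<bar> + \<bar>c - c'\<bar>)"
    using loc_lip[of K] by blast
  have "(2 * L)-lipschitz_on {-K..K} (\<lambda>z. Abar (z, z))"
  proof (rule lipschitz_onI)
    fix x y assume "x \<in> {-K..K}" "y \<in> {-K..K}"
    then show "dist (Abar (x, x)) (Abar (y, y)) \<le> 2 * L * dist x y"
      using L(2)[of x x y y] by (auto simp: dist_real_def abs_le_iff)
  qed (use L in simp)
  then have cont: "continuous_on {-K..K} (\<lambda>z. Abar (z, z))"
    by (rule lipschitz_on_continuous_on)
  have int: "(\<lambda>z. Abar (z, z)) integrable_on {c..d}" if "-K \<le> c" "d \<le> K" for c d
    by (rule integrable_continuous_real, rule continuous_on_subset[OF cont]) (use that in auto)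
  have comb: "integral {-K..d} (\<lambda>z. Abar (z, z)) - integral {-K..c} (\<lambda>z. Abar (z, z)) = integral {c..d} (\<lambda>z. Abar (z, z))"
    if "-K \<le> c" "c \<le> d" "d \<le> K" for c d
    using Henstock_Kurzweil_Integration.integral_combine[of "-K" c d "\<lambda>z. Abar (z, z)"] int that by auto
  show ?thesis
  proof (cases "w \<le> v")
    case True
    have "integral {w..v} (\<lambda>z. Abar (z, z)) \<le> integral {w..v} (\<lambda>z. Abar (v, w))"
    proof (rule integral_le)
      fix z assume "z \<in> {w..v}"
      then show "Abar (z, z) \<le> Abar (v, w)" using mono1[of z v z] mono2[of w z v] by auto
    qed (use K int in auto)
    then show ?thesis using comb[of w v] K True by simp
  next
    case False
    have "integral {v..w} (\<lambda>z. Abar (v, w)) \<le> integral {v..w} (\<lambda>z. Abar (z, z))"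
    proof (rule integral_le)
      fix z assume "z \<in> {v..w}"
      then show "Abar (v, w) \<le> Abar (z, z)" using mono1[of v z w] mono2[of z w z] by auto
    qed (use K int in auto)
    then show ?thesis using comb[of v w] K False by (simp add: algebra_simps)
  qed
qed

text \<open>A vector of mean zero is bounded by its oscillation, hence by its total variation along the cycle;
  the constant is not the optimal one.\<close>

lemma discrete_poincare:
  fixes v :: "nat \<Rightarrow> real"
  assumes "(\<Sum>i=1..N. v i) = 0"
  shows "sq_sum N v \<le> (real N)\<^sup>2 * (\<Sum>i=1..N. (v (nxt N i) - v i)\<^sup>2)"
proof -
  define D where "D = (\<Sum>i=1..N. \<bar>v (nxt N i) - v i\<bar>)"
  have step: "\<bar>v (i + k) - v i\<bar> \<le> (\<Sum>j=i..<i+k. \<bar>v (nxt N j) - v j\<bar>)" if "i + k \<le> N" for i k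
    using that
  proof (induction k)
    case (Suc k)
    then have "nxt N (i + k) = i + Suc k" by (simp add: nxt_def)
    then show ?case using Suc by simp
  qed simp
  have ord: "\<bar>v j - v i\<bar> \<le> D" if "i \<in> {1..N}" "j \<in> {1..N}" "i \<le> j" for i j
  proof -
    have "\<bar>v j - v i\<bar> \<le> (\<Sum>j=i..<j. \<bar>v (nxt N j) - v j\<bar>)" using step[of i "j - i"] that by simp
    also have "\<dots> \<le> D" unfolding D_def by (rule sum_mono2) (use that in auto)
    finally show ?thesis .
  qed
  have osc: "\<bar>v i - v j\<bar> \<le> D" if "i \<in> {1..N}" "j \<in> {1..N}" for i j
    using ord[of i j] ord[of j i] that by (cases "i \<le> j") (auto simp: abs_minus_commute)
  have coord: "(v i)\<^sup>2 \<le> D\<^sup>2" if i: "i \<in> {1..N}" for i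
  proof -
    have "real N * v i = (\<Sum>j=1..N. v i - v j)" using assms by (simp add: sum_subtractf)
    then have "real N * \<bar>v i\<bar> = \<bar>\<Sum>j=1..N. v i - v j\<bar>" by (metis abs_mult abs_of_nat)
    also have "\<dots> \<le> (\<Sum>j=1..N. \<bar>v i - v j\<bar>)" by (rule sum_abs)
    also have "\<dots> \<le> real N * D"
      using sum_bounded_above[of "{1..N}" "\<lambda>j. \<bar>v i - v j\<bar>" D] osc[OF i] by auto
    finally have "\<bar>v i\<bar> \<le> D" using N by simp
    then show ?thesis by (metis abs_le_square_iff abs_of_nonneg abs_ge_zero order_trans)
  qed
  have "D\<^sup>2 \<le> real N * (\<Sum>i=1..N. (v (nxt N i) - v i)\<^sup>2)"
    using Cauchy_Schwarz_ineq_sum[of "\<lambda>_. 1" "\<lambda>i. \<bar>v (nxt N i) - v i\<bar>" "{1..N}"]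
    by (simp add: D_def)
  moreover have "sq_sum N v \<le> real N * D\<^sup>2"
    unfolding sq_sum_def using sum_bounded_above[of "{1..N}" "\<lambda>i. (v i)\<^sup>2" "D\<^sup>2"] coord by auto
  ultimately have "sq_sum N v \<le> real N * (real N * (\<Sum>i=1..N. (v (nxt N i) - v i)\<^sup>2))"
    by (meson mult_left_mono of_nat_0_le_iff order_trans)
  then show ?thesis by (simp add: power2_eq_square mult.assoc)
qed

text \<open>The convective part of the drift telescopes and the viscous part is bounded by the discrete
  Poincare inequality.\<close>

lemma drift_dissipative:
  assumes "(\<Sum>i=1..N. v i) = 0"
  shows "(\<Sum>i=1..N. v i * b v i) \<le> - \<nu> * sq_sum N v"
proof -
  define K where "K = l1_dist N v (\<lambda>_. 0)"
  define P where "P x = integral {-K..x} (\<lambda>z. Abar (z, z))" for x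
  have K: "\<bar>v i\<bar> \<le> K" if "i \<in> {1..N}" for i
    using coord_le_l1_dist[OF that, of v "\<lambda>_. 0"] by (simp add: K_def)
  have "(\<Sum>i=1..N. v i * b v i) = real N * (\<Sum>i=1..N. flux v i * (v (nxt N i) - v i))"
    by (rule sum_drift)
  also have "(\<Sum>i=1..N. flux v i * (v (nxt N i) - v i))
      \<le> (\<Sum>i=1..N. (P (v (nxt N i)) - P (v i)) - \<nu> * real N * (v (nxt N i) - v i)\<^sup>2)"
  proof (rule sum_mono)
    fix i assume i: "i \<in> {1..N}"
    show "flux v i * (v (nxt N i) - v i) \<le> (P (v (nxt N i)) - P (v i)) - \<nu> * real N * (v (nxt N i) - v i)\<^sup>2"
      using flux_energy[OF K[OF i] K[OF nxt_in[OF i]]]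
      by (simp add: flux_def P_def algebra_simps power2_eq_square)
  qed
  also have "\<dots> = - \<nu> * real N * (\<Sum>i=1..N. (v (nxt N i) - v i)\<^sup>2)"
    using sum_nxt[of "\<lambda>i. P (v i)" N] by (simp add: sum_subtractf sum_distrib_left sum_negf)
  finally have "(\<Sum>i=1..N. v i * b v i) \<le> - \<nu> * ((real N)\<^sup>2 * (\<Sum>i=1..N. (v (nxt N i) - v i)\<^sup>2))"
    using N by (simp add: power2_eq_square algebra_simps)
  also have "\<dots> \<le> - \<nu> * sq_sum N v"
    using discrete_poincare[OF assms] nu by simp
  finally show ?thesis .
qed

end

section \<open>The resolvent of the drift\<close>

text \<open>Banach's fixed point theorem for families of vectors indexed by a set \<open>X\<close>, in the norm weighted
  by \<open>w\<close>. A one-point index set gives contractions of vectors, and an interval with an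
  exponential weight gives the Picard iteration on the whole interval at once.\<close>

lemma weighted_fixed_point:
  fixes T :: "('x \<Rightarrow> nat \<Rightarrow> real) \<Rightarrow> 'x \<Rightarrow> nat \<Rightarrow> real"
  assumes c: "0 \<le> c" "c < 1" and w: "\<And>t. t \<in> X \<Longrightarrow> 0 \<le> w t" and D: "0 \<le> D"
    and inv: "\<And>f. f \<in> C \<Longrightarrow> T f \<in> C"
    and contr: "\<And>f g d. f \<in> C \<Longrightarrow> g \<in> C \<Longrightarrow> d \<ge> 0 \<Longrightarrow> (\<And>t. t \<in> X \<Longrightarrow> l1_dist N (f t) (g t) \<le> d * w t) \<Longrightarrow>
                  (\<And>t. t \<in> X \<Longrightarrow> l1_dist N (T f t) (T g t) \<le> c * d * w t)"
    and start: "init \<in> C" "\<And>t. t \<in> X \<Longrightarrow> l1_dist N (init t) (T init t) \<le> D * w t"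
    and closed: "\<And>F f D. (\<And>m::nat. F m \<in> C) \<Longrightarrow>
                   (\<And>m t. t \<in> X \<Longrightarrow> l1_dist N (F m t) (f t) \<le> c ^ m * D * w t) \<Longrightarrow> f \<in> C"
  shows "\<exists>f\<in>C. \<forall>t\<in>X. \<forall>i\<in>{1..N}. T f t i = f t i"
proof -
  define F where "F m = (T ^^ m) init" for m
  define f where "f t i = lim (\<lambda>m. F m t i)" for t i
  define D' where "D' = D / (1 - c)"
  have FC: "F m \<in> C" for m
    by (induction m) (auto simp: F_def start inv)
  have step: "l1_dist N (F m t) (F (Suc m) t) \<le> (c ^ m * D) * w t" if "t \<in> X" for m t
    using that
  proof (induction m arbitrary: t)
    case 0 then show ?case using start by (simp add: F_def)
  next
    case (Suc m)
    have "l1_dist N (T (F m) t) (T (F (Suc m)) t) \<le> c * (c ^ m * D) * w t"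
      by (rule contr[OF FC FC]) (use Suc c D in auto)
    then show ?case by (simp add: F_def mult.assoc)
  qed
  have geo: "(\<Sum>j<k. c ^ (m + j)) \<le> c ^ m / (1 - c)" for m k
  proof -
    have "(\<Sum>j<k. c ^ (m + j)) = c ^ m * ((1 - c ^ k) / (1 - c))"
      using c by (simp add: power_add sum_distrib_left[symmetric] sum_gp_strict)
    also have "\<dots> \<le> c ^ m * (1 / (1 - c))"
      using c by (intro mult_left_mono divide_right_mono) auto
    finally show ?thesis by simp
  qed
  have far: "l1_dist N (F m t) (F (m + k) t) \<le> c ^ m * D' * w t" if t: "t \<in> X" for m k t
  proof -
    have "l1_dist N (F m t) (F (m + k) t) \<le> (\<Sum>j<k. c ^ (m + j)) * (D * w t)"
    proof (induction k)
      case 0 show ?case by (simp add: l1_dist_def)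
    next
      case (Suc k)
      then show ?case
        using l1_dist_triangle[of N "F m t" "F (m + Suc k) t" "F (m + k) t"] step[OF t, of "m + k"]
        by (simp add: algebra_simps)
    qed
    also have "\<dots> \<le> c ^ m / (1 - c) * (D * w t)"
      using geo D w[OF t] by (intro mult_right_mono) auto
    finally show ?thesis by (simp add: D'_def)
  qed
  have conv: "(\<lambda>m. F m t i) \<longlonglongrightarrow> f t i" if t: "t \<in> X" and i: "i \<in> {1..N}" for t i
  proof -
    have "summable (\<lambda>m. F (Suc m) t i - F m t i)"
    proof (rule summable_comparison_test')
      show "summable (\<lambda>m. c ^ m * (D * w t))" using c by (intro summable_mult2 summable_geometric) auto
      fix m
      show "norm (F (Suc m) t i - F m t i) \<le> c ^ m * (D * w t)"
        using step[OF t, of m] coord_le_l1_dist[OF i, of "F (Suc m) t" "F m t"]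
        by (simp add: l1_dist_commute mult.assoc)
    qed
    then have "convergent (\<lambda>n. \<Sum>m<n. F (Suc m) t i - F m t i)" by (simp add: summable_iff_convergent)
    then have "convergent (\<lambda>n. F n t i - F 0 t i)" by (subst (asm) sum_lessThan_telescope[of "\<lambda>m. F m t i"])
    then have "convergent (\<lambda>n. F n t i)" by (simp add: convergent_diff_const_right_iff)
    then show ?thesis unfolding f_def by (simp add: convergent_LIMSEQ_iff)
  qed
  have lim: "l1_dist N (F m t) (f t) \<le> c ^ m * D' * w t" if t: "t \<in> X" for m t
  proof (rule LIMSEQ_le_const2)
    show "(\<lambda>k. l1_dist N (F m t) (F k t)) \<longlonglongrightarrow> l1_dist N (F m t) (f t)"
      unfolding l1_dist_def by (intro tendsto_sum tendsto_rabs tendsto_diff tendsto_const conv t)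
    show "\<exists>K. \<forall>k\<ge>K. l1_dist N (F m t) (F k t) \<le> c ^ m * D' * w t"
      using far[OF t, of m] by (intro exI[of _ m]) (metis le_add_diff_inverse)
  qed
  have fC: "f \<in> C" by (rule closed[OF FC lim])
  have D': "D' \<ge> 0" using D c by (simp add: D'_def)
  have bound: "l1_dist N (T f t) (f t) \<le> 2 * (c ^ Suc m * D' * w t)" if t: "t \<in> X" for t m
  proof -
    have "l1_dist N (T (F m) t) (T f t) \<le> c * (c ^ m * D') * w t"
      by (rule contr[OF FC fC]) (use c D' lim t in auto)
    then have "l1_dist N (T f t) (F (Suc m) t) \<le> c ^ Suc m * D' * w t"
      by (simp add: F_def l1_dist_commute mult.assoc)
    then show ?thesis
      using l1_dist_triangle[of N "T f t" "f t" "F (Suc m) t"] lim[OF t, of "Suc m"] by simp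
  qed
  have "l1_dist N (T f t) (f t) \<le> 0" if t: "t \<in> X" for t
  proof (rule LIMSEQ_le_const)
    show "(\<lambda>m. 2 * (c ^ Suc m * D' * w t)) \<longlonglongrightarrow> 0"
      using c by (intro tendsto_mult_right_zero tendsto_mult_left_zero LIMSEQ_Suc LIMSEQ_power_zero) auto
  qed (use bound[OF t] in auto)
  then have "\<forall>t\<in>X. \<forall>i\<in>{1..N}. T f t i = f t i"
    using l1_dist_eq_0 l1_dist_nonneg by (metis order_antisym)
  with fC show ?thesis by blast
qed

lemma l1_fixed_point:
  assumes c: "0 \<le> c" "c < 1" and T: "\<And>u v. l1_dist N (T u) (T v) \<le> c * l1_dist N u v"
  shows "\<exists>u. \<forall>i\<in>{1..N}. T u i = u i"
proof -
  have "\<exists>f\<in>UNIV. \<forall>t\<in>{()}. \<forall>i\<in>{1..N}. T (f t) i = f t i"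
  proof (rule weighted_fixed_point[where T = "\<lambda>f t. T (f t)" and c = c and w = "\<lambda>_. 1"
        and init = "\<lambda>_ _. 0" and D = "l1_dist N (\<lambda>_. 0) (T (\<lambda>_. 0))" and X = "{()}" and C = UNIV])
    fix f g :: "unit \<Rightarrow> nat \<Rightarrow> real" and d t
    assume *: "\<And>t. t \<in> {()} \<Longrightarrow> l1_dist N (f t) (g t) \<le> d * 1"
    have "l1_dist N (T (f t)) (T (g t)) \<le> c * l1_dist N (f t) (g t)" by (rule T)
    also have "\<dots> \<le> c * d * 1" using *[of t] c by (simp add: mult_left_mono)
    finally show "l1_dist N (T (f t)) (T (g t)) \<le> c * d * 1" .
  qed (rule c UNIV_I zero_le_one l1_dist_nonneg | simp only: mult_1_right order_refl)+
  then obtain f where f: "\<forall>t\<in>{()}. \<forall>i\<in>{1..N}. T (f t) i = f t i" by (rule bexE)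
  show ?thesis by (rule exI[of _ "f ()"]) (rule bspec[OF f singletonI])
qed

definition clip :: "real \<Rightarrow> real \<Rightarrow> real" where
  "clip R x = max (-R) (min R x)"

lemma clip_simps: "\<bar>x\<bar> \<le> R \<Longrightarrow> clip R x = x" "0 \<le> R \<Longrightarrow> \<bar>clip R x\<bar> \<le> R"
  "\<bar>clip R x - clip R y\<bar> \<le> \<bar>x - y\<bar>" "x \<le> y \<Longrightarrow> clip R x \<le> clip R y"
  by (auto simp: clip_def)

text \<open>Truncation turns the locally Lipschitz flux into a globally Lipschitz one and keeps its
  monotonicity. A priori bounds then show that the truncation was not active.\<close>

definition clip_flux :: "real \<Rightarrow> (real \<times> real \<Rightarrow> real) \<Rightarrow> real \<times> real \<Rightarrow> real" where
  "clip_flux R Abar p = Abar (clip R (fst p), clip R (snd p))"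

context monotone_flux
begin

lemma clip_flux_lipschitz:
  assumes "R \<ge> 0"
  obtains L where "L \<ge> 0" "\<And>a c a' c'. \<bar>clip_flux R Abar (a, c) - clip_flux R Abar (a', c')\<bar> \<le> L * (\<bar>a - a'\<bar> + \<bar>c - c'\<bar>)"
proof -
  obtain L where L: "L \<ge> 0" "\<And>a c a' c'. \<bar>a\<bar> \<le> R \<Longrightarrow> \<bar>c\<bar> \<le> R \<Longrightarrow> \<bar>a'\<bar> \<le> R \<Longrightarrow> \<bar>c'\<bar> \<le> R \<Longrightarrow>
                    \<bar>Abar (a, c) - Abar (a', c')\<bar> \<le> L * (\<bar>a - a'\<bar> + \<bar>c - c'\<bar>)"
    using loc_lip[of R] by blast
  have "\<bar>clip_flux R Abar (a, c) - clip_flux R Abar (a', c')\<bar> \<le> L * (\<bar>a - a'\<bar> + \<bar>c - c'\<bar>)" for a c a' c'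
  proof -
    have "\<bar>clip_flux R Abar (a, c) - clip_flux R Abar (a', c')\<bar> \<le> L * (\<bar>clip R a - clip R a'\<bar> + \<bar>clip R c - clip R c'\<bar>)"
      unfolding clip_flux_def fst_conv snd_conv by (intro L clip_simps assms)
    also have "\<dots> \<le> L * (\<bar>a - a'\<bar> + \<bar>c - c'\<bar>)"
      by (intro mult_left_mono add_mono clip_simps L)
    finally show ?thesis .
  qed
  with L(1) show thesis by (rule that)
qed

lemma clipped_monotone_flux: "R \<ge> 0 \<Longrightarrow> monotone_flux \<nu> N (clip_flux R Abar)"
  apply unfold_locales
      apply (rule nu)
     apply (rule N)
    apply (simp add: clip_flux_def mono1 clip_simps)
   apply (simp add: clip_flux_def mono2 clip_simps)
  subgoal for K using clip_flux_lipschitz[of R] by metis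
  done

lemma clipped_drift_lipschitz:
  assumes "R \<ge> 0"
  obtains L where "L \<ge> 0" "\<And>u v. l1_dist N (drift \<nu> (clip_flux R Abar) N u) (drift \<nu> (clip_flux R Abar) N v) \<le> L * l1_dist N u v"
proof -
  interpret c: monotone_flux \<nu> N "clip_flux R Abar" by (rule clipped_monotone_flux[OF assms])
  obtain L where L: "L \<ge> 0" "\<And>a c a' c'. \<bar>clip_flux R Abar (a, c) - clip_flux R Abar (a', c')\<bar> \<le> L * (\<bar>a - a'\<bar> + \<bar>c - c'\<bar>)"
    using clip_flux_lipschitz[OF assms] by blast
  have "l1_dist N (c.b u) (c.b v) \<le> (real N * (4 * real N * (L + \<nu> * real N))) * l1_dist N u v" for u v
  proof -
    have "\<bar>c.b u i - c.b v i\<bar> \<le> 4 * real N * (L + \<nu> * real N) * l1_dist N u v" if "i \<in> {1..N}" for i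
      by (rule c.drift_lipschitz[of L UNIV]) (use L that in auto)
    from l1_dist_le[OF this] show ?thesis by (simp add: mult.assoc)
  qed
  moreover have "real N * (4 * real N * (L + \<nu> * real N)) \<ge> 0" using L nu by simp
  ultimately show thesis by (rule that[rotated])
qed

lemma clipped_drift_eq:
  assumes "\<And>i. i \<in> {1..N} \<Longrightarrow> \<bar>v i\<bar> \<le> R"
  shows "drift \<nu> (clip_flux R Abar) N v = b v"
proof
  fix i
  show "drift \<nu> (clip_flux R Abar) N v i = b v i"
    using prv_in[of i N] nxt_in[of i N] nxt_prv[of i N] assms
    by (auto simp: drift_def Dminus_def D2_def Dplus_def num_flux_def clip_flux_def clip_simps)
qed

text \<open>For a small step \<open>h0\<close> the implicit equation is a contraction. Its resolvent \<open>J\<close> is nonexpansive by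
  accretivity, and the resolvent identity expresses the equation with the large step \<open>h\<close> as a fixed
  point equation for \<open>J\<close> with Lipschitz constant \<open>1 - h0 / h\<close>.\<close>

lemma resolvent_exists_lipschitz:
  assumes L: "L \<ge> 0" "\<And>u v. l1_dist N (b u) (b v) \<le> L * l1_dist N u v" and h: "h > 0"
  shows "\<exists>v. \<forall>i\<in>{1..N}. v i = x i + h * b v i"
proof -
  define h0 where "h0 = min h (1 / (2 * (L + 1)))"
  have h0: "h0 > 0" "h0 \<le> h" "h0 * L \<le> 1 / 2"
  proof -
    show "h0 > 0" "h0 \<le> h" using h L by (auto simp: h0_def)
    have "h0 * L \<le> 1 / (2 * (L + 1)) * L" using L by (intro mult_right_mono) (auto simp: h0_def)
    also have "\<dots> \<le> 1 / 2" using L by (simp add: divide_simps)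
    finally show "h0 * L \<le> 1 / 2" .
  qed
  have ex0: "\<exists>v. \<forall>i\<in>{1..N}. v i = y i + h0 * b v i" for y
  proof -
    have "\<exists>u. \<forall>i\<in>{1..N}. (\<lambda>i. y i + h0 * b u i) i = u i"
    proof (rule l1_fixed_point[where c = "1 / 2"])
      fix u v
      have "l1_dist N (\<lambda>i. y i + h0 * b u i) (\<lambda>i. y i + h0 * b v i) = h0 * l1_dist N (b u) (b v)"
        using h0(1) by (simp add: l1_dist_def sum_distrib_left abs_mult flip: right_diff_distrib)
      also have "\<dots> \<le> h0 * (L * l1_dist N u v)" using L h0 by (intro mult_left_mono) auto
      also have "\<dots> \<le> 1 / 2 * l1_dist N u v"
        unfolding mult.assoc[symmetric] using h0(3) by (intro mult_right_mono) auto
      finally show "l1_dist N (\<lambda>i. y i + h0 * b u i) (\<lambda>i. y i + h0 * b v i) \<le> 1 / 2 * l1_dist N u v" .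
    qed simp_all
    then obtain u where u: "\<And>i. i \<in> {1..N} \<Longrightarrow> y i + h0 * b u i = u i" by blast
    show ?thesis by (intro exI[of _ u] ballI) (rule u[symmetric])
  qed
  define J where "J y = (SOME v. \<forall>i\<in>{1..N}. v i = y i + h0 * b v i)" for y
  have J: "J y i = y i + h0 * b (J y) i" if "i \<in> {1..N}" for y i
    using someI_ex[OF ex0[of y]] that by (auto simp: J_def)
  have Jd: "l1_dist N (J y) (J z) \<le> l1_dist N y z" for y z
  proof -
    have "l1_dist N (J y) (J z) \<le> l1_dist N (\<lambda>i. J y i - h0 * b (J y) i) (\<lambda>i. J z i - h0 * b (J z) i)"
      by (rule l1_dist_implicit) (use h0 in simp)
    also have "\<dots> = l1_dist N y z"
    proof (rule l1_dist_cong)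
      show "J y i - h0 * b (J y) i = y i" "J z i - h0 * b (J z) i = z i" if "i \<in> {1..N}" for i
        using J[OF that, of y] J[OF that, of z] by linarith+
    qed
    finally show ?thesis .
  qed
  \<comment> \<open>\<open>v\<close> solves the equation with step \<open>h\<close> and datum \<open>x\<close> iff it solves the one with step
    \<open>h0\<close> and datum \<open>r x + (1 - r) v\<close>.\<close>
  define r where "r = h0 / h"
  have r: "0 < r" "r \<le> 1" using h0 h by (auto simp: r_def)
  have "\<exists>u. \<forall>i\<in>{1..N}. J (\<lambda>i. r * x i + (1 - r) * u i) i = u i"
  proof (rule l1_fixed_point[where c = "1 - r"])
    fix u v
    have "l1_dist N (J (\<lambda>i. r * x i + (1 - r) * u i)) (J (\<lambda>i. r * x i + (1 - r) * v i))
       \<le> l1_dist N (\<lambda>i. r * x i + (1 - r) * u i) (\<lambda>i. r * x i + (1 - r) * v i)" by (rule Jd)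
    also have "\<dots> = (1 - r) * l1_dist N u v"
      using r by (simp add: l1_dist_def sum_distrib_left abs_mult flip: right_diff_distrib)
    finally show "l1_dist N (J (\<lambda>i. r * x i + (1 - r) * u i)) (J (\<lambda>i. r * x i + (1 - r) * v i))
       \<le> (1 - r) * l1_dist N u v" .
  qed (use r in simp_all)
  then obtain f where f': "\<And>i. i \<in> {1..N} \<Longrightarrow> J (\<lambda>i. r * x i + (1 - r) * f i) i = f i" by blast
  have f: "J (\<lambda>i. r * x i + (1 - r) * f i) i = f i" if "i \<in> {1..N}" for i
    by (rule f'[OF that])
  define v where "v = J (\<lambda>i. r * x i + (1 - r) * f i)"
  have bf: "b v = b f" by (rule drift_cong) (simp only: v_def f)
  have "f i = x i + h * b f i" if i: "i \<in> {1..N}" for i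
  proof -
    have "f i = r * x i + (1 - r) * f i + h0 * b f i"
    proof -
      have "v i = f i" by (simp only: v_def f[OF i])
      then show ?thesis
        using J[OF i, of "\<lambda>i. r * x i + (1 - r) * f i"] unfolding v_def[symmetric] bf by simp
    qed
    then have "r * f i = r * (x i + h * b f i)" using h by (simp add: r_def algebra_simps)
    then show ?thesis using r by simp
  qed
  then show ?thesis by blast
qed

lemma resolvent_exists:
  assumes "h \<ge> 0"
  shows "\<exists>v. v \<in> {1..N} \<rightarrow>\<^sub>E UNIV \<and> (\<forall>i\<in>{1..N}. v i = x i + h * b v i)"
proof (cases "h = 0")
  case True
  then show ?thesis by (intro exI[of _ "restrict x {1..N}"]) auto
next
  case False
  with assms have h: "h > 0" by simp
  \<comment> \<open>The drift vanishes at 0, so accretivity bounds a solution by the \<open>\<ell>\<^sup>1\<close> norm of \<open>x\<close>, whatever the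
    truncation level.\<close>
  define R where "R = l1_dist N x (\<lambda>_. 0)"
  have R: "R \<ge> 0" by (simp add: R_def)
  interpret c: monotone_flux \<nu> N "clip_flux R Abar" by (rule clipped_monotone_flux[OF R])
  obtain L where "L \<ge> 0" "\<And>u v. l1_dist N (c.b u) (c.b v) \<le> L * l1_dist N u v"
    by (rule clipped_drift_lipschitz[OF R]) (rule that)
  from c.resolvent_exists_lipschitz[OF this h, of x]
  obtain v where v: "\<forall>i\<in>{1..N}. v i = x i + h * c.b v i" by blast
  have "l1_dist N v (\<lambda>_. 0) \<le> l1_dist N (\<lambda>i. v i - h * c.b v i) (\<lambda>i. 0 - h * c.b (\<lambda>_. 0) i)"
    using c.l1_dist_implicit[of h v "\<lambda>_. 0"] h by simp
  also have "\<dots> = l1_dist N x (\<lambda>_. 0)"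
  proof (rule l1_dist_cong)
    fix i assume i: "i \<in> {1..N}"
    show "v i - h * c.b v i = x i" using bspec[OF v i] by linarith
    show "0 - h * c.b (\<lambda>_. 0) i = 0" using c.drift_const[of 0 i] i by simp
  qed
  finally have "\<bar>v i\<bar> \<le> R" if "i \<in> {1..N}" for i
    using coord_le_l1_dist[OF that, of v "\<lambda>_. 0"] by (simp add: R_def)
  then have "c.b v = b v" by (rule clipped_drift_eq)
  moreover have "b (restrict v {1..N}) = b v" by (rule drift_cong) auto
  ultimately show ?thesis using bspec[OF v] by (intro exI[of _ "restrict v {1..N}"]) simp
qed

definition resolvent :: "real \<Rightarrow> (nat \<Rightarrow> real) \<Rightarrow> nat \<Rightarrow> real" where
  "resolvent h x = (SOME v. v \<in> {1..N} \<rightarrow>\<^sub>E UNIV \<and> (\<forall>i\<in>{1..N}. v i = x i + h * b v i))"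

lemma resolvent_props:
  assumes "h \<ge> 0"
  shows "resolvent h x \<in> {1..N} \<rightarrow>\<^sub>E UNIV \<and> (\<forall>i\<in>{1..N}. resolvent h x i = x i + h * b (resolvent h x) i)"
  unfolding resolvent_def by (rule someI_ex[OF resolvent_exists[OF assms]])

lemmas resolvent_ext = conjunct1[OF resolvent_props]

lemma resolvent_eq: "h \<ge> 0 \<Longrightarrow> i \<in> {1..N} \<Longrightarrow> resolvent h x i = x i + h * b (resolvent h x) i"
  by (rule bspec[OF conjunct2[OF resolvent_props]])

lemma l1_dist_resolvent_eq:
  assumes "h \<ge> 0"
  shows "l1_dist N (\<lambda>i. resolvent h x i - h * b (resolvent h x) i) y = l1_dist N x y"
proof (rule l1_dist_cong)
  show "resolvent h x i - h * b (resolvent h x) i = x i" if "i \<in> {1..N}" for i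
    using resolvent_eq[OF assms that, of x] by linarith
qed simp

text \<open>A vector that solves the implicit equation up to an error is at most that error away from the exact
  solution. This is the stability behind uniqueness, consistency and the a priori bound.\<close>

lemma resolvent_dist_implicit:
  assumes "h \<ge> 0"
  shows "l1_dist N v (resolvent h x) \<le> l1_dist N (\<lambda>i. v i - h * b v i) x"
proof -
  have "l1_dist N (\<lambda>i. v i - h * b v i) (\<lambda>i. resolvent h x i - h * b (resolvent h x) i)
     = l1_dist N (\<lambda>i. v i - h * b v i) x"
    using l1_dist_resolvent_eq[OF assms, of x] by (subst (1 2) l1_dist_commute)
  then show ?thesis using l1_dist_implicit[OF assms, of v "resolvent h x"] by simp
qed

lemma resolvent_dist: "h \<ge> 0 \<Longrightarrow> l1_dist N (resolvent h x) (resolvent h y) \<le> l1_dist N x y"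
  using resolvent_dist_implicit[of h "resolvent h x" y] by (simp add: l1_dist_resolvent_eq)

lemma resolvent_sum:
  assumes "h \<ge> 0" shows "(\<Sum>i=1..N. resolvent h x i) = (\<Sum>i=1..N. x i)"
proof -
  have "(\<Sum>i=1..N. resolvent h x i) = (\<Sum>i=1..N. x i + h * b (resolvent h x) i)"
    by (intro sum.cong refl resolvent_eq[OF assms]) auto
  then show ?thesis using sum_drift_0[of "resolvent h x"]
    by (simp add: sum.distrib sum_distrib_left[symmetric])
qed

lemma resolvent_R0: "h \<ge> 0 \<Longrightarrow> x \<in> R0 N \<Longrightarrow> resolvent h x \<in> R0 N"
  using resolvent_ext resolvent_sum by (auto simp: R0_def)

lemma resolvent_unique:
  assumes "h \<ge> 0" "\<And>i. i \<in> {1..N} \<Longrightarrow> v i = x i + h * b v i" "i \<in> {1..N}"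
  shows "v i = resolvent h x i"
proof -
  have "l1_dist N v (resolvent h x) \<le> l1_dist N (\<lambda>i. v i - h * b v i) x"
    by (rule resolvent_dist_implicit[OF assms(1)])
  also have "\<dots> = 0" unfolding l1_dist_eq_0
  proof
    fix i assume "i \<in> {1..N}"
    from assms(2)[OF this] show "v i - h * b v i = x i" by linarith
  qed
  finally have "l1_dist N v (resolvent h x) = 0" using l1_dist_nonneg[of N v "resolvent h x"] by linarith
  then show ?thesis using assms(3) by (simp add: l1_dist_eq_0)
qed

lemma resolvent_dist_strict:
  assumes h: "h > 0" and s: "(\<Sum>i=1..N. x i) = (\<Sum>i=1..N. y i)" and ne: "l1_dist N x y \<noteq> 0"
  shows "l1_dist N (resolvent h x) (resolvent h y) < l1_dist N x y"
proof (cases "l1_dist N (resolvent h x) (resolvent h y) = 0")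
  case True
  then show ?thesis using ne l1_dist_nonneg[of N x y] by linarith
next
  case False
  have "l1_dist N (resolvent h x) (resolvent h y)
     < l1_dist N (\<lambda>i. resolvent h x i - h * b (resolvent h x) i) (\<lambda>i. resolvent h y i - h * b (resolvent h y) i)"
    by (rule l1_dist_implicit_strict) (use assms False resolvent_sum in auto)
  also have "\<dots> = l1_dist N x (\<lambda>i. resolvent h y i - h * b (resolvent h y) i)"
    by (rule l1_dist_resolvent_eq) (use h in simp)
  also have "\<dots> = l1_dist N y x"
    by (subst l1_dist_commute, rule l1_dist_resolvent_eq) (use h in simp)
  finally show ?thesis by (simp add: l1_dist_commute[of N y])
qed

text \<open>Squaring \<open>x = v - h b v\<close> and dropping the square of \<open>h b v\<close> leaves twice the dissipated energy.\<close>

lemma resolvent_energy: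
  assumes h: "h \<ge> 0" and x: "(\<Sum>i=1..N. x i) = 0"
  shows "(1 + 2 * h * \<nu>) * sq_sum N (resolvent h x) \<le> sq_sum N x"
proof -
  define v where "v = resolvent h x"
  have xi: "v i - h * b v i = x i" if "i \<in> {1..N}" for i
    using resolvent_eq[OF h that, of x] unfolding v_def by linarith
  have "(v i)\<^sup>2 - 2 * h * (v i * b v i) \<le> (x i)\<^sup>2" if "i \<in> {1..N}" for i
    unfolding xi[OF that, symmetric] using zero_le_power2[of "h * b v i"]
    by (simp add: power2_eq_square algebra_simps)
  then have "(\<Sum>i=1..N. (v i)\<^sup>2 - 2 * h * (v i * b v i)) \<le> sq_sum N x"
    unfolding sq_sum_def by (rule sum_mono)
  then have "sq_sum N v - 2 * h * (\<Sum>i=1..N. v i * b v i) \<le> sq_sum N x"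
    by (simp add: sum_subtractf sq_sum_def sum_distrib_left)
  moreover have "(\<Sum>i=1..N. v i) = 0" unfolding v_def resolvent_sum[OF h] by (rule x)
  then have "2 * h * (\<Sum>i=1..N. v i * b v i) \<le> 2 * h * (- \<nu> * sq_sum N v)"
    by (intro mult_left_mono drift_dissipative) (use h in auto)
  ultimately show ?thesis by (simp add: algebra_simps flip: v_def)
qed

end

section \<open>The pathwise flow\<close>

text \<open>Because the noise is additive, the equation is meaningful for each continuous path \<open>q\<close> separately.\<close>

definition integral_solution ::
    "nat \<Rightarrow> ((nat \<Rightarrow> real) \<Rightarrow> nat \<Rightarrow> real) \<Rightarrow> real \<Rightarrow> (nat \<Rightarrow> real) \<Rightarrow> (real \<Rightarrow> nat \<Rightarrow> real) \<Rightarrow>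
     (real \<Rightarrow> nat \<Rightarrow> real) \<Rightarrow> bool" where
  "integral_solution N b T x q u \<longleftrightarrow>
     (\<forall>i\<in>{1..N}. continuous_on {0..T} (\<lambda>t. u t i)) \<and>
     (\<forall>t\<in>{0..T}. \<forall>i\<in>{1..N}. u t i = x i + integral {0..t} (\<lambda>s. b (u s) i) + q t i)"

lemma integral_solution_mono:
  "integral_solution N b T x q u \<Longrightarrow> T' \<le> T \<Longrightarrow> integral_solution N b T' x q u"
  unfolding integral_solution_def by (auto intro: continuous_on_subset)

lemma bounded_coords:
  fixes u :: "'a::topological_space \<Rightarrow> nat \<Rightarrow> real"
  assumes "compact S" "\<And>i. i \<in> {1..N} \<Longrightarrow> continuous_on S (\<lambda>t. u t i)"
  obtains K where "K \<ge> 0" "\<And>t i. t \<in> S \<Longrightarrow> i \<in> {1..N} \<Longrightarrow> \<bar>u t i\<bar> \<le> K"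
proof -
  have "continuous_on S (\<lambda>t. \<Sum>i=1..N. \<bar>u t i\<bar>)"
    by (intro continuous_on_sum continuous_on_rabs assms)
  then have "bounded ((\<lambda>t. \<Sum>i=1..N. \<bar>u t i\<bar>) ` S)"
    by (intro compact_imp_bounded compact_continuous_image assms)
  then obtain K where K: "\<And>t. t \<in> S \<Longrightarrow> \<bar>\<Sum>i=1..N. \<bar>u t i\<bar>\<bar> \<le> K"
    by (auto simp: bounded_iff)
  show thesis
  proof (rule that[of "\<bar>K\<bar>"])
    fix t i assume "t \<in> S" "i \<in> {1..N}"
    then have "\<bar>u t i\<bar> \<le> (\<Sum>i=1..N. \<bar>u t i\<bar>)" by (intro member_le_sum) auto
    with K[OF \<open>t \<in> S\<close>] show "\<bar>u t i\<bar> \<le> \<bar>K\<bar>" by linarith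
  qed simp
qed

lemma modulus_of_continuity:
  fixes u :: "real \<Rightarrow> nat \<Rightarrow> real"
  assumes "\<And>i. i \<in> {1..N} \<Longrightarrow> continuous_on {0..T} (\<lambda>t. u t i)" "\<epsilon> > 0"
  shows "\<forall>\<^sub>F n in sequentially. \<forall>i\<in>{1..N}. \<forall>s\<in>{0..T}. \<forall>t\<in>{0..T}. \<bar>s - t\<bar> \<le> T / real n \<longrightarrow> \<bar>u s i - u t i\<bar> \<le> \<epsilon>"
proof (rule eventually_ball_finite, simp, rule ballI)
  fix i assume "i \<in> {1..N}"
  then have "uniformly_continuous_on {0..T} (\<lambda>t. u t i)"
    by (intro compact_uniformly_continuous assms) auto
  then obtain d where d: "d > 0" "\<And>s t. s \<in> {0..T} \<Longrightarrow> t \<in> {0..T} \<Longrightarrow> dist s t < d \<Longrightarrow> dist (u s i) (u t i) < \<epsilon>"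
    using assms(2) unfolding uniformly_continuous_on_def by metis
  have "(\<lambda>n. T / real n) \<longlonglongrightarrow> 0" by (rule lim_const_over_n)
  then have "\<forall>\<^sub>F n in sequentially. T / real n < d" using d(1) by (rule order_tendstoD)
  then show "\<forall>\<^sub>F n in sequentially. \<forall>s\<in>{0..T}. \<forall>t\<in>{0..T}. \<bar>s - t\<bar> \<le> T / real n \<longrightarrow> \<bar>u s i - u t i\<bar> \<le> \<epsilon>"
  proof eventually_elim
    case (elim n)
    show ?case
    proof (intro ballI impI)
      fix s t assume "s \<in> {0..T}" "t \<in> {0..T}" "\<bar>s - t\<bar> \<le> T / real n"
      then show "\<bar>u s i - u t i\<bar> \<le> \<epsilon>" using d(2)[of s t] elim by (simp add: dist_real_def)
    qed
  qed
qed

context monotone_flux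
begin

lemma drift_continuous:
  fixes u :: "'a::topological_space \<Rightarrow> nat \<Rightarrow> real"
  assumes S: "compact S" and u: "\<And>i. i \<in> {1..N} \<Longrightarrow> continuous_on S (\<lambda>t. u t i)" and i: "i \<in> {1..N}"
  shows "continuous_on S (\<lambda>t. b (u t) i)"
proof -
  obtain K where K: "\<And>t i. t \<in> S \<Longrightarrow> i \<in> {1..N} \<Longrightarrow> \<bar>u t i\<bar> \<le> K"
    using bounded_coords[OF S, of N u] u by metis
  obtain L where L: "\<And>u v. (\<forall>i\<in>{1..N}. \<bar>u i\<bar> \<le> K \<and> \<bar>v i\<bar> \<le> K) \<Longrightarrow> l1_dist N (b u) (b v) \<le> L * l1_dist N u v"
    using drift_loc_lip[of K] by blast
  show ?thesis
    unfolding continuous_on_def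
  proof
    fix t0 assume t0: "t0 \<in> S"
    have "((\<lambda>t. L * l1_dist N (u t) (u t0)) \<longlongrightarrow> L * l1_dist N (u t0) (u t0)) (at t0 within S)"
      unfolding l1_dist_def
      using u t0 by (intro tendsto_intros) (auto simp: continuous_on_def)
    then have lim: "((\<lambda>t. L * l1_dist N (u t) (u t0)) \<longlongrightarrow> 0) (at t0 within S)"
      by (simp add: l1_dist_def)
    have "((\<lambda>t. b (u t) i - b (u t0) i) \<longlongrightarrow> 0) (at t0 within S)"
    proof (rule Lim_null_comparison[OF _ lim])
      show "\<forall>\<^sub>F t in at t0 within S. norm (b (u t) i - b (u t0) i) \<le> L * l1_dist N (u t) (u t0)"
        unfolding eventually_at_topological
      proof (intro exI[of _ UNIV] conjI ballI impI)
        fix t assume "t \<in> S"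
        then show "norm (b (u t) i - b (u t0) i) \<le> L * l1_dist N (u t) (u t0)"
          using L[of "u t" "u t0"] K t0 coord_le_l1_dist[OF i, of "b (u t)" "b (u t0)"]
          by (simp only: real_norm_def) (meson order_trans)
      qed auto
    qed
    then show "((\<lambda>t. b (u t) i) \<longlongrightarrow> b (u t0) i) (at t0 within S)"
      by (simp add: LIM_zero_iff)
  qed
qed

lemma solution_cont:
  assumes "integral_solution N b T x q u" "i \<in> {1..N}"
  shows "continuous_on {0..T} (\<lambda>t. u t i)" "continuous_on {0..T} (\<lambda>t. b (u t) i)"
  using assms drift_continuous[of "{0..T}" u i] by (auto simp: integral_solution_def)

lemma solution_increment:
  assumes sol: "integral_solution N b T x q u" and i: "i \<in> {1..N}" and st: "0 \<le> s" "s \<le> t" "t \<le> T"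
  shows "u t i = u s i + integral {s..t} (\<lambda>r. b (u r) i) + (q t i - q s i)"
proof -
  have "(\<lambda>r. b (u r) i) integrable_on {0..t}"
    by (rule integrable_continuous_real, rule continuous_on_subset[OF solution_cont(2)[OF sol i]]) (use st in auto)
  from Henstock_Kurzweil_Integration.integral_combine[OF st(1,2) this]
  have "integral {0..s} (\<lambda>r. b (u r) i) + integral {s..t} (\<lambda>r. b (u r) i) = integral {0..t} (\<lambda>r. b (u r) i)" .
  moreover have "u r i = x i + integral {0..r} (\<lambda>r. b (u r) i) + q r i" if "r \<in> {0..T}" for r
    using sol i that unfolding integral_solution_def by blast
  from this[of s] this[of t] have "u s i = x i + integral {0..s} (\<lambda>r. b (u r) i) + q s i"
    "u t i = x i + integral {0..t} (\<lambda>r. b (u r) i) + q t i" using st by auto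
  ultimately show ?thesis by linarith
qed

text \<open>The scheme with step \<open>h\<close>: an implicit step of the drift, followed by the increment of the driving
  path over \<open>[k h, (k + 1) h]\<close>.\<close>

primrec split_step :: "real \<Rightarrow> (real \<Rightarrow> nat \<Rightarrow> real) \<Rightarrow> (nat \<Rightarrow> real) \<Rightarrow> nat \<Rightarrow> nat \<Rightarrow> real" where
  "split_step h q x 0 = x"
| "split_step h q x (Suc k) =
     (\<lambda>i\<in>{1..N}. resolvent h (split_step h q x k) i + (q (real (Suc k) * h) i - q (real k * h) i))"

lemma split_step_dist:
  "h \<ge> 0 \<Longrightarrow> l1_dist N (split_step h q x k) (split_step h q y k) \<le> l1_dist N x y"
proof (induction k)
  case (Suc k)
  have "l1_dist N (split_step h q x (Suc k)) (split_step h q y (Suc k))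
     = l1_dist N (resolvent h (split_step h q x k)) (resolvent h (split_step h q y k))"
    by (simp add: l1_dist_def)
  also have "\<dots> \<le> l1_dist N (split_step h q x k) (split_step h q y k)" by (rule resolvent_dist[OF Suc.prems])
  finally show ?case using Suc.IH[OF Suc.prems] by linarith
qed simp

lemma split_step_R0:
  assumes "h \<ge> 0" "x \<in> R0 N" "\<And>k::nat. q (real k * h) \<in> R0 N"
  shows "split_step h q x k \<in> R0 N"
proof (induction k)
  case (Suc k)
  have "(\<Sum>i=1..N. split_step h q x (Suc k) i) = (\<Sum>i=1..N. resolvent h (split_step h q x k) i)
      + ((\<Sum>i=1..N. q (real (Suc k) * h) i) - (\<Sum>i=1..N. q (real k * h) i))"
    by (simp add: sum.distrib sum_subtractf)
  also have "\<dots> = 0"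
    using resolvent_R0[OF assms(1) Suc] assms(3)[of k] assms(3)[of "Suc k"] by (simp add: R0_def)
  finally show ?case by (auto simp: R0_def)
qed (use assms in simp)

text \<open>Any solution nearly satisfies the implicit equation: the local error is of the order of \<open>h\<close> times the
  modulus of continuity at scale \<open>h\<close>. Since the resolvent is nonexpansive, the local errors just
  add up. The limit does not depend on the solution, which gives uniqueness.\<close>

lemma split_step_converges:
  assumes sol: "integral_solution N b T x q u" and T: "T \<ge> 0"
    and q: "\<And>i. i \<in> {1..N} \<Longrightarrow> continuous_on {0..T} (\<lambda>t. q t i)" "\<And>i. i \<in> {1..N} \<Longrightarrow> q 0 i = 0"
  shows "(\<lambda>n. l1_dist N (u T) (split_step (T / real n) q x n)) \<longlonglongrightarrow> 0"
proof -
  obtain K1 where K1: "K1 \<ge> 0" "\<And>t i. t \<in> {0..T} \<Longrightarrow> i \<in> {1..N} \<Longrightarrow> \<bar>u t i\<bar> \<le> K1"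
    using bounded_coords[of "{0..T}" N u] solution_cont(1)[OF sol] by (metis compact_Icc)
  obtain K2 where K2: "K2 \<ge> 0" "\<And>t i. t \<in> {0..T} \<Longrightarrow> i \<in> {1..N} \<Longrightarrow> \<bar>q t i\<bar> \<le> K2"
    using bounded_coords[of "{0..T}" N q] q(1) by (metis compact_Icc)
  \<comment> \<open>The auxiliary state \<open>v\<close> below differs from \<open>u\<close> by an increment of \<open>q\<close>, whence the bound
    \<open>K1 + 2 * K2\<close> for its coordinates.\<close>
  define K where "K = K1 + 2 * K2"
  obtain L where L: "L \<ge> 0" "\<And>u v. (\<forall>i\<in>{1..N}. \<bar>u i\<bar> \<le> K \<and> \<bar>v i\<bar> \<le> K) \<Longrightarrow> l1_dist N (b u) (b v) \<le> L * l1_dist N u v"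
    using drift_loc_lip[of K] by blast
  define C where "C = T * (real N * (L * (real N * 2)))"
  have C: "C \<ge> 0" using T L by (simp add: C_def)
  have main: "\<forall>\<^sub>F n in sequentially. l1_dist N (u T) (split_step (T / real n) q x n) \<le> C * \<epsilon>" if e: "\<epsilon> > 0" for \<epsilon>
  proof -
    have mu: "\<forall>\<^sub>F n in sequentially. \<forall>i\<in>{1..N}. \<forall>s\<in>{0..T}. \<forall>t\<in>{0..T}. \<bar>s - t\<bar> \<le> T / real n \<longrightarrow> \<bar>u s i - u t i\<bar> \<le> \<epsilon>"
      by (rule modulus_of_continuity[OF solution_cont(1)[OF sol] e])
    have mq: "\<forall>\<^sub>F n in sequentially. \<forall>i\<in>{1..N}. \<forall>s\<in>{0..T}. \<forall>t\<in>{0..T}. \<bar>s - t\<bar> \<le> T / real n \<longrightarrow> \<bar>q s i - q t i\<bar> \<le> \<epsilon>"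
      by (rule modulus_of_continuity[OF q(1) e])
    from mu mq eventually_gt_at_top[of 0] show ?thesis
  proof eventually_elim
    case (elim n)
    define h where "h = T / real n"
    have h: "h \<ge> 0" "real n * h = T" using T elim by (auto simp: h_def)
    have "l1_dist N (u (real k * h)) (split_step h q x k) \<le> real k * h * (real N * (L * (real N * 2))) * \<epsilon>" if "k \<le> n" for k
      using that
    proof (induction k)
      case 0
      have "u 0 i = x i" if "i \<in> {1..N}" for i
        using sol that T q(2)[OF that] unfolding integral_solution_def by force
      then show ?case by (simp add: l1_dist_def)
    next
      case (Suc k)
      define s where "s = real k * h"
      define t where "t = real (Suc k) * h"
      have "real (Suc k) * h \<le> real n * h" using Suc h by (intro mult_right_mono) auto
      then have st: "0 \<le> s" "s \<le> t" "t \<le> T" "t - s = h" using h by (auto simp: s_def t_def algebra_simps)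
      \<comment> \<open>The solution at time \<open>t\<close> without the last increment of the path: the state that the implicit
        step started from \<open>u s\<close> should produce.\<close>
      define v where "v i = u t i - (q t i - q s i)" for i
      have close: "\<bar>u r i - v i\<bar> \<le> 2 * \<epsilon>" if "r \<in> {s..t}" "i \<in> {1..N}" for r i
      proof -
        have "\<bar>u r i - u t i\<bar> \<le> \<epsilon>" "\<bar>q t i - q s i\<bar> \<le> \<epsilon>"
          using elim(1,2) that st by (auto simp: h_def)
        then show ?thesis unfolding v_def by linarith
      qed
      have vK: "\<bar>v i\<bar> \<le> K" if "i \<in> {1..N}" for i
        using K1(2)[OF _ that, of t] K2(2)[OF _ that, of t] K2(2)[OF _ that, of s] st
        unfolding v_def K_def by auto
      have bd: "\<bar>b (u r) i - b v i\<bar> \<le> L * (real N * (2 * \<epsilon>))" if r: "r \<in> {s..t}" and i: "i \<in> {1..N}" for r i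
      proof -
        have "\<bar>b (u r) i - b v i\<bar> \<le> l1_dist N (b (u r)) (b v)" by (rule coord_le_l1_dist[OF i])
        also have "\<dots> \<le> L * l1_dist N (u r) v"
        proof (rule L(2), intro ballI conjI)
          fix j assume j: "j \<in> {1..N}"
          have "\<bar>u r j\<bar> \<le> K1" using K1(2)[OF _ j, of r] st r by auto
          then show "\<bar>u r j\<bar> \<le> K" using K2(1) by (simp add: K_def)
          show "\<bar>v j\<bar> \<le> K" by (rule vK[OF j])
        qed
        also have "\<dots> \<le> L * (real N * (2 * \<epsilon>))"
          by (intro mult_left_mono l1_dist_le close r L)
        finally show ?thesis .
      qed
      have ci: "\<bar>(v i - h * b v i) - u s i\<bar> \<le> h * (L * (real N * (2 * \<epsilon>)))" if i: "i \<in> {1..N}" for i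
      proof -
        have cont: "continuous_on {s..t} (\<lambda>r. b (u r) i)"
          by (rule continuous_on_subset[OF solution_cont(2)[OF sol i]]) (use st in auto)
        have "(v i - h * b v i) - u s i = integral {s..t} (\<lambda>r. b (u r) i) - h * b v i"
          using solution_increment[OF sol i st(1-3)] unfolding v_def by linarith
        also have "\<dots> = integral {s..t} (\<lambda>r. b (u r) i - b v i)"
          using st(2,4) by (subst Henstock_Kurzweil_Integration.integral_diff)
             (auto intro: integrable_continuous_real cont)
        also have "\<bar>\<dots>\<bar> \<le> (L * (real N * (2 * \<epsilon>))) * (t - s)"
          unfolding real_norm_def[symmetric]
          by (rule integral_bound) (use st bd[OF _ i] cont in \<open>auto intro!: continuous_intros\<close>)
        finally show ?thesis using st by (simp add: algebra_simps)
      qed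
      have "l1_dist N (u t) (split_step h q x (Suc k)) = l1_dist N v (resolvent h (split_step h q x k))"
        unfolding l1_dist_def by (intro sum.cong refl) (simp add: v_def s_def t_def algebra_simps)
      also have "\<dots> \<le> l1_dist N (\<lambda>i. v i - h * b v i) (split_step h q x k)"
        by (rule resolvent_dist_implicit[OF h(1)])
      also have "\<dots> \<le> l1_dist N (\<lambda>i. v i - h * b v i) (u s) + l1_dist N (u s) (split_step h q x k)"
        by (rule l1_dist_triangle)
      also have "\<dots> \<le> real N * (h * (L * (real N * (2 * \<epsilon>)))) + real k * h * (real N * (L * (real N * 2))) * \<epsilon>"
        by (intro add_mono l1_dist_le ci) (use Suc in \<open>auto simp: s_def\<close>)
      also have "\<dots> = real (Suc k) * h * (real N * (L * (real N * 2))) * \<epsilon>" by (simp add: algebra_simps)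
      finally show ?case by (simp only: t_def)
    qed
    from this[of n] show ?case using h by (simp add: C_def h_def[symmetric])
  qed
  qed
  show ?thesis
  proof (rule tendstoI)
    fix e :: real assume "e > 0"
    then have "e / (C + 1) > 0" using C by simp
    from main[OF this] show "\<forall>\<^sub>F n in sequentially. dist (l1_dist N (u T) (split_step (T / real n) q x n)) 0 < e"
    proof eventually_elim
      case (elim n)
      have "C * (e / (C + 1)) < e" using C \<open>e > 0\<close> by (simp add: divide_simps)
      with elim show ?case by simp
    qed
  qed
qed

text \<open>The driving path itself satisfies the implicit equation up to the error \<open>h b q\<close>, so the scheme
  cannot leave it faster than these errors accumulate.\<close>

lemma split_step_bound:
  assumes h: "h \<ge> 0" and B: "\<And>j. j < k \<Longrightarrow> l1_dist N (b (q (real j * h))) (\<lambda>_. 0) \<le> B" and q0: "\<And>i. i \<in> {1..N} \<Longrightarrow> q 0 i = 0"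
  shows "l1_dist N (split_step h q x k) (q (real k * h)) \<le> l1_dist N x (\<lambda>_. 0) + real k * h * B"
  using B
proof (induction k)
  case 0
  then show ?case using q0 by (simp add: l1_dist_def)
next
  case (Suc k)
  let ?q = "q (real k * h)"
  have "l1_dist N (split_step h q x (Suc k)) (q (real (Suc k) * h)) = l1_dist N (resolvent h (split_step h q x k)) ?q"
    unfolding l1_dist_def by (intro sum.cong refl) (simp add: algebra_simps)
  also have "\<dots> \<le> l1_dist N (\<lambda>i. ?q i - h * b ?q i) (split_step h q x k)"
    by (subst l1_dist_commute, rule resolvent_dist_implicit[OF h])
  also have "\<dots> \<le> l1_dist N (\<lambda>i. ?q i - h * b ?q i) ?q + l1_dist N ?q (split_step h q x k)"
    by (rule l1_dist_triangle)
  also have "l1_dist N (\<lambda>i. ?q i - h * b ?q i) ?q = h * l1_dist N (b ?q) (\<lambda>_. 0)"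
    using h by (simp add: l1_dist_def sum_distrib_left abs_mult)
  also have "\<dots> \<le> h * B" using Suc.prems[of k] h by (intro mult_left_mono) auto
  also have "l1_dist N ?q (split_step h q x k) \<le> l1_dist N x (\<lambda>_. 0) + real k * h * B"
    by (subst l1_dist_commute, rule Suc.IH) (use Suc.prems in auto)
  finally show ?case by (simp add: algebra_simps)
qed

lemma solution_bound:
  assumes sol: "integral_solution N b T x q u"
    and q: "\<And>i. i \<in> {1..N} \<Longrightarrow> continuous_on {0..T} (\<lambda>t. q t i)" "\<And>i. i \<in> {1..N} \<Longrightarrow> q 0 i = 0"
    and B: "\<And>t. t \<in> {0..T} \<Longrightarrow> l1_dist N (b (q t)) (\<lambda>_. 0) \<le> B" and t: "t \<in> {0..T}"
  shows "l1_dist N (u t) (q t) \<le> l1_dist N x (\<lambda>_. 0) + t * B"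
proof -
  have sol': "integral_solution N b t x q u" by (rule integral_solution_mono[OF sol]) (use t in auto)
  have lim: "(\<lambda>n. l1_dist N (u t) (split_step (t / real n) q x n) + (l1_dist N x (\<lambda>_. 0) + t * B))
      \<longlonglongrightarrow> 0 + (l1_dist N x (\<lambda>_. 0) + t * B)"
  proof (intro tendsto_intros split_step_converges[OF sol'])
    show "continuous_on {0..t} (\<lambda>t. q t i)" if "i \<in> {1..N}" for i
      by (rule continuous_on_subset[OF q(1)[OF that]]) (use t in auto)
  qed (use t q in auto)
  have "l1_dist N (u t) (q t) \<le> l1_dist N (u t) (split_step (t / real n) q x n) + (l1_dist N x (\<lambda>_. 0) + t * B)"
    if n: "n \<ge> 1" for n
  proof -
    have nt: "real n * (t / real n) = t" using n by simp
    have "l1_dist N (split_step (t / real n) q x n) (q (real n * (t / real n))) \<le> l1_dist N x (\<lambda>_. 0) + real n * (t / real n) * B"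
    proof (rule split_step_bound)
      fix j assume "j < n"
      then have "real j * (t / real n) \<le> real n * (t / real n)"
        using t by (intro mult_right_mono) auto
      then show "l1_dist N (b (q (real j * (t / real n)))) (\<lambda>_. 0) \<le> B"
        unfolding nt using t by (intro B) auto
    qed (use t q in auto)
    then show ?thesis
      using l1_dist_triangle[of N "u t" "q t" "split_step (t / real n) q x n"] unfolding nt by linarith
  qed
  then show ?thesis using LIMSEQ_le_const[OF lim] by auto
qed

text \<open>Picard iteration; the weight \<open>exp (lam t)\<close> makes the integral operator a contraction with factor
  one half on the whole interval.\<close>

lemma solution_exists_lipschitz:
  assumes L: "L \<ge> 0" "\<And>u v. l1_dist N (b u) (b v) \<le> L * l1_dist N u v"
    and q: "\<And>i. i \<in> {1..N} \<Longrightarrow> continuous_on {0..T} (\<lambda>t. q t i)"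
  shows "\<exists>u. integral_solution N b T x q u"
proof -
  define \<Phi> where "\<Phi> u t i = x i + integral {0..t} (\<lambda>s. b (u s) i) + q t i" for u :: "real \<Rightarrow> nat \<Rightarrow> real" and t i
  define lam where "lam = 2 * (real N * L + 1)"
  have lam: "lam > 0" using L by (simp add: lam_def add_nonneg_pos)
  define C where "C = {u::real \<Rightarrow> nat \<Rightarrow> real. \<forall>i\<in>{1..N}. continuous_on {0..T} (\<lambda>t. u t i)}"
  have bc: "continuous_on {0..T} (\<lambda>t. b (u t) i)" if "u \<in> C" "i \<in> {1..N}" for u i
    by (rule drift_continuous) (use that in \<open>auto simp: C_def\<close>)
  have inv: "\<Phi> u \<in> C" if u: "u \<in> C" for u
    unfolding C_def \<Phi>_def
    by (auto intro!: continuous_intros indefinite_integral_continuous_1 integrable_continuous_real bc[OF u] q)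
  obtain K where K: "K \<ge> 0" "\<And>t i. t \<in> {0..T} \<Longrightarrow> i \<in> {1..N} \<Longrightarrow> \<bar>\<Phi> (\<lambda>_ _. 0) t i\<bar> \<le> K"
    using bounded_coords[of "{0..T}" N "\<Phi> (\<lambda>_ _. 0)"] inv[of "\<lambda>_ _. 0"] by (auto simp: C_def)
  have "\<exists>u\<in>C. \<forall>t\<in>{0..T}. \<forall>i\<in>{1..N}. \<Phi> u t i = u t i"
  proof (rule weighted_fixed_point[where T = \<Phi> and c = "1/2" and w = "\<lambda>t. exp (lam * t)"
        and init = "\<lambda>_ _. 0" and D = "real N * K" and X = "{0..T}" and C = C])
    fix f g :: "real \<Rightarrow> nat \<Rightarrow> real" and d t
    assume fg: "f \<in> C" "g \<in> C" and d: "d \<ge> 0" and t: "t \<in> {0..T}"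
      and *: "\<And>t. t \<in> {0..T} \<Longrightarrow> l1_dist N (f t) (g t) \<le> d * exp (lam * t)"
    have ei: "((\<lambda>s. L * d * exp (lam * s)) has_integral (L * d * exp (lam * t) / lam - L * d * exp (lam * 0) / lam)) {0..t}"
      by (rule fundamental_theorem_of_calculus)
         (use t lam in \<open>auto intro!: derivative_eq_intros simp flip: has_real_derivative_iff_has_vector_derivative\<close>)
    have "\<bar>\<Phi> f t i - \<Phi> g t i\<bar> \<le> L * d * exp (lam * t) / lam" if i: "i \<in> {1..N}" for i
    proof -
      have int: "(\<lambda>s. b (f s) i) integrable_on {0..t}" "(\<lambda>s. b (g s) i) integrable_on {0..t}"
        using bc[OF fg(1) i] bc[OF fg(2) i] t
        by (auto intro!: integrable_continuous_real elim!: continuous_on_subset)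
      have "\<Phi> f t i - \<Phi> g t i = integral {0..t} (\<lambda>s. b (f s) i - b (g s) i)"
        unfolding \<Phi>_def by (subst Henstock_Kurzweil_Integration.integral_diff[OF int]) simp
      also have "norm \<dots> \<le> integral {0..t} (\<lambda>s. L * d * exp (lam * s))"
      proof (rule integral_norm_bound_integral)
        fix s assume s: "s \<in> {0..t}"
        have "\<bar>b (f s) i - b (g s) i\<bar> \<le> L * l1_dist N (f s) (g s)"
          using coord_le_l1_dist[OF i, of "b (f s)" "b (g s)"] L(2)[of "f s" "g s"] by linarith
        also have "\<dots> \<le> L * (d * exp (lam * s))" using s t by (intro mult_left_mono * L) auto
        finally show "norm (b (f s) i - b (g s) i) \<le> L * d * exp (lam * s)" by (simp add: mult.assoc)
      qed (use int ei in \<open>auto intro: integrable_diff\<close>)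
      also have "\<dots> \<le> L * d * exp (lam * t) / lam"
        using integral_unique[OF ei] L d lam by simp
      finally show ?thesis by simp
    qed
    then have "l1_dist N (\<Phi> f t) (\<Phi> g t) \<le> real N * (L * d * exp (lam * t) / lam)" by (rule l1_dist_le)
    also have "\<dots> = (real N * L / lam) * (d * exp (lam * t))" by simp
    also have "\<dots> \<le> 1 / 2 * (d * exp (lam * t))"
      by (intro mult_right_mono) (use lam d L in \<open>auto simp: lam_def divide_simps\<close>)
    finally show "l1_dist N (\<Phi> f t) (\<Phi> g t) \<le> 1 / 2 * d * exp (lam * t)" by simp
  next
    fix t assume t: "t \<in> {0..T}"
    have "l1_dist N (\<lambda>_. 0) (\<Phi> (\<lambda>_ _. 0) t) \<le> real N * K" by (rule l1_dist_le) (use K(2)[OF t] in simp)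
    also have "\<dots> \<le> real N * K * exp (lam * t)"
      using mult_left_mono[of 1 "exp (lam * t)" "real N * K"] K(1) lam t by simp
    finally show "l1_dist N (\<lambda>_. 0) (\<Phi> (\<lambda>_ _. 0) t) \<le> real N * K * exp (lam * t)" .
  next
    fix F f and D :: real
    assume F: "\<And>m::nat. F m \<in> C" and lim: "\<And>m t. t \<in> {0..T} \<Longrightarrow> l1_dist N (F m t) (f t) \<le> (1/2) ^ m * D * exp (lam * t)"
    show "f \<in> C"
      unfolding C_def
    proof (intro CollectI ballI)
      fix i assume i: "i \<in> {1..N}"
      show "continuous_on {0..T} (\<lambda>t. f t i)"
      proof (rule uniform_limit_theorem)
        show "\<forall>\<^sub>F m in sequentially. continuous_on {0..T} (\<lambda>t. F m t i)" using F i by (auto simp: C_def)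
        show "uniform_limit {0..T} (\<lambda>m t. F m t i) (\<lambda>t. f t i) sequentially"
        proof (rule uniform_limitI)
          fix e :: real assume "e > 0"
          have "(\<lambda>m. (1/2) ^ m * (\<bar>D\<bar> * exp (lam * T))) \<longlonglongrightarrow> 0"
            by (intro tendsto_mult_left_zero LIMSEQ_power_zero) auto
          then have "\<forall>\<^sub>F m in sequentially. (1/2) ^ m * (\<bar>D\<bar> * exp (lam * T)) < e"
            using \<open>e > 0\<close> by (rule order_tendstoD)
          then show "\<forall>\<^sub>F m in sequentially. \<forall>t\<in>{0..T}. dist (F m t i) (f t i) < e"
          proof eventually_elim
            case (elim m)
            show ?case
            proof
              fix t assume t: "t \<in> {0..T}"
              have "\<bar>F m t i - f t i\<bar> \<le> (1/2) ^ m * (D * exp (lam * t))"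
                using coord_le_l1_dist[OF i, of "F m t" "f t"] lim[OF t, of m] by (simp add: mult.assoc)
              also have "\<dots> \<le> (1/2) ^ m * (\<bar>D\<bar> * exp (lam * T))"
                by (intro mult_left_mono mult_mono) (use t lam in auto)
              finally show "dist (F m t i) (f t i) < e" using elim by (simp add: dist_real_def)
            qed
          qed
        qed
      qed simp
    qed
  qed (use inv K in \<open>auto simp: C_def\<close>)
  then obtain u where u: "u \<in> C" "\<forall>t\<in>{0..T}. \<forall>i\<in>{1..N}. \<Phi> u t i = u t i" by (rule bexE)
  have "u t i = \<Phi> u t i" if "t \<in> {0..T}" "i \<in> {1..N}" for t i
    by (rule sym, rule bspec[OF bspec[OF u(2) that(1)] that(2)])
  then have "integral_solution N b T x q u"
    using u(1) unfolding integral_solution_def C_def \<Phi>_def by (intro conjI ballI) (drule CollectD, erule bspec)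
  then show ?thesis by blast
qed

text \<open>The truncation level \<open>R\<close> is the a priori bound for the truncated equation, and this bound does not
  depend on the truncation, because the driving path stays in the region where the flux is unchanged.\<close>

lemma solution_exists:
  assumes q: "\<And>i. i \<in> {1..N} \<Longrightarrow> continuous_on {0..T} (\<lambda>t. q t i)" "\<And>i. i \<in> {1..N} \<Longrightarrow> q 0 i = 0" and T: "T \<ge> 0"
  shows "\<exists>u. integral_solution N b T x q u"
proof -
  obtain K where K: "K \<ge> 0" "\<And>t i. t \<in> {0..T} \<Longrightarrow> i \<in> {1..N} \<Longrightarrow> \<bar>q t i\<bar> \<le> K"
    using bounded_coords[of "{0..T}" N q] q(1) by (metis compact_Icc)
  obtain B where B: "B \<ge> 0" "\<And>t i. t \<in> {0..T} \<Longrightarrow> i \<in> {1..N} \<Longrightarrow> \<bar>b (q t) i\<bar> \<le> B"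
    using bounded_coords[of "{0..T}" N "\<lambda>t. b (q t)"] drift_continuous[of "{0..T}" q] q(1) by (metis compact_Icc)
  define R where "R = l1_dist N x (\<lambda>_. 0) + T * (real N * B) + K"
  have R: "R \<ge> 0" "K \<le> R" using K B T by (auto simp: R_def)
  interpret c: monotone_flux \<nu> N "clip_flux R Abar" by (rule clipped_monotone_flux[OF R(1)])
  obtain L where L: "L \<ge> 0" "\<And>u v. l1_dist N (c.b u) (c.b v) \<le> L * l1_dist N u v"
    by (rule clipped_drift_lipschitz[OF R(1)]) (rule that)
  obtain u where u: "integral_solution N c.b T x q u"
    using c.solution_exists_lipschitz[OF L, of T q x] q(1) by blast
  have qb: "c.b (q t) = b (q t)" if "t \<in> {0..T}" for t
    by (rule clipped_drift_eq) (use K(2)[OF that] R(2) in force)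
  have Bt: "l1_dist N (c.b (q t)) (\<lambda>_. 0) \<le> real N * B" if t: "t \<in> {0..T}" for t
    unfolding qb[OF t] by (rule l1_dist_le) (use B(2)[OF t] in simp)
  have ub: "c.b (u t) = b (u t)" if t: "t \<in> {0..T}" for t
  proof (rule clipped_drift_eq)
    fix i assume i: "i \<in> {1..N}"
    have "\<bar>u t i - q t i\<bar> \<le> l1_dist N x (\<lambda>_. 0) + t * (real N * B)"
      using coord_le_l1_dist[OF i, of "u t" "q t"] c.solution_bound[OF u _ _ Bt t] q by force
    also have "\<dots> \<le> l1_dist N x (\<lambda>_. 0) + T * (real N * B)"
      using t B by (intro add_left_mono mult_right_mono) auto
    finally show "\<bar>u t i\<bar> \<le> R" using K(2)[OF t i] unfolding R_def by linarith
  qed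
  have "integral {0..t} (\<lambda>s. c.b (u s) i) = integral {0..t} (\<lambda>s. b (u s) i)" if "t \<in> {0..T}" for t i
    by (rule integral_cong) (use ub that in auto)
  then have "integral_solution N b T x q u" using u unfolding integral_solution_def by simp
  then show ?thesis by blast
qed

end

text \<open>Projection onto the vectors of mean zero. Applied to limits and series, it leaves their values
  unchanged where they converge and yields an element of the state space where they do not, so that
  the results are defined everywhere and measurable.\<close>

definition center :: "nat \<Rightarrow> (nat \<Rightarrow> real) \<Rightarrow> nat \<Rightarrow> real" where
  "center N v = (\<lambda>i\<in>{1..N}. v i - (\<Sum>j=1..N. v j) / real N)"

lemma center_R0: "N \<ge> 1 \<Longrightarrow> center N v \<in> R0 N"
  by (auto simp: center_def R0_def sum_subtractf)

lemma center_id: "(\<Sum>j=1..N. v j) = 0 \<Longrightarrow> i \<in> {1..N} \<Longrightarrow> center N v i = v i"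
  by (simp add: center_def)

lemma R0_eqI: "u \<in> R0 N \<Longrightarrow> v \<in> R0 N \<Longrightarrow> (\<And>i. i \<in> {1..N} \<Longrightarrow> u i = v i) \<Longrightarrow> u = v"
  unfolding R0_def by (rule PiE_ext[of _ "{1..N}" "\<lambda>_. UNIV"]) simp_all

lemma R0_sum: "v \<in> R0 N \<Longrightarrow> (\<Sum>i=1..N. v i) = 0"
  by (simp add: R0_def)

definition driving_path :: "nat \<Rightarrow> (real \<Rightarrow> nat \<Rightarrow> real) \<Rightarrow> bool" where
  "driving_path N q \<longleftrightarrow> (\<forall>i\<in>{1..N}. continuous_on {0..} (\<lambda>t. q t i)) \<and> (\<forall>t\<ge>0. q t \<in> R0 N) \<and> (\<forall>i\<in>{1..N}. q 0 i = 0)"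

definition shift_path :: "nat \<Rightarrow> real \<Rightarrow> (real \<Rightarrow> nat \<Rightarrow> real) \<Rightarrow> real \<Rightarrow> nat \<Rightarrow> real" where
  "shift_path N s q t = (\<lambda>i\<in>{1..N}. q (s + t) i - q s i)"

lemma driving_path_cont: "driving_path N q \<Longrightarrow> i \<in> {1..N} \<Longrightarrow> continuous_on {0..T} (\<lambda>t. q t i)"
  unfolding driving_path_def by (rule continuous_on_subset[of "{0..}"]) auto

lemma driving_path_0: "driving_path N q \<Longrightarrow> i \<in> {1..N} \<Longrightarrow> q 0 i = 0"
  unfolding driving_path_def by simp

lemma driving_path_R0: "driving_path N q \<Longrightarrow> t \<ge> 0 \<Longrightarrow> q t \<in> R0 N"
  unfolding driving_path_def by simp

lemma driving_path_shift:
  assumes "driving_path N q" "s \<ge> 0" shows "driving_path N (shift_path N s q)"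
proof -
  have "continuous_on {0..} (\<lambda>t. q (s + t) i - q s i)" if "i \<in> {1..N}" for i
  proof -
    have "continuous_on {0..} (\<lambda>t. q (s + t) i)"
      using assms that unfolding driving_path_def
      by (intro continuous_on_compose2[of "{0..}" "\<lambda>t. q t i" "{0..}" "\<lambda>t. s + t"]) (auto intro!: continuous_intros)
    then show ?thesis by (intro continuous_intros)
  qed
  moreover have "shift_path N s q t \<in> R0 N" if "t \<ge> 0" for t
  proof -
    have "(\<Sum>i=1..N. q (s + t) i) = 0" "(\<Sum>i=1..N. q s i) = 0"
      using assms that by (auto simp: driving_path_def R0_def)
    then show ?thesis by (simp add: R0_def shift_path_def sum_subtractf)
  qed
  ultimately show ?thesis by (auto simp: driving_path_def shift_path_def)
qed

context monotone_flux
begin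

text \<open>Defining the flow as the limit of the scheme, rather than by choosing a solution, makes it
  measurable in the initial value and in the path.\<close>

definition flow :: "real \<Rightarrow> (nat \<Rightarrow> real) \<Rightarrow> (real \<Rightarrow> nat \<Rightarrow> real) \<Rightarrow> nat \<Rightarrow> real" where
  "flow t x q = center N (\<lambda>i. lim (\<lambda>n. split_step (t / real n) q x n i))"

lemma flow_R0: "flow t x q \<in> R0 N"
  unfolding flow_def by (rule center_R0[OF N])

lemma solution_eq:
  assumes "integral_solution N b T x q u" "i \<in> {1..N}" "t \<in> {0..T}"
  shows "u t i = x i + integral {0..t} (\<lambda>s. b (u s) i) + q t i"
  using assms(1) unfolding integral_solution_def by (elim conjE) (drule bspec[OF _ assms(3)], erule bspec[OF _ assms(2)])

lemma solution_sum:
  assumes sol: "integral_solution N b T x q u" and x: "x \<in> R0 N" and t: "t \<in> {0..T}" and q: "q t \<in> R0 N"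
  shows "(\<Sum>i=1..N. u t i) = 0"
proof -
  have int: "(\<lambda>s. b (u s) i) integrable_on {0..t}" if "i \<in> {1..N}" for i
    by (rule integrable_continuous_real, rule continuous_on_subset[OF solution_cont(2)[OF sol that]]) (use t in auto)
  have "(\<Sum>i=1..N. integral {0..t} (\<lambda>s. b (u s) i)) = integral {0..t} (\<lambda>s. \<Sum>i=1..N. b (u s) i)"
    by (rule integral_sum[symmetric]) (use int in auto)
  also have "\<dots> = 0" by (simp only: sum_drift_0) simp
  finally have i0: "(\<Sum>i=1..N. integral {0..t} (\<lambda>s. b (u s) i)) = 0" .
  have "(\<Sum>i=1..N. u t i) = (\<Sum>i=1..N. x i + integral {0..t} (\<lambda>s. b (u s) i) + q t i)"
    by (rule sum.cong[OF refl], rule solution_eq[OF sol _ t])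
  also have "\<dots> = 0" using i0 R0_sum[OF x] R0_sum[OF q] by (simp add: sum.distrib)
  finally show ?thesis .
qed

lemma flow_unique:
  assumes q: "driving_path N q" and x: "x \<in> R0 N" and sol: "integral_solution N b T x q u"
    and t: "t \<in> {0..T}" and i: "i \<in> {1..N}"
  shows "flow t x q i = u t i" "(\<lambda>n. split_step (t / real n) q x n i) \<longlonglongrightarrow> flow t x q i"
proof -
  have sol': "integral_solution N b t x q u" by (rule integral_solution_mono[OF sol]) (use t in auto)
  have lim0: "(\<lambda>n. l1_dist N (u t) (split_step (t / real n) q x n)) \<longlonglongrightarrow> 0"
    by (rule split_step_converges[OF sol'])
       (use t driving_path_cont[OF q] driving_path_0[OF q] in auto)
  have lim: "(\<lambda>n. split_step (t / real n) q x n j) \<longlonglongrightarrow> u t j" if j: "j \<in> {1..N}" for j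
  proof -
    have "(\<lambda>n. split_step (t / real n) q x n j - u t j) \<longlonglongrightarrow> 0"
      by (rule Lim_null_comparison[OF _ lim0])
         (simp add: abs_minus_commute[of _ "u t j"] coord_le_l1_dist[OF j])
    then show ?thesis by (simp add: LIM_zero_iff)
  qed
  have "(\<Sum>j=1..N. lim (\<lambda>n. split_step (t / real n) q x n j)) = (\<Sum>j=1..N. u t j)"
    by (intro sum.cong refl limI lim)
  also have "\<dots> = 0" by (rule solution_sum[OF sol x t]) (use driving_path_R0[OF q] t in auto)
  finally show eq: "flow t x q i = u t i"
    unfolding flow_def by (subst center_id[OF _ i]) (auto intro: limI lim i)
  show "(\<lambda>n. split_step (t / real n) q x n i) \<longlonglongrightarrow> flow t x q i"
    unfolding eq by (rule lim[OF i])
qed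

lemma flow_solution:
  assumes q: "driving_path N q" and x: "x \<in> R0 N" and T: "T \<ge> 0"
  shows "integral_solution N b T x q (\<lambda>t. flow t x q)"
proof -
  from solution_exists[of T q x] driving_path_cont[OF q] driving_path_0[OF q] T obtain u where u: "integral_solution N b T x q u" by blast
  have eq: "flow t x q i = u t i" if "t \<in> {0..T}" "i \<in> {1..N}" for t i
    by (rule flow_unique(1)[OF q x u that])
  have "b (flow t x q) = b (u t)" if "t \<in> {0..T}" for t by (rule drift_cong) (rule eq[OF that])
  then have int: "integral {0..t} (\<lambda>s. b (flow s x q) i) = integral {0..t} (\<lambda>s. b (u s) i)" if "t \<in> {0..T}" for t i
    by (intro integral_cong) (use that in auto)
  show ?thesis
    unfolding integral_solution_def
  proof (intro conjI ballI)
    fix i assume i: "i \<in> {1..N}"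
    show "continuous_on {0..T} (\<lambda>t. flow t x q i)"
      using solution_cont(1)[OF u i] continuous_on_cong[OF refl eq[OF _ i]] by (rule iffD2[rotated])
    fix t assume t: "t \<in> {0..T}"
    show "flow t x q i = x i + integral {0..t} (\<lambda>s. b (flow s x q) i) + q t i"
      unfolding int[OF t] eq[OF t i] by (rule solution_eq[OF u i t])
  qed
qed

lemma flow_limit:
  "driving_path N q \<Longrightarrow> x \<in> R0 N \<Longrightarrow> t \<ge> 0 \<Longrightarrow> i \<in> {1..N} \<Longrightarrow>
     (\<lambda>n. split_step (t / real n) q x n i) \<longlonglongrightarrow> flow t x q i"
  by (rule flow_unique(2)[of q x t "\<lambda>t. flow t x q" t, OF _ _ flow_solution]) simp_all

lemma flow_0:
  assumes "driving_path N q" "x \<in> R0 N" shows "flow 0 x q = x"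
proof (rule R0_eqI[OF flow_R0 assms(2)])
  fix i assume i: "i \<in> {1..N}"
  have "flow 0 x q i = x i + integral {0..0} (\<lambda>s. b (flow s x q) i) + q 0 i"
    by (rule solution_eq[OF flow_solution[OF assms order_refl] i]) simp
  then show "flow 0 x q i = x i" using driving_path_0[OF assms(1) i] by simp
qed

lemma flow_dist:
  assumes q: "driving_path N q" and x: "x \<in> R0 N" "y \<in> R0 N" and t: "t \<ge> 0"
  shows "l1_dist N (flow t x q) (flow t y q) \<le> l1_dist N x y"
proof (rule LIMSEQ_le_const2)
  show "(\<lambda>n. l1_dist N (split_step (t / real n) q x n) (split_step (t / real n) q y n))
      \<longlonglongrightarrow> l1_dist N (flow t x q) (flow t y q)"
    unfolding l1_dist_def
    by (intro tendsto_sum tendsto_rabs tendsto_diff flow_limit q x t) auto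
qed (use t in \<open>auto intro!: split_step_dist\<close>)

text \<open>The flow restarted at time \<open>s\<close> along the shifted path solves the same integral equation.\<close>

lemma flow_add:
  assumes q: "driving_path N q" and x: "x \<in> R0 N" and st: "s \<ge> 0" "t \<ge> 0"
  shows "flow (s + t) x q = flow t (flow s x q) (shift_path N s q)"
proof (rule R0_eqI[OF flow_R0 flow_R0])
  fix i assume i: "i \<in> {1..N}"
  have sol: "integral_solution N b (s + t) x q (\<lambda>r. flow r x q)" by (rule flow_solution[OF q x]) (use st in simp)
  have "integral_solution N b t (flow s x q) (shift_path N s q) (\<lambda>r. flow (s + r) x q)"
    unfolding integral_solution_def
  proof (intro conjI ballI)
    fix j assume j: "j \<in> {1..N}"
    show "continuous_on {0..t} (\<lambda>r. flow (s + r) x q j)"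
      by (rule continuous_on_compose2[OF solution_cont(1)[OF sol j]]) (use st in \<open>auto intro!: continuous_intros\<close>)
    fix r assume r: "r \<in> {0..t}"
    have "integral {s..s + r} (\<lambda>z. b (flow z x q) j) = integral {0..r} (\<lambda>z. b (flow (s + z) x q) j)"
      using integral_shift_Icc_real[of 0 r "\<lambda>z. b (flow z x q) j" s] by (simp add: add.commute comp_def)
    moreover have "flow (s + r) x q j = flow s x q j + integral {s..s + r} (\<lambda>z. b (flow z x q) j) + (q (s + r) j - q s j)"
      by (rule solution_increment[OF sol j]) (use st r in auto)
    ultimately show "flow (s + r) x q j = flow s x q j + integral {0..r} (\<lambda>z. b (flow (s + z) x q) j) + shift_path N s q r j"
      using j by (simp add: shift_path_def)
  qed
  from flow_unique(1)[OF driving_path_shift[OF q st(1)] flow_R0 this _ i, of t]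
  show "flow (s + t) x q i = flow t (flow s x q) (shift_path N s q) i" using st by simp
qed

lemma flow_dist_mono:
  assumes q: "driving_path N q" and x: "x \<in> R0 N" "y \<in> R0 N" and st: "0 \<le> s" "s \<le> t"
  shows "l1_dist N (flow t x q) (flow t y q) \<le> l1_dist N (flow s x q) (flow s y q)"
proof -
  have "flow t z q = flow (t - s) (flow s z q) (shift_path N s q)" if "z \<in> R0 N" for z
    using flow_add[OF q that st(1), of "t - s"] st by simp
  then show ?thesis
    using flow_dist[OF driving_path_shift[OF q st(1)] flow_R0 flow_R0, of "t - s" s x q s y q] st x by simp
qed

text \<open>The driving path cancels in the difference of two solutions, which is therefore differentiable
  although neither solution is.\<close>

lemma flow_deriv:
  assumes q: "driving_path N q" and x: "x \<in> R0 N" "y \<in> R0 N" and t: "0 < s" and i: "i \<in> {1..N}"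
  shows "((\<lambda>s. flow s x q i - flow s y q i) has_real_derivative (b (flow s x q) i - b (flow s y q) i)) (at s)"
proof -
  define T where "T = s + 1"
  have T: "T \<ge> 0" "s \<in> {0..T}" "s \<in> interior {0..T}" using t by (auto simp: T_def)
  have sx: "integral_solution N b T x q (\<lambda>r. flow r x q)" and sy: "integral_solution N b T y q (\<lambda>r. flow r y q)"
    by (rule flow_solution[OF q x(1) T(1)], rule flow_solution[OF q x(2) T(1)])
  have d1: "((\<lambda>r. integral {0..r} (\<lambda>z. b (flow z x q) i)) has_real_derivative b (flow s x q) i) (at s within {0..T})"
    by (rule integral_has_real_derivative[OF solution_cont(2)[OF sx i] T(2)])
  have d2: "((\<lambda>r. integral {0..r} (\<lambda>z. b (flow z y q) i)) has_real_derivative b (flow s y q) i) (at s within {0..T})"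
    by (rule integral_has_real_derivative[OF solution_cont(2)[OF sy i] T(2)])
  let ?I = "\<lambda>r. x i - y i + (integral {0..r} (\<lambda>z. b (flow z x q) i) - integral {0..r} (\<lambda>z. b (flow z y q) i))"
  have "(?I has_real_derivative 0 + (b (flow s x q) i - b (flow s y q) i)) (at s within {0..T})"
    by (rule DERIV_add[OF DERIV_const DERIV_diff[OF d1 d2]])
  then have "(?I has_real_derivative b (flow s x q) i - b (flow s y q) i) (at s)"
    by (simp only: at_within_interior[OF T(3)] add_0)
  then show ?thesis
  proof (rule has_field_derivative_transform_within_open)
    show "open {0<..<T}" "s \<in> {0<..<T}" using t by (simp_all add: T_def)
    fix r assume "r \<in> {0<..<T}"
    then have r: "r \<in> {0..T}" by auto
    show "?I r = flow r x q i - flow r y q i"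
      unfolding solution_eq[OF sx i r] solution_eq[OF sy i r] by linarith
  qed
qed

text \<open>The \<open>\<ell>\<^sup>1\<close> distance of two solutions is not differentiable where a coordinate of the difference
  vanishes. At a time \<open>s\<close> at which the number of vanishing coordinates is minimal, the coordinates
  that vanish at \<open>s\<close> vanish also at all nearby times, for the other ones do not vanish there. Near
  \<open>s\<close> the distance is thus a sum with fixed signs, whose derivative at \<open>s\<close> is negative.\<close>

lemma flow_dist_strict:
  assumes q: "driving_path N q" and x: "x \<in> R0 N" "y \<in> R0 N" and t: "t > 0" and ne: "l1_dist N x y \<noteq> 0"
  shows "l1_dist N (flow t x q) (flow t y q) < l1_dist N x y"
proof -
  define w where "w i s = flow s x q i - flow s y q i" for i s
  define Z where "Z s = {i \<in> {1..N}. w i s = 0}" for s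
  have "\<exists>s. s \<in> {0<..<t} \<and> (\<forall>r. r \<in> {0<..<t} \<longrightarrow> card (Z s) \<le> card (Z r))"
    by (rule ex_has_least_nat[of _ "t / 2"]) (use t in auto)
  then obtain s where s: "s \<in> {0<..<t}" and min: "\<And>r. r \<in> {0<..<t} \<Longrightarrow> card (Z s) \<le> card (Z r)" by blast
  have d0: "l1_dist N (flow s x q) (flow s y q) \<le> l1_dist N x y"
    using flow_dist[OF q x, of s] s by auto
  have d1: "l1_dist N (flow t x q) (flow t y q) \<le> l1_dist N (flow s x q) (flow s y q)"
    by (rule flow_dist_mono[OF q x]) (use s in auto)
  show ?thesis
  proof (cases "l1_dist N (flow s x q) (flow s y q) = 0")
    case True
    then show ?thesis using d1 ne l1_dist_nonneg[of N x y] by linarith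
  next
    case False
    let ?s = "sgn_vec (flow s x q) (flow s y q)"
    define f where "f r = (\<Sum>i=1..N. ?s i * w i r)" for r
    have der: "(w i has_real_derivative (b (flow s x q) i - b (flow s y q) i)) (at s)" if "i \<in> {1..N}" for i
      unfolding w_def by (rule flow_deriv[OF q x _ that]) (use s in auto)
    have near: "\<forall>\<^sub>F r in nhds s. \<forall>i\<in>{1..N} - Z s. 0 < ?s i * w i r"
    proof (rule eventually_ball_finite, simp, rule ballI)
      fix i assume i: "i \<in> {1..N} - Z s"
      have "isCont (w i) s" using der i by (intro DERIV_isCont) auto
      then have "(w i \<longlongrightarrow> w i s) (nhds s)" by (simp add: continuous_at tendsto_at_iff_tendsto_nhds)
      then have "((\<lambda>r. ?s i * w i r) \<longlongrightarrow> ?s i * w i s) (nhds s)" by (intro tendsto_intros)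
      moreover have "?s i * w i s > 0" using i by (auto simp: Z_def w_def sgn_vec_def)
      ultimately show "\<forall>\<^sub>F r in nhds s. 0 < ?s i * w i r" by (rule order_tendstoD)
    qed
    have "\<forall>\<^sub>F r in nhds s. r \<in> {0<..<t}" by (rule eventually_nhds_in_open) (use s in auto)
    with near have "\<forall>\<^sub>F r in nhds s. f r = l1_dist N (flow r x q) (flow r y q) \<and> r \<in> {0<..<t}"
    proof eventually_elim
      case (elim r)
      have sub: "Z r \<subseteq> Z s" using elim(1) by (force simp: Z_def)
      have "Z r = Z s"
        by (rule card_seteq[OF _ sub min[OF elim(2)]]) (simp add: Z_def)
      have "?s i * w i r = \<bar>w i r\<bar>" if i: "i \<in> {1..N}" for i
      proof (cases "i \<in> Z s")
        case True
        then have "w i r = 0" using \<open>Z r = Z s\<close> by (auto simp: Z_def)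
        then show ?thesis by simp
      next
        case False
        then have "0 < ?s i * w i r" using elim(1) i by auto
        then show ?thesis by (auto simp: sgn_vec_def split: if_splits)
      qed
      then show ?case using elim(2) by (simp add: f_def l1_dist_def w_def)
    qed
    then obtain d where d: "d > 0" "\<And>r. dist r s < d \<Longrightarrow> f r = l1_dist N (flow r x q) (flow r y q) \<and> r \<in> {0<..<t}"
      unfolding eventually_nhds_metric by blast
    have fd: "(f has_real_derivative (\<Sum>i=1..N. ?s i * (b (flow s x q) i - b (flow s y q) i))) (at s)"
      unfolding f_def by (intro DERIV_sum DERIV_cmult der) auto
    obtain i j where ij: "i \<in> {1..N}" "flow s x q i \<ge> flow s y q i" "j \<in> {1..N}" "flow s x q j < flow s y q j"
      by (rule opposite_signs[OF False]) (use R0_sum[OF flow_R0] in auto)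
    have "(\<Sum>i=1..N. ?s i * (b (flow s x q) i - b (flow s y q) i)) < 0"
      by (rule drift_strictly_accretive[OF ij])
    from DERIV_neg_dec_right[OF fd this] obtain e where e: "e > 0" "\<And>h. 0 < h \<Longrightarrow> h < e \<Longrightarrow> f (s + h) < f s"
      by blast
    define r where "r = s + min d e / 2"
    have r: "f r < f s" "dist r s < d" "s \<le> r" using d(1) e by (auto simp: r_def dist_real_def)
    have "l1_dist N (flow t x q) (flow t y q) \<le> l1_dist N (flow r x q) (flow r y q)"
      by (rule flow_dist_mono[OF q x]) (use d(2)[OF r(2)] in auto)
    also have "\<dots> = f r" using d(2)[OF r(2)] by simp
    also have "\<dots> < f s" by (rule r(1))
    also have "\<dots> = l1_dist N (flow s x q) (flow s y q)" using d by simp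
    finally show ?thesis using d0 by linarith
  qed
qed

end

section \<open>Measures on the state space\<close>

lemma space_borel_R0 [simp]: "space (borel_R0 N) = R0 N"
  by (auto simp: borel_R0_def space_restrict_space space_PiM R0_def)

lemma measurable_R0_coord [measurable]: "(\<lambda>v. v i) \<in> borel_measurable (borel_R0 N)" if "i \<in> {1..N}"
  unfolding borel_R0_def by (intro measurable_restrict_space1 measurable_component_singleton that)

lemma measurable_borel_R0I:
  assumes "\<And>i. i \<in> {1..N} \<Longrightarrow> (\<lambda>x. f x i) \<in> borel_measurable M" "\<And>x. x \<in> space M \<Longrightarrow> f x \<in> R0 N"
  shows "f \<in> M \<rightarrow>\<^sub>M borel_R0 N"
  unfolding borel_R0_def
proof (rule measurable_restrict_space2)
  show "f \<in> space M \<rightarrow> R0 N" using assms by auto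
  show "f \<in> M \<rightarrow>\<^sub>M (\<Pi>\<^sub>M i\<in>{1..N}. borel)"
    by (rule measurable_PiM_single') (use assms in \<open>auto simp: R0_def\<close>)
qed

lemma R0_coord_measurable:
  assumes "f \<in> M \<rightarrow>\<^sub>M borel_R0 N" "i \<in> {1..N}" shows "(\<lambda>x. f x i) \<in> borel_measurable M"
  by (rule measurable_compose[OF assms(1) measurable_R0_coord[OF assms(2)]])

lemma l1_dist_measurable:
  assumes "f \<in> M \<rightarrow>\<^sub>M borel_R0 N" "g \<in> M \<rightarrow>\<^sub>M borel_R0 N"
  shows "(\<lambda>x. l1_dist N (f x) (g x)) \<in> borel_measurable M"
  unfolding l1_dist_def
  by (intro borel_measurable_sum borel_measurable_abs borel_measurable_diff R0_coord_measurable[OF assms(1)] R0_coord_measurable[OF assms(2)])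

lemma sq_sum_measurable:
  assumes "f \<in> M \<rightarrow>\<^sub>M borel_R0 N"
  shows "(\<lambda>x. sq_sum N (f x)) \<in> borel_measurable M"
  unfolding sq_sum_def by (intro borel_measurable_sum borel_measurable_power R0_coord_measurable[OF assms])

text \<open>Measurability in the state space is derived from continuity on the space of all sequences, whose
  product topology generates the product sigma-algebra. The function is carried over by \<open>center\<close>,
  and a vector of the state space is extended by 0.\<close>

lemma lipschitz_measurable:
  fixes f :: "(nat \<Rightarrow> real) \<Rightarrow> real"
  assumes N: "N \<ge> 1" and f: "\<And>x y. x \<in> R0 N \<Longrightarrow> y \<in> R0 N \<Longrightarrow> \<bar>f x - f y\<bar> \<le> C * l1_dist N x y"
  shows "f \<in> borel_measurable (borel_R0 N)"
proof -
  define E where "E v i = (if i \<in> {1..N} then v i else 0)" for v :: "nat \<Rightarrow> real" and i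
  have "continuous_on UNIV (\<lambda>v. f (center N v))"
    unfolding continuous_on_def
  proof
    fix v0 :: "nat \<Rightarrow> real"
    have "continuous_on UNIV (\<lambda>v. C * l1_dist N (center N v) (center N v0))"
      unfolding l1_dist_def center_def
      by (auto intro!: continuous_intros continuous_on_product_coordinates)
    then have "((\<lambda>v. C * l1_dist N (center N v) (center N v0)) \<longlongrightarrow> C * l1_dist N (center N v0) (center N v0)) (at v0)"
      by (simp add: continuous_on_def)
    then have lim: "((\<lambda>v. C * l1_dist N (center N v) (center N v0)) \<longlongrightarrow> 0) (at v0)"
      by (simp add: l1_dist_def)
    have "((\<lambda>v. f (center N v) - f (center N v0)) \<longlongrightarrow> 0) (at v0)"
      by (rule Lim_null_comparison[OF _ lim]) (use f center_R0[OF N] in simp)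
    then show "((\<lambda>v. f (center N v)) \<longlongrightarrow> f (center N v0)) (at v0 within UNIV)"
      by (simp add: LIM_zero_iff)
  qed
  then have "(\<lambda>v. f (center N v)) \<in> borel_measurable (Pi\<^sub>M UNIV (\<lambda>_::nat. borel))"
    unfolding measurable_cong_sets[OF sets_PiM_equal_borel refl] by (rule borel_measurable_continuous_onI)
  moreover have "E \<in> borel_R0 N \<rightarrow>\<^sub>M Pi\<^sub>M UNIV (\<lambda>_::nat. borel)"
  proof (rule measurable_PiM_single')
    show "(\<lambda>v. E v i) \<in> borel_measurable (borel_R0 N)" for i
      unfolding E_def by (cases "i \<in> {1..N}") (auto intro: measurable_R0_coord)
  qed auto
  ultimately have "(\<lambda>v. f (center N (E v))) \<in> borel_measurable (borel_R0 N)"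
    by (rule measurable_compose[rotated])
  moreover have "center N (E v) = v" if v: "v \<in> R0 N" for v
  proof (rule R0_eqI[OF center_R0[OF N] v])
    fix i assume i: "i \<in> {1..N}"
    have "(\<Sum>j=1..N. E v j) = (\<Sum>j=1..N. v j)" by (intro sum.cong) (auto simp: E_def)
    then have "(\<Sum>j=1..N. E v j) = 0" using R0_sum[OF v] by simp
    from center_id[OF this i] have "center N (E v) i = E v i" by simp
    then show "center N (E v) i = v i" using i by (simp add: E_def)
  qed
  ultimately show ?thesis by (subst measurable_cong[where g = "\<lambda>v. f (center N (E v))"]) auto
qed

definition R0_box :: "nat \<Rightarrow> (nat \<Rightarrow> real) \<Rightarrow> (nat \<Rightarrow> real) set" where
  "R0_box N a = {v \<in> R0 N. \<forall>i\<in>{1..N}. v i \<le> a i}"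

lemma sets_borel_R0: "sets (borel_R0 N) = sigma_sets (R0 N) (range (R0_box N))"
proof
  let ?S = "sigma (R0 N) (range (R0_box N))"
  have sub: "range (R0_box N) \<subseteq> Pow (R0 N)" by (auto simp: R0_box_def)
  have "(\<lambda>v. v) \<in> ?S \<rightarrow>\<^sub>M borel_R0 N"
  proof (rule measurable_borel_R0I)
    fix i assume i: "i \<in> {1..N}"
    show "(\<lambda>v. v i) \<in> borel_measurable ?S"
    proof (rule borel_measurable_iff_le[THEN iffD2], rule allI)
      fix c
      have "{v \<in> R0 N. v i \<le> c} = (\<Union>k::nat. R0_box N (\<lambda>j. if j = i then c else real k))"
      proof (intro set_eqI iffI)
        fix v assume v: "v \<in> {v \<in> R0 N. v i \<le> c}"
        obtain k :: nat where k: "(\<Sum>j=1..N. \<bar>v j\<bar>) \<le> real k" using real_arch_simple by blast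
        have "v j \<le> real k" if "j \<in> {1..N}" for j
          using member_le_sum[OF that, of "\<lambda>j. \<bar>v j\<bar>"] k by fastforce
        then have "v \<in> R0_box N (\<lambda>j. if j = i then c else real k)" using v by (auto simp: R0_box_def)
        then show "v \<in> (\<Union>k::nat. R0_box N (\<lambda>j. if j = i then c else real k))" by blast
      qed (use i in \<open>force simp: R0_box_def\<close>)
      also have "\<dots> \<in> sets ?S" using sub by (intro sets.countable_UN) (auto simp: sets_measure_of)
      finally show "{v \<in> space ?S. v i \<le> c} \<in> sets ?S" using sub by (simp add: space_measure_of)
    qed
  qed (use sub in \<open>simp add: space_measure_of\<close>)
  then have "A \<in> sets ?S" if "A \<in> sets (borel_R0 N)" for A
    using measurable_sets[OF _ that, of "\<lambda>v. v" ?S] sets.sets_into_space[OF that] sub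
    by (simp add: space_measure_of Int_absorb2)
  then show "sets (borel_R0 N) \<subseteq> sigma_sets (R0 N) (range (R0_box N))"
    using sub by (auto simp: sets_measure_of)
  have "R0_box N a \<in> sets (borel_R0 N)" for a
  proof -
    have "{v \<in> space (borel_R0 N). \<forall>i\<in>{1..N}. v i \<le> a i} \<in> sets (borel_R0 N)"
      by (intro sets.sets_Collect_finite_All borel_measurable_le measurable_R0_coord) auto
    then show ?thesis by (simp add: R0_box_def)
  qed
  then show "sigma_sets (R0 N) (range (R0_box N)) \<subseteq> sets (borel_R0 N)"
    using sets.sigma_sets_subset[of "range (R0_box N)" "borel_R0 N"] by auto
qed

text \<open>Lipschitz functions that decrease, as \<open>k\<close> grows, to the indicator function of the box with upper
  corner \<open>a\<close>.\<close>

definition box_fun :: "nat \<Rightarrow> (nat \<Rightarrow> real) \<Rightarrow> nat \<Rightarrow> (nat \<Rightarrow> real) \<Rightarrow> real" where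
  "box_fun N a k v = max 0 (1 - real k * (\<Sum>i=1..N. max 0 (v i - a i)))"

text \<open>Bounded Lipschitz functions determine measures, and the transition operator of a random contraction
  maps this class into itself; with values in \<open>[0, 1]\<close> they can be integrated without any side condition.\<close>

definition lip_test :: "nat \<Rightarrow> ((nat \<Rightarrow> real) \<Rightarrow> real) \<Rightarrow> bool" where
  "lip_test N f \<longleftrightarrow> (\<forall>x\<in>R0 N. 0 \<le> f x \<and> f x \<le> 1) \<and>
     (\<exists>L\<ge>0. \<forall>x\<in>R0 N. \<forall>y\<in>R0 N. \<bar>f x - f y\<bar> \<le> L * l1_dist N x y)"

lemma lip_test_measurable: "N \<ge> 1 \<Longrightarrow> lip_test N f \<Longrightarrow> f \<in> borel_measurable (borel_R0 N)"
  unfolding lip_test_def using lipschitz_measurable by blast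

lemma lip_test_box_fun: "lip_test N (box_fun N a k)"
  unfolding lip_test_def
proof (intro conjI ballI exI[of _ "real k"])
  fix x y
  let ?s = "\<lambda>x. \<Sum>i=1..N. max 0 (x i - a i)"
  have "\<bar>?s x - ?s y\<bar> = \<bar>\<Sum>i=1..N. max 0 (x i - a i) - max 0 (y i - a i)\<bar>" by (simp add: sum_subtractf)
  also have "\<dots> \<le> (\<Sum>i=1..N. \<bar>max 0 (x i - a i) - max 0 (y i - a i)\<bar>)" by (rule sum_abs)
  also have "\<dots> \<le> l1_dist N x y" unfolding l1_dist_def by (intro sum_mono) linarith
  finally have "\<bar>?s x - ?s y\<bar> \<le> l1_dist N x y" .
  then have "real k * \<bar>?s x - ?s y\<bar> \<le> real k * l1_dist N x y" by (intro mult_left_mono) auto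
  then have "\<bar>real k * ?s x - real k * ?s y\<bar> \<le> real k * l1_dist N x y"
    by (simp only: abs_mult abs_of_nat flip: right_diff_distrib)
  then show "\<bar>box_fun N a k x - box_fun N a k y\<bar> \<le> real k * l1_dist N x y"
    unfolding box_fun_def by linarith
  have "real k * ?s x \<ge> 0" by (intro mult_nonneg_nonneg sum_nonneg) auto
  then show "box_fun N a k x \<le> 1" by (simp add: box_fun_def)
qed (auto simp: box_fun_def)

text \<open>The boxes are a generator closed under intersection, and their measures are limits of integrals of
  test functions.\<close>

lemma measure_R0_eqI:
  assumes N: "N \<ge> 1" and "\<mu> \<in> prob_measures_R0 N" "\<mu>' \<in> prob_measures_R0 N"
    and eq: "\<And>f. lip_test N f \<Longrightarrow> (LINT v|\<mu>. f v) = (LINT v|\<mu>'. f v)"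
  shows "\<mu> = \<mu>'"
proof (rule measure_eqI_generator_eq[where \<Omega> = "R0 N" and E = "range (R0_box N)" and A = "\<lambda>k. R0_box N (\<lambda>_. real k)"])
  show "sets \<mu> = sigma_sets (R0 N) (range (R0_box N))" "sets \<mu>' = sigma_sets (R0 N) (range (R0_box N))"
    using assms(2,3) sets_borel_R0 by (auto simp: prob_measures_R0_def)
  show "Int_stable (range (R0_box N))"
  proof (rule Int_stableI, safe)
    fix a a'
    have "R0_box N a \<inter> R0_box N a' = R0_box N (\<lambda>i. min (a i) (a' i))" by (auto simp: R0_box_def)
    then show "R0_box N a \<inter> R0_box N a' \<in> range (R0_box N)" by blast
  qed
  show "(\<Union>k::nat. R0_box N (\<lambda>_. real k)) = R0 N"
  proof (intro set_eqI iffI)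
    fix v assume v: "v \<in> R0 N"
    obtain k :: nat where k: "(\<Sum>j=1..N. \<bar>v j\<bar>) \<le> real k" using real_arch_simple by blast
    have "v j \<le> real k" if "j \<in> {1..N}" for j
      using member_le_sum[OF that, of "\<lambda>j. \<bar>v j\<bar>"] k by fastforce
    then have "v \<in> R0_box N (\<lambda>_. real k)" using v by (auto simp: R0_box_def)
    then show "v \<in> (\<Union>k::nat. R0_box N (\<lambda>_. real k))" by blast
  qed (auto simp: R0_box_def)
  interpret m: prob_space \<mu> using assms by (simp add: prob_measures_R0_def)
  show "emeasure \<mu> (R0_box N (\<lambda>_. real k)) \<noteq> \<infinity>" for k :: nat by simp
  have box: "R0_box N a \<in> sets (borel_R0 N)" for a
    unfolding sets_borel_R0 by (rule sigma_sets.Basic) simp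
  have lim: "(\<lambda>k. LINT v|m. box_fun N a k v) \<longlonglongrightarrow> measure m (R0_box N a)" if m: "m \<in> prob_measures_R0 N" for m a
  proof -
    interpret q: prob_space m using m by (simp add: prob_measures_R0_def)
    have sets: "sets m = sets (borel_R0 N)" and sp: "space m = R0 N"
      using m sets_eq_imp_space_eq[of m "borel_R0 N"] by (auto simp: prob_measures_R0_def)
    have "(\<lambda>k. LINT v|m. box_fun N a k v) \<longlonglongrightarrow> (LINT v|m. indicator (R0_box N a) v)"
    proof (rule integral_dominated_convergence[where w = "\<lambda>_. 1"])
      show "(\<lambda>v. indicator (R0_box N a) v :: real) \<in> borel_measurable m" using box[of a] sets by auto
      show "box_fun N a k \<in> borel_measurable m" for k
        using lip_test_measurable[OF N lip_test_box_fun] measurable_cong_sets[OF sets refl] by blast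
      show "AE v in m. norm (box_fun N a k v) \<le> 1" for k
        using lip_test_box_fun[of N a k] by (intro AE_I2) (auto simp: lip_test_def sp)
      show "AE v in m. (\<lambda>k. box_fun N a k v) \<longlonglongrightarrow> indicator (R0_box N a) v"
      proof (intro AE_I2)
        fix v assume "v \<in> space m"
        then have v: "v \<in> R0 N" by (simp add: sp)
        define s where "s = (\<Sum>i=1..N. max 0 (v i - a i))"
        have bf: "box_fun N a k v = max 0 (1 - real k * s)" for k by (simp only: box_fun_def s_def)
        show "(\<lambda>k. box_fun N a k v) \<longlonglongrightarrow> indicator (R0_box N a) v"
        proof (cases "v \<in> R0_box N a")
          case True
          then have "s = 0" unfolding s_def by (intro sum.neutral) (auto simp: R0_box_def)
          then show ?thesis using True by (simp add: bf)
        next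
          case False
          then obtain i where i: "i \<in> {1..N}" "v i > a i" using v by (auto simp: R0_box_def not_le)
          have "max 0 (v i - a i) \<le> s" unfolding s_def by (rule member_le_sum[OF i(1)]) auto
          then have spos: "s > 0" using i by simp
          obtain k0 :: nat where k0: "1 / s \<le> real k0" using real_arch_simple by blast
          have "\<forall>\<^sub>F k in sequentially. box_fun N a k v = indicator (R0_box N a) v"
            using eventually_ge_at_top[of k0]
          proof eventually_elim
            case (elim k)
            have "1 / s \<le> real k" using k0 elim by linarith
            then have "1 \<le> real k * s" using spos by (simp add: divide_simps)
            then show ?case using False by (simp add: bf)
          qed
          then show ?thesis by (rule tendsto_eventually)
        qed
      qed
    qed simp
    then show ?thesis using box[of a] sets by simp
  qed
  show "emeasure \<mu> X = emeasure \<mu>' X" if "X \<in> range (R0_box N)" for X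
  proof -
    obtain a where X: "X = R0_box N a" using \<open>X \<in> range (R0_box N)\<close> by blast
    have "(\<lambda>k. LINT v|\<mu>. box_fun N a k v) = (\<lambda>k. LINT v|\<mu>'. box_fun N a k v)"
      by (intro ext eq lip_test_box_fun)
    then have "measure \<mu> X = measure \<mu>' X"
      using lim[OF assms(2), of a] lim[OF assms(3), of a] unfolding X by (metis LIMSEQ_unique)
    moreover interpret m': prob_space \<mu>' using assms by (simp add: prob_measures_R0_def)
    show ?thesis using \<open>measure \<mu> X = measure \<mu>' X\<close> by (simp add: m.emeasure_eq_measure m'.emeasure_eq_measure)
  qed
qed (auto simp: R0_box_def)

section \<open>Random contractions\<close>

lemma cont_fst_coord: "continuous_on S (\<lambda>p::(nat \<Rightarrow> real) \<times> (nat \<Rightarrow> real). fst p i)"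
  and cont_snd_coord: "continuous_on S (\<lambda>p::(nat \<Rightarrow> real) \<times> (nat \<Rightarrow> real). snd p i)"
proof -
  have c: "continuous_on UNIV (\<lambda>v::nat \<Rightarrow> real. v i)" by (rule continuous_on_product_coordinates)
  show "continuous_on S (\<lambda>p::(nat \<Rightarrow> real) \<times> (nat \<Rightarrow> real). fst p i)"
    by (rule continuous_on_compose2[OF c continuous_on_fst[OF continuous_on_id]]) simp
  show "continuous_on S (\<lambda>p::(nat \<Rightarrow> real) \<times> (nat \<Rightarrow> real). snd p i)"
    by (rule continuous_on_compose2[OF c continuous_on_snd[OF continuous_on_id]]) simp
qed

text \<open>Vectors are functions on all of the naturals that are undefined outside the index set; the
  set is closed in a product of intervals and of singletons, which is compact by Tychonoff.\<close>

lemma compact_R0_sets: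
  "compact {p. fst p \<in> R0 N \<and> snd p \<in> R0 N \<and> sq_sum N (fst p) \<le> R \<and> sq_sum N (snd p) \<le> R \<and> \<delta> \<le> l1_dist N (fst p) (snd p)}"
    (is "compact ?S")
proof -
  define c where "c = \<bar>R\<bar> + 1"
  define B where "B = (\<lambda>i::nat. if i \<in> {1..N} then {-c..c} else {undefined::real})"
  have "compactin (product_topology (\<lambda>i. euclidean) UNIV) (PiE UNIV B)"
    unfolding compactin_PiE B_def by (simp split: if_splits)
  then have cB: "compact (PiE UNIV B)" by (simp only: euclidean_product_topology compactin_euclidean_iff)
  have inB: "v \<in> PiE UNIV B" if v: "v \<in> R0 N" "sq_sum N v \<le> R" for v
  proof -
    have "v i \<in> B i" for i
    proof (cases "i \<in> {1..N}")
      case True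
      have "(v i)\<^sup>2 \<le> sq_sum N v" unfolding sq_sum_def by (rule member_le_sum[OF True]) auto
      moreover have "c\<^sup>2 = \<bar>R\<bar> * \<bar>R\<bar> + 2 * \<bar>R\<bar> + 1" by (simp add: c_def power2_eq_square distrib_left distrib_right)
      ultimately have "\<bar>v i\<bar>\<^sup>2 \<le> c\<^sup>2"
        using v(2) zero_le_square[of "\<bar>R\<bar>"] abs_ge_self[of R] unfolding power2_abs by linarith
      then have "\<bar>v i\<bar> \<le> c" by (rule power2_le_imp_le) (simp add: c_def)
      then have "v i \<in> {-c..c}" by (simp add: abs_le_iff)
      then show ?thesis unfolding B_def by (simp only: True if_True)
    next
      case False
      then have "v i = undefined" using v(1) PiE_arb[of v "{1..N}" "\<lambda>_. UNIV" i] by (simp add: R0_def)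
      then show ?thesis unfolding B_def by (simp only: False if_False singletonI)
    qed
    then show ?thesis by (simp add: PiE_UNIV_domain)
  qed
  have "?S = (PiE UNIV B \<times> PiE UNIV B) \<inter>
     {p. (\<Sum>i=1..N. fst p i) = 0 \<and> (\<Sum>i=1..N. snd p i) = 0 \<and>
         sq_sum N (fst p) \<le> R \<and> sq_sum N (snd p) \<le> R \<and> \<delta> \<le> l1_dist N (fst p) (snd p)}" (is "_ = _ \<inter> ?C")
  proof -
    have "v \<in> {1..N} \<rightarrow>\<^sub>E UNIV" if "v \<in> PiE UNIV B" for v
    proof (rule PiE_I)
      fix i assume i: "i \<notin> {1..N}"
      have "v i \<in> B i" using that by (rule PiE_mem) simp
      then show "v i = undefined" unfolding B_def by (simp only: i if_False singleton_iff)
    qed simp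
    then have "v \<in> R0 N \<and> sq_sum N v \<le> R \<longleftrightarrow> v \<in> PiE UNIV B \<and> (\<Sum>i=1..N. v i) = 0 \<and> sq_sum N v \<le> R" for v
      using inB[of v] by (simp only: R0_def mem_Collect_eq) blast
    then show ?thesis by (intro set_eqI) (simp only: mem_Collect_eq Int_iff mem_Times_iff, blast)
  qed
  moreover have "closed ?C"
    unfolding sq_sum_def l1_dist_def
    by (intro closed_Collect_conj closed_Collect_eq closed_Collect_le continuous_on_sum continuous_on_power
        continuous_on_rabs continuous_on_diff continuous_on_const cont_fst_coord cont_snd_coord)
  ultimately show ?thesis using compact_Int_closed[OF compact_Times[OF cB cB]] by simp
qed

text \<open>One step of a Markov chain, given by a random map: nonexpansive, strictly contracting without any
  rate, and with a second moment that contracts up to an additive constant.\<close>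

locale random_contraction = prob_space M for M :: "'w measure" +
  fixes N :: nat and \<phi> :: "(nat \<Rightarrow> real) \<Rightarrow> 'w \<Rightarrow> nat \<Rightarrow> real" and \<rho> C :: real
  assumes N1: "N \<ge> 1"
    and \<phi>_meas: "(\<lambda>(\<omega>, x). \<phi> x \<omega>) \<in> M \<Otimes>\<^sub>M borel_R0 N \<rightarrow>\<^sub>M borel_R0 N"
    and contract: "AE \<omega> in M. \<forall>x\<in>R0 N. \<forall>y\<in>R0 N. l1_dist N (\<phi> x \<omega>) (\<phi> y \<omega>) \<le> l1_dist N x y"
    and strict: "AE \<omega> in M. \<forall>x\<in>R0 N. \<forall>y\<in>R0 N. l1_dist N x y \<noteq> 0 \<longrightarrow> l1_dist N (\<phi> x \<omega>) (\<phi> y \<omega>) < l1_dist N x y"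
    and rho: "0 \<le> \<rho>" "\<rho> < 1" and C0: "0 \<le> C"
    and moment: "\<And>x. x \<in> R0 N \<Longrightarrow> (\<integral>\<^sup>+ \<omega>. ennreal (sq_sum N (\<phi> x \<omega>)) \<partial>M) \<le> ennreal (\<rho> * sq_sum N x + C)"
begin

abbreviation "E \<equiv> borel_R0 N"

lemma phi_measurable:
  assumes "f \<in> X \<rightarrow>\<^sub>M M" "g \<in> X \<rightarrow>\<^sub>M E" shows "(\<lambda>z. \<phi> (g z) (f z)) \<in> X \<rightarrow>\<^sub>M E"
  using measurable_compose[OF measurable_Pair[OF assms] \<phi>_meas] by simp

lemma phi_R0: "x \<in> R0 N \<Longrightarrow> \<omega> \<in> space M \<Longrightarrow> \<phi> x \<omega> \<in> R0 N"
  using measurable_space[OF \<phi>_meas, of "(\<omega>, x)"] by (simp add: space_pair_measure)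

lemma phi_measurable1: "x \<in> R0 N \<Longrightarrow> (\<lambda>\<omega>. \<phi> x \<omega>) \<in> M \<rightarrow>\<^sub>M E"
  by (rule phi_measurable) auto

text \<open>The transition operator of two copies of the chain driven by the same noise.\<close>

definition pair_op :: "((nat \<Rightarrow> real) \<Rightarrow> (nat \<Rightarrow> real) \<Rightarrow> ennreal) \<Rightarrow> (nat \<Rightarrow> real) \<Rightarrow> (nat \<Rightarrow> real) \<Rightarrow> ennreal" where
  "pair_op h x y = (\<integral>\<^sup>+ \<omega>. h (\<phi> x \<omega>) (\<phi> y \<omega>) \<partial>M)"

definition pair_meas :: "((nat \<Rightarrow> real) \<Rightarrow> (nat \<Rightarrow> real) \<Rightarrow> ennreal) \<Rightarrow> bool" where
  "pair_meas h \<longleftrightarrow> case_prod h \<in> borel_measurable (E \<Otimes>\<^sub>M E)"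

lemma pair_measD:
  assumes "pair_meas h" "f \<in> X \<rightarrow>\<^sub>M E" "g \<in> X \<rightarrow>\<^sub>M E" shows "(\<lambda>z. h (f z) (g z)) \<in> borel_measurable X"
  using measurable_compose[OF measurable_Pair[OF assms(2,3)] assms(1)[unfolded pair_meas_def]] by simp

lemma pair_measI:
  "(\<lambda>p. h (fst p) (snd p)) \<in> borel_measurable (E \<Otimes>\<^sub>M E) \<Longrightarrow> pair_meas h"
  by (simp add: pair_meas_def case_prod_beta')

lemma pair_meas_op: "pair_meas h \<Longrightarrow> pair_meas (pair_op h)"
  unfolding pair_op_def
  by (intro pair_measI borel_measurable_nn_integral)
     (auto simp: case_prod_beta' intro!: pair_measD phi_measurable)

lemma pair_meas_iter: "pair_meas h \<Longrightarrow> pair_meas ((pair_op ^^ n) h)"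
  by (induction n) (auto intro: pair_meas_op)

lemma pair_op_mono:
  assumes "\<And>x y. x \<in> R0 N \<Longrightarrow> y \<in> R0 N \<Longrightarrow> h x y \<le> h' x y" "x \<in> R0 N" "y \<in> R0 N"
  shows "pair_op h x y \<le> pair_op h' x y"
  unfolding pair_op_def by (rule nn_integral_mono) (use assms phi_R0 in auto)

lemma iter_mono:
  assumes "\<And>x y. x \<in> R0 N \<Longrightarrow> y \<in> R0 N \<Longrightarrow> h x y \<le> h' x y" "x \<in> R0 N" "y \<in> R0 N"
  shows "(pair_op ^^ n) h x y \<le> (pair_op ^^ n) h' x y"
  using assms(2,3) by (induction n arbitrary: x y) (auto intro!: pair_op_mono assms)

lemma pair_op_cong:
  assumes "\<And>x y. x \<in> R0 N \<Longrightarrow> y \<in> R0 N \<Longrightarrow> h x y = h' x y" "x \<in> R0 N" "y \<in> R0 N"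
  shows "pair_op h x y = pair_op h' x y"
  unfolding pair_op_def by (rule nn_integral_cong) (use assms phi_R0 in auto)

lemma pair_op_add:
  assumes "pair_meas h" "pair_meas h'" "x \<in> R0 N" "y \<in> R0 N"
  shows "pair_op (\<lambda>x y. h x y + h' x y) x y = pair_op h x y + pair_op h' x y"
  unfolding pair_op_def
  by (rule nn_integral_add) (use assms in \<open>auto intro!: pair_measD phi_measurable1\<close>)

lemma pair_op_cmult:
  assumes "pair_meas h" "x \<in> R0 N" "y \<in> R0 N"
  shows "pair_op (\<lambda>x y. c * h x y) x y = c * pair_op h x y"
  unfolding pair_op_def
  by (rule nn_integral_cmult) (use assms in \<open>auto intro!: pair_measD phi_measurable1\<close>)

lemma pair_meas_add: "pair_meas h \<Longrightarrow> pair_meas h' \<Longrightarrow> pair_meas (\<lambda>x y. h x y + h' x y)"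
  unfolding pair_meas_def case_prod_beta' by (rule borel_measurable_add)

lemma pair_meas_cmult: "pair_meas h \<Longrightarrow> pair_meas (\<lambda>x y. c * h x y)"
  unfolding pair_meas_def case_prod_beta' by (rule borel_measurable_times_ennreal) auto

lemma iter_add:
  assumes "pair_meas h" "pair_meas h'" "x \<in> R0 N" "y \<in> R0 N"
  shows "(pair_op ^^ n) (\<lambda>x y. h x y + h' x y) x y = (pair_op ^^ n) h x y + (pair_op ^^ n) h' x y"
  using assms(3,4)
proof (induction n arbitrary: x y)
  case (Suc n)
  have "(pair_op ^^ Suc n) (\<lambda>x y. h x y + h' x y) x y = pair_op (\<lambda>x y. (pair_op ^^ n) h x y + (pair_op ^^ n) h' x y) x y"
    using pair_op_cong[OF Suc.IH Suc.prems] by simp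
  then show ?case using pair_op_add[OF pair_meas_iter[OF assms(1)] pair_meas_iter[OF assms(2)] Suc.prems] by simp
qed simp

lemma iter_cmult:
  assumes "pair_meas h" "x \<in> R0 N" "y \<in> R0 N"
  shows "(pair_op ^^ n) (\<lambda>x y. c * h x y) x y = c * (pair_op ^^ n) h x y"
  using assms(2,3)
proof (induction n arbitrary: x y)
  case (Suc n)
  have "(pair_op ^^ Suc n) (\<lambda>x y. c * h x y) x y = pair_op (\<lambda>x y. c * (pair_op ^^ n) h x y) x y"
    using pair_op_cong[OF Suc.IH Suc.prems] by simp
  then show ?case using pair_op_cmult[OF pair_meas_iter[OF assms(1)] Suc.prems] by simp
qed simp

lemma iter_Suc: "(pair_op ^^ Suc n) h = (pair_op ^^ n) (pair_op h)"
  by (simp only: funpow_Suc_right comp_def)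

lemma iter_swap:
  assumes "x \<in> R0 N" "y \<in> R0 N"
  shows "(pair_op ^^ n) (\<lambda>x y. h y x) x y = (pair_op ^^ n) h y x"
  using assms
proof (induction n arbitrary: x y)
  case (Suc n)
  have "pair_op ((pair_op ^^ n) (\<lambda>x y. h y x)) x y = pair_op (\<lambda>x y. (pair_op ^^ n) h y x) x y"
    by (rule pair_op_cong[OF Suc.IH Suc.prems])
  also have "\<dots> = pair_op ((pair_op ^^ n) h) y x" by (simp only: pair_op_def)
  finally show ?case by simp
qed simp

text \<open>Pairs of states at distance at least \<open>\<delta>\<close>, and those among them that lie in the ball where
  compactness is available.\<close>

definition "far \<delta> x y = (indicator {p. \<delta> \<le> l1_dist N (fst p) (snd p)} (x, y) :: ennreal)"
definition "tight_far \<delta> R x y = (indicator {p. sq_sum N (fst p) \<le> R \<and> sq_sum N (snd p) \<le> R \<and> \<delta> \<le> l1_dist N (fst p) (snd p)} (x, y) :: ennreal)"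
definition "sq_fst x (y::nat \<Rightarrow> real) = ennreal (sq_sum N x)"
definition "dist_fun x y = ennreal (l1_dist N x y)"

lemma pair_meas_far: "pair_meas (far \<delta>)" and pair_meas_tight_far: "pair_meas (tight_far \<delta> R)"
  and pair_meas_sq: "pair_meas sq_fst" "pair_meas (\<lambda>x y. sq_fst y x)" and pair_meas_dist: "pair_meas dist_fun"
  and pair_meas_const: "pair_meas (\<lambda>_ _. c)"
proof -
  note [measurable] = l1_dist_measurable[of fst "E \<Otimes>\<^sub>M E" N snd] sq_sum_measurable[of fst "E \<Otimes>\<^sub>M E" N] sq_sum_measurable[of snd "E \<Otimes>\<^sub>M E" N]
  show "pair_meas (far \<delta>)" unfolding far_def by (rule pair_measI) (simp, measurable)
  show "pair_meas (tight_far \<delta> R)" unfolding tight_far_def by (rule pair_measI) (simp, measurable)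
  show "pair_meas sq_fst" "pair_meas (\<lambda>x y. sq_fst y x)" "pair_meas dist_fun" "pair_meas (\<lambda>_ _. c)"
    unfolding sq_fst_def dist_fun_def by (rule pair_measI, measurable)+
qed

text \<open>The value at which the recursion \<open>a \<mapsto> \<rho> a + C\<close> of the second moments is stationary.\<close>

definition "C' = C / (1 - \<rho>)"

lemma C'_nonneg: "C' \<ge> 0" using rho C0 by (simp add: C'_def)

lemma iter_sq:
  assumes "x \<in> R0 N" "y \<in> R0 N"
  shows "(pair_op ^^ n) sq_fst x y \<le> ennreal (\<rho> ^ n * sq_sum N x + C' * (1 - \<rho> ^ n))"
  using assms
proof (induction n arbitrary: x y)
  case 0 then show ?case by (simp add: sq_fst_def)
next
  case (Suc n)
  have r: "0 \<le> \<rho> ^ n" "\<rho> ^ n \<le> 1" using rho by (auto intro: power_le_one)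
  have "(pair_op ^^ Suc n) sq_fst x y \<le> pair_op (\<lambda>x y. ennreal (\<rho> ^ n * sq_sum N x + C' * (1 - \<rho> ^ n))) x y"
    using pair_op_mono[OF Suc.IH Suc.prems] by simp
  also have "\<dots> = pair_op (\<lambda>x y. ennreal (\<rho> ^ n) * sq_fst x y + ennreal (C' * (1 - \<rho> ^ n))) x y"
  proof -
    have "ennreal (\<rho> ^ n * sq_sum N x + C' * (1 - \<rho> ^ n)) = ennreal (\<rho> ^ n) * sq_fst x y + ennreal (C' * (1 - \<rho> ^ n))" for x y
      by (subst ennreal_plus) (use r C'_nonneg in \<open>auto simp: sq_fst_def ennreal_mult'\<close>)
    then show ?thesis by simp
  qed
  also have "\<dots> = ennreal (\<rho> ^ n) * pair_op sq_fst x y + ennreal (C' * (1 - \<rho> ^ n))"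
    using Suc.prems by (simp add: pair_op_add pair_meas_cmult pair_op_cmult pair_meas_sq pair_meas_const)
       (simp add: pair_op_def emeasure_space_1)
  also have "\<dots> \<le> ennreal (\<rho> ^ n) * ennreal (\<rho> * sq_sum N x + C) + ennreal (C' * (1 - \<rho> ^ n))"
    using moment[OF Suc.prems(1)] by (intro add_right_mono mult_left_mono) (auto simp: pair_op_def sq_fst_def)
  also have "\<dots> = ennreal (\<rho> ^ n * (\<rho> * sq_sum N x + C) + C' * (1 - \<rho> ^ n))"
  proof -
    have "0 \<le> \<rho> * sq_sum N x + C" using rho C0 by simp
    then show ?thesis
      by (subst ennreal_plus) (use r C'_nonneg in \<open>auto simp: ennreal_mult'\<close>)
  qed
  also have "\<rho> ^ n * (\<rho> * sq_sum N x + C) + C' * (1 - \<rho> ^ n) = \<rho> ^ Suc n * sq_sum N x + C' * (1 - \<rho> ^ Suc n)"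
  proof -
    have "C = C' * (1 - \<rho>)" using rho by (simp add: C'_def)
    from arg_cong[OF this, of "\<lambda>t. \<rho> ^ n * t"] show ?thesis by (simp add: algebra_simps)
  qed
  finally show ?case .
qed

lemma iter_sq_bound: "x \<in> R0 N \<Longrightarrow> y \<in> R0 N \<Longrightarrow> (pair_op ^^ n) sq_fst x y \<le> ennreal (sq_sum N x + C')"
proof -
  assume xy: "x \<in> R0 N" "y \<in> R0 N"
  have "\<rho> ^ n * sq_sum N x \<le> 1 * sq_sum N x" "C' * (1 - \<rho> ^ n) \<le> C' * 1"
    by (intro mult_right_mono mult_left_mono; use rho C'_nonneg in \<open>auto intro: power_le_one\<close>)+
  then show ?thesis using iter_sq[OF xy, of n] by (elim order_trans) (intro ennreal_leI, linarith)
qed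

text \<open>The distance of the two copies never increases.\<close>

lemma far_decreasing:
  assumes "x \<in> R0 N" "y \<in> R0 N" "j \<le> n"
  shows "(pair_op ^^ n) (far \<delta>) x y \<le> (pair_op ^^ j) (far \<delta>) x y"
proof -
  have step1: "pair_op (far \<delta>) x y \<le> far \<delta> x y" if "x \<in> R0 N" "y \<in> R0 N" for x y
  proof -
    have "pair_op (far \<delta>) x y \<le> (\<integral>\<^sup>+ \<omega>. far \<delta> x y \<partial>M)"
      unfolding pair_op_def
      by (rule nn_integral_mono_AE, use contract in eventually_elim)
         (use that in \<open>force simp: far_def indicator_def\<close>)
    then show ?thesis by (simp add: emeasure_space_1)
  qed
  show ?thesis using assms(3)
  proof (induction n rule: dec_induct)
    case (step n)
    have "(pair_op ^^ Suc n) (far \<delta>) x y \<le> (pair_op ^^ n) (far \<delta>) x y"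
      unfolding iter_Suc by (rule iter_mono[OF step1 assms(1,2)])
    with step show ?case by simp
  qed simp
qed

text \<open>For each pair of distinct states the mean distance strictly decreases in one step. The decrease
  is a continuous function of the pair, and it attains its minimum on the compact set of bounded pairs
  at distance at least \<open>\<delta>\<close>.\<close>

lemma uniform_gain:
  assumes d: "\<delta> > 0"
  obtains \<kappa> where "\<kappa> > 0" "\<And>x y. x \<in> R0 N \<Longrightarrow> y \<in> R0 N \<Longrightarrow> pair_op dist_fun x y + ennreal \<kappa> * tight_far \<delta> R x y \<le> dist_fun x y"
proof -
  define S where "S = {p. fst p \<in> R0 N \<and> snd p \<in> R0 N \<and> sq_sum N (fst p) \<le> R \<and> sq_sum N (snd p) \<le> R \<and> \<delta> \<le> l1_dist N (fst p) (snd p)}"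
  define G where "G p = (LINT \<omega>|M. l1_dist N (\<phi> (fst p) \<omega>) (\<phi> (snd p) \<omega>))" for p
  have meas: "(\<lambda>\<omega>. l1_dist N (\<phi> x \<omega>) (\<phi> y \<omega>)) \<in> borel_measurable M" if "x \<in> R0 N" "y \<in> R0 N" for x y
    by (rule l1_dist_measurable[OF phi_measurable1[OF that(1)] phi_measurable1[OF that(2)]])
  have bdd: "AE \<omega> in M. norm (l1_dist N (\<phi> x \<omega>) (\<phi> y \<omega>)) \<le> l1_dist N x y" if "x \<in> R0 N" "y \<in> R0 N" for x y
    using contract by eventually_elim (use that in auto)
  have int: "integrable M (\<lambda>\<omega>. l1_dist N (\<phi> x \<omega>) (\<phi> y \<omega>))" if "x \<in> R0 N" "y \<in> R0 N" for x y
    by (rule integrable_const_bound[OF bdd[OF that] meas[OF that]])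
  have op: "pair_op dist_fun x y = ennreal (G (x, y))" if "x \<in> R0 N" "y \<in> R0 N" for x y
    unfolding pair_op_def dist_fun_def G_def fst_conv snd_conv
    by (rule nn_integral_eq_integral[OF int[OF that]]) simp
  have Glt: "G (x, y) < l1_dist N x y" if xy: "x \<in> R0 N" "y \<in> R0 N" "l1_dist N x y \<noteq> 0" for x y
  proof -
    have "G (x, y) < (LINT \<omega>|M. l1_dist N x y)"
      unfolding G_def fst_conv snd_conv
    proof (rule integral_less_AE_space[OF int[OF xy(1,2)]])
      show "AE \<omega> in M. l1_dist N (\<phi> x \<omega>) (\<phi> y \<omega>) < l1_dist N x y"
        using strict by eventually_elim (use xy in auto)
    qed (auto simp: emeasure_space_1)
    then show ?thesis by (simp add: prob_space)
  qed
  have Gle: "G (x, y) \<le> l1_dist N x y" if xy: "x \<in> R0 N" "y \<in> R0 N" for x y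
  proof -
    have "G (x, y) \<le> (LINT \<omega>|M. l1_dist N x y)"
      unfolding G_def fst_conv snd_conv
      by (rule integral_mono_AE[OF int[OF xy]]) (use bdd[OF xy] in auto)
    then show ?thesis by (simp add: prob_space)
  qed
  \<comment> \<open>The mean distance after one step is Lipschitz in the pair because the map is nonexpansive.\<close>
  have Gd: "\<bar>G (x, y) - G (x', y')\<bar> \<le> l1_dist N x x' + l1_dist N y y'"
    if "x \<in> R0 N" "y \<in> R0 N" "x' \<in> R0 N" "y' \<in> R0 N" for x y x' y'
  proof -
    have "\<bar>G (x, y) - G (x', y')\<bar> = \<bar>LINT \<omega>|M. l1_dist N (\<phi> x \<omega>) (\<phi> y \<omega>) - l1_dist N (\<phi> x' \<omega>) (\<phi> y' \<omega>)\<bar>"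
      unfolding G_def fst_conv snd_conv by (subst Bochner_Integration.integral_diff) (use int that in auto)
    also have "\<dots> \<le> (LINT \<omega>|M. \<bar>l1_dist N (\<phi> x \<omega>) (\<phi> y \<omega>) - l1_dist N (\<phi> x' \<omega>) (\<phi> y' \<omega>)\<bar>)"
      by (rule integral_abs_bound)
    also have "\<dots> \<le> (LINT \<omega>|M. l1_dist N x x' + l1_dist N y y')"
    proof (rule integral_mono_AE)
      show "AE \<omega> in M. \<bar>l1_dist N (\<phi> x \<omega>) (\<phi> y \<omega>) - l1_dist N (\<phi> x' \<omega>) (\<phi> y' \<omega>)\<bar> \<le> l1_dist N x x' + l1_dist N y y'"
        using contract
      proof eventually_elim
        case (elim \<omega>)
        let ?a = "\<phi> x \<omega>" and ?b = "\<phi> y \<omega>" and ?a' = "\<phi> x' \<omega>" and ?b' = "\<phi> y' \<omega>"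
        have "l1_dist N ?a ?a' \<le> l1_dist N x x'" "l1_dist N ?b ?b' \<le> l1_dist N y y'" using elim that by auto
        moreover have "l1_dist N ?a ?b \<le> l1_dist N ?a ?a' + (l1_dist N ?a' ?b' + l1_dist N ?b ?b')"
          using l1_dist_triangle[of N ?a ?b ?a'] l1_dist_triangle[of N ?a' ?b ?b'] by (simp add: l1_dist_commute)
        moreover have "l1_dist N ?a' ?b' \<le> l1_dist N ?a ?a' + (l1_dist N ?a ?b + l1_dist N ?b ?b')"
          using l1_dist_triangle[of N ?a' ?b' ?a] l1_dist_triangle[of N ?a ?b' ?b] by (simp add: l1_dist_commute)
        ultimately show ?case by linarith
      qed
    qed (use int that in auto)
    finally show ?thesis by (simp add: prob_space)
  qed
  have cont: "continuous_on S (\<lambda>p. l1_dist N (fst p) (snd p) - G p)"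
  proof (rule continuous_on_diff)
    show "continuous_on S (\<lambda>p. l1_dist N (fst p) (snd p))"
      unfolding l1_dist_def by (intro continuous_on_sum continuous_on_rabs continuous_on_diff cont_fst_coord cont_snd_coord)
    show "continuous_on S G"
      unfolding continuous_on_def
    proof
      fix p assume p: "p \<in> S"
      have "continuous_on UNIV (\<lambda>q. l1_dist N (fst q) (fst p) + l1_dist N (snd q) (snd p))"
        unfolding l1_dist_def
        by (intro continuous_on_add continuous_on_sum continuous_on_rabs continuous_on_diff continuous_on_const cont_fst_coord cont_snd_coord)
      then have "((\<lambda>q. l1_dist N (fst q) (fst p) + l1_dist N (snd q) (snd p)) \<longlongrightarrow> l1_dist N (fst p) (fst p) + l1_dist N (snd p) (snd p)) (at p within S)"
        using continuous_on_subset[of UNIV _ S] p unfolding continuous_on_def by blast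
      then have lim: "((\<lambda>q. l1_dist N (fst q) (fst p) + l1_dist N (snd q) (snd p)) \<longlongrightarrow> 0) (at p within S)"
        by (simp add: l1_dist_def)
      have "((\<lambda>q. G q - G p) \<longlongrightarrow> 0) (at p within S)"
      proof (rule Lim_null_comparison[OF _ lim])
        show "\<forall>\<^sub>F q in at p within S. norm (G q - G p) \<le> l1_dist N (fst q) (fst p) + l1_dist N (snd q) (snd p)"
          unfolding eventually_at_topological
          by (intro exI[of _ UNIV] conjI ballI impI)
             (use Gd[of "fst _" "snd _" "fst p" "snd p"] p in \<open>auto simp: S_def\<close>)
      qed
      then show "(G \<longlongrightarrow> G p) (at p within S)" by (simp add: LIM_zero_iff)
    qed
  qed
  have "\<exists>\<kappa>>0. \<forall>p\<in>S. G p + \<kappa> \<le> l1_dist N (fst p) (snd p)"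
  proof (cases "S = {}")
    case False
    have "compact S" unfolding S_def by (rule compact_R0_sets)
    from continuous_attains_inf[OF this False cont] obtain p where p: "p \<in> S"
      "\<And>q. q \<in> S \<Longrightarrow> l1_dist N (fst p) (snd p) - G p \<le> l1_dist N (fst q) (snd q) - G q" by blast
    have "l1_dist N (fst p) (snd p) - G p > 0" using Glt[of "fst p" "snd p"] p(1) d by (auto simp: S_def)
    moreover have "G q + (l1_dist N (fst p) (snd p) - G p) \<le> l1_dist N (fst q) (snd q)" if "q \<in> S" for q
      using p(2)[OF that] by linarith
    ultimately show ?thesis by blast
  qed (auto intro: exI[of _ 1])
  then obtain \<kappa> where k: "\<kappa> > 0" "\<And>p. p \<in> S \<Longrightarrow> G p + \<kappa> \<le> l1_dist N (fst p) (snd p)" by blast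
  have G0: "G p \<ge> 0" for p unfolding G_def by (rule integral_nonneg_AE) simp
  show thesis
  proof (rule that[OF k(1)])
    fix x y assume xy: "x \<in> R0 N" "y \<in> R0 N"
    show "pair_op dist_fun x y + ennreal \<kappa> * tight_far \<delta> R x y \<le> dist_fun x y"
    proof (cases "(x, y) \<in> S")
      case True
      then have "tight_far \<delta> R x y = 1" by (simp add: tight_far_def S_def)
      then show ?thesis using k(2)[OF True] k(1) G0[of "(x, y)"] op[OF xy]
        by (simp add: dist_fun_def flip: ennreal_plus)
    next
      case False
      then have "tight_far \<delta> R x y = 0" using xy by (simp add: tight_far_def S_def indicator_def)
      then show ?thesis using op[OF xy] Gle[OF xy] by (simp add: dist_fun_def ennreal_leI)
    qed
  qed
qed

text \<open>Chosen such that \<open>sq_sum N x + sq_sum N y + c0\<close> bounds both the \<open>\<ell>\<^sup>1\<close> distance of \<open>x\<close> and \<open>y\<close> (by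
  \<open>a \<le> 1 + a\<^sup>2\<close>) and the sum of the second moments of the two copies at any later time.\<close>

definition "c0 = 2 * real N + 2 * C'"

text \<open>The distance loses at least \<open>\<kappa>\<close> in the mean at every time at which the pair is bounded and
  \<open>\<delta>\<close> apart, so the expected number of such times is at most the initial distance over \<open>\<kappa>\<close>. By
  Markov's inequality the pair is unbounded with small probability at each time. Since the
  probability of being far apart decreases in time, it is at most its average over the first \<open>n\<close> steps.\<close>

lemma mixing:
  assumes d: "\<delta> > 0" and e: "\<epsilon> > 0"
  obtains n0 where "n0 > 0" "\<And>n x y. n \<ge> n0 \<Longrightarrow> x \<in> R0 N \<Longrightarrow> y \<in> R0 N \<Longrightarrow>
     (pair_op ^^ n) (far \<delta>) x y \<le> ennreal (\<epsilon> * (sq_sum N x + sq_sum N y + c0))"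
proof -
  \<comment> \<open>Leaving the ball of squared radius \<open>R\<close> costs half of \<open>\<epsilon>\<close>, and \<open>n0\<close> makes the averaged decrease
    cost the other half.\<close>
  define R where "R = 2 / \<epsilon>"
  have R: "R > 0" using e by (simp add: R_def)
  obtain \<kappa> where k: "\<kappa> > 0" "\<And>x y. x \<in> R0 N \<Longrightarrow> y \<in> R0 N \<Longrightarrow> pair_op dist_fun x y + ennreal \<kappa> * tight_far \<delta> R x y \<le> dist_fun x y"
    using uniform_gain[OF d, of R] by blast
  obtain n0 :: nat where n0: "2 / (\<epsilon> * \<kappa>) \<le> real n0" "n0 > 0"
    using real_arch_simple[of "max 1 (2 / (\<epsilon> * \<kappa>))"] by (auto simp: Suc_le_eq)
  show thesis
  proof (rule that[OF n0(2)])
    fix n x y assume n: "n \<ge> n0" and xy: "x \<in> R0 N" "y \<in> R0 N"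
    let ?A = "\<lambda>j. (pair_op ^^ j) (tight_far \<delta> R) x y" and ?F = "\<lambda>j. (pair_op ^^ j) (far \<delta>) x y"
    have tele: "(pair_op ^^ m) dist_fun x y + ennreal \<kappa> * (\<Sum>j<m. ?A j) \<le> dist_fun x y" for m
    proof (induction m)
      case (Suc m)
      have "(pair_op ^^ Suc m) dist_fun x y + ennreal \<kappa> * ?A m
        = (pair_op ^^ m) (\<lambda>x y. pair_op dist_fun x y + ennreal \<kappa> * tight_far \<delta> R x y) x y"
        unfolding iter_Suc
        by (simp add: iter_add iter_cmult xy pair_meas_op pair_meas_dist pair_meas_cmult pair_meas_tight_far)
      also have "\<dots> \<le> (pair_op ^^ m) dist_fun x y" by (rule iter_mono[OF k(2) xy])
      finally have "(pair_op ^^ Suc m) dist_fun x y + ennreal \<kappa> * ?A m \<le> (pair_op ^^ m) dist_fun x y" .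
      then have "(pair_op ^^ Suc m) dist_fun x y + ennreal \<kappa> * ?A m + ennreal \<kappa> * (\<Sum>j<m. ?A j) \<le> dist_fun x y"
        using Suc.IH by (meson add_right_mono order_trans)
      then show ?case by (simp add: distrib_left add_ac del: funpow.simps)
    qed simp
    \<comment> \<open>Far pairs outside the ball, by Markov's inequality.\<close>
    have tail: "?F j \<le> ?A j + ennreal ((sq_sum N x + sq_sum N y + 2 * C') / R)" for j
    proof -
      have "?F j \<le> (pair_op ^^ j) (\<lambda>x y. tight_far \<delta> R x y + ennreal (1 / R) * (sq_fst x y + sq_fst y x)) x y"
      proof (rule iter_mono[OF _ xy])
        fix x y :: "nat \<Rightarrow> real"
        show "far \<delta> x y \<le> tight_far \<delta> R x y + ennreal (1 / R) * (sq_fst x y + sq_fst y x)"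
        proof (cases "sq_sum N x \<le> R \<and> sq_sum N y \<le> R")
          case True
          then show ?thesis by (auto simp: far_def tight_far_def indicator_def)
        next
          case False
          then have "R < sq_sum N x + sq_sum N y"
            using sq_sum_nonneg[of N x] sq_sum_nonneg[of N y] by (auto simp del: sq_sum_nonneg)
          then have "1 \<le> 1 / R * (sq_sum N x + sq_sum N y)" using R by (simp add: divide_simps)
          then have "1 \<le> ennreal (1 / R * (sq_sum N x + sq_sum N y))" by simp
          also have "\<dots> = ennreal (1 / R) * (sq_fst x y + sq_fst y x)"
            unfolding sq_fst_def by (subst ennreal_mult', use R in simp) (subst ennreal_plus, simp_all)
          finally have "1 \<le> ennreal (1 / R) * (sq_fst x y + sq_fst y x)" .
          then show ?thesis by (simp add: far_def indicator_def add_increasing)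
        qed
      qed
      also have "\<dots> = ?A j + ennreal (1 / R) * ((pair_op ^^ j) sq_fst x y + (pair_op ^^ j) (\<lambda>x y. sq_fst y x) x y)"
        by (simp add: iter_add iter_cmult xy pair_meas_add pair_meas_cmult pair_meas_tight_far pair_meas_sq)
      also have "(pair_op ^^ j) (\<lambda>x y. sq_fst y x) x y = (pair_op ^^ j) sq_fst y x" by (rule iter_swap[OF xy])
      also have "?A j + ennreal (1 / R) * ((pair_op ^^ j) sq_fst x y + (pair_op ^^ j) sq_fst y x)
        \<le> ?A j + ennreal (1 / R) * (ennreal (sq_sum N x + C') + ennreal (sq_sum N y + C'))"
        by (intro add_left_mono mult_left_mono add_mono iter_sq_bound xy) auto
      also have "\<dots> = ?A j + ennreal ((sq_sum N x + sq_sum N y + 2 * C') / R)"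
        using R C'_nonneg by (simp add: ennreal_mult'[symmetric] add_ac flip: ennreal_plus)
      finally show ?thesis .
    qed
    let ?V = "sq_sum N x + sq_sum N y + c0"
    have V: "0 \<le> ?V" using C'_nonneg by (simp add: c0_def)
    have "of_nat n * ?F n = (\<Sum>j<n. ?F n)" by simp
    also have "\<dots> \<le> (\<Sum>j<n. ?A j + ennreal ((sq_sum N x + sq_sum N y + 2 * C') / R))"
      by (intro sum_mono order_trans[OF far_decreasing[OF xy] tail]) auto
    also have "\<dots> = (\<Sum>j<n. ?A j) + of_nat n * ennreal ((sq_sum N x + sq_sum N y + 2 * C') / R)"
      by (simp add: sum.distrib)
    finally have "ennreal \<kappa> * (of_nat n * ?F n) \<le> ennreal \<kappa> * (\<Sum>j<n. ?A j) + ennreal \<kappa> * (of_nat n * ennreal ((sq_sum N x + sq_sum N y + 2 * C') / R))"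
      unfolding distrib_left[symmetric] by (rule mult_left_mono) simp
    also have "ennreal \<kappa> * (\<Sum>j<n. ?A j) \<le> ennreal (l1_dist N x y)"
      using tele[of n] unfolding dist_fun_def by (rule order_trans[rotated]) simp
    also have "ennreal (l1_dist N x y) \<le> ennreal ?V"
    proof (rule ennreal_leI)
      have "\<bar>x i - y i\<bar> \<le> (x i)\<^sup>2 + (y i)\<^sup>2 + 2" for i
        using zero_le_power2[of "\<bar>x i\<bar> - 1"] zero_le_power2[of "\<bar>y i\<bar> - 1"]
        by (simp add: power2_eq_square algebra_simps)
      then have "l1_dist N x y \<le> (\<Sum>i=1..N. (x i)\<^sup>2 + (y i)\<^sup>2 + 2)" unfolding l1_dist_def by (intro sum_mono)
      also have "\<dots> = sq_sum N x + sq_sum N y + 2 * real N" by (simp add: sq_sum_def sum.distrib)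
      finally show "l1_dist N x y \<le> ?V" using C'_nonneg by (simp add: c0_def)
    qed
    also have "ennreal \<kappa> * (of_nat n * ennreal ((sq_sum N x + sq_sum N y + 2 * C') / R)) \<le> ennreal \<kappa> * (of_nat n * ennreal (?V / R))"
      using R by (intro mult_left_mono ennreal_leI divide_right_mono) (auto simp: c0_def)
    also have "ennreal ?V + ennreal \<kappa> * (of_nat n * ennreal (?V / R)) = ennreal (?V + \<kappa> * (real n * (?V / R)))"
    proof -
      have VR: "0 \<le> ?V / R" using V R by simp
      have "ennreal \<kappa> * (of_nat n * ennreal (?V / R)) = ennreal (\<kappa> * (real n * (?V / R)))"
        using k(1) VR by (simp only: ennreal_mult[OF less_imp_le[OF k(1)]] ennreal_mult mult_nonneg_nonneg of_nat_0_le_iff ennreal_of_nat_eq_real_of_nat)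
      moreover have "0 \<le> \<kappa> * (real n * (?V / R))" using VR k(1) by (intro mult_nonneg_nonneg) auto
      ultimately show ?thesis using V by (subst ennreal_plus) simp_all
    qed
    also have "\<dots> \<le> ennreal (\<kappa> * (real n * (\<epsilon> * ?V)))"
    proof (rule ennreal_leI)
      have "2 / (\<epsilon> * \<kappa>) \<le> real n" using n0(1) n by linarith
      then have "2 \<le> \<kappa> * real n * \<epsilon>" using e k(1) by (simp add: divide_simps mult_ac)
      then have "2 * ?V \<le> \<kappa> * real n * \<epsilon> * ?V" using V by (rule mult_right_mono)
      then show "?V + \<kappa> * (real n * (?V / R)) \<le> \<kappa> * (real n * (\<epsilon> * ?V))"
        using e by (simp add: R_def field_simps)
    qed
    also have "\<dots> = ennreal \<kappa> * (of_nat n * ennreal (\<epsilon> * ?V))"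
      using V e k(1) by (simp add: ennreal_mult ennreal_of_nat_eq_real_of_nat)
    finally have "ennreal \<kappa> * of_nat n * ?F n \<le> ennreal \<kappa> * of_nat n * ennreal (\<epsilon> * ?V)" by (simp add: mult.assoc add_mono)
    then show "?F n \<le> ennreal (\<epsilon> * ?V)"
      using k(1) n n0(2) by (subst (asm) ennreal_mult_le_mult_iff) (auto simp: ennreal_mult_eq_top_iff)
  qed
qed

definition mean_op :: "((nat \<Rightarrow> real) \<Rightarrow> real) \<Rightarrow> (nat \<Rightarrow> real) \<Rightarrow> real" where
  "mean_op f x = (LINT \<omega>|M. f (\<phi> x \<omega>))"

lemma lip_test_bound: "lip_test N f \<Longrightarrow> x \<in> R0 N \<Longrightarrow> \<bar>f x\<bar> \<le> 1"
  unfolding lip_test_def by auto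

lemma integrable_lip_test:
  assumes "prob_space X" and f: "lip_test N f" and g: "g \<in> X \<rightarrow>\<^sub>M E"
  shows "integrable X (\<lambda>z. f (g z))"
proof -
  interpret X: prob_space X by fact
  show ?thesis
    by (rule X.integrable_const_bound[where B = 1])
       (use lip_test_bound[OF f] measurable_space[OF g] in auto,
        rule measurable_compose[OF g lip_test_measurable[OF N1 f]])
qed

lemma lip_test_mean_op:
  assumes f: "lip_test N f" shows "lip_test N (mean_op f)"
proof -
  obtain L where L: "L \<ge> 0" "\<And>x y. x \<in> R0 N \<Longrightarrow> y \<in> R0 N \<Longrightarrow> \<bar>f x - f y\<bar> \<le> L * l1_dist N x y"
    using f unfolding lip_test_def by auto
  have f01: "0 \<le> f x" "f x \<le> 1" if "x \<in> R0 N" for x using f that by (auto simp: lip_test_def)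
  have int: "integrable M (\<lambda>\<omega>. f (\<phi> x \<omega>))" if "x \<in> R0 N" for x
    by (rule integrable_lip_test[OF prob_space_axioms f phi_measurable1[OF that]])
  show ?thesis
    unfolding lip_test_def mean_op_def
  proof (intro conjI ballI exI[of _ L])
    fix x assume x: "x \<in> R0 N"
    show "0 \<le> (LINT \<omega>|M. f (\<phi> x \<omega>))" by (rule integral_nonneg_AE) (use f01 phi_R0[OF x] in auto)
    have "(LINT \<omega>|M. f (\<phi> x \<omega>)) \<le> (LINT \<omega>|M. 1)"
      by (rule integral_mono_AE[OF int[OF x]]) (use f01 phi_R0[OF x] in auto)
    then show "(LINT \<omega>|M. f (\<phi> x \<omega>)) \<le> 1" by (simp add: prob_space)
    fix y assume y: "y \<in> R0 N"
    have "\<bar>(LINT \<omega>|M. f (\<phi> x \<omega>)) - (LINT \<omega>|M. f (\<phi> y \<omega>))\<bar> = \<bar>LINT \<omega>|M. f (\<phi> x \<omega>) - f (\<phi> y \<omega>)\<bar>"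
      using int[OF x] int[OF y] by simp
    also have "\<dots> \<le> (LINT \<omega>|M. \<bar>f (\<phi> x \<omega>) - f (\<phi> y \<omega>)\<bar>)" by (rule integral_abs_bound)
    also have "\<dots> \<le> (LINT \<omega>|M. L * l1_dist N x y)"
    proof (rule integral_mono_AE)
      show "AE \<omega> in M. \<bar>f (\<phi> x \<omega>) - f (\<phi> y \<omega>)\<bar> \<le> L * l1_dist N x y"
        using contract AE_space
      proof eventually_elim
        case (elim \<omega>)
        have "\<bar>f (\<phi> x \<omega>) - f (\<phi> y \<omega>)\<bar> \<le> L * l1_dist N (\<phi> x \<omega>) (\<phi> y \<omega>)"
          by (rule L(2)[OF phi_R0[OF x elim(2)] phi_R0[OF y elim(2)]])
        also have "\<dots> \<le> L * l1_dist N x y" using elim(1) x y L(1) by (intro mult_left_mono) auto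
        finally show ?case .
      qed
    qed (use int[OF x] int[OF y] in auto)
    finally show "\<bar>(LINT \<omega>|M. f (\<phi> x \<omega>)) - (LINT \<omega>|M. f (\<phi> y \<omega>))\<bar> \<le> L * l1_dist N x y" by (simp add: prob_space)
  qed (use L in simp)
qed

lemma lip_test_iter: "lip_test N f \<Longrightarrow> lip_test N ((mean_op ^^ n) f)"
  by (induction n) (auto intro: lip_test_mean_op)

lemma mean_op_diff:
  assumes f: "lip_test N f" and xy: "x \<in> R0 N" "y \<in> R0 N"
  shows "ennreal \<bar>(mean_op ^^ n) f x - (mean_op ^^ n) f y\<bar> \<le> (pair_op ^^ n) (\<lambda>x y. ennreal \<bar>f x - f y\<bar>) x y"
  using xy
proof (induction n arbitrary: x y)
  case (Suc n)
  let ?g = "(mean_op ^^ n) f"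
  have g: "lip_test N ?g" by (rule lip_test_iter[OF f])
  have int: "integrable M (\<lambda>\<omega>. ?g (\<phi> x \<omega>))" if "x \<in> R0 N" for x
    by (rule integrable_lip_test[OF prob_space_axioms g phi_measurable1[OF that]])
  have "(mean_op ^^ Suc n) f x - (mean_op ^^ Suc n) f y = (LINT \<omega>|M. ?g (\<phi> x \<omega>) - ?g (\<phi> y \<omega>))"
    using int[OF Suc.prems(1)] int[OF Suc.prems(2)] by (simp add: mean_op_def)
  then have "ennreal \<bar>(mean_op ^^ Suc n) f x - (mean_op ^^ Suc n) f y\<bar> \<le> (\<integral>\<^sup>+ \<omega>. ennreal \<bar>?g (\<phi> x \<omega>) - ?g (\<phi> y \<omega>)\<bar> \<partial>M)"
    using integral_norm_bound_ennreal[of M "\<lambda>\<omega>. ?g (\<phi> x \<omega>) - ?g (\<phi> y \<omega>)"] int[OF Suc.prems(1)] int[OF Suc.prems(2)] by simp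
  also have "\<dots> \<le> (pair_op ^^ Suc n) (\<lambda>x y. ennreal \<bar>f x - f y\<bar>) x y"
    unfolding funpow.simps comp_def pair_op_def[of "(pair_op ^^ n) _"]
    by (rule nn_integral_mono) (use Suc.IH phi_R0 Suc.prems in auto)
  finally show ?case .
qed simp

text \<open>A test function with Lipschitz constant \<open>L\<close> varies by at most \<open>L \<delta>\<close> on close pairs and by at
  most 1 on far pairs.\<close>

lemma mean_op_mixing:
  assumes f: "lip_test N f" and e: "\<epsilon> > 0"
  obtains n0 where "n0 > 0" "\<And>n x y. n \<ge> n0 \<Longrightarrow> x \<in> R0 N \<Longrightarrow> y \<in> R0 N \<Longrightarrow>
     \<bar>(mean_op ^^ n) f x - (mean_op ^^ n) f y\<bar> \<le> \<epsilon> + \<epsilon> * (sq_sum N x + sq_sum N y + c0)"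
proof -
  obtain L where L: "L \<ge> 0" "\<And>x y. x \<in> R0 N \<Longrightarrow> y \<in> R0 N \<Longrightarrow> \<bar>f x - f y\<bar> \<le> L * l1_dist N x y"
    using f unfolding lip_test_def by auto
  define \<delta> where "\<delta> = \<epsilon> / (L + 1)"
  have d: "\<delta> > 0" "L * \<delta> \<le> \<epsilon>" using e L by (auto simp: \<delta>_def divide_simps)
  obtain n0 where n0: "n0 > 0" "\<And>n x y. n \<ge> n0 \<Longrightarrow> x \<in> R0 N \<Longrightarrow> y \<in> R0 N \<Longrightarrow>
     (pair_op ^^ n) (far \<delta>) x y \<le> ennreal (\<epsilon> * (sq_sum N x + sq_sum N y + c0))"
    by (rule mixing[OF d(1) e]) (rule that)
  show thesis
  proof (rule that[OF n0(1)])
    fix n x y assume n: "n \<ge> n0" and xy: "x \<in> R0 N" "y \<in> R0 N"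
    have V: "0 \<le> sq_sum N x + sq_sum N y + c0" using C'_nonneg by (simp add: c0_def)
    have "(pair_op ^^ n) (\<lambda>x y. ennreal \<bar>f x - f y\<bar>) x y \<le> (pair_op ^^ n) (\<lambda>x y. ennreal \<epsilon> + far \<delta> x y) x y"
    proof (rule iter_mono[OF _ xy])
      fix x y assume xy: "x \<in> R0 N" "y \<in> R0 N"
      show "ennreal \<bar>f x - f y\<bar> \<le> ennreal \<epsilon> + far \<delta> x y"
      proof (cases "\<delta> \<le> l1_dist N x y")
        case True
        have "\<bar>f x - f y\<bar> \<le> 1" using f xy unfolding lip_test_def by (smt (verit))
        then have "ennreal \<bar>f x - f y\<bar> \<le> 1" by simp
        then show ?thesis using True by (simp add: far_def add_increasing)
      next
        case False
        have "L * l1_dist N x y \<le> L * \<delta>" using False L by (intro mult_left_mono) auto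
        then have "\<bar>f x - f y\<bar> \<le> \<epsilon>" using L(2)[OF xy] d(2) by linarith
        then show ?thesis using False by (simp add: far_def ennreal_leI)
      qed
    qed
    also have "\<dots> = (pair_op ^^ n) (\<lambda>_ _. ennreal \<epsilon>) x y + (pair_op ^^ n) (far \<delta>) x y"
      by (rule iter_add[OF pair_meas_const pair_meas_far xy])
    also have "(pair_op ^^ n) (\<lambda>_ _. ennreal \<epsilon>) x y = ennreal \<epsilon>"
      by (induction n arbitrary: x y) (simp_all add: pair_op_def emeasure_space_1)
    also have "ennreal \<epsilon> + (pair_op ^^ n) (far \<delta>) x y \<le> ennreal \<epsilon> + ennreal (\<epsilon> * (sq_sum N x + sq_sum N y + c0))"
      by (intro add_left_mono n0(2) n xy)
    also have "\<dots> = ennreal (\<epsilon> + \<epsilon> * (sq_sum N x + sq_sum N y + c0))"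
      using e V by (subst ennreal_plus) auto
    finally have "ennreal \<bar>(mean_op ^^ n) f x - (mean_op ^^ n) f y\<bar> \<le> ennreal (\<epsilon> + \<epsilon> * (sq_sum N x + sq_sum N y + c0))"
      using mean_op_diff[OF f xy] order_trans by blast
    then show "\<bar>(mean_op ^^ n) f x - (mean_op ^^ n) f y\<bar> \<le> \<epsilon> + \<epsilon> * (sq_sum N x + sq_sum N y + c0)"
      using e V by (subst (asm) ennreal_le_iff) auto
  qed
qed

lemma prob_measures_R0D: "\<mu> \<in> prob_measures_R0 N \<Longrightarrow> sets \<mu> = sets E \<and> space \<mu> = R0 N \<and> prob_space \<mu>"
  using sets_eq_imp_space_eq[of \<mu> E] by (simp add: prob_measures_R0_def)

lemma integral_step:
  assumes mu: "\<mu> \<in> prob_measures_R0 N" and f: "lip_test N f"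
  shows "distr (M \<Otimes>\<^sub>M \<mu>) E (\<lambda>(\<omega>, x). \<phi> x \<omega>) \<in> prob_measures_R0 N"
    and "(LINT v|distr (M \<Otimes>\<^sub>M \<mu>) E (\<lambda>(\<omega>, x). \<phi> x \<omega>). f v) = (LINT x|\<mu>. mean_op f x)"
proof -
  interpret mu: prob_space \<mu> using prob_measures_R0D[OF mu] by simp
  interpret P: pair_prob_space M \<mu> ..
  have s: "sets (M \<Otimes>\<^sub>M \<mu>) = sets (M \<Otimes>\<^sub>M E)" by (rule sets_pair_measure_cong) (use prob_measures_R0D[OF mu] in auto)
  have m: "(\<lambda>(\<omega>, x). \<phi> x \<omega>) \<in> M \<Otimes>\<^sub>M \<mu> \<rightarrow>\<^sub>M E"
    using \<phi>_meas measurable_cong_sets[OF s refl] by blast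
  show "distr (M \<Otimes>\<^sub>M \<mu>) E (\<lambda>(\<omega>, x). \<phi> x \<omega>) \<in> prob_measures_R0 N"
    unfolding prob_measures_R0_def using P.prob_space_distr[OF m] by simp
  have "(LINT v|distr (M \<Otimes>\<^sub>M \<mu>) E (\<lambda>(\<omega>, x). \<phi> x \<omega>). f v) = (LINT z|(M \<Otimes>\<^sub>M \<mu>). f ((\<lambda>(\<omega>, x). \<phi> x \<omega>) z))"
    by (rule integral_distr[OF m lip_test_measurable[OF N1 f]])
  also have "\<dots> = (LINT x|\<mu>. LINT \<omega>|M. f (\<phi> x \<omega>))"
    using P.integral_snd[of "\<lambda>\<omega> x. f (\<phi> x \<omega>)"] integrable_lip_test[OF P.prob_space_axioms f m]
    by (simp add: case_prod_beta')
  finally show "(LINT v|distr (M \<Otimes>\<^sub>M \<mu>) E (\<lambda>(\<omega>, x). \<phi> x \<omega>). f v) = (LINT x|\<mu>. mean_op f x)"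
    by (simp add: mean_op_def)
qed

lemma mean_op_integral_limit:
  assumes mu: "\<mu> \<in> prob_measures_R0 N" and f: "lip_test N f" and z: "z \<in> R0 N"
  shows "(\<lambda>n. (LINT x|\<mu>. (mean_op ^^ n) f x) - (mean_op ^^ n) f z) \<longlonglongrightarrow> 0"
proof -
  interpret mu: prob_space \<mu> using prob_measures_R0D[OF mu] by simp
  have meas: "(mean_op ^^ n) f \<in> borel_measurable \<mu>" for n
    using lip_test_measurable[OF N1 lip_test_iter[OF f]] prob_measures_R0D[OF mu] measurable_cong_sets by blast
  have bd: "\<bar>(mean_op ^^ n) f x\<bar> \<le> 1" if "x \<in> R0 N" for n x by (rule lip_test_bound[OF lip_test_iter[OF f] that])
  have int: "integrable \<mu> ((mean_op ^^ n) f)" for n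
    by (rule mu.integrable_const_bound[where B = 1]) (use bd meas prob_measures_R0D[OF mu] in auto)
  have "(\<lambda>n. LINT x|\<mu>. (mean_op ^^ n) f x - (mean_op ^^ n) f z) \<longlonglongrightarrow> (LINT x|\<mu>. 0)"
  proof (rule integral_dominated_convergence[where w = "\<lambda>_. 2"])
    show "AE x in \<mu>. (\<lambda>n. (mean_op ^^ n) f x - (mean_op ^^ n) f z) \<longlonglongrightarrow> 0"
    proof (rule AE_I2)
      fix x assume "x \<in> space \<mu>"
      then have x: "x \<in> R0 N" using prob_measures_R0D[OF mu] by simp
      show "(\<lambda>n. (mean_op ^^ n) f x - (mean_op ^^ n) f z) \<longlonglongrightarrow> 0"
      proof (rule LIMSEQ_I)
        fix r :: real assume r: "r > 0"
        define V where "V = 1 + (sq_sum N x + sq_sum N z + c0)"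
        have V: "V > 0" using C'_nonneg by (auto simp: V_def c0_def intro!: add_pos_nonneg add_nonneg_nonneg)
        define \<epsilon> where "\<epsilon> = r / (2 * V)"
        have e: "\<epsilon> > 0" "\<epsilon> * V < r" using r V by (auto simp: \<epsilon>_def)
        obtain n0 where "n0 > 0" and n0: "\<And>n x y. n \<ge> n0 \<Longrightarrow> x \<in> R0 N \<Longrightarrow> y \<in> R0 N \<Longrightarrow>
            \<bar>(mean_op ^^ n) f x - (mean_op ^^ n) f y\<bar> \<le> \<epsilon> + \<epsilon> * (sq_sum N x + sq_sum N y + c0)"
          by (rule mean_op_mixing[OF f e(1)]) (rule that)
        have "\<bar>(mean_op ^^ n) f x - (mean_op ^^ n) f z\<bar> \<le> \<epsilon> + \<epsilon> * (sq_sum N x + sq_sum N z + c0)" if "n \<ge> n0" for n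
          by (rule n0[OF that x z])
        then have "\<forall>n\<ge>n0. norm ((mean_op ^^ n) f x - (mean_op ^^ n) f z - 0) < r"
          using e(2) by (auto simp: V_def distrib_left intro: le_less_trans)
        then show "\<exists>no. \<forall>n\<ge>no. norm ((mean_op ^^ n) f x - (mean_op ^^ n) f z - 0) < r" by blast
      qed
    qed
    show "AE x in \<mu>. norm ((mean_op ^^ n) f x - (mean_op ^^ n) f z) \<le> 2" for n
    proof (rule AE_I2)
      fix x assume "x \<in> space \<mu>"
      then show "norm ((mean_op ^^ n) f x - (mean_op ^^ n) f z) \<le> 2"
        using bd[of x n] bd[OF z, of n] prob_measures_R0D[OF mu] by auto
    qed
  qed (use meas in auto)
  then show ?thesis using int by (simp add: mu.prob_space)
qed

sublocale S: sequence_space M ..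

abbreviation "SM \<equiv> Pi\<^sub>M (UNIV :: nat set) (\<lambda>_. M)"

definition zero :: "nat \<Rightarrow> real" where "zero = (\<lambda>i\<in>{1..N}. 0)"

lemma zero_R0: "zero \<in> R0 N" by (simp add: zero_def R0_def)

text \<open>The backward iteration composes the random maps in reverse order, with the newest noise innermost.
  It has the same law as the forward chain started at zero, but one more step changes the
  innermost argument, and contraction makes that change invisible: it converges where the forward
  chain only converges in law.\<close>

primrec backward :: "nat \<Rightarrow> (nat \<Rightarrow> 'w) \<Rightarrow> nat \<Rightarrow> real" where
  "backward 0 \<omega> = zero"
| "backward (Suc n) \<omega> = \<phi> (backward n (\<lambda>k. \<omega> (Suc k))) (\<omega> 0)"

lemma backward_measurable: "backward n \<in> SM \<rightarrow>\<^sub>M E"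
proof (induction n)
  case 0 then show ?case by (simp add: zero_R0)
next
  case (Suc n)
  have "(\<lambda>\<omega>. (\<lambda>k. \<omega> (Suc k))) \<in> SM \<rightarrow>\<^sub>M SM"
    by (rule measurable_PiM_single') (auto simp: space_PiM)
  from measurable_compose[OF this Suc] have "(\<lambda>\<omega>. backward n (\<lambda>k. \<omega> (Suc k))) \<in> SM \<rightarrow>\<^sub>M E" .
  then show ?case by (simp, intro phi_measurable) auto
qed

lemma backward_R0: "\<omega> \<in> space SM \<Longrightarrow> backward n \<omega> \<in> R0 N"
  using measurable_space[OF backward_measurable, of \<omega> n] by simp

lemma nn_integral_SM:
  assumes "f \<in> borel_measurable SM"
  shows "(\<integral>\<^sup>+ \<omega>. f \<omega> \<partial>SM) = (\<integral>\<^sup>+ \<omega>. \<integral>\<^sup>+ s. f (case_nat s \<omega>) \<partial>M \<partial>SM)"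
proof -
  interpret P: pair_sigma_finite M SM ..
  have c: "(\<lambda>(s, \<omega>). case_nat s \<omega>) \<in> M \<Otimes>\<^sub>M SM \<rightarrow>\<^sub>M SM" by measurable
  have "(\<integral>\<^sup>+ \<omega>. f \<omega> \<partial>SM) = (\<integral>\<^sup>+ z. f ((\<lambda>(s, \<omega>). case_nat s \<omega>) z) \<partial>(M \<Otimes>\<^sub>M SM))"
    using nn_integral_distr[OF c, of f] assms by (simp add: S.PiM_iter)
  also have "\<dots> = (\<integral>\<^sup>+ \<omega>. \<integral>\<^sup>+ s. f (case_nat s \<omega>) \<partial>M \<partial>SM)"
    using P.nn_integral_snd[OF measurable_compose[OF c assms]] by simp
  finally show ?thesis .
qed

text \<open>The outer \<open>n\<close> maps are common to both iterations, so their distance is that of two copies of the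
  chain after \<open>n\<close> steps, started from an independent state and from zero.\<close>

lemma backward_pair:
  assumes "pair_meas h"
  shows "(\<integral>\<^sup>+ \<omega>. h (backward (n + m) \<omega>) (backward n \<omega>) \<partial>SM) = (\<integral>\<^sup>+ \<omega>. (pair_op ^^ n) h (backward m \<omega>) zero \<partial>SM)"
  using assms
proof (induction n arbitrary: h)
  case (Suc n)
  have "(\<integral>\<^sup>+ \<omega>. h (backward (Suc n + m) \<omega>) (backward (Suc n) \<omega>) \<partial>SM)
     = (\<integral>\<^sup>+ \<omega>. pair_op h (backward (n + m) \<omega>) (backward n \<omega>) \<partial>SM)"
    by (subst nn_integral_SM[OF pair_measD[OF Suc.prems backward_measurable backward_measurable]])
       (simp add: pair_op_def)
  also have "\<dots> = (\<integral>\<^sup>+ \<omega>. (pair_op ^^ Suc n) h (backward m \<omega>) zero \<partial>SM)"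
    unfolding iter_Suc by (rule Suc.IH[OF pair_meas_op[OF Suc.prems]])
  finally show ?case .
qed simp

lemma backward_moment: "(\<integral>\<^sup>+ \<omega>. ennreal (sq_sum N (backward m \<omega>)) \<partial>SM) \<le> ennreal C'"
proof -
  have "(\<integral>\<^sup>+ \<omega>. sq_fst (backward (m + 0) \<omega>) (backward m \<omega>) \<partial>SM) = (\<integral>\<^sup>+ \<omega>. (pair_op ^^ m) sq_fst (backward 0 \<omega>) zero \<partial>SM)"
    by (rule backward_pair[OF pair_meas_sq(1)])
  also have "\<dots> = (pair_op ^^ m) sq_fst zero zero" by (simp add: S.P.emeasure_space_1)
  also have "\<dots> \<le> ennreal (sq_sum N zero + C')" by (rule iter_sq_bound[OF zero_R0 zero_R0])
  also have "sq_sum N zero = 0" by (simp add: sq_sum_def zero_def)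
  finally show ?thesis by (simp add: sq_fst_def)
qed

lemma backward_cauchy:
  assumes d: "\<delta> > 0" and e: "\<epsilon> > 0"
  obtains n0 where "\<And>n m. n \<ge> n0 \<Longrightarrow> emeasure SM {\<omega> \<in> space SM. \<delta> \<le> l1_dist N (backward (n + m) \<omega>) (backward n \<omega>)} \<le> ennreal \<epsilon>"
proof -
  define \<eta> where "\<eta> = \<epsilon> / (C' + c0 + 1)"
  have c0: "c0 \<ge> 0" using C'_nonneg by (simp add: c0_def)
  have eta: "\<eta> > 0" "\<eta> * (C' + c0) \<le> \<epsilon>"
    using e C'_nonneg c0 by (auto simp: \<eta>_def divide_simps)
  obtain n0 where "n0 > 0" and n0: "\<And>n x y. n \<ge> n0 \<Longrightarrow> x \<in> R0 N \<Longrightarrow> y \<in> R0 N \<Longrightarrow>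
     (pair_op ^^ n) (far \<delta>) x y \<le> ennreal (\<eta> * (sq_sum N x + sq_sum N y + c0))"
    by (rule mixing[OF d eta(1)]) (rule that)
  show thesis
  proof (rule that)
    fix n m assume n: "n \<ge> n0"
    let ?A = "{\<omega> \<in> space SM. \<delta> \<le> l1_dist N (backward (n + m) \<omega>) (backward n \<omega>)}"
    have A: "?A \<in> sets SM"
      using l1_dist_measurable[OF backward_measurable backward_measurable] by measurable
    have "emeasure SM ?A = (\<integral>\<^sup>+ \<omega>. far \<delta> (backward (n + m) \<omega>) (backward n \<omega>) \<partial>SM)"
      unfolding nn_integral_indicator[OF A, symmetric]
      by (rule nn_integral_cong) (auto simp: far_def indicator_def)
    also have "\<dots> = (\<integral>\<^sup>+ \<omega>. (pair_op ^^ n) (far \<delta>) (backward m \<omega>) zero \<partial>SM)"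
      by (rule backward_pair[OF pair_meas_far])
    also have "\<dots> \<le> (\<integral>\<^sup>+ \<omega>. ennreal \<eta> * ennreal (sq_sum N (backward m \<omega>)) + ennreal (\<eta> * c0) \<partial>SM)"
    proof (rule nn_integral_mono)
      fix \<omega> assume w: "\<omega> \<in> space SM"
      have "(pair_op ^^ n) (far \<delta>) (backward m \<omega>) zero \<le> ennreal (\<eta> * (sq_sum N (backward m \<omega>) + sq_sum N zero + c0))"
        by (rule n0[OF n backward_R0[OF w] zero_R0])
      also have "sq_sum N zero = 0" by (simp add: sq_sum_def zero_def)
      also have "ennreal (\<eta> * (sq_sum N (backward m \<omega>) + 0 + c0)) = ennreal \<eta> * ennreal (sq_sum N (backward m \<omega>)) + ennreal (\<eta> * c0)"
        unfolding distrib_left using eta(1) c0 by (subst ennreal_plus) (auto simp: ennreal_mult')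
      finally show "(pair_op ^^ n) (far \<delta>) (backward m \<omega>) zero \<le> \<dots>" .
    qed
    also have "\<dots> = ennreal \<eta> * (\<integral>\<^sup>+ \<omega>. ennreal (sq_sum N (backward m \<omega>)) \<partial>SM) + ennreal (\<eta> * c0)"
      using sq_sum_measurable[OF backward_measurable]
      by (subst nn_integral_add) (auto simp: nn_integral_cmult S.P.emeasure_space_1)
    also have "\<dots> \<le> ennreal \<eta> * ennreal C' + ennreal (\<eta> * c0)"
      by (intro add_right_mono mult_left_mono backward_moment) auto
    also have "\<dots> = ennreal (\<eta> * C' + \<eta> * c0)"
      using eta(1) c0 C'_nonneg by (subst ennreal_plus) (auto simp: ennreal_mult')
    also have "\<dots> \<le> ennreal \<epsilon>" using eta(2) by (intro ennreal_leI) (simp add: distrib_left)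
    finally show "emeasure SM ?A \<le> ennreal \<epsilon>" .
  qed
qed

text \<open>Along a subsequence for which successive distances exceed \<open>(1/2)\<^sup>k\<close> with probability at most
  \<open>(1/2)\<^sup>k\<close>, the Borel--Cantelli lemma gives almost sure convergence.\<close>

lemma backward_converges:
  obtains r X where "strict_mono r" "X \<in> SM \<rightarrow>\<^sub>M E"
    "AE \<omega> in SM. \<forall>i\<in>{1..N}. (\<lambda>k. backward (r k) \<omega> i) \<longlonglongrightarrow> X \<omega> i"
proof -
  have "\<exists>n0. \<forall>n\<ge>n0. \<forall>m. emeasure SM {\<omega> \<in> space SM. (1/2)^k \<le> l1_dist N (backward (n + m) \<omega>) (backward n \<omega>)} \<le> ennreal ((1/2)^k)" for k :: nat
  proof -
    obtain n0 where "\<And>n m. n \<ge> n0 \<Longrightarrow> emeasure SM {\<omega> \<in> space SM. (1/2)^k \<le> l1_dist N (backward (n + m) \<omega>) (backward n \<omega>)} \<le> ennreal ((1/2)^k)"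
      by (rule backward_cauchy[of "(1/2)^k" "(1/2)^k"], simp, simp, rule that)
    then have "\<forall>n\<ge>n0. \<forall>m. emeasure SM {\<omega> \<in> space SM. (1/2)^k \<le> l1_dist N (backward (n + m) \<omega>) (backward n \<omega>)} \<le> ennreal ((1/2)^k)"
      by simp
    then show ?thesis by (rule exI)
  qed
  then have "\<forall>k. \<exists>n0. \<forall>n\<ge>n0. \<forall>m. emeasure SM {\<omega> \<in> space SM. (1/2)^k \<le> l1_dist N (backward (n + m) \<omega>) (backward n \<omega>)} \<le> ennreal ((1/2)^k)"
    by (rule allI)
  from choice[OF this] obtain s where s0: "\<forall>k. \<forall>n\<ge>s k. \<forall>m. emeasure SM {\<omega> \<in> space SM. (1/2)^k \<le> l1_dist N (backward (n + m) \<omega>) (backward n \<omega>)} \<le> ennreal ((1/2)^k)"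
    by (rule exE)
  have s: "emeasure SM {\<omega> \<in> space SM. (1/2)^k \<le> l1_dist N (backward (n + m) \<omega>) (backward n \<omega>)} \<le> ennreal ((1/2)^k)"
    if "n \<ge> s k" for k n m
    using s0 that by simp
  define r where "r k = (\<Sum>j\<le>k. s j) + k" for k :: nat
  have r: "strict_mono r" by (rule strict_monoI_Suc) (simp add: r_def)
  have rs: "r k \<ge> s k" for k
    unfolding r_def using member_le_sum[of k "{..k}" s] by simp
  define A where "A k = {\<omega> \<in> space SM. (1/2)^k \<le> l1_dist N (backward (r (Suc k)) \<omega>) (backward (r k) \<omega>)}" for k
  have A: "A k \<in> sets SM" for k
    unfolding A_def using l1_dist_measurable[OF backward_measurable backward_measurable] by measurable
  have Ae: "emeasure SM (A k) \<le> ennreal ((1/2)^k)" for k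
  proof -
    have "r k + (r (Suc k) - r k) = r (Suc k)" using strict_monoD[OF r, of k "Suc k"] by simp
    then show ?thesis using s[OF rs, of k "r (Suc k) - r k"] unfolding A_def by (simp only:)
  qed
  have "measure SM (A k) \<le> (1/2)^k" for k
    using Ae[of k] by (simp add: S.P.emeasure_eq_measure)
  then have "summable (\<lambda>k. measure SM (A k))"
    by (intro summable_comparison_test'[OF summable_geometric[of "1/2 :: real"]]) auto
  then have ev: "AE \<omega> in SM. \<forall>\<^sub>F k in sequentially. \<omega> \<in> space SM - A k"
    by (intro borel_cantelli_AE1 A) (simp_all add: S.P.emeasure_eq_measure)
  define X where "X \<omega> = center N (\<lambda>i. lim (\<lambda>k. backward (r k) \<omega> i))" for \<omega>
  have "(\<lambda>\<omega>. lim (\<lambda>k. backward (r k) \<omega> i)) \<in> borel_measurable SM" if "i \<in> {1..N}" for i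
    by (rule borel_measurable_lim_metric) (rule R0_coord_measurable[OF backward_measurable that])
  then have Xm: "X \<in> SM \<rightarrow>\<^sub>M E"
  proof (intro measurable_borel_R0I)
    show "X \<omega> \<in> R0 N" for \<omega> unfolding X_def by (rule center_R0[OF N1])
  qed (auto simp: X_def center_def intro!: borel_measurable_diff borel_measurable_divide borel_measurable_sum)
  have "AE \<omega> in SM. \<forall>i\<in>{1..N}. (\<lambda>k. backward (r k) \<omega> i) \<longlonglongrightarrow> X \<omega> i"
    using ev AE_space
  proof eventually_elim
    case (elim \<omega>)
    have lim: "(\<lambda>k. backward (r k) \<omega> i) \<longlonglongrightarrow> lim (\<lambda>k. backward (r k) \<omega> i)" if i: "i \<in> {1..N}" for i
    proof -
      have "\<forall>\<^sub>F k in sequentially. norm (backward (r (Suc k)) \<omega> i - backward (r k) \<omega> i) \<le> (1/2)^k"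
        using elim(1)
      proof eventually_elim
        case (elim k)
        then have "l1_dist N (backward (r (Suc k)) \<omega>) (backward (r k) \<omega>) < (1/2)^k" by (simp add: A_def not_le)
        then show ?case using coord_le_l1_dist[OF i, of "backward (r (Suc k)) \<omega>" "backward (r k) \<omega>"] by simp
      qed
      then have "summable (\<lambda>k. backward (r (Suc k)) \<omega> i - backward (r k) \<omega> i)"
        by (rule summable_comparison_test_ev) (simp add: summable_geometric)
      then have "convergent (\<lambda>n. \<Sum>k<n. backward (r (Suc k)) \<omega> i - backward (r k) \<omega> i)" by (simp add: summable_iff_convergent)
      then have "convergent (\<lambda>n. backward (r n) \<omega> i - backward (r 0) \<omega> i)"
        by (subst (asm) sum_lessThan_telescope[of "\<lambda>k. backward (r k) \<omega> i"])
      then have "convergent (\<lambda>n. backward (r n) \<omega> i)" by (simp add: convergent_diff_const_right_iff)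
      then show ?thesis by (simp add: convergent_LIMSEQ_iff)
    qed
    have "(\<lambda>k. \<Sum>i=1..N. backward (r k) \<omega> i) \<longlonglongrightarrow> (\<Sum>i=1..N. lim (\<lambda>k. backward (r k) \<omega> i))"
      by (intro tendsto_sum lim)
    moreover have "(\<lambda>k. \<Sum>i=1..N. backward (r k) \<omega> i) = (\<lambda>k. 0)" using R0_sum[OF backward_R0[OF elim(2)]] by blast
    ultimately have sum0: "(\<Sum>i=1..N. lim (\<lambda>k. backward (r k) \<omega> i)) = 0" by (simp add: LIMSEQ_const_iff)
    show ?case unfolding X_def using center_id[OF sum0] lim by simp
  qed
  from that[OF r Xm this] show thesis .
qed

text \<open>The limit of the backward iteration has the invariant law: integrals of test functions against the
  \<open>n\<close>-step law converge to integrals against it, from any initial law by mixing, which yields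
  invariance and uniqueness together. Its second moment is finite by Fatou's lemma.\<close>

theorem unique_invariant_measure:
  "\<exists>\<theta>\<in>prob_measures2_R0 N. \<forall>\<mu>\<in>prob_measures_R0 N. distr (M \<Otimes>\<^sub>M \<mu>) E (\<lambda>(\<omega>, x). \<phi> x \<omega>) = \<mu> \<longleftrightarrow> \<mu> = \<theta>"
proof -
  obtain r X where r: "strict_mono r" and X: "X \<in> SM \<rightarrow>\<^sub>M E"
    and lim: "AE \<omega> in SM. \<forall>i\<in>{1..N}. (\<lambda>k. backward (r k) \<omega> i) \<longlonglongrightarrow> X \<omega> i"
    by (rule backward_converges)
  define \<theta> where "\<theta> = distr SM E X"
  have th: "\<theta> \<in> prob_measures_R0 N"
    unfolding \<theta>_def prob_measures_R0_def using S.P.prob_space_distr[OF X] by simp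
  have "(\<integral>\<^sup>+ v. ennreal (sq_sum N v) \<partial>\<theta>) = (\<integral>\<^sup>+ \<omega>. ennreal (sq_sum N (X \<omega>)) \<partial>SM)"
    unfolding \<theta>_def by (rule nn_integral_distr[OF X]) (use sq_sum_measurable[of "\<lambda>v. v" E N] in simp)
  also have "\<dots> = (\<integral>\<^sup>+ \<omega>. liminf (\<lambda>k. ennreal (sq_sum N (backward (r k) \<omega>))) \<partial>SM)"
  proof (rule nn_integral_cong_AE, use lim in eventually_elim)
    case (elim \<omega>)
    have "(\<lambda>k. ennreal (sq_sum N (backward (r k) \<omega>))) \<longlonglongrightarrow> ennreal (sq_sum N (X \<omega>))"
      unfolding sq_sum_def by (intro tendsto_ennrealI tendsto_sum tendsto_power) (use elim in auto)
    then show ?case by (rule lim_imp_Liminf[symmetric, rotated]) simp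
  qed
  also have "\<dots> \<le> liminf (\<lambda>k. \<integral>\<^sup>+ \<omega>. ennreal (sq_sum N (backward (r k) \<omega>)) \<partial>SM)"
    by (rule nn_integral_liminf) (use sq_sum_measurable[OF backward_measurable] in auto)
  also have "\<dots> \<le> ennreal C'"
    by (rule Liminf_le) (use backward_moment in auto)
  finally have fin: "(\<integral>\<^sup>+ v. ennreal (sq_sum N v) \<partial>\<theta>) < \<infinity>" by (simp add: le_less_trans)
  have "integrable \<theta> (\<lambda>v. sq_sum N v)"
  proof (rule integrableI_nonneg)
    show "sq_sum N \<in> borel_measurable \<theta>"
      using sq_sum_measurable[of "\<lambda>v. v" E N] by (simp add: \<theta>_def)
  qed (use fin in auto)
  then have "integrable \<theta> (\<lambda>v. (l2_norm N v)\<^sup>2)"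
  proof -
    have "(l2_norm N v)\<^sup>2 = sq_sum N v / real N" for v
      by (simp add: l2_norm_def sq_sum_def sum_nonneg)
    then show ?thesis using \<open>integrable \<theta> (\<lambda>v. sq_sum N v)\<close> by simp
  qed
  with th have th2: "\<theta> \<in> prob_measures2_R0 N" by (simp add: prob_measures2_R0_def)
  have a: "(LINT \<omega>|SM. f (backward n \<omega>)) = (mean_op ^^ n) f zero" if "lip_test N f" for f n
    using that
  proof (induction n arbitrary: f)
    case 0 then show ?case by (simp add: S.P.prob_space)
  next
    case (Suc n)
    interpret P: pair_prob_space M SM ..
    have m: "backward (Suc n) \<in> SM \<rightarrow>\<^sub>M E" by (rule backward_measurable)
    have c: "(\<lambda>(s, \<omega>). case_nat s \<omega>) \<in> M \<Otimes>\<^sub>M SM \<rightarrow>\<^sub>M SM" by measurable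
    have "(LINT \<omega>|SM. f (backward (Suc n) \<omega>)) = (LINT z|(M \<Otimes>\<^sub>M SM). f (backward (Suc n) ((\<lambda>(s, \<omega>). case_nat s \<omega>) z)))"
      using integral_distr[OF c measurable_compose[OF m lip_test_measurable[OF N1 Suc.prems]]]
      by (simp only: S.PiM_iter)
    also have "\<dots> = (LINT \<omega>|SM. LINT s|M. f (backward (Suc n) (case_nat s \<omega>)))"
      using P.integral_snd[of "\<lambda>s \<omega>. f (backward (Suc n) (case_nat s \<omega>))"]
        integrable_lip_test[OF P.prob_space_axioms Suc.prems measurable_compose[OF c m]]
      by (simp add: case_prod_beta' del: backward.simps)
    also have "\<dots> = (LINT \<omega>|SM. mean_op f (backward n \<omega>))" by (simp add: mean_op_def)
    also have "\<dots> = (mean_op ^^ Suc n) f zero"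
      unfolding funpow_Suc_right comp_def by (rule Suc.IH[OF lip_test_mean_op[OF Suc.prems]])
    finally show ?case .
  qed
  have conv: "(\<lambda>n. (mean_op ^^ n) f zero) \<longlonglongrightarrow> (LINT v|\<theta>. f v)" if f: "lip_test N f" for f
  proof -
    obtain L where L: "L \<ge> 0" "\<And>x y. x \<in> R0 N \<Longrightarrow> y \<in> R0 N \<Longrightarrow> \<bar>f x - f y\<bar> \<le> L * l1_dist N x y"
      using f unfolding lip_test_def by auto
    have sub: "(\<lambda>k. (mean_op ^^ r k) f zero) \<longlonglongrightarrow> (LINT v|\<theta>. f v)"
    proof -
      have "(\<lambda>k. LINT \<omega>|SM. f (backward (r k) \<omega>)) \<longlonglongrightarrow> (LINT \<omega>|SM. f (X \<omega>))"
      proof (rule integral_dominated_convergence[where w = "\<lambda>_. 1"])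
        show "AE \<omega> in SM. (\<lambda>k. f (backward (r k) \<omega>)) \<longlonglongrightarrow> f (X \<omega>)"
          using lim AE_space
        proof eventually_elim
          case (elim \<omega>)
          have "(\<lambda>k. L * l1_dist N (backward (r k) \<omega>) (X \<omega>)) \<longlonglongrightarrow> L * l1_dist N (X \<omega>) (X \<omega>)"
            unfolding l1_dist_def by (intro tendsto_intros) (use elim in auto)
          then have l0: "(\<lambda>k. L * l1_dist N (backward (r k) \<omega>) (X \<omega>)) \<longlonglongrightarrow> 0" by (simp add: l1_dist_def)
          have "(\<lambda>k. f (backward (r k) \<omega>) - f (X \<omega>)) \<longlonglongrightarrow> 0"
            by (rule Lim_null_comparison[OF _ l0])
               (use L(2) backward_R0[OF elim(2)] measurable_space[OF X elim(2)] in simp)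
          then show ?case by (simp add: LIM_zero_iff)
        qed
        show "AE \<omega> in SM. norm (f (backward (r k) \<omega>)) \<le> 1" for k
          by (rule AE_I2) (use lip_test_bound[OF f] backward_R0 in auto)
      qed (use measurable_compose[OF _ lip_test_measurable[OF N1 f]] X backward_measurable in auto)
      also have "(LINT \<omega>|SM. f (X \<omega>)) = (LINT v|\<theta>. f v)"
        unfolding \<theta>_def by (rule integral_distr[OF X lip_test_measurable[OF N1 f], symmetric])
      finally show ?thesis unfolding a[OF f] .
    qed
    \<comment> \<open>Almost sure convergence is known along the subsequence \<open>r\<close> only; mixing makes the whole sequence
      of integrals Cauchy.\<close>
    have "Cauchy (\<lambda>n. (mean_op ^^ n) f zero)"
    proof (rule metric_CauchyI)
      fix e :: real assume e: "e > 0"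
      define V where "V = 1 + (C' + c0)"
      have V: "V > 0" using C'_nonneg by (auto simp: V_def c0_def intro!: add_pos_nonneg add_nonneg_nonneg)
      define \<epsilon> where "\<epsilon> = e / (4 * V)"
      have eps: "\<epsilon> > 0" "\<epsilon> * V \<le> e / 4" using e V by (auto simp: \<epsilon>_def)
      obtain n0 where "n0 > 0" and n0: "\<And>n x y. n \<ge> n0 \<Longrightarrow> x \<in> R0 N \<Longrightarrow> y \<in> R0 N \<Longrightarrow>
         \<bar>(mean_op ^^ n) f x - (mean_op ^^ n) f y\<bar> \<le> \<epsilon> + \<epsilon> * (sq_sum N x + sq_sum N y + c0)"
        by (rule mean_op_mixing[OF f eps(1)]) (rule that)
      have close: "\<bar>(mean_op ^^ (n0 + m)) f zero - (mean_op ^^ n0) f zero\<bar> \<le> e / 4" for m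
      proof -
        let ?g = "(mean_op ^^ n0) f"
        have g: "lip_test N ?g" by (rule lip_test_iter[OF f])
        have ig: "integrable SM (\<lambda>\<omega>. ?g (backward m \<omega>))"
          by (rule integrable_lip_test[OF S.P.prob_space_axioms g backward_measurable])
        have isq: "integrable SM (\<lambda>\<omega>. sq_sum N (backward m \<omega>))"
        proof (rule integrableI_nonneg)
          show "(\<lambda>\<omega>. sq_sum N (backward m \<omega>)) \<in> borel_measurable SM" by (rule sq_sum_measurable[OF backward_measurable])
          show "(\<integral>\<^sup>+ \<omega>. ennreal (sq_sum N (backward m \<omega>)) \<partial>SM) < \<infinity>"
            using backward_moment[of m] by (simp add: le_less_trans)
        qed auto
        have Esq: "(LINT \<omega>|SM. sq_sum N (backward m \<omega>)) \<le> C'"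
          using backward_moment[of m] nn_integral_eq_integral[OF isq] C'_nonneg by simp
        have split: "(mean_op ^^ (n0 + m)) f zero = (mean_op ^^ m) ?g zero"
          by (subst add.commute) (simp add: funpow_add)
        have eq: "(mean_op ^^ m) ?g zero - ?g zero = (LINT \<omega>|SM. ?g (backward m \<omega>) - ?g zero)"
          unfolding a[OF g, symmetric] using ig by (simp add: S.P.prob_space)
        have "\<bar>(mean_op ^^ m) ?g zero - ?g zero\<bar> \<le> (LINT \<omega>|SM. \<bar>?g (backward m \<omega>) - ?g zero\<bar>)"
          unfolding eq by (rule integral_abs_bound)
        also have "\<dots> \<le> (LINT \<omega>|SM. \<epsilon> + \<epsilon> * (sq_sum N (backward m \<omega>) + c0))"
        proof (rule integral_mono_AE)
          have "sq_sum N zero = 0" by (simp add: sq_sum_def zero_def)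
          then show "AE \<omega> in SM. \<bar>?g (backward m \<omega>) - ?g zero\<bar> \<le> \<epsilon> + \<epsilon> * (sq_sum N (backward m \<omega>) + c0)"
            using n0[OF order_refl backward_R0 zero_R0] by (intro AE_I2) auto
        qed (use ig isq in auto)
        also have "\<dots> = \<epsilon> + \<epsilon> * ((LINT \<omega>|SM. sq_sum N (backward m \<omega>)) + c0)"
          using isq by (simp add: S.P.prob_space)
        also have "\<dots> \<le> \<epsilon> + \<epsilon> * (C' + c0)" using Esq eps(1) by simp
        also have "\<dots> \<le> e / 4" using eps(2) by (simp add: V_def distrib_left)
        finally show ?thesis unfolding split .
      qed
      have "dist ((mean_op ^^ n) f zero) ((mean_op ^^ n') f zero) < e" if "n \<ge> n0" "n' \<ge> n0" for n n'
      proof -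
        have "n0 + (n - n0) = n" "n0 + (n' - n0) = n'" using that by simp_all
        with close[of "n - n0"] close[of "n' - n0"] e show ?thesis
          unfolding dist_real_def by (simp only:)
      qed
      then show "\<exists>K. \<forall>m\<ge>K. \<forall>n\<ge>K. dist ((mean_op ^^ m) f zero) ((mean_op ^^ n) f zero) < e" by blast
    qed
    then obtain l where l: "(\<lambda>n. (mean_op ^^ n) f zero) \<longlonglongrightarrow> l" using Cauchy_convergent convergent_def by blast
    from LIMSEQ_subseq_LIMSEQ[OF l r] have "(\<lambda>k. (mean_op ^^ r k) f zero) \<longlonglongrightarrow> l" by (simp add: comp_def)
    with sub have "l = (LINT v|\<theta>. f v)" by (rule LIMSEQ_unique[rotated])
    with l show ?thesis by simp
  qed
  have conv': "(\<lambda>n. LINT x|\<mu>. (mean_op ^^ n) f x) \<longlonglongrightarrow> (LINT v|\<theta>. f v)"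
    if mu: "\<mu> \<in> prob_measures_R0 N" and f: "lip_test N f" for \<mu> f
    using tendsto_add[OF mean_op_integral_limit[OF mu f zero_R0] conv[OF f]] by simp
  show ?thesis
  proof (rule bexI[OF _ th2], intro ballI iffI)
    fix \<mu> assume mu: "\<mu> \<in> prob_measures_R0 N" and inv: "distr (M \<Otimes>\<^sub>M \<mu>) E (\<lambda>(\<omega>, x). \<phi> x \<omega>) = \<mu>"
    show "\<mu> = \<theta>"
    proof (rule measure_R0_eqI[OF N1 mu th])
      fix f assume f: "lip_test N f"
      have "(LINT x|\<mu>. (mean_op ^^ n) f x) = (LINT x|\<mu>. f x)" for n
      proof (induction n)
        case (Suc n)
        show ?case using integral_step(2)[OF mu lip_test_iter[OF f, of n]] Suc unfolding inv by simp
      qed simp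
      then show "(LINT v|\<mu>. f v) = (LINT v|\<theta>. f v)"
        using conv'[OF mu f] by (simp add: LIMSEQ_const_iff)
    qed
  next
    fix \<mu> assume mu: "\<mu> \<in> prob_measures_R0 N" and eq: "\<mu> = \<theta>"
    show "distr (M \<Otimes>\<^sub>M \<mu>) E (\<lambda>(\<omega>, x). \<phi> x \<omega>) = \<mu>"
    proof (rule measure_R0_eqI[OF N1 integral_step(1)[OF mu lip_test_box_fun] mu])
      fix f assume f: "lip_test N f"
      have "(\<lambda>n. (mean_op ^^ n) (mean_op f) zero) \<longlonglongrightarrow> (LINT v|\<theta>. mean_op f v)"
        by (rule conv[OF lip_test_mean_op[OF f]])
      moreover have "(\<lambda>n. (mean_op ^^ n) (mean_op f) zero) \<longlonglongrightarrow> (LINT v|\<theta>. f v)"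
        using LIMSEQ_Suc[OF conv[OF f]] by (simp only: funpow_Suc_right comp_def)
      ultimately have "(LINT v|\<theta>. mean_op f v) = (LINT v|\<theta>. f v)" by (rule LIMSEQ_unique)
      then show "(LINT v|distr (M \<Otimes>\<^sub>M \<mu>) E (\<lambda>(\<omega>, x). \<phi> x \<omega>). f v) = (LINT v|\<mu>. f v)"
        using integral_step(2)[OF mu f] eq by simp
    qed
  qed
qed

end

section \<open>Families of independent Brownian motions\<close>

text \<open>Ottaviani's argument. At the first \<open>j\<close> for which \<open>E j\<close> occurs, the independent event \<open>V j\<close> has
  probability at least one half, and then \<open>A\<close> occurs; so \<open>A\<close> has at least half the probability that
  some \<open>E j\<close> occurs.\<close>

lemma (in prob_space) first_passage_bound:
  fixes n :: nat and E V :: "nat \<Rightarrow> 'a set"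
  assumes ev: "\<And>j. j \<le> n \<Longrightarrow> E j \<in> events" "\<And>j. j \<le> n \<Longrightarrow> V j \<in> events" "A \<in> events"
    and indep: "\<And>j. j \<le> n \<Longrightarrow> prob ((E j - (\<Union>i<j. E i)) \<inter> V j) = prob (E j - (\<Union>i<j. E i)) * prob (V j)"
    and half: "\<And>j. j \<le> n \<Longrightarrow> 1 / 2 \<le> prob (V j)"
    and sub: "\<And>j. j \<le> n \<Longrightarrow> E j \<inter> V j \<subseteq> A"
  shows "prob (\<Union>j\<le>n. E j) \<le> 2 * prob A"
proof -
  define D where "D j = E j - (\<Union>i<j. E i)" for j
  have D: "D j \<in> events" if "j \<le> n" for j
    unfolding D_def using that ev(1) by (intro sets.Diff sets.finite_UN) auto
  have disj: "disjoint_family_on D {..n}"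
    unfolding disjoint_family_on_def
  proof (intro ballI impI)
    fix i j :: nat assume "i \<noteq> j"
    then show "D i \<inter> D j = {}" by (cases "i < j") (auto simp: D_def)
  qed
  have un: "(\<Union>j\<le>n. E j) = (\<Union>j\<le>n. D j)"
  proof (intro set_eqI iffI)
    fix x assume "x \<in> (\<Union>j\<le>n. E j)"
    then obtain j where j: "j \<le> n" "x \<in> E j" by auto
    define i where "i = (LEAST i. x \<in> E i)"
    have "x \<in> E i" unfolding i_def using j(2) by (rule LeastI)
    moreover have "i \<le> j" unfolding i_def using j(2) by (rule Least_le)
    moreover have "x \<notin> E l" if "l < i" for l using not_less_Least[of l "\<lambda>i. x \<in> E i"] that by (simp add: i_def)
    ultimately show "x \<in> (\<Union>j\<le>n. D j)" using j(1) by (auto simp: D_def)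
  qed (auto simp: D_def)
  have "prob (\<Union>j\<le>n. E j) = (\<Sum>j\<le>n. prob (D j))"
    unfolding un by (rule finite_measure_finite_Union) (use D disj in auto)
  also have "\<dots> \<le> (\<Sum>j\<le>n. 2 * prob (D j \<inter> V j))"
  proof (rule sum_mono)
    fix j assume j: "j \<in> {..n}"
    have "prob (D j) * (1 / 2) \<le> prob (D j) * prob (V j)" using half[of j] j by (intro mult_left_mono) auto
    then show "prob (D j) \<le> 2 * prob (D j \<inter> V j)" using indep[of j] j by (simp add: D_def)
  qed
  also have "\<dots> = 2 * prob (\<Union>j\<le>n. D j \<inter> V j)"
  proof -
    have "prob (\<Union>j\<le>n. D j \<inter> V j) = (\<Sum>j\<le>n. prob (D j \<inter> V j))"
    proof (rule finite_measure_finite_Union)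
      show "disjoint_family_on (\<lambda>j. D j \<inter> V j) {..n}" using disj unfolding disjoint_family_on_def by blast
    qed (use D ev(2) in auto)
    then show ?thesis by (simp add: sum_distrib_left)
  qed
  also have "\<dots> \<le> 2 * prob A"
    using sub by (intro mult_left_mono finite_measure_mono ev(3)) (auto simp: D_def)
  finally show ?thesis .
qed

locale brownian_family = prob_space M for M :: "'w measure" +
  fixes F :: "real \<Rightarrow> 'w measure" and B :: "nat \<Rightarrow> real \<Rightarrow> 'w \<Rightarrow> real"
  assumes filt: "normal_filtration M F"
    and bm: "\<And>k. brownian_motion M F (B k)"
    and paths_indep: "indep_vars (\<lambda>_. \<Pi>\<^sub>M t\<in>{0..}. borel) (\<lambda>k \<omega>. \<lambda>t\<in>{0..}. B k t \<omega>) UNIV"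
begin

abbreviation "PP \<equiv> (\<Pi>\<^sub>M t\<in>{0::real..}. (borel :: real measure))"
abbreviation "bpath k \<omega> \<equiv> (\<lambda>t\<in>{0..}. B k t \<omega>)"

definition "inc s t k \<omega> = B k t \<omega> - B k s \<omega>"
text \<open>The sigma-algebra of the whole path with index \<open>k\<close>; \<open>past\<close> and \<open>fut\<close> are the events of
  that path up to time \<open>s\<close> and those of its increment after \<open>s\<close>, and \<open>G\<close> and \<open>FU\<close> collect them over
  all indices.\<close>

definition "path_alg k = vimage_algebra (space M) (bpath k) PP"
definition "past s k = sigma_sets (space M) (\<Union>r\<in>{0..s}. {B k r -` A \<inter> space M | A. A \<in> sets borel})"
definition "fut s t k = {inc s t k -` A \<inter> space M | A. A \<in> sets borel}"
definition "G s = sigma (space M) (\<Union>k. past s k)"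
definition "FU s t = sigma (space M) (\<Union>k. fut s t k)"

lemma space_F: "t \<ge> 0 \<Longrightarrow> space (F t) = space M"
  and sets_F: "t \<ge> 0 \<Longrightarrow> sets (F t) \<subseteq> sets M"
  and sets_F_mono: "0 \<le> s \<Longrightarrow> s \<le> t \<Longrightarrow> sets (F s) \<subseteq> sets (F t)"
  using filt unfolding normal_filtration_def subalgebra_def by auto

lemma B_F: "t \<ge> 0 \<Longrightarrow> B k t \<in> borel_measurable (F t)"
  using bm[of k] unfolding brownian_motion_def by blast

lemma B_adapted: "0 \<le> r \<Longrightarrow> r \<le> t \<Longrightarrow> B k r \<in> borel_measurable (F t)"
  using B_F[of r k] sets_F_mono[of r t] space_F[of r] space_F[of t]
  by (auto simp: measurable_def)

lemma B_M: "t \<ge> 0 \<Longrightarrow> B k t \<in> borel_measurable M"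
  using B_F[of t k] sets_F[of t] space_F[of t] by (auto simp: measurable_def)

lemma inc_M: "s \<ge> 0 \<Longrightarrow> t \<ge> 0 \<Longrightarrow> inc s t k \<in> borel_measurable M"
  unfolding inc_def using B_M by auto

lemma sets_path_alg: "sets (path_alg k) = {bpath k -` A \<inter> space M | A. A \<in> sets PP}"
  unfolding path_alg_def by (rule sets_vimage_algebra2) (auto simp: space_PiM)

lemma B_path_alg: "t \<ge> 0 \<Longrightarrow> B k t \<in> borel_measurable (path_alg k)"
proof -
  assume t: "t \<ge> 0"
  have "bpath k \<in> path_alg k \<rightarrow>\<^sub>M PP" unfolding path_alg_def by (rule measurable_vimage_algebra1) (auto simp: space_PiM)
  from measurable_compose[OF this measurable_component_singleton[of t]] t
  have "(\<lambda>\<omega>. bpath k \<omega> t) \<in> borel_measurable (path_alg k)" by auto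
  then show ?thesis using t by simp
qed

lemma space_path_alg: "space (path_alg k) = space M"
  by (simp add: path_alg_def)

lemma indep_path_alg: "indep_sets (\<lambda>k. sets (path_alg k)) UNIV"
  using paths_indep unfolding indep_vars_def2 sets_path_alg by simp

lemma path_alg_events: "sets (path_alg k) \<subseteq> events"
  using indep_path_alg unfolding indep_sets_def by auto

lemma past_path_alg: "past s k \<subseteq> sets (path_alg k)"
proof -
  have "(\<Union>r\<in>{0..s}. {B k r -` A \<inter> space M | A. A \<in> sets borel}) \<subseteq> sets (path_alg k)"
    using measurable_sets[OF B_path_alg] space_path_alg by auto
  from sets.sigma_sets_subset[OF this] show ?thesis unfolding past_def space_path_alg .
qed

lemma fut_path_alg: "0 \<le> s \<Longrightarrow> 0 \<le> t \<Longrightarrow> fut s t k \<subseteq> sets (path_alg k)"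
proof -
  assume st: "0 \<le> s" "0 \<le> t"
  have "inc s t k \<in> borel_measurable (path_alg k)"
    unfolding inc_def using B_path_alg[OF st(1)] B_path_alg[OF st(2)] by auto
  from measurable_sets[OF this] show ?thesis unfolding fut_def space_path_alg by auto
qed

lemma past_F: "0 \<le> s \<Longrightarrow> past s k \<subseteq> sets (F s)"
proof -
  assume s: "0 \<le> s"
  have "(\<Union>r\<in>{0..s}. {B k r -` A \<inter> space M | A. A \<in> sets borel}) \<subseteq> sets (F s)"
  proof (rule UN_least, rule subsetI)
    fix r X assume r: "r \<in> {0..s}" and "X \<in> {B k r -` A \<inter> space M |A. A \<in> sets borel}"
    then obtain A where "A \<in> sets borel" "X = B k r -` A \<inter> space M" by auto
    then show "X \<in> sets (F s)" using measurable_sets[OF B_adapted[of r s k], of A] r space_F[OF s] by simp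
  qed
  then show ?thesis unfolding past_def using sets.sigma_sets_subset[of _ "F s"] space_F[OF s] by simp
qed

lemma past_fut_indep:
  assumes "0 \<le> s" "s < t" "a \<in> past s k" "f \<in> fut s t k"
  shows "prob (a \<inter> f) = prob a * prob f"
proof -
  have "indep_set (sets (F s)) (sets (vimage_algebra (space M) (\<lambda>\<omega>. B k t \<omega> - B k s \<omega>) borel))"
    using bm[of k] assms unfolding brownian_motion_def by blast
  note * = this
  have "f \<in> sets (vimage_algebra (space M) (\<lambda>\<omega>. B k t \<omega> - B k s \<omega>) borel)"
    using assms(4) by (subst sets_vimage_algebra2) (auto simp: fut_def inc_def)
  from indep_setD[OF * subsetD[OF past_F[OF assms(1)] assms(3)] this] show ?thesis .
qed

text \<open>Each increment is independent of the past of its own path, and different paths are independent;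
  together, the pasts and the increments of all indices form one independent family. The filtration
  itself does not give this, since it is only assumed to be independent of each increment
  separately.\<close>

lemma indep_past_increments:
  assumes st: "0 \<le> s" "s < t"
  shows "indep_sets (\<lambda>p. if snd p then past s (fst p) else fut s t (fst p)) (UNIV :: (nat \<times> bool) set)"
    (is "indep_sets ?E _")
proof (rule indep_setsI)
  fix p :: "nat \<times> bool"
  have sub: "?E p \<subseteq> sets (path_alg (fst p))" using past_path_alg fut_path_alg[of s t] st by auto
  then show "?E p \<subseteq> events" using path_alg_events by blast
next
  fix A and J :: "(nat \<times> bool) set"
  assume J: "J \<noteq> {}" "finite J" and A: "\<forall>j\<in>J. A j \<in> ?E j"
  define A' where "A' p = (if p \<in> J then A p else space M)" for p
  have sp: "space M \<in> ?E p" for p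
  proof -
    have "space M \<in> fut s t (fst p)"
      unfolding fut_def by (intro CollectI exI[of _ UNIV]) simp
    moreover have "space M \<in> past s (fst p)" unfolding past_def by (rule sigma_sets_top)
    ultimately show ?thesis by simp
  qed
  have A': "A' p \<in> ?E p" for p using A sp[of p] unfolding A'_def by auto
  have At: "A' (k, True) \<in> past s k" and Af: "A' (k, False) \<in> fut s t k" for k
    using A'[of "(k, True)"] A'[of "(k, False)"] by simp_all
  define K where "K = fst ` J"
  have K: "finite K" "K \<noteq> {}" using J by (auto simp: K_def)
  have "(\<Inter>j\<in>J. A j) = (\<Inter>k\<in>K. A' (k, True) \<inter> A' (k, False))"
  proof (intro set_eqI iffI)
    fix x assume x: "x \<in> (\<Inter>j\<in>J. A j)"
    obtain j where j: "j \<in> J" using J by auto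
    have "A j \<in> sets (path_alg (fst j))"
    proof (cases "snd j")
      case True
      then show ?thesis using bspec[OF A j] subsetD[OF past_path_alg[of s "fst j"]] by simp
    next
      case False
      then show ?thesis using bspec[OF A j] subsetD[OF fut_path_alg[of s t "fst j"]] st by simp
    qed
    then have "A j \<subseteq> space M" using sets.sets_into_space[of "A j" "path_alg (fst j)"] space_path_alg by simp
    then have "x \<in> space M" using x j by auto
    then show "x \<in> (\<Inter>k\<in>K. A' (k, True) \<inter> A' (k, False))" using x by (auto simp: A'_def)
  next
    fix x assume x: "x \<in> (\<Inter>k\<in>K. A' (k, True) \<inter> A' (k, False))"
    show "x \<in> (\<Inter>j\<in>J. A j)"
    proof
      fix j assume j: "j \<in> J"
      then have "x \<in> A' (fst j, True) \<inter> A' (fst j, False)" using x by (auto simp: K_def)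
      then have "x \<in> A' j" by (cases j; cases "snd j") auto
      then show "x \<in> A j" using j by (simp add: A'_def)
    qed
  qed
  also have "prob \<dots> = (\<Prod>k\<in>K. prob (A' (k, True) \<inter> A' (k, False)))"
  proof (rule indep_setsD[OF indep_path_alg])
    have "A' (k, True) \<inter> A' (k, False) \<in> sets (path_alg k)" for k
      using subsetD[OF past_path_alg At] subsetD[OF fut_path_alg Af] st by (intro sets.Int) auto
    then show "\<forall>k\<in>K. A' (k, True) \<inter> A' (k, False) \<in> sets (path_alg k)" by blast
  qed (use K in auto)
  also have "\<dots> = (\<Prod>k\<in>K. \<Prod>b\<in>UNIV. prob (A' (k, b)))"
    by (intro prod.cong refl) (simp add: past_fut_indep[OF st At Af] UNIV_bool mult.commute)
  also have "\<dots> = (\<Prod>p\<in>K \<times> UNIV. prob (A' p))" by (simp add: prod.cartesian_product)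
  also have "\<dots> = (\<Prod>p\<in>J. prob (A' p))"
  proof (rule prod.mono_neutral_right)
    show "J \<subseteq> K \<times> UNIV" by (force simp: K_def)
    show "\<forall>p\<in>K \<times> UNIV - J. prob (A' p) = 1" by (auto simp: A'_def prob_space)
  qed (use K in auto)
  also have "\<dots> = (\<Prod>p\<in>J. prob (A p))" by (intro prod.cong) (auto simp: A'_def)
  finally show "prob (\<Inter>j\<in>J. A j) = (\<Prod>j\<in>J. prob (A j))" .
qed

lemma Int_stable_past_fut: "Int_stable (past s k)" "Int_stable (fut s t k)"
proof -
  have sub: "(\<Union>r\<in>{0..s}. {B k r -` A \<inter> space M | A. A \<in> sets borel}) \<subseteq> Pow (space M)" by auto
  interpret sigma_algebra "space M" "past s k" unfolding past_def by (rule sigma_algebra_sigma_sets[OF sub])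
  show "Int_stable (past s k)" by (rule Int_stableI) (rule Int)
  show "Int_stable (fut s t k)"
  proof (rule Int_stableI)
    fix a b assume "a \<in> fut s t k" "b \<in> fut s t k"
    then obtain A A' where "a = inc s t k -` A \<inter> space M" "A \<in> sets borel" "b = inc s t k -` A' \<inter> space M" "A' \<in> sets borel"
      unfolding fut_def by auto
    then have "a \<inter> b = inc s t k -` (A \<inter> A') \<inter> space M" "A \<inter> A' \<in> sets borel" by auto
    then show "a \<inter> b \<in> fut s t k" unfolding fut_def by blast
  qed
qed

lemma past_fut_Pow: "past s k \<subseteq> Pow (space M)" "fut s t k \<subseteq> Pow (space M)"
  using past_path_alg[of s k] path_alg_events[of k] sets.space_closed[of M] by (blast, auto simp: fut_def)

lemma sets_G: "sets (G s) = sigma_sets (space M) (\<Union>k. past s k)" and space_G: "space (G s) = space M"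
  unfolding G_def using UN_least[OF past_fut_Pow(1)] by (rule sets_measure_of, rule space_measure_of)

lemma sets_FU: "sets (FU s t) = sigma_sets (space M) (\<Union>k. fut s t k)" and space_FU: "space (FU s t) = space M"
  unfolding FU_def using UN_least[OF past_fut_Pow(2)] by (rule sets_measure_of, rule space_measure_of)

lemma indep_G_FU:
  assumes st: "0 \<le> s" "s < t"
  shows "indep_set (sets (G s)) (sets (FU s t))"
proof -
  let ?E = "\<lambda>p. if snd p then past s (fst p) else fut s t (fst p)"
  have "indep_sets (\<lambda>j. sigma_sets (space M) (\<Union>i\<in>UNIV \<times> {j}. ?E i)) (UNIV :: bool set)"
  proof (rule indep_sets_collect_sigma)
    have "(\<Union>j\<in>UNIV. UNIV \<times> {j}) = (UNIV :: (nat \<times> bool) set)" by auto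
    then show "indep_sets ?E (\<Union>j\<in>UNIV. UNIV \<times> {j})" using indep_past_increments[OF st] by simp
    show "Int_stable (?E i)" for i by (cases "snd i") (simp_all only: if_True if_False Int_stable_past_fut)
    show "disjoint_family_on (\<lambda>j. (UNIV :: nat set) \<times> {j}) (UNIV :: bool set)" by (auto simp: disjoint_family_on_def)
  qed
  moreover have "(\<Union>i\<in>UNIV \<times> {True}. ?E i) = (\<Union>k. past s k)" "(\<Union>i\<in>UNIV \<times> {False}. ?E i) = (\<Union>k. fut s t k)"
  proof -
    have im: "UNIV \<times> {b} = range (\<lambda>k::nat. (k, b))" for b :: bool by auto
    show "(\<Union>i\<in>UNIV \<times> {True}. ?E i) = (\<Union>k. past s k)" "(\<Union>i\<in>UNIV \<times> {False}. ?E i) = (\<Union>k. fut s t k)"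
      by (simp_all only: im image_image fst_conv snd_conv if_True if_False)
  qed
  ultimately show ?thesis
    unfolding indep_set_def sets_G sets_FU by (elim indep_sets_mono_sets) (auto split: bool.split)
qed

lemma G_events: "0 \<le> s \<Longrightarrow> sets (G s) \<subseteq> events"
  using indep_setD_ev1[OF indep_G_FU[of s "s + 1"]] by simp

lemma FU_events: "0 \<le> s \<Longrightarrow> s < t \<Longrightarrow> sets (FU s t) \<subseteq> events"
  using indep_setD_ev2[OF indep_G_FU[of s t]] by simp

lemma B_G: "0 \<le> r \<Longrightarrow> r \<le> s \<Longrightarrow> B k r \<in> borel_measurable (G s)"
proof (rule measurableI)
  fix A :: "real set" assume "0 \<le> r" "r \<le> s" "A \<in> sets borel"
  then have "B k r -` A \<inter> space M \<in> past s k" unfolding past_def by (intro sigma_sets.Basic UN_I[of r]) auto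
  then show "B k r -` A \<inter> space (G s) \<in> sets (G s)" unfolding sets_G space_G by (intro sigma_sets.Basic) auto
qed simp

lemma inc_FU: "inc s t k \<in> borel_measurable (FU s t)"
proof (rule measurableI)
  fix A :: "real set" assume "A \<in> sets borel"
  then have "inc s t k -` A \<inter> space M \<in> fut s t k" unfolding fut_def by auto
  then show "inc s t k -` A \<inter> space (FU s t) \<in> sets (FU s t)" unfolding sets_FU space_FU by (intro sigma_sets.Basic) auto
qed simp

lemma indep_var_G_FU:
  assumes st: "0 \<le> s" "s < t" and Y: "Y \<in> G s \<rightarrow>\<^sub>M X1" and D: "D \<in> FU s t \<rightarrow>\<^sub>M X2"
  shows "indep_var X1 Y X2 D"
  unfolding indep_var_eq
proof (intro conjI)
  show "random_variable X1 Y" using Y G_events[OF st(1)] space_G by (auto simp: measurable_def)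
  show "random_variable X2 D" using D FU_events[OF st] space_FU by (auto simp: measurable_def)
  have "sigma_sets (space M) {Y -` A \<inter> space M |A. A \<in> sets X1} \<subseteq> sets (G s)"
    using sets.sigma_sets_subset[of "{Y -` A \<inter> space M |A. A \<in> sets X1}" "G s"] measurable_sets[OF Y] space_G[of s] by auto
  moreover have "sigma_sets (space M) {D -` A \<inter> space M |A. A \<in> sets X2} \<subseteq> sets (FU s t)"
    using sets.sigma_sets_subset[of "{D -` A \<inter> space M |A. A \<in> sets X2}" "FU s t"] measurable_sets[OF D] space_FU[of s t] by auto
  ultimately show "indep_set (sigma_sets (space M) {Y -` A \<inter> space M |A. A \<in> sets X1}) (sigma_sets (space M) {D -` A \<inter> space M |A. A \<in> sets X2})"
    using indep_G_FU[OF st] unfolding indep_set_def by (elim indep_sets_mono_sets) (auto split: bool.split)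
qed

section \<open>Gaussian sums and maximal inequalities\<close>

lemma inc_indep: "0 \<le> s \<Longrightarrow> 0 \<le> t \<Longrightarrow> indep_vars (\<lambda>_. borel) (inc s t) UNIV"
proof -
  assume st: "0 \<le> s" "0 \<le> t"
  have "indep_vars (\<lambda>_. borel) (\<lambda>k \<omega>. bpath k \<omega> t - bpath k \<omega> s) UNIV"
    by (rule indep_vars_compose2[OF paths_indep, of "\<lambda>_ p. p t - p s"]) (use st in auto)
  then show ?thesis using st by (simp add: inc_def[abs_def])
qed

lemma inc_distributed: "0 \<le> s \<Longrightarrow> s < t \<Longrightarrow> distributed M lborel (inc s t k) (normal_density 0 (sqrt (t - s)))"
  using bm[of k] unfolding brownian_motion_def inc_def[abs_def] by blast

lemma inc_moments:
  assumes st: "0 \<le> s" "s \<le> t"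
  shows "integrable M (inc s t k)" "expectation (inc s t k) = 0"
    "integrable M (\<lambda>\<omega>. (inc s t k \<omega>)\<^sup>2)" "expectation (\<lambda>\<omega>. (inc s t k \<omega>)\<^sup>2) = t - s"
proof -
  have "integrable M (inc s t k) \<and> expectation (inc s t k) = 0 \<and> integrable M (\<lambda>\<omega>. (inc s t k \<omega>)\<^sup>2) \<and> expectation (\<lambda>\<omega>. (inc s t k \<omega>)\<^sup>2) = t - s"
  proof (cases "s = t")
    case True then show ?thesis by (simp add: inc_def[abs_def])
  next
    case False
    then have pos: "0 < sqrt (t - s)" and D: "distributed M lborel (inc s t k) (normal_density 0 (sqrt (t - s)))"
      using inc_distributed[of s t k] st by auto
    have i1: "integrable M (inc s t k)"
      using distributed_integrable[OF D, of "\<lambda>x. x"] integrable_normal_moment_nz_1[OF pos, of 0] by simp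
    have i2: "integrable M (\<lambda>\<omega>. (inc s t k \<omega>)\<^sup>2)"
      using distributed_integrable[OF D, of "\<lambda>x. x\<^sup>2"] integrable_normal_moment[OF pos, of 0 2] by simp
    have e2: "expectation (\<lambda>\<omega>. (inc s t k \<omega>)\<^sup>2) = (sqrt (t - s))\<^sup>2"
      using distributed_integral[OF D, of "\<lambda>x. x\<^sup>2"] integral_normal_moment_even[OF pos, of 0 1] by simp
    show ?thesis using i1 i2 e2 normal_distributed_expectation[OF pos D] st by simp
  qed
  then show "integrable M (inc s t k)" "expectation (inc s t k) = 0"
    "integrable M (\<lambda>\<omega>. (inc s t k \<omega>)\<^sup>2)" "expectation (\<lambda>\<omega>. (inc s t k \<omega>)\<^sup>2) = t - s" by auto
qed

lemma inc_product:
  assumes st: "0 \<le> s" "s \<le> t"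
  shows "integrable M (\<lambda>\<omega>. inc s t k \<omega> * inc s t l \<omega>)" (is ?a)
    and "expectation (\<lambda>\<omega>. inc s t k \<omega> * inc s t l \<omega>) = (if k = l then t - s else 0)" (is ?b)
proof -
  have "?a \<and> ?b"
  proof (cases "k = l")
    case True then show ?thesis using inc_moments[OF st] by (simp add: power2_eq_square)
  next
    case False
    have iv: "indep_vars (\<lambda>_. borel) (inc s t) {k, l}"
      by (rule indep_vars_subset[OF inc_indep]) (use st in auto)
    show ?thesis
      using indep_vars_lebesgue_integral[OF _ iv] indep_vars_integrable[OF _ iv] inc_moments[OF st] False by simp
  qed
  then show ?a ?b by auto
qed

text \<open>The partial sums of the noise, taken over an index set \<open>K\<close> and a time interval.\<close>

definition "comb K a s t \<omega> = (\<Sum>k\<in>K. a k * inc s t k \<omega>)"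

lemma comb_moments:
  assumes K: "finite K" and st: "0 \<le> s" "s \<le> t"
  shows "integrable M (comb K a s t)" "expectation (comb K a s t) = 0"
    "integrable M (\<lambda>\<omega>. (comb K a s t \<omega>)\<^sup>2)" "expectation (\<lambda>\<omega>. (comb K a s t \<omega>)\<^sup>2) = (t - s) * (\<Sum>k\<in>K. (a k)\<^sup>2)"
proof -
  show "integrable M (comb K a s t)" "expectation (comb K a s t) = 0"
    unfolding comb_def[abs_def] using inc_moments[OF st] by simp_all
  have eq: "(comb K a s t \<omega>)\<^sup>2 = (\<Sum>k\<in>K. \<Sum>l\<in>K. a k * a l * (inc s t k \<omega> * inc s t l \<omega>))" for \<omega>
    by (simp add: comb_def power2_eq_square sum_product mult_ac)
  show "integrable M (\<lambda>\<omega>. (comb K a s t \<omega>)\<^sup>2)"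
    unfolding eq using inc_product[OF st] by simp
  have "expectation (\<lambda>\<omega>. (comb K a s t \<omega>)\<^sup>2) = (\<Sum>k\<in>K. \<Sum>l\<in>K. a k * a l * (if k = l then t - s else 0))"
    unfolding eq using inc_product[OF st] by simp
  also have "\<dots> = (\<Sum>k\<in>K. (a k)\<^sup>2 * (t - s))"
    using K by (intro sum.cong refl) (simp add: power2_eq_square if_distrib cong: if_cong)
  finally show "expectation (\<lambda>\<omega>. (comb K a s t \<omega>)\<^sup>2) = (t - s) * (\<Sum>k\<in>K. (a k)\<^sup>2)"
    by (simp add: sum_distrib_left mult.commute)
qed

lemma comb_M: "0 \<le> s \<Longrightarrow> 0 \<le> t \<Longrightarrow> comb K a s t \<in> borel_measurable M"
  unfolding comb_def[abs_def] using inc_M by (intro borel_measurable_sum borel_measurable_times) auto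

lemma comb_FU: "comb K a s t \<in> borel_measurable (FU s t)"
  unfolding comb_def[abs_def] using inc_FU by (intro borel_measurable_sum borel_measurable_times) auto

lemma comb_G: "0 \<le> s \<Longrightarrow> s \<le> r \<Longrightarrow> 0 \<le> t \<Longrightarrow> t \<le> r \<Longrightarrow> comb K a s t \<in> borel_measurable (G r)"
  unfolding comb_def[abs_def] inc_def using B_G by (intro borel_measurable_sum borel_measurable_times borel_measurable_diff) auto

lemma comb_add: "comb K a r t \<omega> = comb K a r s \<omega> + comb K a s t \<omega>"
  by (simp add: comb_def inc_def sum.distrib[symmetric] algebra_simps)

lemma comb_tail:
  assumes K: "finite K" and st: "0 \<le> s" "s \<le> t" and x: "x > 0"
  shows "prob {\<omega> \<in> space M. x < \<bar>comb K a s t \<omega>\<bar>} \<le> (t - s) * (\<Sum>k\<in>K. (a k)\<^sup>2) / x\<^sup>2"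
proof -
  have [measurable]: "comb K a s t \<in> borel_measurable M" using comb_M st by auto
  have "prob {\<omega> \<in> space M. x < \<bar>comb K a s t \<omega>\<bar>} \<le> prob {\<omega> \<in> space M. x \<le> \<bar>comb K a s t \<omega>\<bar>}"
    by (intro finite_measure_mono) auto
  also have "\<dots> \<le> expectation (\<lambda>\<omega>. (comb K a s t \<omega>)\<^sup>2) / x\<^sup>2"
    by (rule second_moment_method) (use comb_moments[OF K st] x in auto)
  finally show ?thesis by (simp add: comb_moments[OF K st])
qed

end

text \<open>Bounds for a continuous path follow from bounds at dyadic times, which are countably many and
  nested in the level \<open>p\<close>.\<close>

lemma dyadic_bound:
  fixes f :: "real \<Rightarrow> real"
  assumes cont: "continuous_on {0..T} f" and T: "T > 0"
    and bd: "\<And>p j::nat. j \<le> 2 ^ p \<Longrightarrow> \<bar>f (T * real j / 2 ^ p)\<bar> \<le> C" and t: "t \<in> {0..T}"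
  shows "\<bar>f t\<bar> \<le> C"
proof -
  define j where "j p = nat \<lfloor>2 ^ p * (t / T)\<rfloor>" for p :: nat
  define s where "s p = T * real (j p) / 2 ^ p" for p
  have tT: "0 \<le> t / T" "t / T \<le> 1" using t T by auto
  have rj: "real (j p) = of_int \<lfloor>2 ^ p * (t / T)\<rfloor>" for p
    unfolding j_def by (rule of_nat_nat) (use mult_nonneg_nonneg[of "2 ^ p" "t / T"] tT in simp)
  have j_le: "real (j p) \<le> 2 ^ p * (t / T)" "2 ^ p * (t / T) < real (j p) + 1" for p
    unfolding rj by (rule of_int_floor_le, rule floor_less_one[THEN iffD1, of _, simplified] | linarith)+
  have jp: "j p \<le> 2 ^ p" for p
  proof -
    have "2 ^ p * (t / T) \<le> 2 ^ p * 1" by (rule mult_left_mono[OF tT(2)]) simp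
    then have "real (j p) \<le> 2 ^ p" using j_le(1)[of p] by linarith
    also have "2 ^ p = real (2 ^ p)" by simp
    finally show ?thesis by (simp only: of_nat_le_iff)
  qed
  have s_le: "s p \<le> t" "t - s p \<le> T * (1 / 2) ^ p" for p
  proof -
    have "s p * 2 ^ p = T * real (j p)" by (simp add: s_def)
    moreover have "T * real (j p) \<le> T * (2 ^ p * (t / T))" "T * (2 ^ p * (t / T)) \<le> T * (real (j p) + 1)"
      using j_le[of p] T by (intro mult_left_mono; simp)+
    moreover have "T * (2 ^ p * (t / T)) = t * 2 ^ p" using T by simp
    ultimately have "s p * 2 ^ p \<le> t * 2 ^ p" "t * 2 ^ p \<le> s p * 2 ^ p + T" by (simp_all add: distrib_left)
    then show "s p \<le> t" "t - s p \<le> T * (1 / 2) ^ p" by (simp_all add: field_simps power_one_over)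
  qed
  have s0: "0 \<le> s p" for p using T by (simp add: s_def)
  have "(\<lambda>p. t - T * (1 / 2) ^ p) \<longlonglongrightarrow> t - T * 0" by (intro tendsto_intros LIMSEQ_power_zero) simp
  then have lim: "s \<longlonglongrightarrow> t"
    by (intro tendsto_sandwich[of "\<lambda>p. t - T * (1 / 2) ^ p" s _ "\<lambda>_. t"])
       (use s_le in \<open>auto intro!: always_eventually simp: algebra_simps\<close>)
  have "(\<lambda>p. f (s p)) \<longlonglongrightarrow> f t"
    by (rule continuous_on_tendsto_compose[OF cont lim t]) (use s0 s_le(1) t in \<open>auto intro!: always_eventually intro: order_trans\<close>)
  then have "(\<lambda>p. \<bar>f (s p)\<bar>) \<longlonglongrightarrow> \<bar>f t\<bar>" by (rule tendsto_rabs)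
  then show ?thesis by (rule LIMSEQ_le_const2) (use bd[OF jp] in \<open>auto simp: s_def\<close>)
qed

context brownian_family
begin

text \<open>The events that depend only on the paths with index in \<open>S\<close>.\<close>

definition "index_alg S = sigma (space M) (\<Union>k\<in>S. sets (path_alg k))"

lemma sets_path_alg_Pow: "(\<Union>k\<in>S. sets (path_alg k)) \<subseteq> Pow (space M)"
  using path_alg_events sets.space_closed[of M] by blast

lemma sets_index_alg: "sets (index_alg S) = sigma_sets (space M) (\<Union>k\<in>S. sets (path_alg k))" and space_index_alg: "space (index_alg S) = space M"
  unfolding index_alg_def using sets_path_alg_Pow by (rule sets_measure_of, rule space_measure_of)

lemma indep_index_alg:
  assumes "S \<inter> S' = {}"
  shows "indep_set (sets (index_alg S)) (sets (index_alg S'))"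
proof -
  have "indep_sets (\<lambda>j. sigma_sets (space M) (\<Union>i\<in>(if j then S else S'). sets (path_alg i))) (UNIV :: bool set)"
  proof (rule indep_sets_collect_sigma)
    show "indep_sets (\<lambda>i. sets (path_alg i)) (\<Union>j\<in>UNIV. if j then S else S')"
      by (rule indep_sets_mono_index[OF _ indep_path_alg]) simp
    show "disjoint_family_on (\<lambda>j. if j then S else S') (UNIV :: bool set)"
      using assms by (auto simp: disjoint_family_on_def)
  qed (rule sets.Int_stable)
  then show ?thesis
    unfolding indep_set_def sets_index_alg by (elim indep_sets_mono_sets) (auto split: bool.split)
qed

lemma comb_index_alg:
  assumes "K \<subseteq> S" "0 \<le> s" "0 \<le> t"
  shows "comb K a s t \<in> borel_measurable (index_alg S)"
proof -
  have "inc s t k \<in> borel_measurable (index_alg S)" if "k \<in> S" for k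
  proof (rule measurableI)
    fix A :: "real set" assume "A \<in> sets borel"
    then have "inc s t k -` A \<inter> space M \<in> sets (path_alg k)" using fut_path_alg[OF assms(2,3), of k] by (auto simp: fut_def)
    then show "inc s t k -` A \<inter> space (index_alg S) \<in> sets (index_alg S)"
      unfolding sets_index_alg space_index_alg by (intro sigma_sets.Basic UN_I[OF that])
  qed simp
  then show ?thesis unfolding comb_def[abs_def]
    using assms(1) by (intro borel_measurable_sum borel_measurable_times) auto
qed

text \<open>The maximal inequality over times, for a fixed index set: from the first time at which the sum
  is large, the increment up to \<open>T\<close> is independent and small with probability at least one half by
  Chebyshev's inequality.\<close>

lemma time_max:
  assumes K: "finite K" and T: "T > 0" and n: "n > 0" and x: "x > 0"
  shows "prob {\<omega> \<in> space M. \<exists>j\<le>n. 2 * x < \<bar>comb K a 0 (T * real j / real n) \<omega>\<bar>} \<le> 2 * (T * (\<Sum>k\<in>K. (a k)\<^sup>2) / x\<^sup>2)"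
proof (cases "T * (\<Sum>k\<in>K. (a k)\<^sup>2) / x\<^sup>2 \<le> 1 / 2")
  \<comment> \<open>The bound exceeds 1 unless the variance is small, and this smallness is what \<open>V\<close> needs.\<close>
  case False
  then show ?thesis by (intro order_trans[OF prob_le_1]) linarith
next
  case small: True
  define \<sigma> where "\<sigma> = (\<Sum>k\<in>K. (a k)\<^sup>2)"
  have s0: "\<sigma> \<ge> 0" unfolding \<sigma>_def by (intro sum_nonneg) auto
  define t where "t j = T * real j / real n" for j
  have t: "0 \<le> t j" for j using T by (simp add: t_def)
  have tT: "t j \<le> T" if "j \<le> n" for j using that T n by (simp add: t_def divide_simps)
  have tT': "t j < T" if "j < n" for j using that T n by (simp add: t_def divide_simps)
  have tn: "t n = T" using n by (simp add: t_def)
  have tm: "t i \<le> t j" if "i \<le> j" for i j using that T n by (simp add: t_def divide_right_mono)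
  define E where "E j = {\<omega> \<in> space M. 2 * x < \<bar>comb K a 0 (t j) \<omega>\<bar>}" for j
  define V where "V j = {\<omega> \<in> space M. \<bar>comb K a (t j) T \<omega>\<bar> \<le> x}" for j
  define A where "A = {\<omega> \<in> space M. x < \<bar>comb K a 0 T \<omega>\<bar>}"
  have [measurable]: "comb K a 0 (t j) \<in> borel_measurable M" "comb K a (t j) T \<in> borel_measurable M" "comb K a 0 T \<in> borel_measurable M" for j
    using comb_M t T by auto
  have ev: "E j \<in> events" "V j \<in> events" "A \<in> events" for j unfolding E_def V_def A_def by measurable
  have "prob (\<Union>j\<le>n. E j) \<le> 2 * prob A"
  proof (rule first_passage_bound)
    fix j assume j: "j \<le> n"
    show "prob ((E j - (\<Union>i<j. E i)) \<inter> V j) = prob (E j - (\<Union>i<j. E i)) * prob (V j)"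
    proof (cases "j = n")
      \<comment> \<open>At the final time the increment over an empty interval vanishes.\<close>
      case True
      have "V j = space M" using x by (simp add: V_def True tn comb_def inc_def)
      then show ?thesis using ev(1) sets.sets_into_space[OF ev(1)] by (simp add: prob_space Int_absorb2 Diff_subset[THEN order_trans])
    next
      case False
      then have jn: "j < n" using j by simp
      have EG: "E i \<in> sets (G (t j))" if "i \<le> j" for i
      proof -
        have "{\<omega> \<in> space (G (t j)). 2 * x < \<bar>comb K a 0 (t i) \<omega>\<bar>} \<in> sets (G (t j))"
          using comb_G[of 0 "t j" "t i" K a] t tm[OF that] by measurable
        then show ?thesis by (simp add: E_def space_G)
      qed
      have "{\<omega> \<in> space (FU (t j) T). \<bar>comb K a (t j) T \<omega>\<bar> \<le> x} \<in> sets (FU (t j) T)"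
        using comb_FU[of K a "t j" T] by measurable
      then have "V j \<in> sets (FU (t j) T)" by (simp add: V_def space_FU)
      moreover have "E j - (\<Union>i<j. E i) \<in> sets (G (t j))"
        by (intro sets.Diff sets.finite_UN EG) auto
      ultimately show ?thesis by (intro indep_setD[OF indep_G_FU[OF t tT'[OF jn]]])
    qed
    have "prob {\<omega> \<in> space M. x < \<bar>comb K a (t j) T \<omega>\<bar>} \<le> (T - t j) * \<sigma> / x\<^sup>2"
      unfolding \<sigma>_def by (rule comb_tail[OF K t tT[OF j] x])
    also have "\<dots> \<le> T * \<sigma> / x\<^sup>2" using t[of j] s0 by (intro divide_right_mono mult_right_mono) auto
    also have "\<dots> \<le> 1 / 2" using small by (simp add: \<sigma>_def)
    finally have "prob {\<omega> \<in> space M. x < \<bar>comb K a (t j) T \<omega>\<bar>} \<le> 1 / 2" .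
    moreover have "{\<omega> \<in> space M. x < \<bar>comb K a (t j) T \<omega>\<bar>} = space M - V j" by (auto simp: V_def)
    ultimately show "1 / 2 \<le> prob (V j)" using prob_compl[OF ev(2)[of j]] by simp
    show "E j \<inter> V j \<subseteq> A"
    proof
      fix \<omega> assume "\<omega> \<in> E j \<inter> V j"
      then show "\<omega> \<in> A" using comb_add[of K a 0 T \<omega> "t j"] by (auto simp: E_def V_def A_def)
    qed
  qed (use ev in auto)
  also have "(\<Union>j\<le>n. E j) = {\<omega> \<in> space M. \<exists>j\<le>n. 2 * x < \<bar>comb K a 0 (T * real j / real n) \<omega>\<bar>}"
    by (auto simp: E_def t_def)
  also have "2 * prob A \<le> 2 * (T * \<sigma> / x\<^sup>2)"
    using comb_tail[OF K _ _ x, of 0 T a] T by (simp add: A_def \<sigma>_def)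
  finally show ?thesis by (simp add: \<sigma>_def)
qed

text \<open>The same argument in the summation index: the sum over the remaining indices is independent of the
  first partial sum that is large, and \<open>time_max\<close> makes it small at all times at once.\<close>

lemma index_max:
  assumes T: "T > 0" and n: "n > 0" and x: "x > 0"
  shows "prob {\<omega> \<in> space M. \<exists>l\<le>L. \<exists>j\<le>n. 4 * x < \<bar>comb {m..<m + l} a 0 (T * real j / real n) \<omega>\<bar>}
    \<le> 4 * (T * (\<Sum>k\<in>{m..<m + L}. (a k)\<^sup>2) / x\<^sup>2)"
proof (cases "T * (\<Sum>k\<in>{m..<m + L}. (a k)\<^sup>2) / x\<^sup>2 \<le> 1 / 4")
  case False
  then show ?thesis by (intro order_trans[OF prob_le_1]) linarith
next
  case small: True
  define t where "t j = T * real j / real n" for j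
  have t: "0 \<le> t j" for j using T by (simp add: t_def)
  define E where "E l = {\<omega> \<in> space M. \<exists>j\<in>{..n}. 4 * x < \<bar>comb {m..<m + l} a 0 (t j) \<omega>\<bar>}" for l
  define V where "V l = {\<omega> \<in> space M. \<not> (\<exists>j\<in>{..n}. 2 * x < \<bar>comb {m + l..<m + L} a 0 (t j) \<omega>\<bar>)}" for l
  define A where "A = {\<omega> \<in> space M. \<exists>j\<in>{..n}. 2 * x < \<bar>comb {m..<m + L} a 0 (t j) \<omega>\<bar>}"
  have [measurable]: "comb K a 0 (t j) \<in> borel_measurable M" for K j using comb_M t by auto
  have ev: "E l \<in> events" "V l \<in> events" "A \<in> events" for l unfolding E_def V_def A_def by measurable
  have "prob (\<Union>l\<le>L. E l) \<le> 2 * prob A"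
  proof (rule first_passage_bound)
    fix l assume l: "l \<le> L"
    show "prob ((E l - (\<Union>i<l. E i)) \<inter> V l) = prob (E l - (\<Union>i<l. E i)) * prob (V l)"
    proof (rule indep_setD[OF indep_index_alg])
      show "{..<m + l} \<inter> {m + l..} = {}" by auto
      have "E i \<in> sets (index_alg {..<m + l})" if "i \<le> l" for i
      proof -
        have [measurable]: "comb {m..<m + i} a 0 (t j) \<in> borel_measurable (index_alg {..<m + l})" for j
          by (rule comb_index_alg) (use that t in auto)
        have "{\<omega> \<in> space (index_alg {..<m + l}). \<exists>j\<in>{..n}. 4 * x < \<bar>comb {m..<m + i} a 0 (t j) \<omega>\<bar>} \<in> sets (index_alg {..<m + l})"
          by measurable
        then show ?thesis by (simp add: E_def space_index_alg)
      qed
      then show "E l - (\<Union>i<l. E i) \<in> sets (index_alg {..<m + l})" by (intro sets.Diff sets.finite_UN) auto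
      have [measurable]: "comb {m + l..<m + L} a 0 (t j) \<in> borel_measurable (index_alg {m + l..})" for j
        by (rule comb_index_alg) (use t in auto)
      have "{\<omega> \<in> space (index_alg {m + l..}). \<not> (\<exists>j\<in>{..n}. 2 * x < \<bar>comb {m + l..<m + L} a 0 (t j) \<omega>\<bar>)} \<in> sets (index_alg {m + l..})"
        by measurable
      then show "V l \<in> sets (index_alg {m + l..})" by (simp add: V_def space_index_alg)
    qed
    have "prob {\<omega> \<in> space M. \<exists>j\<le>n. 2 * x < \<bar>comb {m + l..<m + L} a 0 (T * real j / real n) \<omega>\<bar>} \<le> 2 * (T * (\<Sum>k\<in>{m + l..<m + L}. (a k)\<^sup>2) / x\<^sup>2)"
      by (rule time_max) (use T n x in auto)
    also have "\<dots> \<le> 2 * (T * (\<Sum>k\<in>{m..<m + L}. (a k)\<^sup>2) / x\<^sup>2)"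
      using T by (intro mult_left_mono divide_right_mono sum_mono2) auto
    also have "\<dots> \<le> 1 / 2" using small by linarith
    finally have "prob {\<omega> \<in> space M. \<exists>j\<le>n. 2 * x < \<bar>comb {m + l..<m + L} a 0 (T * real j / real n) \<omega>\<bar>} \<le> 1 / 2" .
    moreover have "{\<omega> \<in> space M. \<exists>j\<le>n. 2 * x < \<bar>comb {m + l..<m + L} a 0 (T * real j / real n) \<omega>\<bar>} = space M - V l"
      by (auto simp: V_def t_def)
    ultimately show "1 / 2 \<le> prob (V l)" using prob_compl[OF ev(2)[of l]] by simp
    show "E l \<inter> V l \<subseteq> A"
    proof
      fix \<omega> assume w: "\<omega> \<in> E l \<inter> V l"
      then obtain j where j: "j \<le> n" "4 * x < \<bar>comb {m..<m + l} a 0 (t j) \<omega>\<bar>" by (auto simp: E_def)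
      have "\<bar>comb {m + l..<m + L} a 0 (t j) \<omega>\<bar> \<le> 2 * x" using w j(1) by (auto simp: V_def not_less)
      moreover have "{m..<m + L} = {m..<m + l} \<union> {m + l..<m + L}" using l by auto
      then have "comb {m..<m + L} a 0 (t j) \<omega> = comb {m..<m + l} a 0 (t j) \<omega> + comb {m + l..<m + L} a 0 (t j) \<omega>"
        unfolding comb_def by (simp add: sum.union_disjoint)
      ultimately have "2 * x < \<bar>comb {m..<m + L} a 0 (t j) \<omega>\<bar>" using j(2) by linarith
      then show "\<omega> \<in> A" using j(1) w by (auto simp: A_def E_def)
    qed
  qed (use ev in auto)
  also have "(\<Union>l\<le>L. E l) = {\<omega> \<in> space M. \<exists>l\<le>L. \<exists>j\<le>n. 4 * x < \<bar>comb {m..<m + l} a 0 (T * real j / real n) \<omega>\<bar>}"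
    by (auto simp: E_def t_def)
  also have "2 * prob A \<le> 2 * (2 * (T * (\<Sum>k\<in>{m..<m + L}. (a k)\<^sup>2) / x\<^sup>2))"
  proof -
    have "A = {\<omega> \<in> space M. \<exists>j\<le>n. 2 * x < \<bar>comb {m..<m + L} a 0 (T * real j / real n) \<omega>\<bar>}" by (auto simp: A_def t_def)
    then show ?thesis using time_max[OF _ T n x, of "{m..<m + L}" a] by (intro mult_left_mono) auto
  qed
  finally show ?thesis by simp
qed

lemma AE_paths_continuous: "AE \<omega> in M. \<forall>k. continuous_on {0..} (\<lambda>t. B k t \<omega>) \<and> B k 0 \<omega> = 0"
proof (subst AE_all_countable, intro allI)
  fix k
  have "AE \<omega> in M. B k 0 \<omega> = 0" "AE \<omega> in M. continuous_on {0..} (\<lambda>t. B k t \<omega>)"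
    using bm[of k] unfolding brownian_motion_def by auto
  then show "AE \<omega> in M. continuous_on {0..} (\<lambda>t. B k t \<omega>) \<and> B k 0 \<omega> = 0" by eventually_elim simp
qed

text \<open>The bound of \<open>index_max\<close> depends neither on the number of times nor on the number of indices, except
  through the tail of the series of the squares, so it passes to all dyadic times and all
  indices and then, by continuity, to all times.\<close>

lemma AE_uniform_tail:
  assumes a: "summable (\<lambda>k. (a k)\<^sup>2)" and T: "T > 0" and x: "x > 0"
  shows "AE \<omega> in M. \<exists>m. \<forall>l. \<forall>t\<in>{0..T}. \<bar>comb {m..<m + l} a 0 t \<omega>\<bar> \<le> 4 * x"
proof -
  \<comment> \<open>The level \<open>p\<close> bounds the index and the fineness of the time grid at once, so that these events increase
    with \<open>p\<close>.\<close>
  define C where "C m p = {\<omega> \<in> space M. \<exists>l\<in>{..p}. \<exists>j\<in>{..(2::nat) ^ p}. 4 * x < \<bar>comb {m..<m + l} a 0 (T * real j / real (2 ^ p)) \<omega>\<bar>}" for m p :: nat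
  define Bad where "Bad m = (\<Union>p. C m p)" for m
  have [measurable]: "comb K a 0 (T * real j / real (2 ^ p)) \<in> borel_measurable M" for K and j p :: nat
    using comb_M T by simp
  have Cev: "C m p \<in> events" for m p unfolding C_def by measurable
  define tail where "tail m = (\<Sum>k. (a (k + m))\<^sup>2)" for m
  have sm: "summable (\<lambda>k. (a (k + m))\<^sup>2)" for m by (rule summable_ignore_initial_segment[OF a])
  have "prob (C m p) \<le> 4 * (T * tail m / x\<^sup>2)" for m p
  proof -
    have "C m p = {\<omega> \<in> space M. \<exists>l\<le>p. \<exists>j\<le>2 ^ p. 4 * x < \<bar>comb {m..<m + l} a 0 (T * real j / real (2 ^ p)) \<omega>\<bar>}"
      unfolding C_def by (simp only: Bex_def atMost_iff)
    also have "prob \<dots> \<le> 4 * (T * (\<Sum>k\<in>{m..<m + p}. (a k)\<^sup>2) / x\<^sup>2)"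
      by (rule index_max) (use T x in auto)
    also have "(\<Sum>k\<in>{m..<m + p}. (a k)\<^sup>2) = (\<Sum>k<p. (a (k + m))\<^sup>2)"
      using sum.shift_bounds_nat_ivl[of "\<lambda>k. (a k)\<^sup>2" 0 m p] by (simp add: add.commute atLeast0LessThan)
    also have "\<dots> \<le> tail m" unfolding tail_def by (rule sum_le_suminf[OF sm]) auto
    finally show ?thesis using T by (simp add: divide_right_mono mult_left_mono)
  qed
  note Cp = this
  have incC: "C m p \<subseteq> C m (Suc p)" for m p
  proof
    fix \<omega> assume "\<omega> \<in> C m p"
    then obtain l j where w: "\<omega> \<in> space M" "l \<le> p" "j \<le> 2 ^ p" "4 * x < \<bar>comb {m..<m + l} a 0 (T * real j / real (2 ^ p)) \<omega>\<bar>"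
      by (auto simp: C_def)
    have "T * real j / real (2 ^ p) = T * real (2 * j) / real (2 ^ Suc p)" by simp
    then have "4 * x < \<bar>comb {m..<m + l} a 0 (T * real (2 * j) / real (2 ^ Suc p)) \<omega>\<bar>" using w(4) by simp
    moreover have "2 * j \<in> {..2 ^ Suc p}" "l \<in> {..Suc p}" using w by auto
    ultimately show "\<omega> \<in> C m (Suc p)" using w(1) unfolding C_def by blast
  qed
  have monoC: "C m p \<subseteq> C m p'" if "p \<le> p'" for m p p'
    using that by (induction p' rule: dec_induct) (use incC in auto)
  have Bad_ev: "Bad m \<in> events" for m unfolding Bad_def using Cev by auto
  have Bad_le: "prob (Bad m) \<le> 4 * (T * tail m / x\<^sup>2)" for m
  proof (rule LIMSEQ_le_const2)
    show "(\<lambda>p. prob (C m p)) \<longlonglongrightarrow> prob (Bad m)"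
      unfolding Bad_def
    proof (rule finite_Lim_measure_incseq)
      show "incseq (C m)" by (rule incseq_SucI) (rule incC)
    qed (use Cev in auto)
  qed (use Cp in auto)
  have "tail \<longlonglongrightarrow> 0" unfolding tail_def by (rule suminf_exist_split2[OF a])
  then have lim: "(\<lambda>m. 4 * (T * tail m / x\<^sup>2)) \<longlonglongrightarrow> 0"
    using tendsto_mult_right_zero[of "\<lambda>m. T * tail m / x\<^sup>2" sequentially 4] tendsto_divide_zero[of "\<lambda>m. T * tail m" sequentially "x\<^sup>2"]
      tendsto_mult_right_zero[of tail sequentially T] by blast
  have "prob (\<Inter>m. Bad m) \<le> 4 * (T * tail m / x\<^sup>2)" for m
    by (rule order_trans[OF finite_measure_mono Bad_le[of m]]) (use Bad_ev in auto)
  then have "prob (\<Inter>m. Bad m) \<le> 0" using LIMSEQ_le_const[OF lim] by blast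
  then have "prob (\<Inter>m. Bad m) = 0" using measure_nonneg[of M "\<Inter>m. Bad m"] by linarith
  moreover have "(\<Inter>m. Bad m) \<in> events" using Bad_ev by auto
  ultimately have "(\<Inter>m. Bad m) \<in> null_sets M" by (simp add: null_sets_def emeasure_eq_measure)
  then have "AE \<omega> in M. \<omega> \<notin> (\<Inter>m. Bad m)" by (rule AE_not_in)
  then show ?thesis using AE_paths_continuous AE_space
  proof eventually_elim
    case (elim \<omega>)
    then obtain m where m: "\<omega> \<notin> Bad m" by auto
    have "\<bar>comb {m..<m + l} a 0 t \<omega>\<bar> \<le> 4 * x" if t: "t \<in> {0..T}" for l t
    proof (rule dyadic_bound[OF _ T _ t])
      show "continuous_on {0..T} (\<lambda>t. comb {m..<m + l} a 0 t \<omega>)"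
        unfolding comb_def inc_def using elim(2) by (intro continuous_intros) (auto intro: continuous_on_subset)
      fix p j :: nat assume j: "j \<le> 2 ^ p"
      \<comment> \<open>A level that is fine enough for the time and large enough for the index \<open>l\<close>.\<close>
      define p' where "p' = max l p"
      define j' where "j' = j * 2 ^ (p' - p)"
      have pp: "p \<le> p'" "l \<le> p'" by (auto simp: p'_def)
      have e: "(2::nat) ^ p' = 2 ^ p * 2 ^ (p' - p)" using pp by (simp flip: power_add)
      have "j' \<le> 2 ^ p'" using j by (simp add: j'_def e)
      moreover have "\<omega> \<notin> C m p'" using m by (simp add: Bad_def)
      ultimately have "\<not> 4 * x < \<bar>comb {m..<m + l} a 0 (T * real j' / real (2 ^ p')) \<omega>\<bar>"
        using pp elim(3) unfolding C_def by blast
      moreover have "T * real j' / real (2 ^ p') = T * real j / 2 ^ p" by (simp add: j'_def e)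
      ultimately show "\<bar>comb {m..<m + l} a 0 (T * real j / 2 ^ p) \<omega>\<bar> \<le> 4 * x" by simp
    qed
    then show ?case by blast
  qed
qed

lemma AE_series_continuous:
  assumes a: "summable (\<lambda>k. (a k)\<^sup>2)"
  shows "AE \<omega> in M. (\<forall>t\<ge>0. summable (\<lambda>k. a k * B k t \<omega>)) \<and> continuous_on {0..} (\<lambda>t. \<Sum>k. a k * B k t \<omega>)"
proof -
  have "AE \<omega> in M. \<forall>T q. \<exists>m. \<forall>l. \<forall>t\<in>{0..real (Suc T)}. \<bar>comb {m..<m + l} a 0 t \<omega>\<bar> \<le> 4 * (1 / real (Suc q))"
    unfolding AE_all_countable by (intro allI AE_uniform_tail[OF a]) auto
  then show ?thesis using AE_paths_continuous
  proof eventually_elim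
    case (elim \<omega>)
    let ?P = "\<lambda>n t. \<Sum>k<n. a k * B k t \<omega>"
    have combP: "comb {m..<m + l} a 0 t \<omega> = ?P (m + l) t - ?P m t" for m l t
    proof -
      have "?P (m + l) t = ?P m t + (\<Sum>k\<in>{m..<m + l}. a k * B k t \<omega>)"
        using sum.atLeastLessThan_concat[of 0 m "m + l" "\<lambda>k. a k * B k t \<omega>"] by (simp add: atLeast0LessThan)
      then show ?thesis using elim(2) by (simp add: comb_def inc_def)
    qed
    have lim: "uniform_limit {0..real (Suc T)} ?P (\<lambda>t. lim (\<lambda>n. ?P n t)) sequentially" for T
    proof -
      have "uniformly_Cauchy_on {0..real (Suc T)} ?P"
      proof (rule uniformly_Cauchy_onI)
        fix e :: real assume e: "e > 0"
        obtain q where q: "1 / real (Suc q) < e / 8" using reals_Archimedean[of "e / 8"] e by (auto simp: inverse_eq_divide)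
        obtain m where m: "\<And>l t. t \<in> {0..real (Suc T)} \<Longrightarrow> \<bar>comb {m..<m + l} a 0 t \<omega>\<bar> \<le> 4 * (1 / real (Suc q))"
          using elim(1) by meson
        have close: "\<bar>?P n t - ?P m t\<bar> < e / 2" if "n \<ge> m" "t \<in> {0..real (Suc T)}" for n t
          using m[OF that(2), of "n - m"] q that(1) unfolding combP by simp
        show "\<exists>M. \<forall>x\<in>{0..real (Suc T)}. \<forall>m\<ge>M. \<forall>n\<ge>M. dist (?P m x) (?P n x) < e"
        proof (intro exI[of _ m] ballI allI impI)
          fix t n n' assume "t \<in> {0..real (Suc T)}" "n \<ge> m" "n' \<ge> m"
          then show "dist (?P n t) (?P n' t) < e" using close[of n t] close[of n' t] unfolding dist_real_def by linarith
        qed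
      qed
      then have "uniformly_convergent_on {0..real (Suc T)} ?P" by (rule Cauchy_uniformly_convergent)
      then show ?thesis by (simp add: uniformly_convergent_uniform_limit_iff)
    qed
    have sumb: "summable (\<lambda>k. a k * B k t \<omega>)" if "t \<ge> 0" for t
    proof -
      obtain T :: nat where T: "t \<le> real T" using real_arch_simple by blast
      have "(\<lambda>n. ?P n t) \<longlonglongrightarrow> lim (\<lambda>n. ?P n t)"
        by (rule tendsto_uniform_limitI[OF lim[of T]]) (use T that in auto)
      then show ?thesis unfolding summable_iff_convergent convergent_def by blast
    qed
    have "continuous_on {0..real (Suc T)} (\<lambda>t. \<Sum>k. a k * B k t \<omega>)" for T
      unfolding suminf_eq_lim
    proof (rule uniform_limit_theorem[OF _ lim])
      show "\<forall>\<^sub>F n in sequentially. continuous_on {0..real (Suc T)} (?P n)"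
        using elim(2) by (intro always_eventually allI continuous_intros) (auto intro: continuous_on_subset)
    qed simp
    note contT = this
    have "continuous_on {0..} (\<lambda>t. \<Sum>k. a k * B k t \<omega>)"
      unfolding continuous_on_eq_continuous_within
    proof
      fix t :: real assume t: "t \<in> {0..}"
      obtain T :: nat where T: "t \<le> real T" using real_arch_simple by blast
      have "continuous (at t within {0..real (Suc T)}) (\<lambda>t. \<Sum>k. a k * B k t \<omega>)"
        using contT[of T] t T unfolding continuous_on_eq_continuous_within by auto
      moreover have "at t within {0..real (Suc T)} = at t within {0..}"
        by (rule at_within_nhd[of t "{..<real (Suc T)}"]) (use T in auto)
      ultimately show "continuous (at t within {0..}) (\<lambda>t. \<Sum>k. a k * B k t \<omega>)" by simp
    qed
    then show ?case using sumb by blast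
  qed
qed

end

section \<open>Gaussian noise in the state space\<close>

text \<open>The coefficients \<open>c k\<close> of the Brownian motions have mean zero, so the noise stays in the state
  space; square summability is exactly what convergence of the series requires.\<close>

locale bm_noise = brownian_family M F B for M :: "'w measure" and F and B +
  fixes N :: nat and c :: "nat \<Rightarrow> nat \<Rightarrow> real"
  assumes N1: "N \<ge> 1"
    and c_summable: "\<And>i. i \<in> {1..N} \<Longrightarrow> summable (\<lambda>k. (c k i)\<^sup>2)"
    and c_zero: "\<And>k. (\<Sum>i=1..N. c k i) = 0"
begin

text \<open>The noise as a function of the values of all Brownian motions, centered so that it lies in the
  state space and is measurable even where a series diverges.\<close>

definition "H d = center N (\<lambda>i. \<Sum>k. c k i * d k)"
definition "Q t \<omega> = H (\<lambda>k. B k t \<omega>)"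

lemma H_R0: "H d \<in> R0 N"
  unfolding H_def by (rule center_R0[OF N1])

lemma H_measurable:
  assumes X: "\<And>k. X k \<in> borel_measurable A"
  shows "(\<lambda>\<omega>. H (\<lambda>k. X k \<omega>)) \<in> A \<rightarrow>\<^sub>M borel_R0 N"
proof (rule measurable_borel_R0I)
  fix i assume i: "i \<in> {1..N}"
  have m: "(\<lambda>\<omega>. \<Sum>k. c k j * X k \<omega>) \<in> borel_measurable A" for j
    by (intro borel_measurable_suminf borel_measurable_times borel_measurable_const X)
  have "(\<lambda>\<omega>. (\<Sum>k. c k i * X k \<omega>) - (\<Sum>j=1..N. \<Sum>k. c k j * X k \<omega>) / real N) \<in> borel_measurable A"
    by (intro borel_measurable_diff borel_measurable_divide borel_measurable_sum borel_measurable_const m)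
  then show "(\<lambda>\<omega>. H (\<lambda>k. X k \<omega>) i) \<in> borel_measurable A"
    using i by (simp add: H_def center_def)
qed (rule H_R0)

lemma Q_M: "t \<ge> 0 \<Longrightarrow> Q t \<in> M \<rightarrow>\<^sub>M borel_R0 N"
  unfolding Q_def[abs_def] by (rule H_measurable) (rule B_M)

lemma Q_G: "0 \<le> t \<Longrightarrow> t \<le> s \<Longrightarrow> Q t \<in> G s \<rightarrow>\<^sub>M borel_R0 N"
  unfolding Q_def[abs_def] by (rule H_measurable) (rule B_G)

lemma H_eq:
  assumes "\<And>i. i \<in> {1..N} \<Longrightarrow> summable (\<lambda>k. c k i * d k)" "i \<in> {1..N}"
  shows "H d i = (\<Sum>k. c k i * d k)"
  unfolding H_def
proof (rule center_id[OF _ assms(2)])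
  have "(\<Sum>j=1..N. \<Sum>k. c k j * d k) = (\<Sum>k. \<Sum>j=1..N. c k j * d k)"
    by (rule suminf_sum[symmetric]) (rule assms(1))
  also have "\<dots> = (\<Sum>k. 0)" by (simp only: sum_distrib_right[symmetric] c_zero mult_zero_left)
  finally show "(\<Sum>j=1..N. \<Sum>k. c k j * d k) = 0" by simp
qed

lemma AE_Q:
  "AE \<omega> in M. (\<forall>t\<ge>0. \<forall>i\<in>{1..N}. summable (\<lambda>k. c k i * B k t \<omega>)) \<and> (\<forall>k. B k 0 \<omega> = 0) \<and>
     driving_path N (\<lambda>t. Q t \<omega>) \<and> (\<forall>t\<ge>0. \<forall>i\<in>{1..N}. Q t \<omega> i = (\<Sum>k. c k i * B k t \<omega>))"
proof -
  have "AE \<omega> in M. \<forall>i\<in>{1..N}. (\<forall>t\<ge>0. summable (\<lambda>k. c k i * B k t \<omega>)) \<and> continuous_on {0..} (\<lambda>t. \<Sum>k. c k i * B k t \<omega>)"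
    by (rule AE_finite_allI) (simp, rule AE_series_continuous, rule c_summable)
  then show ?thesis using AE_paths_continuous
  proof eventually_elim
    case (elim \<omega>)
    have eq: "Q t \<omega> i = (\<Sum>k. c k i * B k t \<omega>)" if "t \<ge> 0" "i \<in> {1..N}" for t i
      unfolding Q_def by (rule H_eq) (use elim(1) that in auto)
    have "continuous_on {0..} (\<lambda>t. Q t \<omega> i)" if i: "i \<in> {1..N}" for i
    proof -
      have "continuous_on {0..} (\<lambda>t. \<Sum>k. c k i * B k t \<omega>)" using elim(1) i by blast
      then show ?thesis by (rule continuous_on_cong[THEN iffD1, rotated 2]) (use eq[OF _ i] in auto)
    qed
    moreover have "Q 0 \<omega> i = 0" if "i \<in> {1..N}" for i
      using eq[OF order_refl that] elim(2) by simp
    moreover have "Q t \<omega> \<in> R0 N" for t unfolding Q_def by (rule H_R0)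
    ultimately have "driving_path N (\<lambda>t. Q t \<omega>)" by (auto simp: driving_path_def)
    then show ?case using elim eq by blast
  qed
qed

abbreviation "SQ \<equiv> Pi\<^sub>M (UNIV :: nat set) (\<lambda>_. borel :: real measure)"

text \<open>The increments of the different indices are independent with the same normal law at every time.\<close>

lemma inc_law:
  assumes s: "0 \<le> s" and h: "0 < h"
  shows "distr M SQ (\<lambda>\<omega> k. inc s (s + h) k \<omega>) = distr M SQ (\<lambda>\<omega> k. inc 0 h k \<omega>)"
proof -
  have "distr M SQ (\<lambda>\<omega>. \<lambda>k\<in>UNIV. inc r (r + h) k \<omega>) = Pi\<^sub>M UNIV (\<lambda>k. density lborel (normal_density 0 (sqrt h)))" if r: "0 \<le> r" for r
  proof -
    have "distr M SQ (\<lambda>\<omega>. \<lambda>k\<in>UNIV. inc r (r + h) k \<omega>) = Pi\<^sub>M UNIV (\<lambda>k. distr M borel (inc r (r + h) k))"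
    proof (rule iffD1[OF indep_vars_iff_distr_eq_PiM])
      show "indep_vars (\<lambda>_. borel) (inc r (r + h)) UNIV" by (rule inc_indep) (use r h in auto)
      show "random_variable borel (inc r (r + h) k)" for k by (rule inc_M) (use r h in auto)
    qed simp
    moreover have "distr M borel (inc r (r + h) k) = density lborel (normal_density 0 (sqrt h))" for k
    proof -
      have "distr M lborel (inc r (r + h) k) = density lborel (normal_density 0 (sqrt (r + h - r)))"
        using inc_distributed[of r "r + h" k] r h unfolding distributed_def by simp
      moreover have "distr M lborel (inc r (r + h) k) = distr M borel (inc r (r + h) k)"
        by (rule distr_cong) auto
      ultimately show ?thesis by simp
    qed
    ultimately show ?thesis by simp
  qed
  from this[OF s] this[OF order_refl] show ?thesis by (simp add: restrict_UNIV)
qed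

text \<open>The Markov property in the form that the scheme needs: a state known at time \<open>s\<close> and the noise
  over the next interval of length \<open>h\<close> may be integrated separately, and the latter has the law of
  \<open>Q h\<close>.\<close>

lemma increment_formula:
  assumes s: "0 \<le> s" and h: "0 < h" and Y: "Y \<in> G s \<rightarrow>\<^sub>M borel_R0 N"
    and f: "f \<in> borel_measurable (borel_R0 N \<Otimes>\<^sub>M borel_R0 N)"
  shows "(\<integral>\<^sup>+ \<omega>. f (Y \<omega>, \<lambda>i\<in>{1..N}. Q (s + h) \<omega> i - Q s \<omega> i) \<partial>M) = (\<integral>\<^sup>+ \<omega>. \<integral>\<^sup>+ \<omega>'. f (Y \<omega>, Q h \<omega>') \<partial>M \<partial>M)"
proof -
  define D where "D r \<omega> k = inc r (r + h) k \<omega>" for r \<omega> k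
  have D_M: "D r \<in> M \<rightarrow>\<^sub>M SQ" if "0 \<le> r" for r
    unfolding D_def[abs_def] by (rule measurable_PiM_single') (use inc_M that h in \<open>auto simp: space_PiM\<close>)
  have D_FU: "D s \<in> FU s (s + h) \<rightarrow>\<^sub>M SQ"
    unfolding D_def[abs_def] by (rule measurable_PiM_single') (use inc_FU in \<open>auto simp: space_PiM\<close>)
  have Hm: "H \<in> SQ \<rightarrow>\<^sub>M borel_R0 N"
    using H_measurable[of "\<lambda>k d. d k" SQ] by (simp add: measurable_component_singleton)
  have Y_M: "Y \<in> M \<rightarrow>\<^sub>M borel_R0 N"
    using Y G_events[OF s] space_G by (auto simp: measurable_def)
  have law: "distr M SQ (D s) = distr M SQ (D 0)"
    using inc_law[OF s h] by (simp add: D_def[abs_def])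
  \<comment> \<open>The increment of the series is almost surely the series of the increments.\<close>
  have AE1: "AE \<omega> in M. (\<lambda>i\<in>{1..N}. Q (s + h) \<omega> i - Q s \<omega> i) = H (D s \<omega>)"
    using AE_Q
  proof eventually_elim
    case (elim \<omega>)
    have eq: "(\<Sum>k. c k i * D s \<omega> k) = Q (s + h) \<omega> i - Q s \<omega> i" and sm: "summable (\<lambda>k. c k i * D s \<omega> k)" if i: "i \<in> {1..N}" for i
    proof -
      have a: "summable (\<lambda>k. c k i * B k (s + h) \<omega>)" "summable (\<lambda>k. c k i * B k s \<omega>)" using elim i s h by auto
      have "Q (s + h) \<omega> i = (\<Sum>k. c k i * B k (s + h) \<omega>)" "Q s \<omega> i = (\<Sum>k. c k i * B k s \<omega>)" using elim i s h by auto
      then show "(\<Sum>k. c k i * D s \<omega> k) = Q (s + h) \<omega> i - Q s \<omega> i"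
        using suminf_diff[OF a] by (simp add: D_def inc_def right_diff_distrib)
      show "summable (\<lambda>k. c k i * D s \<omega> k)"
        using summable_diff[OF a] by (simp add: D_def inc_def right_diff_distrib)
    qed
    show ?case
    proof
      fix i show "(\<lambda>i\<in>{1..N}. Q (s + h) \<omega> i - Q s \<omega> i) i = H (D s \<omega>) i"
      proof (cases "i \<in> {1..N}")
        case True
        then show ?thesis using H_eq[OF sm True] eq[OF True] by simp
      qed (auto simp: H_def center_def)
    qed
  qed
  have AE2: "AE \<omega> in M. Q h \<omega> = H (D 0 \<omega>)"
    using AE_Q
  proof eventually_elim
    case (elim \<omega>)
    then have "(\<lambda>k. B k h \<omega>) = D 0 \<omega>" by (simp add: D_def inc_def fun_eq_iff)
    then show ?case by (simp only: Q_def)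
  qed
  have "indep_var (borel_R0 N) Y SQ (D s)"
    by (rule indep_var_G_FU[OF s _ Y D_FU]) (use h in simp)
  then have joint: "distr M (borel_R0 N) Y \<Otimes>\<^sub>M distr M SQ (D s) = distr M (borel_R0 N \<Otimes>\<^sub>M SQ) (\<lambda>\<omega>. (Y \<omega>, D s \<omega>))"
    unfolding indep_var_distribution_eq by blast
  define g where "g p = f (fst p, H (snd p))" for p
  have g: "g \<in> borel_measurable (borel_R0 N \<Otimes>\<^sub>M SQ)"
    unfolding g_def[abs_def] by (rule measurable_compose[OF _ f]) (use Hm in measurable)
  interpret dY: prob_space "distr M (borel_R0 N) Y" by (rule prob_space_distr[OF Y_M])
  interpret dD: prob_space "distr M SQ (D s)" by (rule prob_space_distr[OF D_M[OF s]])
  interpret P: pair_sigma_finite "distr M (borel_R0 N) Y" "distr M SQ (D s)" ..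
  have "(\<integral>\<^sup>+ \<omega>. f (Y \<omega>, \<lambda>i\<in>{1..N}. Q (s + h) \<omega> i - Q s \<omega> i) \<partial>M) = (\<integral>\<^sup>+ \<omega>. g (Y \<omega>, D s \<omega>) \<partial>M)"
    by (rule nn_integral_cong_AE, use AE1 in eventually_elim) (simp only: g_def fst_conv snd_conv)
  also have "\<dots> = (\<integral>\<^sup>+ p. g p \<partial>distr M (borel_R0 N \<Otimes>\<^sub>M SQ) (\<lambda>\<omega>. (Y \<omega>, D s \<omega>)))"
    by (rule nn_integral_distr[symmetric]) (use Y_M D_M[OF s] g in auto)
  also have "\<dots> = (\<integral>\<^sup>+ y. \<integral>\<^sup>+ d. g (y, d) \<partial>distr M SQ (D s) \<partial>distr M (borel_R0 N) Y)"
    unfolding joint[symmetric] by (rule dD.nn_integral_fst[symmetric]) (use g in simp)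
  also have "\<dots> = (\<integral>\<^sup>+ y. \<integral>\<^sup>+ \<omega>'. g (y, D 0 \<omega>') \<partial>M \<partial>distr M (borel_R0 N) Y)"
  proof (rule nn_integral_cong)
    fix y assume "y \<in> space (distr M (borel_R0 N) Y)"
    then have y: "y \<in> space (borel_R0 N)" by simp
    have gy: "(\<lambda>d. g (y, d)) \<in> borel_measurable SQ" by (rule measurable_compose[OF measurable_Pair1'[OF y] g])
    show "(\<integral>\<^sup>+ d. g (y, d) \<partial>distr M SQ (D s)) = (\<integral>\<^sup>+ \<omega>'. g (y, D 0 \<omega>') \<partial>M)"
      unfolding law by (rule nn_integral_distr[OF D_M]) (use gy in auto)
  qed
  also have "\<dots> = (\<integral>\<^sup>+ \<omega>. \<integral>\<^sup>+ \<omega>'. g (Y \<omega>, D 0 \<omega>') \<partial>M \<partial>M)"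
  proof (rule nn_integral_distr[OF Y_M])
    have "(\<lambda>p. g (fst p, D 0 (snd p))) \<in> borel_measurable (borel_R0 N \<Otimes>\<^sub>M M)"
      by (rule measurable_compose[OF _ g]) (use D_M[of 0] in measurable)
    then show "(\<lambda>y. \<integral>\<^sup>+ \<omega>'. g (y, D 0 \<omega>') \<partial>M) \<in> borel_measurable (distr M (borel_R0 N) Y)"
      using borel_measurable_nn_integral[of "\<lambda>y \<omega>'. g (y, D 0 \<omega>')" "borel_R0 N"] by (simp add: case_prod_beta')
  qed
  also have "\<dots> = (\<integral>\<^sup>+ \<omega>. \<integral>\<^sup>+ \<omega>'. f (Y \<omega>, Q h \<omega>') \<partial>M \<partial>M)"
    by (rule nn_integral_cong, rule nn_integral_cong_AE, use AE2 in eventually_elim) (simp only: g_def fst_conv snd_conv)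
  finally show ?thesis .
qed

definition "noise_var = (\<Sum>i=1..N. \<Sum>k. (c k i)\<^sup>2)"

text \<open>Fatou's lemma bounds the second moment of the difference to a partial sum, which also forces the
  mean of the limit to vanish.\<close>

lemma Q_moments:
  assumes h: "0 \<le> h" and i: "i \<in> {1..N}"
  shows "integrable M (\<lambda>\<omega>. Q h \<omega> i)" "expectation (\<lambda>\<omega>. Q h \<omega> i) = 0"
    "integrable M (\<lambda>\<omega>. (Q h \<omega> i)\<^sup>2)" "expectation (\<lambda>\<omega>. (Q h \<omega> i)\<^sup>2) \<le> h * (\<Sum>k. (c k i)\<^sup>2)"
proof -
  define a where "a k = c k i" for k
  define X where "X \<omega> = Q h \<omega> i" for \<omega>
  define P where "P n = comb {..<n} a 0 h" for n
  define tail where "tail n = (\<Sum>k. (a (k + n))\<^sup>2)" for n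
  have as: "summable (\<lambda>k. (a k)\<^sup>2)" using c_summable[OF i] by (simp add: a_def)
  have [measurable]: "X \<in> borel_measurable M" unfolding X_def[abs_def] by (rule R0_coord_measurable[OF Q_M[OF h] i])
  have [measurable]: "P n \<in> borel_measurable M" for n unfolding P_def using comb_M h by simp
  have lim: "AE \<omega> in M. (\<lambda>n. P n \<omega>) \<longlonglongrightarrow> X \<omega>"
    using AE_Q
  proof eventually_elim
    case (elim \<omega>)
    have "(\<lambda>k. c k i * B k h \<omega>) sums X \<omega>"
      using elim h i by (simp add: X_def summable_sums)
    then show ?case using elim by (simp add: sums_def P_def comb_def inc_def a_def)
  qed
  have diff: "(\<integral>\<^sup>+ \<omega>. ennreal ((P m \<omega> - P n \<omega>)\<^sup>2) \<partial>M) \<le> ennreal (h * tail n)" if mn: "n \<le> m" for m n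
  proof -
    have "P m \<omega> - P n \<omega> = comb {n..<m} a 0 h \<omega>" for \<omega>
      using sum.atLeastLessThan_concat[of 0 n m "\<lambda>k. a k * inc 0 h k \<omega>"] mn
      by (simp add: P_def comb_def atLeast0LessThan)
    then have "(\<integral>\<^sup>+ \<omega>. ennreal ((P m \<omega> - P n \<omega>)\<^sup>2) \<partial>M) = ennreal (h * (\<Sum>k\<in>{n..<m}. (a k)\<^sup>2))"
      using comb_moments(3,4)[of "{n..<m}" 0 h a] h
      by (subst nn_integral_eq_integral) auto
    also have "(\<Sum>k\<in>{n..<m}. (a k)\<^sup>2) = (\<Sum>k<m - n. (a (k + n))\<^sup>2)"
      using sum.shift_bounds_nat_ivl[of "\<lambda>k. (a k)\<^sup>2" 0 n "m - n"] mn by (simp add: atLeast0LessThan)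
    also have "ennreal (h * \<dots>) \<le> ennreal (h * tail n)"
      unfolding tail_def
      by (intro ennreal_leI mult_left_mono sum_le_suminf summable_ignore_initial_segment[OF as] h) auto
    finally show ?thesis .
  qed
  have fatou: "(\<integral>\<^sup>+ \<omega>. ennreal ((X \<omega> - P n \<omega>)\<^sup>2) \<partial>M) \<le> ennreal (h * tail n)" for n
  proof -
    have "(\<integral>\<^sup>+ \<omega>. ennreal ((X \<omega> - P n \<omega>)\<^sup>2) \<partial>M) = (\<integral>\<^sup>+ \<omega>. liminf (\<lambda>m. ennreal ((P m \<omega> - P n \<omega>)\<^sup>2)) \<partial>M)"
    proof (rule nn_integral_cong_AE, use lim in eventually_elim)
      case (elim \<omega>)
      then have "(\<lambda>m. ennreal ((P m \<omega> - P n \<omega>)\<^sup>2)) \<longlonglongrightarrow> ennreal ((X \<omega> - P n \<omega>)\<^sup>2)"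
        by (intro tendsto_ennrealI tendsto_intros)
      then show ?case by (rule lim_imp_Liminf[symmetric, rotated]) simp
    qed
    also have "\<dots> \<le> liminf (\<lambda>m. \<integral>\<^sup>+ \<omega>. ennreal ((P m \<omega> - P n \<omega>)\<^sup>2) \<partial>M)"
      by (rule nn_integral_liminf) measurable
    also have "\<dots> \<le> ennreal (h * tail n)"
      by (rule Liminf_le) (use diff in \<open>auto intro!: eventually_sequentiallyI[of n]\<close>)
    finally show ?thesis .
  qed
  have sqi: "integrable M (\<lambda>\<omega>. (X \<omega> - P n \<omega>)\<^sup>2)" for n
    by (rule integrableI_nonneg) (use fatou[of n] in \<open>auto intro: le_less_trans\<close>)
  have tail0: "tail n \<ge> 0" for n unfolding tail_def by (intro suminf_nonneg summable_ignore_initial_segment[OF as]) auto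
  have sqe: "expectation (\<lambda>\<omega>. (X \<omega> - P n \<omega>)\<^sup>2) \<le> h * tail n" for n
    using fatou[of n] nn_integral_eq_integral[OF sqi[of n]] h tail0[of n] by simp
  have P0: "P 0 \<omega> = 0" for \<omega> by (simp add: P_def comb_def)
  show "integrable M (\<lambda>\<omega>. (Q h \<omega> i)\<^sup>2)" "expectation (\<lambda>\<omega>. (Q h \<omega> i)\<^sup>2) \<le> h * (\<Sum>k. (c k i)\<^sup>2)"
    using sqi[of 0] sqe[of 0] by (simp_all add: P0 X_def tail_def a_def)
  have Xi: "integrable M X"
    by (rule square_integrable_imp_integrable) (use sqi[of 0] P0 in auto)
  then show "integrable M (\<lambda>\<omega>. Q h \<omega> i)" by (simp add: X_def[abs_def])
  \<comment> \<open>The partial sums are centered, so the squared mean of \<open>X\<close> is at most the second moment of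
    the remainder.\<close>
  have "(expectation X)\<^sup>2 \<le> h * tail n" for n
  proof -
    have Pi: "integrable M (P n)" "expectation (P n) = 0" unfolding P_def using comb_moments[of "{..<n}" 0 h a] h by auto
    have Zi: "integrable M (\<lambda>\<omega>. X \<omega> - P n \<omega>)" using Xi Pi by simp
    have "0 \<le> variance (\<lambda>\<omega>. X \<omega> - P n \<omega>)" by (rule variance_positive)
    also have "\<dots> = expectation (\<lambda>\<omega>. (X \<omega> - P n \<omega>)\<^sup>2) - (expectation (\<lambda>\<omega>. X \<omega> - P n \<omega>))\<^sup>2"
      by (rule variance_eq[OF Zi sqi])
    also have "expectation (\<lambda>\<omega>. X \<omega> - P n \<omega>) = expectation X" using Xi Pi by simp
    finally show ?thesis using sqe[of n] by linarith
  qed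
  moreover have "(\<lambda>n. h * tail n) \<longlonglongrightarrow> 0"
    unfolding tail_def by (intro tendsto_mult_right_zero suminf_exist_split2[OF as])
  ultimately have "(expectation X)\<^sup>2 \<le> 0" by (intro LIMSEQ_le_const) auto
  then show "expectation (\<lambda>\<omega>. Q h \<omega> i) = 0" by (simp add: X_def[abs_def])
qed

text \<open>The mixed term vanishes since the noise is centered.\<close>

lemma noise_energy:
  assumes h: "0 \<le> h"
  shows "(\<integral>\<^sup>+ \<omega>. ennreal (sq_sum N (\<lambda>i. y i + Q h \<omega> i)) \<partial>M) \<le> ennreal (sq_sum N y + noise_var * h)"
proof -
  have int: "integrable M (\<lambda>\<omega>. (y i)\<^sup>2 + 2 * y i * Q h \<omega> i + (Q h \<omega> i)\<^sup>2)" if "i \<in> {1..N}" for i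
    using Q_moments[OF h that] by simp
  have eq: "sq_sum N (\<lambda>i. y i + Q h \<omega> i) = (\<Sum>i=1..N. (y i)\<^sup>2 + 2 * y i * Q h \<omega> i + (Q h \<omega> i)\<^sup>2)" for \<omega>
    unfolding sq_sum_def by (intro sum.cong refl) (simp add: power2_eq_square algebra_simps)
  have "(\<integral>\<^sup>+ \<omega>. ennreal (sq_sum N (\<lambda>i. y i + Q h \<omega> i)) \<partial>M) = ennreal (expectation (\<lambda>\<omega>. sq_sum N (\<lambda>i. y i + Q h \<omega> i)))"
  proof (rule nn_integral_eq_integral)
    show "integrable M (\<lambda>\<omega>. sq_sum N (\<lambda>i. y i + Q h \<omega> i))" unfolding eq by (rule Bochner_Integration.integrable_sum) (rule int)
  qed simp
  also have "\<dots> \<le> ennreal (sq_sum N y + noise_var * h)"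
  proof (rule ennreal_leI)
    have "expectation (\<lambda>\<omega>. sq_sum N (\<lambda>i. y i + Q h \<omega> i)) = (\<Sum>i=1..N. expectation (\<lambda>\<omega>. (y i)\<^sup>2 + 2 * y i * Q h \<omega> i + (Q h \<omega> i)\<^sup>2))"
      unfolding eq using int by simp
    also have "\<dots> = (\<Sum>i=1..N. (y i)\<^sup>2 + expectation (\<lambda>\<omega>. (Q h \<omega> i)\<^sup>2))"
      by (intro sum.cong refl) (simp add: Q_moments[OF h] prob_space)
    also have "\<dots> \<le> (\<Sum>i=1..N. (y i)\<^sup>2 + h * (\<Sum>k. (c k i)\<^sup>2))"
      by (intro sum_mono add_left_mono Q_moments[OF h])
    also have "\<dots> = sq_sum N y + noise_var * h"
      by (simp add: sum.distrib sq_sum_def noise_var_def sum_distrib_left mult.commute)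
    finally show "expectation (\<lambda>\<omega>. sq_sum N (\<lambda>i. y i + Q h \<omega> i)) \<le> sq_sum N y + noise_var * h" .
  qed
  finally show ?thesis .
qed

lemma noise_var_nonneg: "noise_var \<ge> 0"
  unfolding noise_var_def by (intro sum_nonneg suminf_nonneg c_summable) auto

end

section \<open>Cell means of Sobolev functions\<close>

lemma deriv_Re_of_real:
  assumes S: "open S" "\<And>x::real. of_real x \<in> S" and F: "F holomorphic_on S"
  shows "((\<lambda>x. Re (F (of_real x))) has_real_derivative Re (deriv F (of_real x))) (at x)"
proof -
  have "(F has_field_derivative deriv F (of_real x)) (at (of_real x))"
    by (rule holomorphic_derivI[OF F S])
  then have "((\<lambda>x. F (of_real x)) has_vector_derivative deriv F (of_real x)) (at x)"
    by (rule has_vector_derivative_real_field)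
  from bounded_linear.has_vector_derivative[OF bounded_linear_Re this] show ?thesis
    by (simp add: has_real_derivative_iff_has_vector_derivative)
qed

text \<open>Smoothness of test functions is obtained from holomorphy: all complex derivatives exist at once,
  and their restrictions to the real line are the real derivatives.\<close>

lemma higher_deriv_Re_of_real:
  assumes S: "open S" "\<And>x::real. of_real x \<in> S" and F: "F holomorphic_on S"
  shows "(deriv ^^ n) (\<lambda>x. Re (F (of_real x))) field_differentiable (at x)"
  using F
proof (induction n arbitrary: F)
  case 0
  then show ?case using deriv_Re_of_real[OF S 0] by (auto simp: field_differentiable_def)
next
  case (Suc n)
  have "deriv (\<lambda>x. Re (F (of_real x))) = (\<lambda>x. Re (deriv F (of_real x)))"
    by (intro ext DERIV_imp_deriv deriv_Re_of_real[OF S Suc.prems])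
  then show ?case
    using Suc.IH[OF holomorphic_deriv[OF Suc.prems S(1)]] by (simp only: funpow_Suc_right comp_def)
qed

lemma antiderivative_exists:
  fixes f :: "real \<Rightarrow> real"
  assumes f: "continuous_on UNIV f"
  obtains F where "\<And>x. (F has_real_derivative f x) (at x)" "F 0 = 0"
proof -
  define F where "F x = (if 0 \<le> x then integral {0..x} f else - integral {x..0} f)" for x
  have int: "f integrable_on {a..b}" for a b
    by (rule integrable_continuous_real) (rule continuous_on_subset[OF f], simp)
  have "(F has_real_derivative f x) (at x)" for x
  proof -
    define a where "a = min x 0 - 1"
    have Fa: "integral {a..y} f - integral {a..0} f = F y" if "y \<in> {a<..<x + 1}" for y
    proof (cases "0 \<le> y")
      case True
      have "a \<le> 0" by (simp add: a_def)
      from Henstock_Kurzweil_Integration.integral_combine[OF this True int] show ?thesis using True by (simp add: F_def)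
    next
      case False
      have "a \<le> y" "y \<le> 0" using that False by auto
      from Henstock_Kurzweil_Integration.integral_combine[OF this int] show ?thesis using False by (simp add: F_def)
    qed
    have x: "x \<in> {a..x + 1}" "x \<in> interior {a..x + 1}" by (auto simp: a_def)
    have "((\<lambda>y. integral {a..y} f) has_real_derivative f x) (at x within {a..x + 1})"
      by (rule integral_has_real_derivative[OF _ x(1)]) (rule continuous_on_subset[OF f], simp)
    then have "((\<lambda>y. integral {a..y} f) has_real_derivative f x) (at x)"
      by (simp only: at_within_interior[OF x(2)])
    then have "((\<lambda>y. integral {a..y} f - integral {a..0} f) has_real_derivative f x - 0) (at x)"
      by (rule DERIV_diff[OF _ DERIV_const])
    then have "((\<lambda>y. integral {a..y} f - integral {a..0} f) has_real_derivative f x) (at x)" by simp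
    then show ?thesis
    proof (rule has_field_derivative_transform_within_open)
      show "open {a<..<x + 1}" "x \<in> {a<..<x + 1}" by (auto simp: a_def)
    qed (rule Fa)
  qed
  moreover have "F 0 = 0" by (simp add: F_def)
  ultimately show thesis by (rule that)
qed

text \<open>Subtracting the mean makes the antiderivative periodic. It vanishes at 0, so the mean value theorem
  bounds it on a period.\<close>

lemma periodic_antiderivative:
  fixes f :: "real \<Rightarrow> real"
  assumes f: "continuous_on UNIV f" and per: "\<And>x. f (x + 1) = f x"
    and C: "\<And>x. x \<in> {0..1} \<Longrightarrow> \<bar>f x - integral {0..1} f\<bar> \<le> C"
  obtains F where "\<And>x. (F has_real_derivative (f x - integral {0..1} f)) (at x)" "\<And>x. F (x + 1) = F x"
    "\<And>x. x \<in> {0..1} \<Longrightarrow> \<bar>F x\<bar> \<le> C"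
proof -
  define m where "m = integral {0..1} f"
  obtain F where F: "\<And>x. (F has_real_derivative (f x - m)) (at x)" "F 0 = 0"
    by (rule antiderivative_exists[of "\<lambda>x. f x - m"]) (use f in \<open>auto intro!: continuous_intros\<close>)
  have "((\<lambda>x. f x - m) has_integral F 1 - F 0) {0..1}"
    by (rule fundamental_theorem_of_calculus)
       (use F(1) in \<open>auto simp flip: has_real_derivative_iff_has_vector_derivative intro: has_field_derivative_at_within\<close>)
  then have "integral {0..1} (\<lambda>x. f x - m) = F 1 - F 0" by (rule integral_unique)
  moreover have "integral {0..1} (\<lambda>x. f x - m) = integral {0..1} f - integral {0..1} (\<lambda>x::real. m)"
    by (subst Henstock_Kurzweil_Integration.integral_diff)
       (simp_all only: integrable_continuous_real[OF continuous_on_subset[OF f subset_UNIV]] integrable_const_ivl)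
  moreover have "integral {0..1} (\<lambda>x::real. m) = m" by simp
  ultimately have F1: "F 1 = 0" using F(2) by (simp only: m_def)
  have sh: "((\<lambda>x. F (x + 1) - F x) has_real_derivative 0) (at x)" for x
  proof -
    have "((\<lambda>x. F (x + 1)) has_real_derivative (f (x + 1) - m)) (at x)" using F(1)[of "x + 1"] by (simp add: DERIV_shift)
    from DERIV_diff[OF this F(1)[of x]] show ?thesis by (simp add: per)
  qed
  have per': "F (x + 1) = F x" for x
  proof -
    have "F (x + 1) - F x = F (0 + 1) - F 0" by (rule DERIV_isconst_all) (use sh in blast)
    then show ?thesis using F1 F(2) by simp
  qed
  have bd: "\<bar>F x\<bar> \<le> C" if x: "x \<in> {0..1}" for x
  proof (cases "x = 0")
    case True
    have "0 \<le> C" using C[of 0] by simp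
    then show ?thesis using True F(2) by simp
  next
    case False
    then have "0 < x" using x by simp
    from MVT2[OF this, of F "\<lambda>x. f x - m"] F(1) obtain z where z: "0 < z" "z < x" "F x - F 0 = (x - 0) * (f z - m)" by blast
    have "\<bar>F x\<bar> = x * \<bar>f z - m\<bar>" using z F(2) \<open>0 < x\<close> by (simp add: abs_mult)
    also have "\<dots> \<le> 1 * \<bar>f z - m\<bar>" using x by (intro mult_right_mono) auto
    also have "\<dots> \<le> C" using C[of z] z x by (simp add: m_def)
    finally show ?thesis .
  qed
  show thesis by (rule that[OF F(1)[unfolded m_def] per' bd])
qed

text \<open>The logistic function applied to a multiple of a product of two sines that is positive inside
  \<open>(l, r)\<close> and negative outside its closure; the product has period 1 because both sines change
  sign. These are analytic approximations of the indicator function of the cell, which spares the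
  construction of smooth functions with compact support.\<close>

definition bump :: "real \<Rightarrow> real \<Rightarrow> nat \<Rightarrow> real \<Rightarrow> real" where
  "bump l r K x = 1 / (1 + exp (- (real K * (sin (pi * (x - l)) * sin (pi * (r - x))))))"

lemma bump_bounds: "0 \<le> bump l r K x" "bump l r K x \<le> 1"
  by (auto simp: bump_def add_pos_pos)

lemma bump_periodic: "bump l r K (x + 1) = bump l r K x"
proof -
  have "sin (pi * (x + 1 - l)) = - sin (pi * (x - l))" "sin (pi * (r - (x + 1))) = - sin (pi * (r - x))"
    using sin_periodic_pi[of "pi * (x - l)"] sin_periodic_pi[of "pi * (r - (x + 1))"] by (simp_all add: algebra_simps)
  then show ?thesis by (simp add: bump_def)
qed

lemma bump_continuous: "continuous_on S (bump l r K)"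
proof -
  have "1 + exp y \<noteq> 0" for y :: real using exp_gt_zero[of y] by linarith
  then show ?thesis unfolding bump_def[abs_def] by (intro continuous_intros) auto
qed

lemma bump_smooth: "(deriv ^^ n) (\<lambda>x. bump l r K x - m) field_differentiable (at x)"
proof -
  define h where "h z = 1 + exp (- (of_real (real K) * (sin (of_real pi * (z - of_real l)) * sin (of_real pi * (of_real r - z)))))" for z :: complex
  have hR: "h (of_real x) = of_real (1 + exp (- (real K * (sin (pi * (x - l)) * sin (pi * (r - x))))))" for x
  proof -
    have "sin (of_real pi * (of_real x - of_real l)) = (of_real (sin (pi * (x - l))) :: complex)"
      "sin (of_real pi * (of_real r - of_real x)) = (of_real (sin (pi * (r - x))) :: complex)"
      using sin_of_real[of "pi * (x - l)", where 'a = complex] sin_of_real[of "pi * (r - x)", where 'a = complex]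
      by (simp_all only: of_real_mult of_real_diff)
    then have "h (of_real x) = 1 + exp (of_real (- (real K * (sin (pi * (x - l)) * sin (pi * (r - x))))))"
      unfolding h_def by (simp only: of_real_mult of_real_minus)
    then show ?thesis by (simp only: exp_of_real of_real_add of_real_1)
  qed
  have pos: "1 + exp y \<noteq> 0" for y :: real using exp_gt_zero[of y] by linarith
  define S where "S = {z. h z \<noteq> 0}"
  have S: "open S" unfolding S_def h_def by (intro open_Collect_neq continuous_intros)
  have SR: "of_real x \<in> S" for x :: real unfolding S_def mem_Collect_eq hR of_real_eq_0_iff by (rule pos)
  have hol: "(\<lambda>z. 1 / h z - of_real m) holomorphic_on S"
  proof -
    have "h holomorphic_on S" unfolding h_def by (intro holomorphic_intros)
    then show ?thesis by (intro holomorphic_on_diff holomorphic_on_divide holomorphic_on_const) (auto simp: S_def)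
  qed
  have re: "Re (1 / of_real y - of_real m) = 1 / y - m" for y
  proof -
    have "1 / complex_of_real y - complex_of_real m = complex_of_real (1 / y - m)" by simp
    then show ?thesis by (simp only: Re_complex_of_real)
  qed
  have "bump l r K x - m = Re (1 / h (of_real x) - of_real m)" for x
    unfolding hR bump_def re by (rule refl)
  then have "(\<lambda>x. bump l r K x - m) = (\<lambda>x. Re (1 / h (of_real x) - of_real m))" by (rule ext)
  then show ?thesis using higher_deriv_Re_of_real[OF S SR hol] by (simp only:)
qed

text \<open>At the excluded points the product of sines may vanish, and the limit would be one half; these
  points form a null set.\<close>

lemma bump_limit:
  assumes "0 \<le> l" "l < r" "r \<le> 1" "0 < x" "x < 1" "x \<noteq> l" "x \<noteq> r"
  shows "(\<lambda>K. bump l r K x) \<longlonglongrightarrow> indicator {l<..r} x"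
proof -
  define \<theta> where "\<theta> = sin (pi * (x - l)) * sin (pi * (r - x))"
  have pos: "sin (pi * y) > 0" if "0 < y" "y < 1" for y
    by (rule sin_gt_zero) (use that in auto)
  have neg: "sin (pi * y) < 0" if "-1 < y" "y < 0" for y
    using pos[of "-y"] that by simp
  consider "l < x" "x < r" | "x < l" | "r < x" using assms by linarith
  then show ?thesis
  proof cases
    case 1
    then have "\<theta> > 0" unfolding \<theta>_def using assms by (intro mult_pos_pos pos) auto
    then have "(\<lambda>K. 1 / (1 + exp (- (real K * \<theta>)))) \<longlonglongrightarrow> 1" by real_asymp
    then show ?thesis using 1 by (simp add: bump_def \<theta>_def)
  next
    case 2
    then have "\<theta> < 0" unfolding \<theta>_def using assms by (intro mult_neg_pos pos neg) auto
    then have "(\<lambda>K. 1 / (1 + exp (- (real K * \<theta>)))) \<longlonglongrightarrow> 0" by real_asymp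
    then show ?thesis using 2 by (simp add: bump_def \<theta>_def)
  next
    case 3
    then have "\<theta> < 0" unfolding \<theta>_def using assms by (intro mult_pos_neg pos neg) auto
    then have "(\<lambda>K. 1 / (1 + exp (- (real K * \<theta>)))) \<longlonglongrightarrow> 0" by real_asymp
    then show ?thesis using 3 by (simp add: bump_def \<theta>_def)
  qed
qed

text \<open>Two periodic antiderivatives turn the approximate indicator function, up to its mean, into the
  second derivative of a test function that is bounded independently of \<open>K\<close>.\<close>

lemma bump_primitive:
  obtains \<phi> where "torus_test_fun \<phi>" "\<And>x. x \<in> {0..1} \<Longrightarrow> \<bar>\<phi> x\<bar> \<le> 2"
    "(deriv ^^ 2) \<phi> = (\<lambda>x. bump l r K x - integral {0..1} (bump l r K))"
proof -
  let ?f = "bump l r K"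
  define m where "m = integral {0..1} ?f"
  have int: "?f integrable_on {0..1}" by (rule integrable_continuous_real) (rule bump_continuous)
  have m: "0 \<le> m" "m \<le> 1"
  proof -
    show "0 \<le> m" unfolding m_def by (rule Henstock_Kurzweil_Integration.integral_nonneg[OF int]) (rule bump_bounds)
    have "m \<le> integral {0..1} (\<lambda>x::real. 1::real)" unfolding m_def by (rule integral_le[OF int]) (auto simp: bump_bounds)
    then show "m \<le> 1" by simp
  qed
  obtain F where F: "\<And>x. (F has_real_derivative (?f x - m)) (at x)" "\<And>x. F (x + 1) = F x" "\<And>x. x \<in> {0..1} \<Longrightarrow> \<bar>F x\<bar> \<le> 1"
  proof (rule periodic_antiderivative[of ?f 1])
    fix x show "\<bar>?f x - integral {0..1} ?f\<bar> \<le> 1"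
      using m bump_bounds[of l r K x] unfolding m_def[symmetric] by linarith
  qed (auto simp: bump_continuous bump_periodic m_def)
  have Fc: "continuous_on UNIV F" using F(1) by (intro continuous_at_imp_continuous_on) (auto intro: DERIV_isCont)
  define m2 where "m2 = integral {0..1} F"
  have m2: "\<bar>m2\<bar> \<le> 1"
    using integral_bound[of 0 1 F 1] F(3) continuous_on_subset[OF Fc] by (simp add: m2_def)
  obtain \<phi> where p: "\<And>x. (\<phi> has_real_derivative (F x - m2)) (at x)" "\<And>x. \<phi> (x + 1) = \<phi> x" "\<And>x. x \<in> {0..1} \<Longrightarrow> \<bar>\<phi> x\<bar> \<le> 2"
  proof (rule periodic_antiderivative[of F 2])
    fix x :: real assume "x \<in> {0..1}"
    then show "\<bar>F x - integral {0..1} F\<bar> \<le> 2" using m2 F(3)[of x] unfolding m2_def[symmetric] by linarith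
  qed (auto simp: Fc F(2) m2_def)
  have d1: "deriv \<phi> = (\<lambda>x. F x - m2)" by (intro ext DERIV_imp_deriv p)
  have Fm: "((\<lambda>x. F x - m2) has_real_derivative (?f x - m)) (at x)" for x
    using DERIV_diff[OF F(1)[of x] DERIV_const[of m2]] by simp
  have d2: "deriv (\<lambda>x. F x - m2) = (\<lambda>x. ?f x - m)" by (intro ext DERIV_imp_deriv Fm)
  have dd: "(deriv ^^ 2) \<phi> = (\<lambda>x. ?f x - m)" by (simp add: numeral_2_eq_2 d1 d2)
  have smooth: "(deriv ^^ n) \<phi> field_differentiable (at x)" for n x
  proof -
    consider "n = 0" | "n = 1" | "n \<ge> 2" by linarith
    then show ?thesis
    proof cases
      case 1 then show ?thesis using p(1) by (auto simp: field_differentiable_def)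
    next
      case 2 then show ?thesis using Fm by (auto simp: field_differentiable_def d1)
    next
      case 3
      then have e: "n - 2 + 2 = n" by simp
      have "(deriv ^^ n) \<phi> = (deriv ^^ (n - 2 + 2)) \<phi>" by (simp only: e)
      also have "\<dots> = (deriv ^^ (n - 2)) ((deriv ^^ 2) \<phi>)" unfolding funpow_add by (rule comp_apply)
      finally show ?thesis using bump_smooth[of "n - 2" l r K m x] by (simp only: dd)
    qed
  qed
  have "torus_test_fun \<phi>" unfolding torus_test_fun_def using p(2) smooth by blast
  from that[OF this p(3)] show thesis using dd unfolding m_def by blast
qed

lemma prob_space_torus: "prob_space torus"
proof (rule prob_spaceI)
  have "emeasure torus {0<..1::real} = emeasure lebesgue {0<..1::real}"
    unfolding torus_def by (subst emeasure_restrict_space) auto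
  then show "emeasure torus (space torus) = 1" by (simp add: torus_def space_restrict_space)
qed

lemma space_torus: "space torus = {0<..1}"
  by (simp add: torus_def space_restrict_space)

lemma L2_torus_integrable: "v \<in> L2_torus \<Longrightarrow> integrable torus v"
proof -
  interpret prob_space torus by (rule prob_space_torus)
  assume "v \<in> L2_torus"
  then show ?thesis unfolding L2_torus_def by (elim CollectE conjE) (rule square_integrable_imp_integrable)
qed

lemma L2_torus_abs_integral: "v \<in> L2_torus \<Longrightarrow> (LINT x|torus. \<bar>v x\<bar>) \<le> L2_norm_torus v"
proof -
  interpret prob_space torus by (rule prob_space_torus)
  assume v: "v \<in> L2_torus"
  have i: "integrable torus (\<lambda>x. \<bar>v x\<bar>)" "integrable torus (\<lambda>x. \<bar>v x\<bar>\<^sup>2)"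
    using L2_torus_integrable[OF v] v by (auto simp: L2_torus_def)
  have "(LINT x|torus. \<bar>v x\<bar>)\<^sup>2 \<le> (LINT x|torus. (v x)\<^sup>2)"
    using variance_positive[of "\<lambda>x. \<bar>v x\<bar>"] variance_eq[OF i] by simp
  then show ?thesis unfolding L2_norm_torus_def by (rule real_le_rsqrt)
qed

lemma torus_cell_integral:
  fixes g :: "real \<Rightarrow> real"
  assumes "0 \<le> l" "l \<le> r" "r \<le> 1"
  shows "(LINT x:{l<..r}|lebesgue. g x) = (LINT x|torus. g x * indicator {l<..r} x)"
proof -
  have "(LINT x|torus. g x * indicator {l<..r} x) = (LINT x|lebesgue. indicator {0<..1} x *\<^sub>R (g x * indicator {l<..r} x))"
    unfolding torus_def by (subst Bochner_Integration.integral_restrict_space) auto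
  also have "\<dots> = (LINT x|lebesgue. indicator {l<..r} x *\<^sub>R g x)"
    by (rule Bochner_Integration.integral_cong) (use assms in \<open>auto simp: indicator_def\<close>)
  finally show ?thesis by (simp add: set_lebesgue_integral_def)
qed

text \<open>Since \<open>g\<close> has mean zero, its integral over the cell is the limit of the integrals of \<open>g\<close> against the
  second derivatives of bounded test functions. The definition of the weak derivative
  moves both derivatives to \<open>g\<close>.\<close>

lemma cell_integral_bound:
  assumes g: "g \<in> H0_torus 2" and lr: "0 \<le> l" "l < r" "r \<le> 1"
  shows "\<bar>LINT x:{l<..r}|lebesgue. g x\<bar> \<le> 2 * H0_norm_torus 2 g"
proof -
  interpret prob_space torus by (rule prob_space_torus)
  define w where "w = (SOME w. weak_deriv_torus 2 g w)"
  have "\<exists>w. weak_deriv_torus 2 g w" using g by (auto simp: H0_torus_def)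
  then have w: "weak_deriv_torus 2 g w" unfolding w_def by (rule someI_ex)
  have wL2: "w \<in> L2_torus" using w by (simp add: weak_deriv_torus_def)
  have gL2: "g \<in> L2_torus" and g0: "(LINT x|torus. g x) = 0" using g by (auto simp: H0_torus_def)
  have gi: "integrable torus g" and wi: "integrable torus w" using L2_torus_integrable gL2 wL2 by auto
  have bm: "bump l r K \<in> borel_measurable torus" for K
  proof -
    have "bump l r K \<in> borel_measurable lebesgue"
      by (rule measurable_completion) (simp add: borel_measurable_continuous_onI[OF bump_continuous])
    then show ?thesis unfolding torus_def by (rule measurable_restrict_space1)
  qed
  have gbi: "integrable torus (\<lambda>x. g x * bump l r K x)" for K
  proof (rule Bochner_Integration.integrable_bound[OF gi])
    show "(\<lambda>x. g x * bump l r K x) \<in> borel_measurable torus" using gi bm by auto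
    show "AE x in torus. norm (g x * bump l r K x) \<le> norm (g x)"
      using bump_bounds by (intro AE_I2) (simp add: abs_mult mult_left_le)
  qed
  have bound: "\<bar>LINT x|torus. g x * bump l r K x\<bar> \<le> 2 * L2_norm_torus w" for K
  proof -
    define m where "m = integral {0..1} (bump l r K)"
    obtain \<phi> where p: "torus_test_fun \<phi>" "\<And>x. x \<in> {0..1} \<Longrightarrow> \<bar>\<phi> x\<bar> \<le> 2"
        "(deriv ^^ 2) \<phi> = (\<lambda>x. bump l r K x - integral {0..1} (bump l r K))"
      by (rule bump_primitive[of l r K]) (rule that)
    have "(LINT x|torus. g x * bump l r K x) = (LINT x|torus. g x * (bump l r K x - m))"
    proof -
      have "(LINT x|torus. g x * (bump l r K x - m)) = (LINT x|torus. g x * bump l r K x) - (LINT x|torus. g x * m)"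
        unfolding right_diff_distrib by (rule Bochner_Integration.integral_diff) (use gbi gi in auto)
      then show ?thesis using g0 gi by simp
    qed
    also have "\<dots> = (LINT x|torus. w x * \<phi> x)"
      using w p(1,3) unfolding weak_deriv_torus_def m_def by auto
    also have "\<bar>\<dots>\<bar> \<le> (LINT x|torus. 2 * \<bar>w x\<bar>)"
    proof (cases "integrable torus (\<lambda>x. w x * \<phi> x)")
      case True
      have "\<bar>LINT x|torus. w x * \<phi> x\<bar> \<le> (LINT x|torus. \<bar>w x * \<phi> x\<bar>)" by (rule integral_abs_bound)
      also have "\<dots> \<le> (LINT x|torus. 2 * \<bar>w x\<bar>)"
      proof (rule integral_mono_AE)
        show "AE x in torus. \<bar>w x * \<phi> x\<bar> \<le> 2 * \<bar>w x\<bar>"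
        proof (rule AE_I2)
          fix x assume "x \<in> space torus"
          then have "\<bar>\<phi> x\<bar> \<le> 2" by (intro p(2)) (simp add: space_torus)
          then show "\<bar>w x * \<phi> x\<bar> \<le> 2 * \<bar>w x\<bar>" using mult_right_mono[of "\<bar>\<phi> x\<bar>" 2 "\<bar>w x\<bar>"] by (simp add: abs_mult mult.commute)
        qed
      qed (use True wi in auto)
      finally show ?thesis .
    next
      \<comment> \<open>The Bochner integral of a function that is not integrable is 0.\<close>
      case False
      then show ?thesis by (simp add: not_integrable_integral_eq)
    qed
    also have "\<dots> = 2 * (LINT x|torus. \<bar>w x\<bar>)" by simp
    also have "\<dots> \<le> 2 * L2_norm_torus w" using L2_torus_abs_integral[OF wL2] by simp
    finally show ?thesis .
  qed
  have null: "AE x in torus. x \<notin> {l, r, 1}"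
  proof -
    have "{l, r, 1} \<in> null_sets lebesgue" by (intro null_sets_completionI finite_imp_null_set_lborel) simp
    then have "AE x in lebesgue. x \<notin> {l, r, 1}" by (rule AE_not_in)
    then show ?thesis unfolding torus_def by (subst AE_restrict_space_iff) auto
  qed
  have "(\<lambda>K. LINT x|torus. g x * bump l r K x) \<longlonglongrightarrow> (LINT x|torus. g x * indicator {l<..r} x)"
  proof (rule integral_dominated_convergence[where w = "\<lambda>x. \<bar>g x\<bar>"])
    show "AE x in torus. (\<lambda>K. g x * bump l r K x) \<longlonglongrightarrow> g x * indicator {l<..r} x"
      using null AE_space
    proof eventually_elim
      case (elim x)
      then show ?case using lr by (intro tendsto_mult_left bump_limit) (auto simp: space_torus)
    qed
    show "AE x in torus. norm (g x * bump l r K x) \<le> \<bar>g x\<bar>" for K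
      using bump_bounds by (intro AE_I2) (simp add: abs_mult mult_left_le)
    have "{l<..r} \<inter> space torus \<in> sets torus" unfolding torus_def by (intro sets_restrict_space_iff[THEN iffD2]) (auto simp: space_restrict_space)
    then have "(indicator {l<..r} :: real \<Rightarrow> real) \<in> borel_measurable torus" by (simp add: borel_measurable_indicator_iff)
    then show "(\<lambda>x. g x * indicator {l<..r} x) \<in> borel_measurable torus" using gi by auto
  qed (use gi gbi in auto)
  then have "(\<lambda>K. \<bar>LINT x|torus. g x * bump l r K x\<bar>) \<longlonglongrightarrow> \<bar>LINT x|torus. g x * indicator {l<..r} x\<bar>" by (rule tendsto_rabs)
  then have "\<bar>LINT x|torus. g x * indicator {l<..r} x\<bar> \<le> 2 * L2_norm_torus w"
    by (rule LIMSEQ_le_const2) (use bound in auto)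
  then show ?thesis using torus_cell_integral[of l r g] lr by (simp add: H0_norm_torus_def w_def)
qed

lemma cell_mean_bound:
  assumes g: "g \<in> H0_torus 2" and i: "i \<in> {1..N}"
  shows "\<bar>cell_mean N g i\<bar> \<le> 2 * real N * H0_norm_torus 2 g"
proof -
  have "\<bar>LINT x:{(real i - 1) / real N <.. real i / real N}|lebesgue. g x\<bar> \<le> 2 * H0_norm_torus 2 g"
    by (rule cell_integral_bound[OF g]) (use i in \<open>auto simp: divide_simps\<close>)
  from mult_left_mono[OF this, of "real N"] show ?thesis using i by (simp add: cell_mean_def abs_mult)
qed

text \<open>The cells partition the torus.\<close>

lemma cell_mean_sum:
  assumes g: "g \<in> H0_torus 2" and N: "N \<ge> 1"
  shows "(\<Sum>i=1..N. cell_mean N g i) = 0"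
proof -
  have gL2: "g \<in> L2_torus" and g0: "(LINT x|torus. g x) = 0" using g by (auto simp: H0_torus_def)
  have gi: "integrable torus g" by (rule L2_torus_integrable[OF gL2])
  have cell: "integrable torus (\<lambda>x. g x * indicator {l<..r} x)" if "0 \<le> l" "r \<le> 1" for l r
  proof -
    have "{l<..r} \<inter> space torus \<in> sets torus" unfolding torus_def by (intro sets_restrict_space_iff[THEN iffD2]) (auto simp: space_restrict_space)
    then have "(indicator {l<..r} :: real \<Rightarrow> real) \<in> borel_measurable torus" by (simp add: borel_measurable_indicator_iff)
    then have "(\<lambda>x. g x * indicator {l<..r} x) \<in> borel_measurable torus"
      using gi by (intro borel_measurable_times) auto
    then show ?thesis by (rule Bochner_Integration.integrable_bound[OF gi]) (auto simp: indicator_def)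
  qed
  have "(\<Sum>i=1..k. LINT x:{(real i - 1) / real N <.. real i / real N}|lebesgue. g x) = (LINT x|torus. g x * indicator {0<..real k / real N} x)"
    if "k \<le> N" for k
    using that
  proof (induction k)
    case (Suc k)
    let ?l = "real k / real N" and ?r = "real (Suc k) / real N"
    have lr: "0 \<le> ?l" "?l \<le> ?r" "?r \<le> 1" using Suc.prems N by (auto simp: divide_simps)
    have "(\<Sum>i=1..Suc k. LINT x:{(real i - 1) / real N <.. real i / real N}|lebesgue. g x)
      = (LINT x|torus. g x * indicator {0<..?l} x) + (LINT x|torus. g x * indicator {?l<..?r} x)"
      using Suc torus_cell_integral[OF lr, of g] by simp
    also have "\<dots> = (LINT x|torus. g x * indicator {0<..?l} x + g x * indicator {?l<..?r} x)"
      by (rule Bochner_Integration.integral_add[symmetric]) (use cell lr in auto)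
    also have "\<dots> = (LINT x|torus. g x * indicator {0<..?r} x)"
      by (rule Bochner_Integration.integral_cong) (use lr in \<open>auto simp: indicator_def space_torus\<close>)
    finally show ?case .
  qed simp
  from this[of N] have "(\<Sum>i=1..N. LINT x:{(real i - 1) / real N <.. real i / real N}|lebesgue. g x) = (LINT x|torus. g x * indicator {0<..1} x)"
    using N by simp
  also have "\<dots> = (LINT x|torus. g x)" by (rule Bochner_Integration.integral_cong) (auto simp: space_torus)
  finally have "(\<Sum>i=1..N. LINT x:{(real i - 1) / real N <.. real i / real N}|lebesgue. g x) = 0" using g0 by simp
  moreover have "(\<Sum>i=1..N. cell_mean N g i) = real N * (\<Sum>i=1..N. LINT x:{(real i - 1) / real N <.. real i / real N}|lebesgue. g x)"
    by (simp add: cell_mean_def sum_distrib_left)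
  ultimately show ?thesis by simp
qed

lemma cell_mean_square_summable:
  assumes g: "\<And>k. g (Suc k) \<in> H0_torus 2" and sum: "summable (\<lambda>k. (H0_norm_torus 2 (g (Suc k)))\<^sup>2)" and i: "i \<in> {1..N}"
  shows "summable (\<lambda>k. (cell_mean N (g (Suc k)) i)\<^sup>2)"
proof (rule summable_comparison_test')
  show "summable (\<lambda>k. (2 * real N)\<^sup>2 * (H0_norm_torus 2 (g (Suc k)))\<^sup>2)" by (rule summable_mult[OF sum])
  fix k
  have "\<bar>cell_mean N (g (Suc k)) i\<bar>\<^sup>2 \<le> (2 * real N * H0_norm_torus 2 (g (Suc k)))\<^sup>2"
    by (rule power_mono[OF cell_mean_bound[OF g i]]) simp
  then show "norm ((cell_mean N (g (Suc k)) i)\<^sup>2) \<le> (2 * real N)\<^sup>2 * (H0_norm_torus 2 (g (Suc k)))\<^sup>2"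
    by (simp add: power_mult_distrib)
qed

section \<open>Transition operators of the scheme and of the flow\<close>

lemma measure_R0_eqI_nn_integral:
  assumes N: "N \<ge> 1" and mu: "\<mu> \<in> prob_measures_R0 N" "\<mu>' \<in> prob_measures_R0 N"
    and eq: "\<And>f. lip_test N f \<Longrightarrow> (\<integral>\<^sup>+ v. ennreal (f v) \<partial>\<mu>) = (\<integral>\<^sup>+ v. ennreal (f v) \<partial>\<mu>')"
  shows "\<mu> = \<mu>'"
proof (rule measure_R0_eqI[OF N mu])
  fix f assume f: "lip_test N f"
  have "(LINT v|m. f v) = enn2real (\<integral>\<^sup>+ v. ennreal (f v) \<partial>m)" if m: "m \<in> prob_measures_R0 N" for m
  proof (rule integral_eq_nn_integral)
    have s: "sets m = sets (borel_R0 N)" using m by (simp add: prob_measures_R0_def)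
    show "f \<in> borel_measurable m" using lip_test_measurable[OF N f] measurable_cong_sets[OF s refl] by blast
    show "AE v in m. 0 \<le> f v"
      using f sets_eq_imp_space_eq[OF s] by (intro AE_I2) (auto simp: lip_test_def)
  qed
  then show "(LINT v|\<mu>. f v) = (LINT v|\<mu>'. f v)" using mu eq[OF f] by simp
qed

locale noisy_flux = monotone_flux \<nu> N Abar + bm_noise M F B N c
  for \<nu> :: real and N :: nat and Abar :: "real \<times> real \<Rightarrow> real"
    and M :: "'w measure" and F B and c :: "nat \<Rightarrow> nat \<Rightarrow> real"
begin

abbreviation "E \<equiv> borel_R0 N"
abbreviation "qp \<omega> \<equiv> (\<lambda>t. Q t \<omega>)"

lemma resolvent_measurable:
  assumes h: "h \<ge> 0" and X: "X \<in> A \<rightarrow>\<^sub>M E"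
  shows "(\<lambda>z. resolvent h (X z)) \<in> A \<rightarrow>\<^sub>M E"
proof (rule measurable_borel_R0I)
  show "resolvent h (X z) \<in> R0 N" if "z \<in> space A" for z
    using resolvent_R0[OF h] measurable_space[OF X that] by simp
  fix i assume i: "i \<in> {1..N}"
  have "(\<lambda>x. resolvent h x i) \<in> borel_measurable E"
  proof (rule lipschitz_measurable[OF N1])
    fix x y
    show "\<bar>resolvent h x i - resolvent h y i\<bar> \<le> 1 * l1_dist N x y"
      using coord_le_l1_dist[OF i, of "resolvent h x" "resolvent h y"] resolvent_dist[OF h, of x y] by linarith
  qed
  from measurable_compose[OF X this] show "(\<lambda>z. resolvent h (X z) i) \<in> borel_measurable A" .
qed

lemma add_measurable:
  assumes "X \<in> A \<rightarrow>\<^sub>M E" "Y \<in> A \<rightarrow>\<^sub>M E"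
  shows "(\<lambda>z. \<lambda>i\<in>{1..N}. X z i + Y z i) \<in> A \<rightarrow>\<^sub>M E"
proof (rule measurable_borel_R0I)
  show "(\<lambda>i\<in>{1..N}. X z i + Y z i) \<in> R0 N" if "z \<in> space A" for z
    using R0_sum[of "X z" N] R0_sum[of "Y z" N] measurable_space[OF assms(1) that] measurable_space[OF assms(2) that]
    by (simp add: R0_def sum.distrib)
  fix i assume i: "i \<in> {1..N}"
  then show "(\<lambda>z. (\<lambda>i\<in>{1..N}. X z i + Y z i) i) \<in> borel_measurable A"
    using R0_coord_measurable[OF assms(1) i] R0_coord_measurable[OF assms(2) i] by simp
qed

lemma diff_measurable:
  assumes "X \<in> A \<rightarrow>\<^sub>M E" "Y \<in> A \<rightarrow>\<^sub>M E"
  shows "(\<lambda>z. \<lambda>i\<in>{1..N}. X z i - Y z i) \<in> A \<rightarrow>\<^sub>M E"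
proof (rule measurable_borel_R0I)
  show "(\<lambda>i\<in>{1..N}. X z i - Y z i) \<in> R0 N" if "z \<in> space A" for z
    using R0_sum[of "X z" N] R0_sum[of "Y z" N] measurable_space[OF assms(1) that] measurable_space[OF assms(2) that]
    by (simp add: R0_def sum_subtractf)
  fix i assume i: "i \<in> {1..N}"
  then show "(\<lambda>z. (\<lambda>i\<in>{1..N}. X z i - Y z i) i) \<in> borel_measurable A"
    using R0_coord_measurable[OF assms(1) i] R0_coord_measurable[OF assms(2) i] by simp
qed

lemma split_step_measurable:
  assumes h: "h \<ge> 0" and X: "X \<in> A \<rightarrow>\<^sub>M E" and q: "\<And>k. k \<le> n \<Longrightarrow> (\<lambda>z. q z (real k * h)) \<in> A \<rightarrow>\<^sub>M E"
  shows "(\<lambda>z. split_step h (q z) (X z) n) \<in> A \<rightarrow>\<^sub>M E"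
  using q
proof (induction n)
  case 0 then show ?case using X by simp
next
  case (Suc n)
  have "(\<lambda>z. \<lambda>i\<in>{1..N}. resolvent h (split_step h (q z) (X z) n) i
        + (\<lambda>i\<in>{1..N}. q z (real (Suc n) * h) i - q z (real n * h) i) i) \<in> A \<rightarrow>\<^sub>M E"
    by (intro add_measurable resolvent_measurable diff_measurable Suc h) auto
  also have "(\<lambda>z. \<lambda>i\<in>{1..N}. resolvent h (split_step h (q z) (X z) n) i
        + (\<lambda>i\<in>{1..N}. q z (real (Suc n) * h) i - q z (real n * h) i) i) = (\<lambda>z. split_step h (q z) (X z) (Suc n))"
    by (intro ext) simp
  finally show ?case .
qed

text \<open>Only the values of the path up to time \<open>t\<close> enter, so the flow is adapted.\<close>

lemma flow_measurable:
  assumes t: "t \<ge> 0" and X: "X \<in> A \<rightarrow>\<^sub>M E" and q: "\<And>s. 0 \<le> s \<Longrightarrow> s \<le> t \<Longrightarrow> (\<lambda>z. q z s) \<in> A \<rightarrow>\<^sub>M E"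
  shows "(\<lambda>z. flow t (X z) (q z)) \<in> A \<rightarrow>\<^sub>M E"
proof (rule measurable_borel_R0I)
  fix i assume i: "i \<in> {1..N}"
  have m: "(\<lambda>z. lim (\<lambda>n. split_step (t / real n) (q z) (X z) n j)) \<in> borel_measurable A" if j: "j \<in> {1..N}" for j
  proof (rule borel_measurable_lim_metric)
    fix n
    have "(\<lambda>z. split_step (t / real n) (q z) (X z) n) \<in> A \<rightarrow>\<^sub>M E"
    proof (rule split_step_measurable[OF _ X])
      fix k assume k: "k \<le> n"
      have "real k * t \<le> real n * t" using t k by (intro mult_right_mono) auto
      then have "real k * (t / real n) \<le> t" using t by (cases "n = 0") (auto simp: divide_simps mult.commute)
      then show "(\<lambda>z. q z (real k * (t / real n))) \<in> A \<rightarrow>\<^sub>M E" using t by (intro q) auto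
    qed (use t in simp)
    then show "(\<lambda>z. split_step (t / real n) (q z) (X z) n j) \<in> borel_measurable A"
      by (rule R0_coord_measurable[OF _ j])
  qed
  have "(\<lambda>z. lim (\<lambda>n. split_step (t / real n) (q z) (X z) n i)
     - (\<Sum>j=1..N. lim (\<lambda>n. split_step (t / real n) (q z) (X z) n j)) / real N) \<in> borel_measurable A"
    by (intro borel_measurable_diff borel_measurable_divide borel_measurable_sum borel_measurable_const m i)
  then show "(\<lambda>z. flow t (X z) (q z) i) \<in> borel_measurable A" using i by (simp add: flow_def center_def)
qed (rule flow_R0)

lemma AE_driving: "AE \<omega> in M. driving_path N (qp \<omega>)"
  using AE_Q by eventually_elim blast

lemma Q_R0: "Q t \<omega> \<in> R0 N"
  unfolding Q_def by (rule H_R0)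

definition scheme_map :: "real \<Rightarrow> (nat \<Rightarrow> real) \<Rightarrow> 'w \<Rightarrow> nat \<Rightarrow> real" where
  "scheme_map h x \<omega> = (\<lambda>i\<in>{1..N}. resolvent h x i + Q h \<omega> i)"

definition scheme_op :: "real \<Rightarrow> ((nat \<Rightarrow> real) \<Rightarrow> ennreal) \<Rightarrow> (nat \<Rightarrow> real) \<Rightarrow> ennreal" where
  "scheme_op h f x = (\<integral>\<^sup>+ \<omega>. f (scheme_map h x \<omega>) \<partial>M)"

lemma scheme_map_measurable:
  assumes "h \<ge> 0" "X \<in> A \<rightarrow>\<^sub>M E" "g \<in> A \<rightarrow>\<^sub>M M"
  shows "(\<lambda>z. scheme_map h (X z) (g z)) \<in> A \<rightarrow>\<^sub>M E"
  unfolding scheme_map_def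
  by (intro add_measurable resolvent_measurable assms measurable_compose[OF assms(3) Q_M])

lemma scheme_op_measurable:
  assumes h: "h \<ge> 0" and f: "f \<in> borel_measurable E"
  shows "scheme_op h f \<in> borel_measurable E"
  unfolding scheme_op_def[abs_def]
proof (rule borel_measurable_nn_integral)
  have "(\<lambda>p. scheme_map h (fst p) (snd p)) \<in> E \<Otimes>\<^sub>M M \<rightarrow>\<^sub>M E" by (rule scheme_map_measurable[OF h]) auto
  from measurable_compose[OF this f] show "(\<lambda>(x, \<omega>). f (scheme_map h x \<omega>)) \<in> borel_measurable (E \<Otimes>\<^sub>M M)"
    by (simp add: case_prod_beta')
qed

lemma scheme_op_iter_measurable:
  "h \<ge> 0 \<Longrightarrow> f \<in> borel_measurable E \<Longrightarrow> (scheme_op h ^^ n) f \<in> borel_measurable E"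
  by (induction n) (auto intro: scheme_op_measurable)

text \<open>The scheme started at time \<open>s\<close> from a random state \<open>Y\<close>.\<close>

definition chain :: "real \<Rightarrow> real \<Rightarrow> ('w \<Rightarrow> nat \<Rightarrow> real) \<Rightarrow> nat \<Rightarrow> 'w \<Rightarrow> nat \<Rightarrow> real" where
  "chain h s Y n \<omega> = split_step h (\<lambda>t. Q (s + t) \<omega>) (Y \<omega>) n"

lemma chain_G:
  assumes h: "h \<ge> 0" and s: "s \<ge> 0" and Y: "Y \<in> G s \<rightarrow>\<^sub>M E"
  shows "chain h s Y n \<in> G (s + real n * h) \<rightarrow>\<^sub>M E"
  unfolding chain_def[abs_def]
proof (rule split_step_measurable[OF h])
  have sub: "sets (G s) \<subseteq> sets (G (s + real n * h))"
    unfolding sets_G past_def using h by (intro sigma_sets_mono' UN_mono order_refl) auto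
  then show "Y \<in> G (s + real n * h) \<rightarrow>\<^sub>M E" using Y by (auto simp: measurable_def space_G)
  fix k assume "k \<le> n"
  then have "real k * h \<le> real n * h" using h by (intro mult_right_mono) auto
  then show "(\<lambda>\<omega>. Q (s + real k * h) \<omega>) \<in> G (s + real n * h) \<rightarrow>\<^sub>M E"
    using s h by (intro Q_G) auto
qed

text \<open>Each step uses a noise increment that is independent of the current state, by
  \<open>increment_formula\<close>.\<close>

lemma chain_law:
  assumes h: "h > 0" and s: "s \<ge> 0" and Y: "Y \<in> G s \<rightarrow>\<^sub>M E" and f: "f \<in> borel_measurable E"
  shows "(\<integral>\<^sup>+ \<omega>. f (chain h s Y n \<omega>) \<partial>M) = (\<integral>\<^sup>+ \<omega>. (scheme_op h ^^ n) f (Y \<omega>) \<partial>M)"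
  using f
proof (induction n arbitrary: f)
  case 0 then show ?case by (simp add: chain_def)
next
  case (Suc n)
  let ?r = "s + real n * h"
  define f' where "f' p = f (\<lambda>i\<in>{1..N}. resolvent h (fst p) i + snd p i)" for p
  have f': "f' \<in> borel_measurable (E \<Otimes>\<^sub>M E)"
    unfolding f'_def[abs_def]
    by (rule measurable_compose[OF add_measurable[OF resolvent_measurable] Suc.prems]) (use h in auto)
  have "chain h s Y (Suc n) \<omega> = (\<lambda>i\<in>{1..N}. resolvent h (chain h s Y n \<omega>) i + (\<lambda>i\<in>{1..N}. Q (?r + h) \<omega> i - Q ?r \<omega> i) i)" for \<omega>
  proof -
    have "s + real (Suc n) * h = s + real n * h + h" by (simp add: algebra_simps)
    then show ?thesis unfolding chain_def split_step.simps by (intro ext) (simp only:, simp)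
  qed
  then have "(\<integral>\<^sup>+ \<omega>. f (chain h s Y (Suc n) \<omega>) \<partial>M) = (\<integral>\<^sup>+ \<omega>. f' (chain h s Y n \<omega>, \<lambda>i\<in>{1..N}. Q (?r + h) \<omega> i - Q ?r \<omega> i) \<partial>M)"
    by (simp add: f'_def)
  also have "\<dots> = (\<integral>\<^sup>+ \<omega>. \<integral>\<^sup>+ \<omega>'. f' (chain h s Y n \<omega>, Q h \<omega>') \<partial>M \<partial>M)"
    by (rule increment_formula[OF _ h chain_G f']) (use s h Y in auto)
  also have "\<dots> = (\<integral>\<^sup>+ \<omega>. scheme_op h f (chain h s Y n \<omega>) \<partial>M)"
    by (simp add: scheme_op_def scheme_map_def f'_def)
  also have "\<dots> = (\<integral>\<^sup>+ \<omega>. (scheme_op h ^^ Suc n) f (Y \<omega>) \<partial>M)"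
    unfolding funpow_Suc_right comp_def by (rule Suc.IH[OF scheme_op_measurable[OF _ Suc.prems]]) (use h in simp)
  finally show ?case .
qed

lemma split_step_law:
  assumes h: "h > 0" and x: "x \<in> R0 N" and f: "f \<in> borel_measurable E"
  shows "(\<integral>\<^sup>+ \<omega>. f (split_step h (qp \<omega>) x n) \<partial>M) = (scheme_op h ^^ n) f x"
  using chain_law[OF h order_refl, of "\<lambda>_. x" f n] x f by (simp add: chain_def emeasure_space_1)

lemma scheme_moment:
  assumes h: "h \<ge> 0" and x: "x \<in> R0 N"
  shows "(\<integral>\<^sup>+ \<omega>. ennreal (sq_sum N (scheme_map h x \<omega>)) \<partial>M) \<le> ennreal (1 / (1 + 2 * h * \<nu>) * sq_sum N x + noise_var * h)"
proof -
  have "sq_sum N (scheme_map h x \<omega>) = sq_sum N (\<lambda>i. resolvent h x i + Q h \<omega> i)" for \<omega>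
    by (simp add: sq_sum_def scheme_map_def)
  then have "(\<integral>\<^sup>+ \<omega>. ennreal (sq_sum N (scheme_map h x \<omega>)) \<partial>M) \<le> ennreal (sq_sum N (resolvent h x) + noise_var * h)"
    using noise_energy[OF h, of "resolvent h x"] by simp
  also have "\<dots> \<le> ennreal (1 / (1 + 2 * h * \<nu>) * sq_sum N x + noise_var * h)"
  proof (intro ennreal_leI add_right_mono)
    have "1 + 2 * h * \<nu> > 0" using h nu by (intro add_pos_nonneg) auto
    then show "sq_sum N (resolvent h x) \<le> 1 / (1 + 2 * h * \<nu>) * sq_sum N x"
      using resolvent_energy[OF h R0_sum[OF x]] by (simp add: field_simps)
  qed
  finally show ?thesis .
qed

lemma scheme_map_R0: "h \<ge> 0 \<Longrightarrow> x \<in> R0 N \<Longrightarrow> \<omega> \<in> space M \<Longrightarrow> scheme_map h x \<omega> \<in> R0 N"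
  using measurable_space[OF scheme_map_measurable[of h "\<lambda>_. x" M "\<lambda>\<omega>. \<omega>"]] by simp

text \<open>The constant is the stationary value of the recursion in \<open>scheme_moment\<close>; it stays bounded as
  \<open>h\<close> tends to 0, so the estimate passes to the flow.\<close>

lemma scheme_iter_moment:
  assumes h: "h > 0" and x: "x \<in> R0 N"
  defines "\<rho> \<equiv> 1 / (1 + 2 * h * \<nu>)"
  shows "(scheme_op h ^^ n) (\<lambda>v. ennreal (sq_sum N v)) x \<le> ennreal (\<rho> ^ n * sq_sum N x + noise_var * (1 + 2 * h * \<nu>) / (2 * \<nu>) * (1 - \<rho> ^ n))"
  using x
proof (induction n arbitrary: x)
  case 0 then show ?case by simp
next
  case (Suc n)
  have hn: "h * \<nu> > 0" using h nu by simp
  have p: "0 < 1 + 2 * h * \<nu>" "1 \<le> 1 + 2 * h * \<nu>" using hn by linarith+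
  have r: "0 < \<rho>" "\<rho> \<le> 1"
    unfolding \<rho>_def by (rule divide_pos_pos[OF zero_less_one p(1)], rule divide_le_eq_1_pos[OF p(1), THEN iffD2, OF p(2)])
  have rn: "0 \<le> \<rho> ^ n" "\<rho> ^ n \<le> 1" using r by (auto intro: power_le_one)
  define K where "K = noise_var * (1 + 2 * h * \<nu>) / (2 * \<nu>)"
  have K: "K \<ge> 0" using noise_var_nonneg hn nu by (simp add: K_def)
  have Kh: "noise_var * h = K * (1 - \<rho>)"
  proof -
    define q where "q = 1 + 2 * h * \<nu>"
    have q: "q > 0" unfolding q_def by (rule p(1))
    have "K * (1 - \<rho>) = noise_var * (q - 1) / (2 * \<nu>)"
      unfolding K_def \<rho>_def q_def[symmetric] using q nu by (simp add: field_simps)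
    also have "\<dots> = noise_var * h" unfolding q_def using nu by simp
    finally show ?thesis by simp
  qed
  have "(scheme_op h ^^ Suc n) (\<lambda>v. ennreal (sq_sum N v)) x
    \<le> (\<integral>\<^sup>+ \<omega>. ennreal (\<rho> ^ n) * ennreal (sq_sum N (scheme_map h x \<omega>)) + ennreal (K * (1 - \<rho> ^ n)) \<partial>M)"
    unfolding funpow.simps comp_def scheme_op_def[of h "(scheme_op h ^^ n) _"]
  proof (rule nn_integral_mono)
    fix \<omega> assume w: "\<omega> \<in> space M"
    have "(scheme_op h ^^ n) (\<lambda>v. ennreal (sq_sum N v)) (scheme_map h x \<omega>) \<le> ennreal (\<rho> ^ n * sq_sum N (scheme_map h x \<omega>) + K * (1 - \<rho> ^ n))"
      unfolding K_def by (rule Suc.IH[OF scheme_map_R0]) (use h w Suc.prems in auto)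
    also have "\<dots> = ennreal (\<rho> ^ n) * ennreal (sq_sum N (scheme_map h x \<omega>)) + ennreal (K * (1 - \<rho> ^ n))"
      by (subst ennreal_plus) (use rn K in \<open>auto simp: ennreal_mult'\<close>)
    finally show "(scheme_op h ^^ n) (\<lambda>v. ennreal (sq_sum N v)) (scheme_map h x \<omega>)
       \<le> ennreal (\<rho> ^ n) * ennreal (sq_sum N (scheme_map h x \<omega>)) + ennreal (K * (1 - \<rho> ^ n))" .
  qed
  also have "\<dots> = ennreal (\<rho> ^ n) * (\<integral>\<^sup>+ \<omega>. ennreal (sq_sum N (scheme_map h x \<omega>)) \<partial>M) + ennreal (K * (1 - \<rho> ^ n))"
  proof -
    have m: "(\<lambda>\<omega>. ennreal (sq_sum N (scheme_map h x \<omega>))) \<in> borel_measurable M"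
      using sq_sum_measurable[OF scheme_map_measurable[of h "\<lambda>_. x" M "\<lambda>\<omega>. \<omega>"]] h Suc.prems by simp
    show ?thesis using m by (subst nn_integral_add) (auto simp: nn_integral_cmult emeasure_space_1)
  qed
  also have "\<dots> \<le> ennreal (\<rho> ^ n) * ennreal (\<rho> * sq_sum N x + noise_var * h) + ennreal (K * (1 - \<rho> ^ n))"
    unfolding \<rho>_def by (intro add_right_mono mult_left_mono scheme_moment) (use h Suc.prems in auto)
  also have "\<dots> = ennreal (\<rho> ^ n * (\<rho> * sq_sum N x + noise_var * h) + K * (1 - \<rho> ^ n))"
  proof -
    have "0 \<le> \<rho> * sq_sum N x + noise_var * h" using r noise_var_nonneg h by simp
    then show ?thesis by (subst ennreal_plus) (use rn K in \<open>auto simp: ennreal_mult'\<close>)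
  qed
  also have "\<rho> ^ n * (\<rho> * sq_sum N x + noise_var * h) + K * (1 - \<rho> ^ n) = \<rho> ^ Suc n * sq_sum N x + K * (1 - \<rho> ^ Suc n)"
    unfolding Kh by (simp add: algebra_simps)
  finally show ?case by (simp only: K_def)
qed

lemma flow_qp_measurable:
  assumes "t \<ge> 0" "X \<in> A \<rightarrow>\<^sub>M E" "g \<in> A \<rightarrow>\<^sub>M M"
  shows "(\<lambda>z. flow t (X z) (qp (g z))) \<in> A \<rightarrow>\<^sub>M E"
  by (rule flow_measurable[OF assms(1,2)]) (rule measurable_compose[OF assms(3) Q_M])

definition flow_op :: "real \<Rightarrow> ((nat \<Rightarrow> real) \<Rightarrow> ennreal) \<Rightarrow> (nat \<Rightarrow> real) \<Rightarrow> ennreal" where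
  "flow_op t f x = (\<integral>\<^sup>+ \<omega>. f (flow t x (qp \<omega>)) \<partial>M)"

lemma flow_op_measurable:
  assumes t: "t \<ge> 0" and f: "f \<in> borel_measurable E"
  shows "flow_op t f \<in> borel_measurable E"
  unfolding flow_op_def[abs_def]
proof (rule borel_measurable_nn_integral)
  have "(\<lambda>p. flow t (fst p) (qp (snd p))) \<in> E \<Otimes>\<^sub>M M \<rightarrow>\<^sub>M E" by (rule flow_qp_measurable[OF t]) auto
  from measurable_compose[OF this f] show "(\<lambda>(x, \<omega>). f (flow t x (qp \<omega>))) \<in> borel_measurable (E \<Otimes>\<^sub>M M)"
    by (simp add: case_prod_beta')
qed

lemma lip_test_tendsto:
  assumes f: "lip_test N f" and X: "\<And>n. X n \<in> R0 N" "x \<in> R0 N" and lim: "\<And>i. i \<in> {1..N} \<Longrightarrow> (\<lambda>n. X n i) \<longlonglongrightarrow> x i"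
  shows "(\<lambda>n. ennreal (f (X n))) \<longlonglongrightarrow> ennreal (f x)"
proof -
  obtain L where L: "\<And>x y. x \<in> R0 N \<Longrightarrow> y \<in> R0 N \<Longrightarrow> \<bar>f x - f y\<bar> \<le> L * l1_dist N x y"
    using f unfolding lip_test_def by auto
  have "(\<lambda>n. L * l1_dist N (X n) x) \<longlonglongrightarrow> L * l1_dist N x x"
    unfolding l1_dist_def by (intro tendsto_intros lim)
  then have l0: "(\<lambda>n. L * l1_dist N (X n) x) \<longlonglongrightarrow> 0" by (simp add: l1_dist_def)
  have "(\<lambda>n. f (X n) - f x) \<longlonglongrightarrow> 0"
    by (rule Lim_null_comparison[OF _ l0]) (use L[OF X(1) X(2)] in simp)
  then have "(\<lambda>n. f (X n)) \<longlonglongrightarrow> f x" by (simp add: LIM_zero_iff)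
  then show ?thesis by (rule tendsto_ennrealI)
qed

text \<open>The semigroup property of the transition operators. Discretising only the time after \<open>s\<close>, the
  scheme started from the flow at time \<open>s\<close> converges on the one hand to the flow at time
  \<open>s + t\<close> along the shifted path, and has on the other hand, by \<open>chain_law\<close>, the law of the scheme
  with fresh noise.\<close>

lemma flow_op_add:
  assumes f: "lip_test N f" and s: "s \<ge> 0" and t: "t > 0" and x: "x \<in> R0 N"
  shows "flow_op (s + t) (\<lambda>v. ennreal (f v)) x = flow_op s (flow_op t (\<lambda>v. ennreal (f v))) x"
proof -
  let ?f = "\<lambda>v. ennreal (f v)"
  define Y where "Y \<omega> = flow s x (qp \<omega>)" for \<omega>
  have fm: "?f \<in> borel_measurable E" using lip_test_measurable[OF N1 f] by simp
  have f1: "?f v \<le> 1" if "v \<in> R0 N" for v using f that by (simp add: lip_test_def)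
  have Y_G: "Y \<in> G s \<rightarrow>\<^sub>M E"
    unfolding Y_def[abs_def] by (rule flow_measurable[OF s]) (use x Q_G in auto)
  have Y_M: "Y \<in> M \<rightarrow>\<^sub>M E" unfolding Y_def[abs_def] by (rule flow_qp_measurable[OF s]) (use x in auto)
  have YR: "Y \<omega> \<in> R0 N" for \<omega> unfolding Y_def by (rule flow_R0)
  have hn: "t / real (Suc n) > 0" for n using t by simp
  have law: "(\<integral>\<^sup>+ \<omega>. ?f (chain (t / real (Suc n)) s Y (Suc n) \<omega>) \<partial>M)
      = (\<integral>\<^sup>+ \<omega>. \<integral>\<^sup>+ \<omega>'. ?f (split_step (t / real (Suc n)) (qp \<omega>') (Y \<omega>) (Suc n)) \<partial>M \<partial>M)" for n
    unfolding chain_law[OF hn s Y_G fm] by (intro nn_integral_cong split_step_law[symmetric] hn YR fm)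
  have chR: "chain (t / real (Suc n)) s Y (Suc n) \<omega> \<in> R0 N" for n \<omega>
    unfolding chain_def by (rule split_step_R0) (use hn[of n] YR Q_R0 in auto)
  have ssR: "split_step (t / real (Suc n)) (qp \<omega>') (Y \<omega>) (Suc n) \<in> R0 N" for n \<omega> \<omega>'
    by (rule split_step_R0) (use hn[of n] YR Q_R0 in auto)
  \<comment> \<open>The limit along the shifted path.\<close>
  have lim1: "(\<lambda>n. \<integral>\<^sup>+ \<omega>. ?f (chain (t / real (Suc n)) s Y (Suc n) \<omega>) \<partial>M) \<longlonglongrightarrow> (\<integral>\<^sup>+ \<omega>. ?f (flow (s + t) x (qp \<omega>)) \<partial>M)"
  proof (rule nn_integral_dominated_convergence[where w = "\<lambda>_. 1"])
    show "(\<lambda>\<omega>. ?f (chain (t / real (Suc n)) s Y (Suc n) \<omega>)) \<in> borel_measurable M" for n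
    proof (rule measurable_compose[OF _ fm])
      show "chain (t / real (Suc n)) s Y (Suc n) \<in> M \<rightarrow>\<^sub>M E"
        unfolding chain_def[abs_def] by (rule split_step_measurable[OF _ Y_M]) (use hn[of n] s t in \<open>auto intro!: Q_M\<close>)
    qed
    show "(\<lambda>\<omega>. ?f (flow (s + t) x (qp \<omega>))) \<in> borel_measurable M"
      by (rule measurable_compose[OF flow_qp_measurable fm]) (use s t x in auto)
    show "AE \<omega> in M. (\<lambda>n. ?f (chain (t / real (Suc n)) s Y (Suc n) \<omega>)) \<longlonglongrightarrow> ?f (flow (s + t) x (qp \<omega>))"
      using AE_driving
    proof eventually_elim
      case (elim \<omega>)
      have sh: "split_step h (shift_path N s (qp \<omega>)) y n = split_step h (\<lambda>t. Q (s + t) \<omega>) y n" for h y n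
      proof (induction n)
        case (Suc n)
        show ?case unfolding split_step.simps Suc.IH by (intro ext) (simp add: shift_path_def)
      qed simp
      show ?case
        unfolding flow_add[OF elim x s less_imp_le[OF t]]
      proof (rule lip_test_tendsto[OF f chR flow_R0])
        fix i assume i: "i \<in> {1..N}"
        have "(\<lambda>n. split_step (t / real n) (shift_path N s (qp \<omega>)) (flow s x (qp \<omega>)) n i) \<longlonglongrightarrow> flow t (flow s x (qp \<omega>)) (shift_path N s (qp \<omega>)) i"
          by (rule flow_limit[OF driving_path_shift[OF elim s] flow_R0 less_imp_le[OF t] i])
        from LIMSEQ_Suc[OF this] show "(\<lambda>n. chain (t / real (Suc n)) s Y (Suc n) \<omega> i) \<longlonglongrightarrow> flow t (flow s x (qp \<omega>)) (shift_path N s (qp \<omega>)) i"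
          unfolding sh chain_def Y_def .
      qed
    qed
  qed (use f1[OF chR] in \<open>auto simp: emeasure_space_1\<close>)
  have ssm: "(\<lambda>p. ?f (split_step (t / real (Suc n)) (qp (snd p)) (Y (fst p)) (Suc n))) \<in> borel_measurable (M \<Otimes>\<^sub>M M)" for n
  proof (rule measurable_compose[OF split_step_measurable fm])
    show "(\<lambda>p. Y (fst p)) \<in> M \<Otimes>\<^sub>M M \<rightarrow>\<^sub>M E" by (rule measurable_compose[OF measurable_fst Y_M])
    show "(\<lambda>p. Q (real k * (t / real (Suc n))) (snd p)) \<in> M \<Otimes>\<^sub>M M \<rightarrow>\<^sub>M E" for k
      by (rule measurable_compose[OF measurable_snd Q_M]) (use t in simp)
  qed (use t in simp)
  have flm: "(\<lambda>p. ?f (flow t (Y (fst p)) (qp (snd p)))) \<in> borel_measurable (M \<Otimes>\<^sub>M M)"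
    by (rule measurable_compose[OF flow_qp_measurable fm]) (use t in \<open>auto intro: measurable_compose[OF measurable_fst Y_M]\<close>)
  \<comment> \<open>The limit with independent noise.\<close>
  have lim2: "(\<lambda>n. \<integral>\<^sup>+ \<omega>. \<integral>\<^sup>+ \<omega>'. ?f (split_step (t / real (Suc n)) (qp \<omega>') (Y \<omega>) (Suc n)) \<partial>M \<partial>M)
      \<longlonglongrightarrow> (\<integral>\<^sup>+ \<omega>. \<integral>\<^sup>+ \<omega>'. ?f (flow t (Y \<omega>) (qp \<omega>')) \<partial>M \<partial>M)"
  proof (rule nn_integral_dominated_convergence[where w = "\<lambda>_. 1"])
    show "(\<lambda>\<omega>. \<integral>\<^sup>+ \<omega>'. ?f (split_step (t / real (Suc n)) (qp \<omega>') (Y \<omega>) (Suc n)) \<partial>M) \<in> borel_measurable M" for n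
      by (rule borel_measurable_nn_integral) (unfold case_prod_beta', rule ssm)
    show "(\<lambda>\<omega>. \<integral>\<^sup>+ \<omega>'. ?f (flow t (Y \<omega>) (qp \<omega>')) \<partial>M) \<in> borel_measurable M"
      by (rule borel_measurable_nn_integral) (unfold case_prod_beta', rule flm)
    show "AE \<omega> in M. (\<integral>\<^sup>+ \<omega>'. ?f (split_step (t / real (Suc n)) (qp \<omega>') (Y \<omega>) (Suc n)) \<partial>M) \<le> 1" for n
    proof (rule AE_I2)
      fix \<omega>
      have "(\<integral>\<^sup>+ \<omega>'. ?f (split_step (t / real (Suc n)) (qp \<omega>') (Y \<omega>) (Suc n)) \<partial>M) \<le> (\<integral>\<^sup>+ \<omega>'. 1 \<partial>M)"
        by (intro nn_integral_mono f1 ssR)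
      then show "(\<integral>\<^sup>+ \<omega>'. ?f (split_step (t / real (Suc n)) (qp \<omega>') (Y \<omega>) (Suc n)) \<partial>M) \<le> 1" by (simp add: emeasure_space_1)
    qed
    show "AE \<omega> in M. (\<lambda>n. \<integral>\<^sup>+ \<omega>'. ?f (split_step (t / real (Suc n)) (qp \<omega>') (Y \<omega>) (Suc n)) \<partial>M) \<longlonglongrightarrow> (\<integral>\<^sup>+ \<omega>'. ?f (flow t (Y \<omega>) (qp \<omega>')) \<partial>M)"
    proof (rule AE_I2)
      fix \<omega> assume w: "\<omega> \<in> space M"
      show "(\<lambda>n. \<integral>\<^sup>+ \<omega>'. ?f (split_step (t / real (Suc n)) (qp \<omega>') (Y \<omega>) (Suc n)) \<partial>M) \<longlonglongrightarrow> (\<integral>\<^sup>+ \<omega>'. ?f (flow t (Y \<omega>) (qp \<omega>')) \<partial>M)"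
      proof (rule nn_integral_dominated_convergence[where w = "\<lambda>_. 1"])
        show "(\<lambda>\<omega>'. ?f (split_step (t / real (Suc n)) (qp \<omega>') (Y \<omega>) (Suc n))) \<in> borel_measurable M" for n
          by (rule measurable_compose[OF measurable_Pair1'[OF w] ssm[of n], unfolded fst_conv snd_conv])
        show "(\<lambda>\<omega>'. ?f (flow t (Y \<omega>) (qp \<omega>'))) \<in> borel_measurable M"
          using measurable_compose[OF measurable_Pair1'[OF w] flm] by simp
        show "AE \<omega>' in M. (\<lambda>n. ?f (split_step (t / real (Suc n)) (qp \<omega>') (Y \<omega>) (Suc n))) \<longlonglongrightarrow> ?f (flow t (Y \<omega>) (qp \<omega>'))"
          using AE_driving
        proof eventually_elim
          case (elim \<omega>')
          show ?case
            by (rule lip_test_tendsto[OF f ssR flow_R0]) (rule LIMSEQ_Suc[OF flow_limit[OF elim YR less_imp_le[OF t]]])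
        qed
      qed (use f1[OF ssR] in \<open>auto simp: emeasure_space_1\<close>)
    qed
  qed (auto simp: emeasure_space_1)
  have "flow_op (s + t) ?f x = (\<integral>\<^sup>+ \<omega>. \<integral>\<^sup>+ \<omega>'. ?f (flow t (Y \<omega>) (qp \<omega>')) \<partial>M \<partial>M)"
    unfolding flow_op_def using LIMSEQ_unique[OF lim1] lim2 unfolding law by blast
  then show ?thesis unfolding flow_op_def Y_def .
qed

lemma flow_op_0:
  assumes x: "x \<in> R0 N" shows "flow_op 0 f x = f x"
proof -
  have "flow_op 0 f x = (\<integral>\<^sup>+ \<omega>. f x \<partial>M)"
    unfolding flow_op_def
    by (rule nn_integral_cong_AE, use AE_driving in eventually_elim) (simp add: flow_0[OF _ x])
  then show ?thesis by (simp add: emeasure_space_1)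
qed

text \<open>Fatou's lemma along the scheme with step \<open>1 / n\<close>; Bernoulli's inequality bounds the contraction
  factor \<open>(1 + 2 \<nu> / n)\<^bsup>-n\<^esup>\<close> by \<open>1 / (1 + 2 \<nu>)\<close>.\<close>

lemma flow_moment:
  assumes x: "x \<in> R0 N"
  shows "(\<integral>\<^sup>+ \<omega>. ennreal (sq_sum N (flow 1 x (qp \<omega>))) \<partial>M) \<le> ennreal (1 / (1 + 2 * \<nu>) * sq_sum N x + noise_var * (1 + 2 * \<nu>) / (2 * \<nu>))"
proof -
  let ?h = "\<lambda>n. 1 / real (Suc n)"
  have sm: "(\<lambda>v. ennreal (sq_sum N v)) \<in> borel_measurable E" using sq_sum_measurable[of "\<lambda>v. v" E N] by simp
  have "(\<integral>\<^sup>+ \<omega>. ennreal (sq_sum N (flow 1 x (qp \<omega>))) \<partial>M) = (\<integral>\<^sup>+ \<omega>. liminf (\<lambda>n. ennreal (sq_sum N (split_step (?h n) (qp \<omega>) x (Suc n)))) \<partial>M)"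
  proof (rule nn_integral_cong_AE, use AE_driving in eventually_elim)
    case (elim \<omega>)
    have "(\<lambda>n. ennreal (sq_sum N (split_step (?h n) (qp \<omega>) x (Suc n)))) \<longlonglongrightarrow> ennreal (sq_sum N (flow 1 x (qp \<omega>)))"
      unfolding sq_sum_def
      by (intro tendsto_ennrealI tendsto_sum tendsto_power LIMSEQ_Suc[OF flow_limit[OF elim x]]) auto
    then show ?case by (rule lim_imp_Liminf[symmetric, rotated]) simp
  qed
  also have "\<dots> \<le> liminf (\<lambda>n. \<integral>\<^sup>+ \<omega>. ennreal (sq_sum N (split_step (?h n) (qp \<omega>) x (Suc n))) \<partial>M)"
  proof (rule nn_integral_liminf)
    show "(\<lambda>\<omega>. ennreal (sq_sum N (split_step (?h n) (qp \<omega>) x (Suc n)))) \<in> borel_measurable M" for n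
      by (rule measurable_compose[OF split_step_measurable sm]) (use x in \<open>auto intro!: Q_M\<close>)
  qed
  also have "\<dots> \<le> ennreal (1 / (1 + 2 * \<nu>) * sq_sum N x + noise_var * (1 + 2 * \<nu>) / (2 * \<nu>))"
  proof (rule Liminf_le, simp, rule always_eventually, rule allI)
    fix n
    let ?r = "1 / (1 + 2 * ?h n * \<nu>)"
    have h: "?h n > 0" "?h n \<le> 1" by auto
    have hn: "2 * ?h n * \<nu> > 0" "2 * ?h n * \<nu> \<le> 2 * \<nu>" using nu by (auto simp: divide_simps)
    have "1 + real (Suc n) * (2 * ?h n * \<nu>) \<le> (1 + 2 * ?h n * \<nu>) ^ Suc n"
      by (rule Bernoulli_inequality) (use hn in linarith)
    moreover have "real (Suc n) * (2 * ?h n * \<nu>) = 2 * \<nu>" by simp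
    ultimately have "1 + 2 * \<nu> \<le> (1 + 2 * ?h n * \<nu>) ^ Suc n" by linarith
    then have r1: "?r ^ Suc n \<le> 1 / (1 + 2 * \<nu>)"
      unfolding power_one_over using nu by (intro divide_left_mono) (auto intro!: mult_pos_pos zero_less_power add_pos_pos hn)
    have r0: "0 \<le> ?r ^ Suc n" using hn by (intro zero_le_power) simp
    have "(\<integral>\<^sup>+ \<omega>. ennreal (sq_sum N (split_step (?h n) (qp \<omega>) x (Suc n))) \<partial>M) = (scheme_op (?h n) ^^ Suc n) (\<lambda>v. ennreal (sq_sum N v)) x"
      by (rule split_step_law[OF h(1) x sm])
    also have "\<dots> \<le> ennreal (?r ^ Suc n * sq_sum N x + noise_var * (1 + 2 * ?h n * \<nu>) / (2 * \<nu>) * (1 - ?r ^ Suc n))"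
      by (rule scheme_iter_moment[OF h(1) x])
    also have "\<dots> \<le> ennreal (1 / (1 + 2 * \<nu>) * sq_sum N x + noise_var * (1 + 2 * \<nu>) / (2 * \<nu>))"
    proof (rule ennreal_leI, rule add_mono)
      show "?r ^ Suc n * sq_sum N x \<le> 1 / (1 + 2 * \<nu>) * sq_sum N x" by (rule mult_right_mono[OF r1]) simp
      have "noise_var * (1 + 2 * ?h n * \<nu>) / (2 * \<nu>) * (1 - ?r ^ Suc n) \<le> noise_var * (1 + 2 * ?h n * \<nu>) / (2 * \<nu>) * 1"
        using r0 noise_var_nonneg hn nu by (intro mult_left_mono) auto
      also have "\<dots> \<le> noise_var * (1 + 2 * \<nu>) / (2 * \<nu>)"
        unfolding mult_1_right using noise_var_nonneg hn nu by (intro divide_right_mono mult_left_mono) auto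
      finally show "noise_var * (1 + 2 * ?h n * \<nu>) / (2 * \<nu>) * (1 - ?r ^ Suc n) \<le> noise_var * (1 + 2 * \<nu>) / (2 * \<nu>)" .
    qed
    finally show "(\<integral>\<^sup>+ \<omega>. ennreal (sq_sum N (split_step (?h n) (qp \<omega>) x (Suc n))) \<partial>M)
       \<le> ennreal (1 / (1 + 2 * \<nu>) * sq_sum N x + noise_var * (1 + 2 * \<nu>) / (2 * \<nu>))" .
  qed
  finally show ?thesis .
qed

lemma scheme_contraction:
  assumes h: "h > 0"
  shows "random_contraction M N (scheme_map h) (1 / (1 + 2 * h * \<nu>)) (noise_var * h)"
proof unfold_locales
  show "N \<ge> 1" by (rule N1)
  show "(\<lambda>(\<omega>, x). scheme_map h x \<omega>) \<in> M \<Otimes>\<^sub>M E \<rightarrow>\<^sub>M E"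
    using scheme_map_measurable[of h snd "M \<Otimes>\<^sub>M E" fst] h by (simp add: case_prod_beta')
  have eq: "l1_dist N (scheme_map h x \<omega>) (scheme_map h y \<omega>) = l1_dist N (resolvent h x) (resolvent h y)" for x y \<omega>
    by (simp add: l1_dist_def scheme_map_def)
  show "AE \<omega> in M. \<forall>x\<in>R0 N. \<forall>y\<in>R0 N. l1_dist N (scheme_map h x \<omega>) (scheme_map h y \<omega>) \<le> l1_dist N x y"
    unfolding eq using resolvent_dist[of h] h by auto
  show "AE \<omega> in M. \<forall>x\<in>R0 N. \<forall>y\<in>R0 N. l1_dist N x y \<noteq> 0 \<longrightarrow> l1_dist N (scheme_map h x \<omega>) (scheme_map h y \<omega>) < l1_dist N x y"
    unfolding eq using resolvent_dist_strict[OF h] R0_sum by (intro AE_I2 ballI impI) auto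
  have hn: "h * \<nu> > 0" using h nu by simp
  have p: "0 < 1 + 2 * h * \<nu>" "1 < 1 + 2 * h * \<nu>" using hn by linarith+
  show "0 \<le> 1 / (1 + 2 * h * \<nu>)" by (rule divide_nonneg_pos[OF zero_le_one p(1)])
  show "1 / (1 + 2 * h * \<nu>) < 1" by (rule divide_less_eq_1_pos[OF p(1), THEN iffD2, OF p(2)])
  show "0 \<le> noise_var * h" using noise_var_nonneg h by simp
  show "(\<integral>\<^sup>+ \<omega>. ennreal (sq_sum N (scheme_map h x \<omega>)) \<partial>M) \<le> ennreal (1 / (1 + 2 * h * \<nu>) * sq_sum N x + noise_var * h)" if "x \<in> R0 N" for x
    by (rule scheme_moment[OF less_imp_le[OF h] that])
qed

lemma flow_contraction:
  "random_contraction M N (\<lambda>x \<omega>. flow 1 x (qp \<omega>)) (1 / (1 + 2 * \<nu>)) (noise_var * (1 + 2 * \<nu>) / (2 * \<nu>))"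
proof unfold_locales
  show "N \<ge> 1" by (rule N1)
  show "(\<lambda>(\<omega>, x). flow 1 x (qp \<omega>)) \<in> M \<Otimes>\<^sub>M E \<rightarrow>\<^sub>M E"
    using flow_qp_measurable[of 1 snd "M \<Otimes>\<^sub>M E" fst] by (simp add: case_prod_beta')
  show "AE \<omega> in M. \<forall>x\<in>R0 N. \<forall>y\<in>R0 N. l1_dist N (flow 1 x (qp \<omega>)) (flow 1 y (qp \<omega>)) \<le> l1_dist N x y"
    using AE_driving by eventually_elim (intro ballI flow_dist, auto)
  show "AE \<omega> in M. \<forall>x\<in>R0 N. \<forall>y\<in>R0 N. l1_dist N x y \<noteq> 0 \<longrightarrow> l1_dist N (flow 1 x (qp \<omega>)) (flow 1 y (qp \<omega>)) < l1_dist N x y"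
    using AE_driving by eventually_elim (intro ballI impI flow_dist_strict, auto)
  show "0 \<le> 1 / (1 + 2 * \<nu>)" "1 / (1 + 2 * \<nu>) < 1" using nu by auto
  show "0 \<le> noise_var * (1 + 2 * \<nu>) / (2 * \<nu>)" using noise_var_nonneg nu by simp
qed (rule flow_moment)

end

section \<open>Invariance expressed by one step of the dynamics\<close>

lemma AE_fst:
  assumes mu: "prob_space \<mu>" and P: "AE \<omega> in M. P \<omega>"
  shows "AE z in M \<Otimes>\<^sub>M \<mu>. P (fst z)"
proof -
  interpret mu: prob_space \<mu> by fact
  obtain Z where Z: "{\<omega> \<in> space M. \<not> P \<omega>} \<subseteq> Z" "Z \<in> null_sets M"
    using P by (auto elim: AE_E simp: null_sets_def)
  have "emeasure (M \<Otimes>\<^sub>M \<mu>) (Z \<times> space \<mu>) = emeasure M Z * emeasure \<mu> (space \<mu>)"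
    by (rule mu.emeasure_pair_measure_Times) (use Z in auto)
  then have "Z \<times> space \<mu> \<in> null_sets (M \<Otimes>\<^sub>M \<mu>)" using Z by (auto simp: null_sets_def)
  then show ?thesis by (rule AE_I') (use Z in \<open>auto simp: space_pair_measure\<close>)
qed

context noisy_flux
begin

lemma Q_adapted: "0 \<le> s \<Longrightarrow> s \<le> t \<Longrightarrow> Q s \<in> F t \<rightarrow>\<^sub>M E"
  unfolding Q_def[abs_def] by (rule H_measurable) (rule B_adapted)

lemma snd_measurable: "\<mu> \<in> prob_measures_R0 N \<Longrightarrow> snd \<in> A \<Otimes>\<^sub>M \<mu> \<rightarrow>\<^sub>M E"
  using measurable_snd[of A \<mu>] by (simp add: prob_measures_R0_def measurable_def sets_eq_imp_space_eq[of \<mu> E])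

text \<open>The noise does not depend on the coordinate that carries the initial condition; Fubini's theorem
  writes the law of a function of both as a mixture over the initial law.\<close>

lemma ext_law:
  assumes mu: "\<mu> \<in> prob_measures_R0 N" and X: "(\<lambda>p. X (fst p) (snd p)) \<in> M \<Otimes>\<^sub>M E \<rightarrow>\<^sub>M E"
  shows "(\<lambda>z. X (fst z) (snd z)) \<in> M \<Otimes>\<^sub>M \<mu> \<rightarrow>\<^sub>M E"
    and "distr (M \<Otimes>\<^sub>M \<mu>) E (\<lambda>z. X (fst z) (snd z)) \<in> prob_measures_R0 N"
    and "f \<in> borel_measurable E \<Longrightarrow>
      (\<integral>\<^sup>+ v. f v \<partial>distr (M \<Otimes>\<^sub>M \<mu>) E (\<lambda>z. X (fst z) (snd z))) = (\<integral>\<^sup>+ x. \<integral>\<^sup>+ \<omega>. f (X \<omega> x) \<partial>M \<partial>\<mu>)"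
proof -
  interpret mu: prob_space \<mu> using mu by (simp add: prob_measures_R0_def)
  interpret P: pair_prob_space M \<mu> ..
  have s: "sets (M \<Otimes>\<^sub>M \<mu>) = sets (M \<Otimes>\<^sub>M E)"
    by (rule sets_pair_measure_cong) (use mu in \<open>auto simp: prob_measures_R0_def\<close>)
  show m: "(\<lambda>z. X (fst z) (snd z)) \<in> M \<Otimes>\<^sub>M \<mu> \<rightarrow>\<^sub>M E"
    using X measurable_cong_sets[OF s refl] by blast
  show "distr (M \<Otimes>\<^sub>M \<mu>) E (\<lambda>z. X (fst z) (snd z)) \<in> prob_measures_R0 N"
    unfolding prob_measures_R0_def using P.prob_space_distr[OF m] by simp
  assume f: "f \<in> borel_measurable E"
  have "(\<integral>\<^sup>+ v. f v \<partial>distr (M \<Otimes>\<^sub>M \<mu>) E (\<lambda>z. X (fst z) (snd z))) = (\<integral>\<^sup>+ z. f (X (fst z) (snd z)) \<partial>(M \<Otimes>\<^sub>M \<mu>))"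
    by (rule nn_integral_distr[OF m]) (use f in simp)
  also have "\<dots> = (\<integral>\<^sup>+ x. \<integral>\<^sup>+ \<omega>. f (X \<omega> x) \<partial>M \<partial>\<mu>)"
    using P.nn_integral_snd[of "\<lambda>z. f (X (fst z) (snd z))"] measurable_compose[OF m f] by simp
  finally show "(\<integral>\<^sup>+ v. f v \<partial>distr (M \<Otimes>\<^sub>M \<mu>) E (\<lambda>z. X (fst z) (snd z))) = (\<integral>\<^sup>+ x. \<integral>\<^sup>+ \<omega>. f (X \<omega> x) \<partial>M \<partial>\<mu>)" .
qed

lemma split_step_pair_measurable:
  "h \<ge> 0 \<Longrightarrow> (\<lambda>p. split_step h (qp (fst p)) (snd p) n) \<in> M \<Otimes>\<^sub>M E \<rightarrow>\<^sub>M E"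
  by (rule split_step_measurable) (auto intro: measurable_compose[OF measurable_fst Q_M])

lemma flow_pair_measurable:
  "t \<ge> 0 \<Longrightarrow> (\<lambda>p. flow t (snd p) (qp (fst p))) \<in> M \<Otimes>\<^sub>M E \<rightarrow>\<^sub>M E"
  by (rule flow_qp_measurable) auto

lemma space_mu: "\<mu> \<in> prob_measures_R0 N \<Longrightarrow> space \<mu> = R0 N"
  using sets_eq_imp_space_eq[of \<mu> E] by (simp add: prob_measures_R0_def)

lemma snd_R0: "\<mu> \<in> prob_measures_R0 N \<Longrightarrow> z \<in> space (M \<Otimes>\<^sub>M \<mu>) \<Longrightarrow> snd z \<in> R0 N"
  unfolding space_pair_measure mem_Times_iff by (simp only: space_mu)

lemma distr_eqI:
  assumes "\<mu> \<in> prob_measures_R0 N" "\<mu>' \<in> prob_measures_R0 N"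
    "\<And>f. f \<in> borel_measurable E \<Longrightarrow> (\<integral>\<^sup>+ v. f v \<partial>\<mu>) = (\<integral>\<^sup>+ v. f v \<partial>\<mu>')"
  shows "\<mu> = \<mu>'"
proof (rule measure_eqI)
  show s: "sets \<mu> = sets \<mu>'" using assms by (simp add: prob_measures_R0_def)
  fix A assume A: "A \<in> sets \<mu>"
  then have "A \<in> sets E" using assms by (simp add: prob_measures_R0_def)
  then have "(\<integral>\<^sup>+ v. indicator A v \<partial>\<mu>) = (\<integral>\<^sup>+ v. indicator A v \<partial>\<mu>')" by (intro assms(3)) auto
  then show "emeasure \<mu> A = emeasure \<mu>' A" using A s by simp
qed

text \<open>The noise is given as a series \<open>V\<close>, which agrees with its everywhere defined version \<open>Q\<close>
  almost surely; modifying it on a null set changes neither the solutions nor the laws.\<close>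

context
  fixes V :: "real \<Rightarrow> 'w \<Rightarrow> nat \<Rightarrow> real"
  assumes V: "AE \<omega> in M. \<forall>t\<ge>0. \<forall>i\<in>{1..N}. V t \<omega> i = Q t \<omega> i"
begin

lemma scheme_solution_exists:
  assumes mu: "\<mu> \<in> prob_measures_R0 N" and h: "h > 0"
  shows "scheme_solution (M \<Otimes>\<^sub>M \<mu>) (ext_filtration F \<mu>) N h b (ext_noise V) snd
     (\<lambda>n z. split_step h (qp (fst z)) (snd z) n)"
  unfolding scheme_solution_def
proof (intro conjI exI)
  have m: "(\<lambda>z. split_step h (qp (fst z)) (snd z) n) \<in> F (real n * h) \<Otimes>\<^sub>M \<mu> \<rightarrow>\<^sub>M E" for n
  proof (rule split_step_measurable[OF _ snd_measurable[OF mu]])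
    fix k assume "k \<le> n"
    then have "real k * h \<le> real n * h" using h by (intro mult_right_mono) auto
    then show "(\<lambda>z. Q (real k * h) (fst z)) \<in> F (real n * h) \<Otimes>\<^sub>M \<mu> \<rightarrow>\<^sub>M E"
      using h by (intro measurable_compose[OF measurable_fst Q_adapted]) auto
  qed (use h in simp)
  then show "\<forall>n. (\<lambda>z. split_step h (qp (fst z)) (snd z) n) \<in> ext_filtration F \<mu> (real n * h) \<rightarrow>\<^sub>M E"
    by (simp add: ext_filtration_def)
  show "\<forall>n. (\<lambda>z. resolvent h (split_step h (qp (fst z)) (snd z) n)) \<in> ext_filtration F \<mu> (real n * h) \<rightarrow>\<^sub>M E"
    using m by (auto simp: ext_filtration_def intro!: resolvent_measurable less_imp_le[OF h])
  show "AE z in M \<Otimes>\<^sub>M \<mu>. \<forall>i\<in>{1..N}. split_step h (qp (fst z)) (snd z) 0 i = snd z i" by simp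
  have p: "prob_space \<mu>" using mu by (simp add: prob_measures_R0_def)
  show "AE z in M \<Otimes>\<^sub>M \<mu>. \<forall>n. \<forall>i\<in>{1..N}.
     resolvent h (split_step h (qp (fst z)) (snd z) n) i = split_step h (qp (fst z)) (snd z) n i + h * b (resolvent h (split_step h (qp (fst z)) (snd z) n)) i \<and>
     split_step h (qp (fst z)) (snd z) (Suc n) i = resolvent h (split_step h (qp (fst z)) (snd z) n) i +
       (ext_noise V (real (Suc n) * h) z i - ext_noise V (real n * h) z i)"
    using AE_fst[OF p V]
  proof eventually_elim
    case (elim z)
    show ?case
    proof (intro allI ballI conjI)
      fix n i assume i: "i \<in> {1..N}"
      show "resolvent h (split_step h (qp (fst z)) (snd z) n) i = split_step h (qp (fst z)) (snd z) n i + h * b (resolvent h (split_step h (qp (fst z)) (snd z) n)) i"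
        by (rule resolvent_eq[OF less_imp_le[OF h] i])
      have v: "V (real k * h) (fst z) i = Q (real k * h) (fst z) i" for k :: nat using elim i h by simp
      show "split_step h (qp (fst z)) (snd z) (Suc n) i = resolvent h (split_step h (qp (fst z)) (snd z) n) i +
         (ext_noise V (real (Suc n) * h) z i - ext_noise V (real n * h) z i)"
        using i unfolding ext_noise_def split_step.simps v by simp
    qed
  qed
qed

lemma scheme_solution_law:
  assumes mu: "\<mu> \<in> prob_measures_R0 N" and h: "h > 0"
    and U: "scheme_solution (M \<Otimes>\<^sub>M \<mu>) (ext_filtration F \<mu>) N h b (ext_noise V) snd U"
  shows "distr (M \<Otimes>\<^sub>M \<mu>) E (U n) = distr (M \<Otimes>\<^sub>M \<mu>) E (\<lambda>z. split_step h (qp (fst z)) (snd z) n)"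
proof -
  have p: "prob_space \<mu>" using mu by (simp add: prob_measures_R0_def)
  have Um: "U n \<in> F (real n * h) \<Otimes>\<^sub>M \<mu> \<rightarrow>\<^sub>M E" for n using U by (simp add: scheme_solution_def ext_filtration_def)
  have sub: "sets (F t \<Otimes>\<^sub>M \<mu>) \<subseteq> sets (M \<Otimes>\<^sub>M \<mu>)" "space (F t \<Otimes>\<^sub>M \<mu>) = space (M \<Otimes>\<^sub>M \<mu>)" if "t \<ge> 0" for t
    using sets_F[OF that] space_F[OF that]
    by (auto simp: sets_pair_measure space_pair_measure intro!: sigma_sets_mono')
  have UM: "U n \<in> M \<Otimes>\<^sub>M \<mu> \<rightarrow>\<^sub>M E" for n
    using Um[of n] sub[of "real n * h"] h by (auto simp: measurable_def)
  obtain Uh where "AE z in M \<Otimes>\<^sub>M \<mu>. \<forall>n. \<forall>i\<in>{1..N}. Uh n z i = U n z i + h * b (Uh n z) i \<and>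
      U (Suc n) z i = Uh n z i + (ext_noise V (real (Suc n) * h) z i - ext_noise V (real n * h) z i)"
    and "AE z in M \<Otimes>\<^sub>M \<mu>. \<forall>i\<in>{1..N}. U 0 z i = snd z i"
    using U unfolding scheme_solution_def by blast
  then have "AE z in M \<Otimes>\<^sub>M \<mu>. U n z = split_step h (qp (fst z)) (snd z) n"
    using AE_fst[OF p V] AE_space
  proof eventually_elim
    case (elim z)
    have UR: "U n z \<in> R0 N" for n using measurable_space[OF UM elim(4)] by simp
    have sz: "snd z \<in> R0 N" by (rule snd_R0[OF mu elim(4)])
    have SR: "split_step h (qp (fst z)) (snd z) n \<in> R0 N" for n
      by (rule split_step_R0) (use h sz Q_R0 in auto)
    show ?case
    proof (induction n)
      case 0 show ?case by (rule R0_eqI[OF UR SR]) (use elim(2) in simp)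
    next
      case (Suc n)
      have r: "Uh n z i = resolvent h (U n z) i" if "i \<in> {1..N}" for i
        by (rule resolvent_unique[OF less_imp_le[OF h] _ that]) (use elim(1) in blast)
      show ?case
      proof (rule R0_eqI[OF UR SR])
        fix i assume i: "i \<in> {1..N}"
        have v: "V (real k * h) (fst z) i = Q (real k * h) (fst z) i" for k :: nat using elim(3) i h by simp
        have "U (Suc n) z i = Uh n z i + (ext_noise V (real (Suc n) * h) z i - ext_noise V (real n * h) z i)"
          using elim(1) i by blast
        also have "\<dots> = resolvent h (split_step h (qp (fst z)) (snd z) n) i + (Q (real (Suc n) * h) (fst z) i - Q (real n * h) (fst z) i)"
          unfolding r[OF i] Suc ext_noise_def v ..
        also have "\<dots> = split_step h (qp (fst z)) (snd z) (Suc n) i" using i by simp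
        finally show "U (Suc n) z i = split_step h (qp (fst z)) (snd z) (Suc n) i" .
      qed
    qed
  qed
  then show ?thesis
    by (rule distr_cong_AE[OF refl refl _ UM ext_law(1)[OF mu, of "\<lambda>\<omega> x. split_step h (qp \<omega>) x n"]])
       (use split_step_pair_measurable h in auto)
qed

text \<open>Solutions of the scheme are unique almost surely, so invariance concerns one explicit
  solution; and invariance under one step implies invariance under all steps.\<close>

lemma scheme_invariant_iff:
  assumes mu: "\<mu> \<in> prob_measures_R0 N" and h: "h > 0"
  shows "scheme_invariant M F N h b V \<mu> \<longleftrightarrow> distr (M \<Otimes>\<^sub>M \<mu>) E (\<lambda>(\<omega>, x). scheme_map h x \<omega>) = \<mu>"
proof -
  have sm: "(\<lambda>p. scheme_map h (snd p) (fst p)) \<in> M \<Otimes>\<^sub>M E \<rightarrow>\<^sub>M E" by (rule scheme_map_measurable) (use h in auto)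
  note lS = ext_law[OF mu split_step_pair_measurable[OF less_imp_le[OF h]]]
  note lM = ext_law[OF mu, of "\<lambda>\<omega> x. scheme_map h x \<omega>", OF sm]
  have S: "(\<integral>\<^sup>+ v. f v \<partial>distr (M \<Otimes>\<^sub>M \<mu>) E (\<lambda>z. split_step h (qp (fst z)) (snd z) n)) = (\<integral>\<^sup>+ x. (scheme_op h ^^ n) f x \<partial>\<mu>)"
    if "f \<in> borel_measurable E" for f n
    unfolding lS(3)[OF that] by (rule nn_integral_cong) (simp add: split_step_law[OF h _ that] space_mu[OF mu])
  have Mp: "(\<integral>\<^sup>+ v. f v \<partial>distr (M \<Otimes>\<^sub>M \<mu>) E (\<lambda>(\<omega>, x). scheme_map h x \<omega>)) = (\<integral>\<^sup>+ x. scheme_op h f x \<partial>\<mu>)"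
    if "f \<in> borel_measurable E" for f
    using lM(3)[OF that] by (simp add: scheme_op_def case_prod_beta')
  have Mpm: "distr (M \<Otimes>\<^sub>M \<mu>) E (\<lambda>(\<omega>, x). scheme_map h x \<omega>) \<in> prob_measures_R0 N"
    using lM(2) by (simp add: case_prod_beta')
  show ?thesis
  proof
    assume inv: "scheme_invariant M F N h b V \<mu>"
    then have "distr (M \<Otimes>\<^sub>M \<mu>) E (\<lambda>z. split_step h (qp (fst z)) (snd z) 1) = \<mu>"
      using scheme_solution_exists[OF mu h] unfolding scheme_invariant_def by blast
    then have "(\<integral>\<^sup>+ x. scheme_op h f x \<partial>\<mu>) = (\<integral>\<^sup>+ v. f v \<partial>\<mu>)" if "f \<in> borel_measurable E" for f
      using S[OF that, of 1] by simp
    then show "distr (M \<Otimes>\<^sub>M \<mu>) E (\<lambda>(\<omega>, x). scheme_map h x \<omega>) = \<mu>"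
      by (intro distr_eqI[OF Mpm mu]) (simp add: Mp)
  next
    assume inv: "distr (M \<Otimes>\<^sub>M \<mu>) E (\<lambda>(\<omega>, x). scheme_map h x \<omega>) = \<mu>"
    have step: "(\<integral>\<^sup>+ x. scheme_op h f x \<partial>\<mu>) = (\<integral>\<^sup>+ v. f v \<partial>\<mu>)" if "f \<in> borel_measurable E" for f
      using Mp[OF that] unfolding inv by simp
    have "(\<integral>\<^sup>+ x. (scheme_op h ^^ n) f x \<partial>\<mu>) = (\<integral>\<^sup>+ v. f v \<partial>\<mu>)" if "f \<in> borel_measurable E" for f n
    proof (induction n)
      case (Suc n)
      then show ?case using step[OF scheme_op_iter_measurable[OF less_imp_le[OF h] that, of n]] by simp
    qed simp
    then have "distr (M \<Otimes>\<^sub>M \<mu>) E (\<lambda>z. split_step h (qp (fst z)) (snd z) n) = \<mu>" for n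
      by (intro distr_eqI[OF lS(2) mu]) (simp add: S)
    then show "scheme_invariant M F N h b V \<mu>"
      unfolding scheme_invariant_def
      using mu scheme_solution_exists[OF mu h] scheme_solution_law[OF mu h] by auto
  qed
qed

lemma sde_solution_exists:
  assumes mu: "\<mu> \<in> prob_measures_R0 N"
  shows "sde_solution (M \<Otimes>\<^sub>M \<mu>) (ext_filtration F \<mu>) N b (ext_noise V) snd (\<lambda>t z. flow t (snd z) (qp (fst z)))"
  unfolding sde_solution_def
proof (intro conjI allI impI)
  fix t :: real assume t: "t \<ge> 0"
  show "(\<lambda>z. flow t (snd z) (qp (fst z))) \<in> ext_filtration F \<mu> t \<rightarrow>\<^sub>M E"
    unfolding ext_filtration_def
    by (rule flow_measurable[OF t snd_measurable[OF mu]]) (rule measurable_compose[OF measurable_fst Q_adapted])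
next
  have p: "prob_space \<mu>" using mu by (simp add: prob_measures_R0_def)
  show "AE z in M \<Otimes>\<^sub>M \<mu>. \<forall>i\<in>{1..N}. continuous_on {0..} (\<lambda>t. flow t (snd z) (qp (fst z)) i)"
    using AE_fst[OF p AE_driving] AE_space
  proof eventually_elim
    case (elim z)
    have sz: "snd z \<in> R0 N" by (rule snd_R0[OF mu elim(2)])
    show ?case
    proof
      fix i assume i: "i \<in> {1..N}"
      show "continuous_on {0..} (\<lambda>t. flow t (snd z) (qp (fst z)) i)"
        unfolding continuous_on_eq_continuous_within
      proof
        fix t :: real assume t: "t \<in> {0..}"
        have "continuous_on {0..t + 1} (\<lambda>t. flow t (snd z) (qp (fst z)) i)"
          by (rule solution_cont(1)[OF flow_solution[OF elim(1) sz] i]) (use t in simp)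
        then have "continuous (at t within {0..t + 1}) (\<lambda>t. flow t (snd z) (qp (fst z)) i)"
          using t unfolding continuous_on_eq_continuous_within by auto
        moreover have "at t within {0..t + 1} = at t within {0..}"
          by (rule at_within_nhd[of t "{..<t + 1}"]) auto
        ultimately show "continuous (at t within {0..}) (\<lambda>t. flow t (snd z) (qp (fst z)) i)" by simp
      qed
    qed
  qed
  show "AE z in M \<Otimes>\<^sub>M \<mu>. \<forall>t\<ge>0. \<forall>i\<in>{1..N}. flow t (snd z) (qp (fst z)) i =
     snd z i + integral {0..t} (\<lambda>s. b (flow s (snd z) (qp (fst z))) i) + ext_noise V t z i"
    using AE_fst[OF p AE_driving] AE_fst[OF p V] AE_space
  proof eventually_elim
    case (elim z)
    have sz: "snd z \<in> R0 N" by (rule snd_R0[OF mu elim(3)])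
    show ?case
    proof (intro allI impI ballI)
      fix t :: real and i assume t: "t \<ge> 0" and i: "i \<in> {1..N}"
      have v: "ext_noise V t z i = Q t (fst z) i" using elim(2) t i by (simp add: ext_noise_def)
      show "flow t (snd z) (qp (fst z)) i = snd z i + integral {0..t} (\<lambda>s. b (flow s (snd z) (qp (fst z))) i) + ext_noise V t z i"
        unfolding v by (rule solution_eq[OF flow_solution[OF elim(1) sz t] i]) (use t in simp)
    qed
  qed
qed

lemma sde_solution_law:
  assumes mu: "\<mu> \<in> prob_measures_R0 N" and t: "t \<ge> 0"
    and U: "sde_solution (M \<Otimes>\<^sub>M \<mu>) (ext_filtration F \<mu>) N b (ext_noise V) snd U"
  shows "distr (M \<Otimes>\<^sub>M \<mu>) E (U t) = distr (M \<Otimes>\<^sub>M \<mu>) E (\<lambda>z. flow t (snd z) (qp (fst z)))"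
proof -
  have p: "prob_space \<mu>" using mu by (simp add: prob_measures_R0_def)
  have Um: "U t \<in> F t \<Otimes>\<^sub>M \<mu> \<rightarrow>\<^sub>M E" using U t by (simp add: sde_solution_def ext_filtration_def)
  have "sets (F t \<Otimes>\<^sub>M \<mu>) \<subseteq> sets (M \<Otimes>\<^sub>M \<mu>)" "space (F t \<Otimes>\<^sub>M \<mu>) = space (M \<Otimes>\<^sub>M \<mu>)"
    using sets_F[OF t] space_F[OF t]
    by (auto simp: sets_pair_measure space_pair_measure intro!: sigma_sets_mono')
  then have UM: "U t \<in> M \<Otimes>\<^sub>M \<mu> \<rightarrow>\<^sub>M E" using Um by (auto simp: measurable_def)
  have "AE z in M \<Otimes>\<^sub>M \<mu>. \<forall>i\<in>{1..N}. continuous_on {0..} (\<lambda>t. U t z i)"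
    and "AE z in M \<Otimes>\<^sub>M \<mu>. \<forall>t\<ge>0. \<forall>i\<in>{1..N}. U t z i = snd z i + integral {0..t} (\<lambda>s. b (U s z) i) + ext_noise V t z i"
    using U unfolding sde_solution_def by auto
  then have "AE z in M \<Otimes>\<^sub>M \<mu>. U t z = flow t (snd z) (qp (fst z))"
    using AE_fst[OF p AE_driving] AE_fst[OF p V] AE_space
  proof eventually_elim
    case (elim z)
    have UR: "U t z \<in> R0 N" using measurable_space[OF UM elim(5)] by simp
    have sz: "snd z \<in> R0 N" by (rule snd_R0[OF mu elim(5)])
    have sol: "integral_solution N b t (snd z) (qp (fst z)) (\<lambda>t. U t z)"
      unfolding integral_solution_def
    proof (intro conjI ballI)
      show "continuous_on {0..t} (\<lambda>t. U t z i)" if "i \<in> {1..N}" for i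
        by (rule continuous_on_subset[of "{0..}"]) (use elim(1) that in auto)
      fix s i assume s: "s \<in> {0..t}" and i: "i \<in> {1..N}"
      have v: "ext_noise V s z i = Q s (fst z) i" using elim(4) s i by (simp add: ext_noise_def)
      have "s \<ge> 0" using s by simp
      from elim(2)[rule_format, OF this i] show "U s z i = snd z i + integral {0..s} (\<lambda>s. b (U s z) i) + Q s (fst z) i"
        unfolding v .
    qed
    show ?case
      by (rule R0_eqI[OF UR flow_R0]) (rule flow_unique(1)[OF elim(3) sz sol, symmetric], use t in auto)
  qed
  then show ?thesis
    by (rule distr_cong_AE[OF refl refl _ UM ext_law(1)[OF mu flow_pair_measurable[OF t]]])
qed

text \<open>Invariance under the flow at time 1 already implies invariance at every time \<open>t\<close>: the image \<open>\<mu>t\<close> of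
  \<open>\<mu>\<close> at time \<open>t\<close> is again invariant at time 1 by the semigroup property, and the invariant law at
  time 1 is unique.\<close>

lemma sde_invariant_iff:
  assumes mu: "\<mu> \<in> prob_measures_R0 N"
  shows "sde_invariant M F N b V \<mu> \<longleftrightarrow> distr (M \<Otimes>\<^sub>M \<mu>) E (\<lambda>(\<omega>, x). flow 1 x (qp \<omega>)) = \<mu>"
proof
  assume "sde_invariant M F N b V \<mu>"
  then have "distr (M \<Otimes>\<^sub>M \<mu>) E (\<lambda>z. flow 1 (snd z) (qp (fst z))) = \<mu>"
    using sde_solution_exists[OF mu] unfolding sde_invariant_def by (meson zero_le_one)
  then show "distr (M \<Otimes>\<^sub>M \<mu>) E (\<lambda>(\<omega>, x). flow 1 x (qp \<omega>)) = \<mu>" by (simp add: case_prod_beta')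
next
  assume inv: "distr (M \<Otimes>\<^sub>M \<mu>) E (\<lambda>(\<omega>, x). flow 1 x (qp \<omega>)) = \<mu>"
  interpret rc: random_contraction M N "\<lambda>x \<omega>. flow 1 x (qp \<omega>)" "1 / (1 + 2 * \<nu>)" "noise_var * (1 + 2 * \<nu>) / (2 * \<nu>)"
    by (rule flow_contraction)
  obtain \<theta> where th: "\<And>\<mu>. \<mu> \<in> prob_measures_R0 N \<Longrightarrow> distr (M \<Otimes>\<^sub>M \<mu>) E (\<lambda>(\<omega>, x). flow 1 x (qp \<omega>)) = \<mu> \<longleftrightarrow> \<mu> = \<theta>"
    using rc.unique_invariant_measure by (elim bexE) (rule that, blast)
  have step: "(\<integral>\<^sup>+ x. flow_op 1 f x \<partial>\<mu>) = (\<integral>\<^sup>+ v. f v \<partial>\<mu>)" if f: "f \<in> borel_measurable E" for f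
    using ext_law(3)[OF mu flow_pair_measurable[of 1] f] inv by (simp add: flow_op_def case_prod_beta')
  have "distr (M \<Otimes>\<^sub>M \<mu>) E (\<lambda>z. flow t (snd z) (qp (fst z))) = \<mu>" if t: "t \<ge> 0" for t
  proof -
    define \<mu>t where "\<mu>t = distr (M \<Otimes>\<^sub>M \<mu>) E (\<lambda>z. flow t (snd z) (qp (fst z)))"
    have mut: "\<mu>t \<in> prob_measures_R0 N" unfolding \<mu>t_def by (rule ext_law(2)[OF mu flow_pair_measurable[OF t]])
    have It: "(\<integral>\<^sup>+ v. f v \<partial>\<mu>t) = (\<integral>\<^sup>+ x. flow_op t f x \<partial>\<mu>)" if "f \<in> borel_measurable E" for f
      unfolding \<mu>t_def flow_op_def by (rule ext_law(3)[OF mu flow_pair_measurable[OF t] that])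
    have e1: "distr (M \<Otimes>\<^sub>M \<mu>t) E (\<lambda>(\<omega>, x). flow 1 x (qp \<omega>)) = distr (M \<Otimes>\<^sub>M \<mu>t) E (\<lambda>z. flow 1 (snd z) (qp (fst z)))"
      by (simp add: case_prod_beta')
    have "distr (M \<Otimes>\<^sub>M \<mu>t) E (\<lambda>(\<omega>, x). flow 1 x (qp \<omega>)) = \<mu>t"
      unfolding e1
    proof (rule measure_R0_eqI_nn_integral[OF N1 ext_law(2)[OF mut flow_pair_measurable] mut])
      fix f assume f: "lip_test N f"
      let ?f = "\<lambda>v. ennreal (f v)"
      have fm: "?f \<in> borel_measurable E" using lip_test_measurable[OF N1 f] by simp
      have "(\<integral>\<^sup>+ v. ?f v \<partial>distr (M \<Otimes>\<^sub>M \<mu>t) E (\<lambda>z. flow 1 (snd z) (qp (fst z)))) = (\<integral>\<^sup>+ x. flow_op 1 ?f x \<partial>\<mu>t)"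
        unfolding flow_op_def by (rule ext_law(3)[OF mut flow_pair_measurable fm]) simp
      also have "\<dots> = (\<integral>\<^sup>+ x. flow_op t (flow_op 1 ?f) x \<partial>\<mu>)"
        by (rule It[OF flow_op_measurable[OF _ fm]]) simp
      also have "\<dots> = (\<integral>\<^sup>+ x. flow_op (t + 1) ?f x \<partial>\<mu>)"
        by (rule nn_integral_cong) (simp add: flow_op_add[OF f t zero_less_one] space_mu[OF mu])
      also have "\<dots> = (\<integral>\<^sup>+ x. flow_op 1 (flow_op t ?f) x \<partial>\<mu>)"
      proof (rule nn_integral_cong)
        fix x assume "x \<in> space \<mu>"
        then have x: "x \<in> R0 N" by (simp add: space_mu[OF mu])
        \<comment> \<open>The semigroup property is available for a positive second time only.\<close>
        show "flow_op (t + 1) ?f x = flow_op 1 (flow_op t ?f) x"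
        proof (cases "t = 0")
          case True
          have "flow_op 1 (flow_op 0 ?f) x = flow_op 1 ?f x"
            unfolding flow_op_def[of 1] by (intro nn_integral_cong flow_op_0 flow_R0)
          then show ?thesis using True by simp
        next
          case False
          then show ?thesis using flow_op_add[OF f zero_le_one _ x, of t] t by (simp add: add.commute)
        qed
      qed
      also have "\<dots> = (\<integral>\<^sup>+ x. flow_op t ?f x \<partial>\<mu>)" by (rule step[OF flow_op_measurable[OF t fm]])
      also have "\<dots> = (\<integral>\<^sup>+ v. ?f v \<partial>\<mu>t)" by (rule It[OF fm, symmetric])
      finally show "(\<integral>\<^sup>+ v. ?f v \<partial>distr (M \<Otimes>\<^sub>M \<mu>t) E (\<lambda>z. flow 1 (snd z) (qp (fst z)))) = (\<integral>\<^sup>+ v. ?f v \<partial>\<mu>t)" .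
    qed simp
    then have "\<mu>t = \<theta>" using th[OF mut] by simp
    moreover have "\<mu> = \<theta>" using th[OF mu] inv by simp
    ultimately show ?thesis by (simp add: \<mu>t_def)
  qed
  then show "sde_invariant M F N b V \<mu>"
    unfolding sde_invariant_def using mu sde_solution_exists[OF mu] sde_solution_law[OF mu] by auto
qed

lemma scheme_unique_invariant:
  assumes h: "h > 0"
  shows "\<exists>\<theta>\<in>prob_measures2_R0 N. \<forall>\<mu>. scheme_invariant M F N h b V \<mu> \<longleftrightarrow> \<mu> = \<theta>"
proof -
  interpret rc: random_contraction M N "scheme_map h" "1 / (1 + 2 * h * \<nu>)" "noise_var * h"
    by (rule scheme_contraction[OF h])
  obtain \<theta> where th: "\<theta> \<in> prob_measures2_R0 N" "\<forall>\<mu>\<in>prob_measures_R0 N. distr (M \<Otimes>\<^sub>M \<mu>) E (\<lambda>(\<omega>, x). scheme_map h x \<omega>) = \<mu> \<longleftrightarrow> \<mu> = \<theta>"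
    using rc.unique_invariant_measure by (elim bexE) (rule that)
  have th': "\<theta> \<in> prob_measures_R0 N" using th(1) by (simp add: prob_measures2_R0_def)
  have "scheme_invariant M F N h b V \<mu> \<longleftrightarrow> \<mu> = \<theta>" for \<mu>
  proof (cases "\<mu> \<in> prob_measures_R0 N")
    case True then show ?thesis using scheme_invariant_iff[OF True h] th(2) by simp
  next
    case False then show ?thesis using th' by (auto simp: scheme_invariant_def)
  qed
  with th(1) show ?thesis by blast
qed

lemma sde_unique_invariant:
  "\<exists>\<theta>\<in>prob_measures2_R0 N. \<forall>\<mu>. sde_invariant M F N b V \<mu> \<longleftrightarrow> \<mu> = \<theta>"
proof -
  interpret rc: random_contraction M N "\<lambda>x \<omega>. flow 1 x (qp \<omega>)" "1 / (1 + 2 * \<nu>)" "noise_var * (1 + 2 * \<nu>) / (2 * \<nu>)"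
    by (rule flow_contraction)
  obtain \<theta> where th: "\<theta> \<in> prob_measures2_R0 N" "\<forall>\<mu>\<in>prob_measures_R0 N. distr (M \<Otimes>\<^sub>M \<mu>) E (\<lambda>(\<omega>, x). flow 1 x (qp \<omega>)) = \<mu> \<longleftrightarrow> \<mu> = \<theta>"
    using rc.unique_invariant_measure by (elim bexE) (rule that)
  have th': "\<theta> \<in> prob_measures_R0 N" using th(1) by (simp add: prob_measures2_R0_def)
  have "sde_invariant M F N b V \<mu> \<longleftrightarrow> \<mu> = \<theta>" for \<mu>
  proof (cases "\<mu> \<in> prob_measures_R0 N")
    case True then show ?thesis using sde_invariant_iff[OF True] th(2) by simp
  next
    case False then show ?thesis using th' by (auto simp: sde_invariant_def)
  qed
  with th(1) show ?thesis by blast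
qed

end
end

section \<open>Existence, uniqueness and second moments of the invariant measures\<close>

text \<open>The signs of the partial derivatives give monotonicity, and their growth bounds the Lipschitz
  constant on bounded sets.\<close>

lemma monotone_flux_of_C1:
  fixes Abar d\<^sub>1 d\<^sub>2 :: "real \<times> real \<Rightarrow> real"
  assumes nu: "\<nu> > 0" and N: "N \<ge> 1"
    and deriv: "\<And>v w. (Abar has_derivative (\<lambda>(h, k). d\<^sub>1 (v, w) * h + d\<^sub>2 (v, w) * k)) (at (v, w))"
    and mono: "\<And>v w. d\<^sub>1 (v, w) \<ge> 0" "\<And>v w. d\<^sub>2 (v, w) \<le> 0"
    and growth: "\<And>v w. \<bar>d\<^sub>1 (v, w)\<bar> \<le> C * (1 + \<bar>v\<bar> ^ p)" "\<And>v w. \<bar>d\<^sub>2 (v, w)\<bar> \<le> C * (1 + \<bar>w\<bar> ^ p)"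
  shows "monotone_flux \<nu> N Abar"
proof
  have D1: "((\<lambda>a. Abar (a, c)) has_real_derivative d\<^sub>1 (a, c)) (at a)" for a c
    unfolding has_field_derivative_def
  proof -
    have "((\<lambda>a. (a, c)) has_derivative (\<lambda>h. (h, 0))) (at a)" by (intro has_derivative_Pair has_derivative_ident has_derivative_const)
    from has_derivative_compose[OF this, of Abar, OF deriv] show "((\<lambda>a. Abar (a, c)) has_derivative (*) (d\<^sub>1 (a, c))) (at a)"
      by (simp add: mult.commute[of _ 0])
  qed
  have D2: "((\<lambda>c. Abar (a, c)) has_real_derivative d\<^sub>2 (a, c)) (at c)" for a c
    unfolding has_field_derivative_def
  proof -
    have "((\<lambda>c. (a, c)) has_derivative (\<lambda>h. (0, h))) (at c)" by (intro has_derivative_Pair has_derivative_ident has_derivative_const)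
    from has_derivative_compose[OF this, of Abar, OF deriv] show "((\<lambda>c. Abar (a, c)) has_derivative (*) (d\<^sub>2 (a, c))) (at c)"
      by (simp add: mult.commute[of _ 0])
  qed
  show "Abar (a, c) \<le> Abar (a', c)" if "a \<le> a'" for a a' c
    by (rule DERIV_nonneg_imp_nondecreasing[OF that]) (use D1 mono in blast)
  show "Abar (a, c') \<le> Abar (a, c)" if "c \<le> c'" for a c c'
    by (rule DERIV_nonpos_imp_nonincreasing[OF that]) (use D2 mono in blast)
  fix K :: real
  define L where "L = C * (1 + \<bar>K\<bar> ^ p)"
  have "0 \<le> C * (1 + \<bar>0\<bar> ^ p)" using growth(1)[of 0 0] by linarith
  then have C: "C \<ge> 0" by (cases p) (auto simp: zero_le_mult_iff)
  have L: "C * (1 + \<bar>x\<bar> ^ p) \<le> L" if "\<bar>x\<bar> \<le> K" for x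
    unfolding L_def using that C by (intro mult_left_mono add_left_mono power_mono) auto
  have L0: "L \<ge> 0" unfolding L_def using C by simp
  have x1: "\<bar>Abar (a, c) - Abar (a', c)\<bar> \<le> L * \<bar>a - a'\<bar>" if "\<bar>a\<bar> \<le> K" "\<bar>a'\<bar> \<le> K" for a a' c
  proof -
    have "norm (Abar (a, c) - Abar (a', c)) \<le> L * norm (a - a')"
    proof (rule field_differentiable_bound[of "{- K..K}"])
      fix z assume "z \<in> {- K..K}"
      then have "\<bar>z\<bar> \<le> K" by auto
      from growth(1)[of z c] L[OF this] show "norm (d\<^sub>1 (z, c)) \<le> L" by simp
      show "((\<lambda>a. Abar (a, c)) has_field_derivative d\<^sub>1 (z, c)) (at z within {- K..K})"
        by (rule has_field_derivative_at_within[OF D1])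
    qed (use that in auto)
    then show ?thesis by simp
  qed
  have x2: "\<bar>Abar (a, c) - Abar (a, c')\<bar> \<le> L * \<bar>c - c'\<bar>" if "\<bar>c\<bar> \<le> K" "\<bar>c'\<bar> \<le> K" for a c c'
  proof -
    have "norm (Abar (a, c) - Abar (a, c')) \<le> L * norm (c - c')"
    proof (rule field_differentiable_bound[of "{- K..K}"])
      fix z assume "z \<in> {- K..K}"
      then have "\<bar>z\<bar> \<le> K" by auto
      from growth(2)[of a z] L[OF this] show "norm (d\<^sub>2 (a, z)) \<le> L" by simp
      show "((\<lambda>c. Abar (a, c)) has_field_derivative d\<^sub>2 (a, z)) (at z within {- K..K})"
        by (rule has_field_derivative_at_within[OF D2])
    qed (use that in auto)
    then show ?thesis by simp
  qed
  have "\<bar>Abar (a, c) - Abar (a', c')\<bar> \<le> L * (\<bar>a - a'\<bar> + \<bar>c - c'\<bar>)"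
    if "\<bar>a\<bar> \<le> K" "\<bar>c\<bar> \<le> K" "\<bar>a'\<bar> \<le> K" "\<bar>c'\<bar> \<le> K" for a c a' c'
    using x1[OF that(1,3), of c] x2[OF that(2,4), of a'] unfolding distrib_left by linarith
  then show "\<exists>L\<ge>0. \<forall>a c a' c'. \<bar>a\<bar> \<le> K \<longrightarrow> \<bar>c\<bar> \<le> K \<longrightarrow> \<bar>a'\<bar> \<le> K \<longrightarrow> \<bar>c'\<bar> \<le> K \<longrightarrow>
                    \<bar>Abar (a, c) - Abar (a', c')\<bar> \<le> L * (\<bar>a - a'\<bar> + \<bar>c - c'\<bar>)"
    using L0 by blast
qed (use nu N in auto)

text \<open>Passes from families indexed from 1 to families indexed from 0.\<close>

lemma (in prob_space) indep_vars_Suc: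
  assumes "indep_vars N X {1..}" shows "indep_vars (\<lambda>k. N (Suc k)) (\<lambda>k. X (Suc k)) UNIV"
proof -
  have m: "\<forall>i\<in>{1..}. random_variable (N i) (X i)"
    and ind: "indep_sets (\<lambda>i. {X i -` A \<inter> space M | A. A \<in> sets (N i)}) {1..}"
    using assms unfolding indep_vars_def2 by auto
  show ?thesis
    unfolding indep_vars_def2
  proof (intro conjI indep_setsI ballI)
    show "random_variable (N (Suc k)) (X (Suc k))" for k using m by simp
    then show "{X (Suc k) -` A \<inter> space M |A. A \<in> sets (N (Suc k))} \<subseteq> events" for k
      by (auto intro: measurable_sets)
    fix A J assume J: "J \<noteq> {}" "J \<subseteq> UNIV" "finite J"
      and A: "\<forall>j\<in>J. A j \<in> {X (Suc j) -` A \<inter> space M |A. A \<in> sets (N (Suc j))}"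
    have "prob (\<Inter>j\<in>Suc ` J. A (j - 1)) = (\<Prod>j\<in>Suc ` J. prob (A (j - 1)))"
      by (rule indep_setsD[OF ind]) (use J A in auto)
    then show "prob (\<Inter>j\<in>J. A j) = (\<Prod>j\<in>J. prob (A j))"
      by (simp add: prod.reindex)
  qed
qed

lemma brownian_family_Suc:
  assumes M: "prob_space M" and F: "normal_filtration M F" and W: "independent_brownian_motions M F W"
  shows "brownian_family M F (\<lambda>k. W (Suc k))"
proof -
  interpret prob_space M by fact
  have "indep_vars (\<lambda>k. \<Pi>\<^sub>M t\<in>{0..}. borel) (\<lambda>k \<omega>. \<lambda>t\<in>{0..}. W k t \<omega>) {1..}"
    using W by (simp add: independent_brownian_motions_def)
  then have "indep_vars (\<lambda>k. \<Pi>\<^sub>M t\<in>{0..}. borel) (\<lambda>k \<omega>. \<lambda>t\<in>{0..}. W (Suc k) t \<omega>) UNIV"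
    by (rule indep_vars_Suc)
  moreover have "brownian_motion M F (W (Suc k))" for k
    using W by (simp add: independent_brownian_motions_def)
  ultimately show ?thesis
    by (intro brownian_family.intro brownian_family_axioms.intro M F) auto
qed

theorem theorem1p5:
  fixes \<nu> :: real
    and A A' A'' :: "real \<Rightarrow> real" and C\<^sub>A :: real and p\<^sub>A :: nat
    and g :: "nat \<Rightarrow> real \<Rightarrow> real"
    and M :: "'w measure" and F :: "real \<Rightarrow> 'w measure" and W :: "nat \<Rightarrow> real \<Rightarrow> 'w \<Rightarrow> real"
    and Abar d\<^sub>1 d\<^sub>2 :: "real \<times> real \<Rightarrow> real" and C\<^sub>B :: real and p\<^sub>B :: nat
  assumes nu: "\<nu> > 0"
    and A_deriv: "\<And>v. (A has_real_derivative A' v) (at v)"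
    and A_deriv2: "\<And>v. (A' has_real_derivative A'' v) (at v)"
    and A''_cont: "continuous_on UNIV A''"
    and A''_lip: "locally_lipschitz A''"
    and A_growth: "C\<^sub>A > 0" "p\<^sub>A \<ge> 1" "\<And>v. \<bar>A' v\<bar> \<le> C\<^sub>A * (1 + \<bar>v\<bar> ^ p\<^sub>A)"
    and g_H2: "\<And>k. k \<ge> 1 \<Longrightarrow> g k \<in> H0_torus 2"
    and g_sum: "summable (\<lambda>k. (H0_norm_torus 2 (g (Suc k)))\<^sup>2)"
    and M_prob: "prob_space M"
    and F_normal: "normal_filtration M F"
    and W_BM: "independent_brownian_motions M F W"
    and Abar_deriv: "\<And>v w. (Abar has_derivative (\<lambda>(h, k). d\<^sub>1 (v, w) * h + d\<^sub>2 (v, w) * k)) (at (v, w))"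
    and Abar_C1: "continuous_on UNIV d\<^sub>1" "continuous_on UNIV d\<^sub>2"
    and Abar_lip: "locally_lipschitz d\<^sub>1" "locally_lipschitz d\<^sub>2"
    and Abar_consistent: "\<And>v. Abar (v, v) = A v"
    and Abar_monotone: "\<And>v w. d\<^sub>1 (v, w) \<ge> 0" "\<And>v w. d\<^sub>2 (v, w) \<le> 0"
    and Abar_growth: "C\<^sub>B > 0" "p\<^sub>B \<ge> 1"
      "\<And>v w. \<bar>d\<^sub>1 (v, w)\<bar> \<le> C\<^sub>B * (1 + \<bar>v\<bar> ^ p\<^sub>B)"
      "\<And>v w. \<bar>d\<^sub>2 (v, w)\<bar> \<le> C\<^sub>B * (1 + \<bar>w\<bar> ^ p\<^sub>B)"
  shows
    "(\<forall>N\<ge>1. \<exists>!\<theta>. sde_invariant M F N (drift \<nu> Abar N) (WQN g W N) \<theta>) \<and>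
     (\<forall>N\<ge>1. \<forall>\<Delta>t>0. \<exists>!\<theta>. scheme_invariant M F N \<Delta>t (drift \<nu> Abar N) (WQN g W N) \<theta>) \<and>
     (\<forall>N\<ge>1. \<forall>\<Delta>t>0.
        (\<forall>\<theta>. sde_invariant M F N (drift \<nu> Abar N) (WQN g W N) \<theta> \<longrightarrow> \<theta> \<in> prob_measures2_R0 N) \<and>
        (\<forall>\<theta>. scheme_invariant M F N \<Delta>t (drift \<nu> Abar N) (WQN g W N) \<theta> \<longrightarrow> \<theta> \<in> prob_measures2_R0 N))"
proof -
  have key: "(\<exists>\<theta>\<in>prob_measures2_R0 N. \<forall>\<mu>. sde_invariant M F N (drift \<nu> Abar N) (WQN g W N) \<mu> \<longleftrightarrow> \<mu> = \<theta>) \<and>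
      (\<forall>\<Delta>t>0. \<exists>\<theta>\<in>prob_measures2_R0 N. \<forall>\<mu>. scheme_invariant M F N \<Delta>t (drift \<nu> Abar N) (WQN g W N) \<mu> \<longleftrightarrow> \<mu> = \<theta>)"
    if N: "N \<ge> 1" for N
  proof -
    have g: "g (Suc k) \<in> H0_torus 2" for k by (rule g_H2) simp
    interpret fl: monotone_flux \<nu> N Abar
      by (rule monotone_flux_of_C1[OF nu N Abar_deriv Abar_monotone Abar_growth(3,4)])
    interpret bf: brownian_family M F "\<lambda>k. W (Suc k)"
      by (rule brownian_family_Suc[OF M_prob F_normal W_BM])
    interpret bn: bm_noise M F "\<lambda>k. W (Suc k)" N "\<lambda>k. cell_mean N (g (Suc k))"
      by unfold_locales (rule N, rule cell_mean_square_summable[OF g g_sum], assumption, rule cell_mean_sum[OF g N])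
    interpret nf: noisy_flux \<nu> N Abar M F "\<lambda>k. W (Suc k)" "\<lambda>k. cell_mean N (g (Suc k))"
      by unfold_locales
    have V: "AE \<omega> in M. \<forall>t\<ge>0. \<forall>i\<in>{1..N}. WQN g W N t \<omega> i = bn.Q t \<omega> i"
      using bn.AE_Q
    proof eventually_elim
      case (elim \<omega>)
      then show ?case unfolding WQN_def by auto
    qed
    show ?thesis using nf.sde_unique_invariant[OF V] nf.scheme_unique_invariant[OF V] by blast
  qed
  show ?thesis
  proof (intro conjI allI impI)
    fix N :: nat assume N: "N \<ge> 1"
    show "\<exists>!\<theta>. sde_invariant M F N (drift \<nu> Abar N) (WQN g W N) \<theta>" using key[OF N] by metis
    fix \<Delta>t :: real assume dt: "\<Delta>t > 0"
    show "\<exists>!\<theta>. scheme_invariant M F N \<Delta>t (drift \<nu> Abar N) (WQN g W N) \<theta>" using key[OF N] dt by metis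
    show "\<theta> \<in> prob_measures2_R0 N" if "sde_invariant M F N (drift \<nu> Abar N) (WQN g W N) \<theta>" for \<theta>
      using key[OF N] that by metis
    show "\<theta> \<in> prob_measures2_R0 N" if "scheme_invariant M F N \<Delta>t (drift \<nu> Abar N) (WQN g W N) \<theta>" for \<theta>
      using key[OF N] dt that by metis
  qed
qed

end
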